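(* Let $\mathbb{K}$ be a field of characteristic $0$. The embedding of differential graded operads $(\mathrm{Lie},0)\to\mathrm{Greg}_{-1}$, given by $l\mapsto x-y$, induces an isomorphism $\mathrm{Lie}\to H^*(\mathrm{Greg}_{-1})$.
   Context: Operads are symmetric operads over $\mathbb{K}$; a transposition acts on an operation by exchanging the corresponding inputs; $\mathcal{T}\{\dots\}$ is the free operad on the given binary generators. Differentials have degree $+1$ and Koszul sign rules apply. $(\mathrm{Lie},0)$ is the Lie operad (generated by the bracket $l$, $l.(1\;2)=-l$) concentrated in degree $0$ with zero differential. The operad $\mathrm{Greg}$ is the quotient of $\mathcal{T}\{x,y,g\}$, with $x.(1\;2)=y$ and $g.(1\;2)=g$, by the ideal generated by $(x\circ_1 x - x\circ_2 x) - (x\circ_1 x - x\circ_2 x).(2\;3)$ and $(x\circ_1 g - (g\circ_1 x).(2\;3) - g\circ_2 x) - (x\circ_1 g - (g\circ_1 x).(2\;3) - g\circ_2 x).(2\;3)$. $\mathrm{Greg}_{-1}$ is the differential graded operad given by the same generators and relations as $\mathrm{Greg}$, with $x,y$ in degree $0$, $g$ in degree $1$, and with differential the operadic derivation $d$ of degree $1$ such that $d(x)=d(y)=-g$ (and $d(g)=0$). *)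

theory Defs
  imports "HOL-Algebra.Algebraic_Closure_Type" "HOL-Combinatorics.Combinatorics"
begin

section \<open>Graded symmetric operads\<close>

text \<open>
  The base field is a type of class \<^class>\<open>field\<close>. An operad \<open>P\<close> is given by its homogeneous
  components: \<open>cpt P n d\<close> is the vector space of operations of arity \<open>n\<close> and degree \<open>d\<close>.
  \<open>pcomp P a i b\<close> is the partial composite \<open>a \<circ>\<^sub>i b\<close> (inputs are numbered from \<open>1\<close>), and
  \<open>act P a \<sigma>\<close> is the right action \<open>a.\<sigma>\<close> of a permutation \<open>\<sigma>\<close> of \<open>{1..n}\<close>.
  The components are required to be disjoint, so that an operation determines its arity and degree.
\<close>

abbreviation base_field :: "('k::field) ring"
  where "base_field \<equiv> ring_of_type_algebra"

record ('k, 'a) operad =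
  cpt :: "nat \<Rightarrow> int \<Rightarrow> ('k, 'a) module"
  ounit :: 'a
  pcomp :: "'a \<Rightarrow> nat \<Rightarrow> 'a \<Rightarrow> 'a"
  act :: "'a \<Rightarrow> (nat \<Rightarrow> nat) \<Rightarrow> 'a"

record ('k, 'a) dg_operad = "('k, 'a) operad" +
  dif :: "'a \<Rightarrow> 'a"

abbreviation ops :: "('k, 'a, 'm) operad_scheme \<Rightarrow> nat \<Rightarrow> int \<Rightarrow> 'a set"
  where "ops P n d \<equiv> carrier (cpt P n d)"

definition koszul_sign :: "int \<Rightarrow> int \<Rightarrow> 'k::field"
  where "koszul_sign p q = (-1) powi (p * q)"

text \<open>
  The convention for the action is \<open>(a.\<sigma>)(x\<^sub>1, \<dots>, x\<^sub>n) = a(x\<^bsub>\<sigma>\<^sup>-\<^sup>1(1)\<^esub>, \<dots>, x\<^bsub>\<sigma>\<^sup>-\<^sup>1(n)\<^esub>)\<close>, i.e. the \<open>j\<close>-th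
  input of \<open>a.\<sigma>\<close> is the \<open>\<sigma> j\<close>-th input of \<open>a\<close>. Hence, for \<open>a\<close> of arity \<open>m\<close> and \<open>b\<close> of arity \<open>n\<close>,
  \<open>a.\<sigma> \<circ>\<^sub>i b = (a \<circ>\<^bsub>\<sigma> i\<^esub> b).(outer_perm m n i \<sigma>)\<close> and \<open>a \<circ>\<^sub>i b.\<tau> = (a \<circ>\<^sub>i b).(inner_perm n i \<tau>)\<close>.
\<close>

definition outer_perm :: "nat \<Rightarrow> nat \<Rightarrow> nat \<Rightarrow> (nat \<Rightarrow> nat) \<Rightarrow> nat \<Rightarrow> nat"
  where "outer_perm m n i \<sigma> j =
    (if j < 1 \<or> m + n - 1 < j then j
     else if i \<le> j \<and> j < i + n then \<sigma> i + (j - i)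
     else (let k = \<sigma> (if j < i then j else j + 1 - n)
           in if k < \<sigma> i then k else k + n - 1))"

definition inner_perm :: "nat \<Rightarrow> nat \<Rightarrow> (nat \<Rightarrow> nat) \<Rightarrow> nat \<Rightarrow> nat"
  where "inner_perm n i \<tau> j = (if i \<le> j \<and> j < i + n then \<tau> (j + 1 - i) + i - 1 else j)"

locale graded_operad =
  fixes P :: "('k::field, 'a, 'm) operad_scheme"
  assumes module_cpt: "module base_field (cpt P n d)"
    and disjoint_cpt: "a \<in> ops P n d \<Longrightarrow> a \<in> ops P m e \<Longrightarrow> n = m \<and> d = e"
    and unit_closed: "ounit P \<in> ops P 1 0"
    and comp_closed:
      "a \<in> ops P m p \<Longrightarrow> b \<in> ops P n q \<Longrightarrow> i \<in> {1..m} \<Longrightarrow>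
        pcomp P a i b \<in> ops P (m + n - 1) (p + q)"
    and comp_add_left:
      "a \<in> ops P m p \<Longrightarrow> a' \<in> ops P m p \<Longrightarrow> b \<in> ops P n q \<Longrightarrow> i \<in> {1..m} \<Longrightarrow>
        pcomp P (a \<oplus>\<^bsub>cpt P m p\<^esub> a') i b
          = pcomp P a i b \<oplus>\<^bsub>cpt P (m + n - 1) (p + q)\<^esub> pcomp P a' i b"
    and comp_add_right:
      "a \<in> ops P m p \<Longrightarrow> b \<in> ops P n q \<Longrightarrow> b' \<in> ops P n q \<Longrightarrow> i \<in> {1..m} \<Longrightarrow>
        pcomp P a i (b \<oplus>\<^bsub>cpt P n q\<^esub> b')
          = pcomp P a i b \<oplus>\<^bsub>cpt P (m + n - 1) (p + q)\<^esub> pcomp P a i b'"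
    and comp_smult_left:
      "a \<in> ops P m p \<Longrightarrow> b \<in> ops P n q \<Longrightarrow> i \<in> {1..m} \<Longrightarrow>
        pcomp P (c \<odot>\<^bsub>cpt P m p\<^esub> a) i b = c \<odot>\<^bsub>cpt P (m + n - 1) (p + q)\<^esub> pcomp P a i b"
    and comp_smult_right:
      "a \<in> ops P m p \<Longrightarrow> b \<in> ops P n q \<Longrightarrow> i \<in> {1..m} \<Longrightarrow>
        pcomp P a i (c \<odot>\<^bsub>cpt P n q\<^esub> b) = c \<odot>\<^bsub>cpt P (m + n - 1) (p + q)\<^esub> pcomp P a i b"
    and unit_left: "a \<in> ops P n d \<Longrightarrow> pcomp P (ounit P) 1 a = a"
    and unit_right: "a \<in> ops P n d \<Longrightarrow> i \<in> {1..n} \<Longrightarrow> pcomp P a i (ounit P) = a"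
    and comp_sequential:
      "a \<in> ops P l p \<Longrightarrow> b \<in> ops P m q \<Longrightarrow> h \<in> ops P n r \<Longrightarrow> i \<in> {1..l} \<Longrightarrow> j \<in> {1..m} \<Longrightarrow>
        pcomp P (pcomp P a i b) (i + j - 1) h = pcomp P a i (pcomp P b j h)"
    and comp_parallel:
      "a \<in> ops P l p \<Longrightarrow> b \<in> ops P m q \<Longrightarrow> h \<in> ops P n r \<Longrightarrow> i \<in> {1..l} \<Longrightarrow> k \<in> {1..l} \<Longrightarrow> i < k \<Longrightarrow>
        pcomp P (pcomp P a i b) (k + m - 1) h
          = koszul_sign q r \<odot>\<^bsub>cpt P (l + m + n - 2) (p + q + r)\<^esub> pcomp P (pcomp P a k h) i b"
    and act_closed: "a \<in> ops P n d \<Longrightarrow> \<sigma> permutes {1..n} \<Longrightarrow> act P a \<sigma> \<in> ops P n d"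
    and act_add:
      "a \<in> ops P n d \<Longrightarrow> b \<in> ops P n d \<Longrightarrow> \<sigma> permutes {1..n} \<Longrightarrow>
        act P (a \<oplus>\<^bsub>cpt P n d\<^esub> b) \<sigma> = act P a \<sigma> \<oplus>\<^bsub>cpt P n d\<^esub> act P b \<sigma>"
    and act_smult:
      "a \<in> ops P n d \<Longrightarrow> \<sigma> permutes {1..n} \<Longrightarrow>
        act P (c \<odot>\<^bsub>cpt P n d\<^esub> a) \<sigma> = c \<odot>\<^bsub>cpt P n d\<^esub> act P a \<sigma>"
    and act_id: "a \<in> ops P n d \<Longrightarrow> act P a id = a"
    and act_act:
      "a \<in> ops P n d \<Longrightarrow> \<sigma> permutes {1..n} \<Longrightarrow> \<tau> permutes {1..n} \<Longrightarrow>
        act P (act P a \<sigma>) \<tau> = act P a (\<sigma> \<circ> \<tau>)"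
    and comp_act_left:
      "a \<in> ops P m p \<Longrightarrow> b \<in> ops P n q \<Longrightarrow> i \<in> {1..m} \<Longrightarrow> \<sigma> permutes {1..m} \<Longrightarrow>
        pcomp P (act P a \<sigma>) i b = act P (pcomp P a (\<sigma> i) b) (outer_perm m n i \<sigma>)"
    and comp_act_right:
      "a \<in> ops P m p \<Longrightarrow> b \<in> ops P n q \<Longrightarrow> i \<in> {1..m} \<Longrightarrow> \<tau> permutes {1..n} \<Longrightarrow>
        pcomp P a i (act P b \<tau>) = act P (pcomp P a i b) (inner_perm n i \<tau>)"

locale operadic_derivation = graded_operad P
  for P :: "('k::field, 'a, 'm) operad_scheme" and D :: "'a \<Rightarrow> 'a" +
  assumes der_closed: "a \<in> ops P n d \<Longrightarrow> D a \<in> ops P n (d + 1)"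
    and der_add:
      "a \<in> ops P n d \<Longrightarrow> b \<in> ops P n d \<Longrightarrow>
        D (a \<oplus>\<^bsub>cpt P n d\<^esub> b) = D a \<oplus>\<^bsub>cpt P n (d + 1)\<^esub> D b"
    and der_smult:
      "a \<in> ops P n d \<Longrightarrow> D (c \<odot>\<^bsub>cpt P n d\<^esub> a) = c \<odot>\<^bsub>cpt P n (d + 1)\<^esub> D a"
    and der_act: "a \<in> ops P n d \<Longrightarrow> \<sigma> permutes {1..n} \<Longrightarrow> D (act P a \<sigma>) = act P (D a) \<sigma>"
    and der_comp:
      "a \<in> ops P m p \<Longrightarrow> b \<in> ops P n q \<Longrightarrow> i \<in> {1..m} \<Longrightarrow>
        D (pcomp P a i b) = pcomp P (D a) i b \<oplus>\<^bsub>cpt P (m + n - 1) (p + q + 1)\<^esub>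
          koszul_sign 1 p \<odot>\<^bsub>cpt P (m + n - 1) (p + q + 1)\<^esub> pcomp P a i (D b)"

locale differential_graded_operad = operadic_derivation P "dif P"
  for P :: "('k::field, 'a, 'm) dg_operad_scheme" +
  assumes dif_dif: "a \<in> ops P n d \<Longrightarrow> dif P (dif P a) = \<zero>\<^bsub>cpt P n (d + 2)\<^esub>"

locale operad_hom = P: graded_operad P + Q: graded_operad Q
  for P :: "('k::field, 'a, 'm) operad_scheme" and Q :: "('k, 'b, 'n) operad_scheme"
    and f :: "'a \<Rightarrow> 'b" +
  assumes hom_closed: "a \<in> ops P n d \<Longrightarrow> f a \<in> ops Q n d"
    and hom_add:
      "a \<in> ops P n d \<Longrightarrow> b \<in> ops P n d \<Longrightarrow> f (a \<oplus>\<^bsub>cpt P n d\<^esub> b) = f a \<oplus>\<^bsub>cpt Q n d\<^esub> f b"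
    and hom_smult: "a \<in> ops P n d \<Longrightarrow> f (c \<odot>\<^bsub>cpt P n d\<^esub> a) = c \<odot>\<^bsub>cpt Q n d\<^esub> f a"
    and hom_unit: "f (ounit P) = ounit Q"
    and hom_comp:
      "a \<in> ops P m p \<Longrightarrow> b \<in> ops P n q \<Longrightarrow> i \<in> {1..m} \<Longrightarrow> f (pcomp P a i b) = pcomp Q (f a) i (f b)"
    and hom_act: "a \<in> ops P n d \<Longrightarrow> \<sigma> permutes {1..n} \<Longrightarrow> f (act P a \<sigma>) = act Q (f a) \<sigma>"

locale dg_operad_hom =
  P: differential_graded_operad P + Q: differential_graded_operad Q + operad_hom P Q f
  for P :: "('k::field, 'a, 'm) dg_operad_scheme" and Q :: "('k, 'b, 'n) dg_operad_scheme"
    and f :: "'a \<Rightarrow> 'b" +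
  assumes hom_dif: "a \<in> ops P n d \<Longrightarrow> f (dif P a) = dif Q (f a)"

definition dg_operad_embedding ::
    "('k::field, 'a, 'm) dg_operad_scheme \<Rightarrow> ('k, 'b, 'n) dg_operad_scheme \<Rightarrow> ('a \<Rightarrow> 'b) \<Rightarrow> bool"
  where "dg_operad_embedding P Q f \<longleftrightarrow>
    dg_operad_hom P Q f \<and> (\<forall>n d. inj_on f (ops P n d))"

definition operad_iso ::
    "('k::field, 'a, 'm) operad_scheme \<Rightarrow> ('k, 'b, 'n) operad_scheme \<Rightarrow> ('a \<Rightarrow> 'b) \<Rightarrow> bool"
  where "operad_iso P Q f \<longleftrightarrow>
    operad_hom P Q f \<and> (\<forall>n d. bij_betw f (ops P n d) (ops Q n d))"


section \<open>Ideals, quotients and cohomology\<close>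

definition arity :: "('k, 'a, 'm) operad_scheme \<Rightarrow> 'a \<Rightarrow> nat"
  where "arity P a = (THE n. \<exists>d. a \<in> ops P n d)"

definition degree_of :: "('k, 'a, 'm) operad_scheme \<Rightarrow> 'a \<Rightarrow> int"
  where "degree_of P a = (THE d. \<exists>n. a \<in> ops P n d)"

definition operadic_ideal ::
    "('k::field, 'a, 'm) operad_scheme \<Rightarrow> (nat \<Rightarrow> int \<Rightarrow> 'a set) \<Rightarrow> bool"
  where "operadic_ideal P I \<longleftrightarrow>
    (\<forall>n d. submodule (I n d) base_field (cpt P n d)) \<and>
    (\<forall>n d \<sigma>. \<forall>a \<in> I n d. \<sigma> permutes {1..n} \<longrightarrow> act P a \<sigma> \<in> I n d) \<and>
    (\<forall>m p n q. \<forall>a \<in> I m p. \<forall>b \<in> ops P n q. \<forall>i \<in> {1..m}.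
       pcomp P a i b \<in> I (m + n - 1) (p + q)) \<and>
    (\<forall>m p n q. \<forall>a \<in> ops P m p. \<forall>b \<in> I n q. \<forall>i \<in> {1..m}.
       pcomp P a i b \<in> I (m + n - 1) (p + q))"

definition ideal_generated ::
    "('k::field, 'a, 'm) operad_scheme \<Rightarrow> 'a set \<Rightarrow> nat \<Rightarrow> int \<Rightarrow> 'a set"
  where "ideal_generated P R n d =
    \<Inter> {I n d | I. operadic_ideal P I \<and> (\<forall>m e. R \<inter> ops P m e \<subseteq> I m e)}"

definition quotient_module :: "('k, 'a) module \<Rightarrow> 'a set \<Rightarrow> ('k, 'a set) module"
  where "quotient_module M N =
    \<lparr>carrier = a_rcosets\<^bsub>M\<^esub> N, monoid.mult = undefined, one = undefined, ring.zero = N,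
     add = (\<lambda>A B. A <+>\<^bsub>M\<^esub> B), module.smult = (\<lambda>c A. \<Union>a\<in>A. N +>\<^bsub>M\<^esub> (c \<odot>\<^bsub>M\<^esub> a))\<rparr>"

text \<open>The class \<open>a + I\<close> of a homogeneous operation \<open>a\<close>.\<close>

definition op_coset ::
    "('k, 'a, 'm) operad_scheme \<Rightarrow> (nat \<Rightarrow> int \<Rightarrow> 'a set) \<Rightarrow> 'a \<Rightarrow> 'a set"
  where "op_coset P I a =
    I (arity P a) (degree_of P a) +>\<^bsub>cpt P (arity P a) (degree_of P a)\<^esub> a"

definition quotient_operad ::
    "('k, 'a, 'm) operad_scheme \<Rightarrow> (nat \<Rightarrow> int \<Rightarrow> 'a set) \<Rightarrow> ('k, 'a set) operad"
  where "quotient_operad P I =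
    \<lparr>cpt = (\<lambda>n d. quotient_module (cpt P n d) (I n d)),
     ounit = op_coset P I (ounit P),
     pcomp = (\<lambda>A i B. \<Union>a\<in>A. \<Union>b\<in>B. op_coset P I (pcomp P a i b)),
     act = (\<lambda>A \<sigma>. \<Union>a\<in>A. op_coset P I (act P a \<sigma>))\<rparr>"

definition with_differential :: "('k, 'a) operad \<Rightarrow> ('a \<Rightarrow> 'a) \<Rightarrow> ('k, 'a) dg_operad"
  where "with_differential P D =
    \<lparr>cpt = cpt P, ounit = ounit P, pcomp = pcomp P, act = act P, dif = D\<rparr>"

definition zero_differential :: "('k, 'a) operad \<Rightarrow> 'a \<Rightarrow> 'a"
  where "zero_differential P a = \<zero>\<^bsub>cpt P (arity P a) (degree_of P a + 1)\<^esub>"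

definition cocycles :: "('k, 'a, 'm) dg_operad_scheme \<Rightarrow> nat \<Rightarrow> int \<Rightarrow> 'a set"
  where "cocycles P n d = {a \<in> ops P n d. dif P a = \<zero>\<^bsub>cpt P n (d + 1)\<^esub>}"

definition coboundaries :: "('k, 'a, 'm) dg_operad_scheme \<Rightarrow> nat \<Rightarrow> int \<Rightarrow> 'a set"
  where "coboundaries P n d = dif P ` ops P n (d - 1)"

definition cocycle_operad :: "('k, 'a, 'm) dg_operad_scheme \<Rightarrow> ('k, 'a) operad"
  where "cocycle_operad P =
    \<lparr>cpt = (\<lambda>n d. (cpt P n d)\<lparr>carrier := cocycles P n d\<rparr>),
     ounit = ounit P, pcomp = pcomp P, act = act P\<rparr>"

definition cohomology :: "('k, 'a, 'm) dg_operad_scheme \<Rightarrow> ('k, 'a set) operad"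
  where "cohomology P = quotient_operad (cocycle_operad P) (coboundaries P)"

definition cohomology_class :: "('k, 'a, 'm) dg_operad_scheme \<Rightarrow> 'a \<Rightarrow> 'a set"
  where "cohomology_class P a = op_coset (cocycle_operad P) (coboundaries P) a"


section \<open>Free operads on binary generators\<close>

text \<open>
  The free operad on binary generators is the set of formal operadic expressions in the
  generators, modulo the congruence generated by the axioms of graded operads and the prescribed
  action of the transposition on the generators: \<open>gdeg g\<close> is the degree of the generator \<open>g\<close>, and
  \<open>sw g = (c, h)\<close> stands for \<open>g.(1 2) = c h\<close>.
\<close>

datatype ('k, 'g) opterm =
    Gen 'g
  | Unit
  | Zero nat int
  | Add "('k, 'g) opterm" "('k, 'g) opterm"
  | Scale 'k "('k, 'g) opterm"
  | Comp "('k, 'g) opterm" nat "('k, 'g) opterm"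
  | Act "('k, 'g) opterm" "nat \<Rightarrow> nat"

primrec tar :: "('k, 'g) opterm \<Rightarrow> nat" where
  "tar (Gen g) = 2"
| "tar Unit = 1"
| "tar (Zero n d) = n"
| "tar (Add s t) = tar s"
| "tar (Scale c t) = tar t"
| "tar (Comp s i t) = tar s + tar t - 1"
| "tar (Act t \<sigma>) = tar t"

primrec tdeg :: "('g \<Rightarrow> int) \<Rightarrow> ('k, 'g) opterm \<Rightarrow> int" where
  "tdeg gdeg (Gen g) = gdeg g"
| "tdeg gdeg Unit = 0"
| "tdeg gdeg (Zero n d) = d"
| "tdeg gdeg (Add s t) = tdeg gdeg s"
| "tdeg gdeg (Scale c t) = tdeg gdeg t"
| "tdeg gdeg (Comp s i t) = tdeg gdeg s + tdeg gdeg t"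
| "tdeg gdeg (Act t \<sigma>) = tdeg gdeg t"

primrec twf :: "('g \<Rightarrow> int) \<Rightarrow> ('k, 'g) opterm \<Rightarrow> bool" where
  "twf gdeg (Gen g) \<longleftrightarrow> True"
| "twf gdeg Unit \<longleftrightarrow> True"
| "twf gdeg (Zero n d) \<longleftrightarrow> True"
| "twf gdeg (Add s t) \<longleftrightarrow> twf gdeg s \<and> twf gdeg t \<and> tar s = tar t \<and> tdeg gdeg s = tdeg gdeg t"
| "twf gdeg (Scale c t) \<longleftrightarrow> twf gdeg t"
| "twf gdeg (Comp s i t) \<longleftrightarrow> twf gdeg s \<and> twf gdeg t \<and> i \<in> {1..tar s}"
| "twf gdeg (Act t \<sigma>) \<longleftrightarrow> twf gdeg t \<and> \<sigma> permutes {1..tar t}"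

inductive opeq ::
    "('g \<Rightarrow> int) \<Rightarrow> ('g \<Rightarrow> 'k::field \<times> 'g) \<Rightarrow> ('k, 'g) opterm \<Rightarrow> ('k, 'g) opterm \<Rightarrow> bool"
  for gdeg :: "'g \<Rightarrow> int" and sw :: "'g \<Rightarrow> 'k \<times> 'g"
where
  refl: "twf gdeg t \<Longrightarrow> opeq gdeg sw t t"
| sym: "opeq gdeg sw s t \<Longrightarrow> opeq gdeg sw t s"
| trans: "opeq gdeg sw s t \<Longrightarrow> opeq gdeg sw t u \<Longrightarrow> opeq gdeg sw s u"
| cong_add:
    "twf gdeg (Add s t) \<Longrightarrow> opeq gdeg sw s s' \<Longrightarrow> opeq gdeg sw t t' \<Longrightarrow>
      opeq gdeg sw (Add s t) (Add s' t')"
| cong_scale: "opeq gdeg sw t t' \<Longrightarrow> opeq gdeg sw (Scale c t) (Scale c t')"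
| cong_comp:
    "twf gdeg (Comp s i t) \<Longrightarrow> opeq gdeg sw s s' \<Longrightarrow> opeq gdeg sw t t' \<Longrightarrow>
      opeq gdeg sw (Comp s i t) (Comp s' i t')"
| cong_act:
    "twf gdeg (Act t \<sigma>) \<Longrightarrow> opeq gdeg sw t t' \<Longrightarrow> opeq gdeg sw (Act t \<sigma>) (Act t' \<sigma>)"
| add_assoc: "twf gdeg (Add (Add s t) u) \<Longrightarrow> opeq gdeg sw (Add (Add s t) u) (Add s (Add t u))"
| add_comm: "twf gdeg (Add s t) \<Longrightarrow> opeq gdeg sw (Add s t) (Add t s)"
| add_zero: "twf gdeg t \<Longrightarrow> opeq gdeg sw (Add (Zero (tar t) (tdeg gdeg t)) t) t"
| scale_zero: "twf gdeg t \<Longrightarrow> opeq gdeg sw (Scale 0 t) (Zero (tar t) (tdeg gdeg t))"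
| scale_one: "twf gdeg t \<Longrightarrow> opeq gdeg sw (Scale 1 t) t"
| scale_scale: "twf gdeg t \<Longrightarrow> opeq gdeg sw (Scale b (Scale c t)) (Scale (b * c) t)"
| scale_add_left: "twf gdeg t \<Longrightarrow> opeq gdeg sw (Scale (b + c) t) (Add (Scale b t) (Scale c t))"
| scale_add_right:
    "twf gdeg (Add s t) \<Longrightarrow> opeq gdeg sw (Scale c (Add s t)) (Add (Scale c s) (Scale c t))"
| comp_add_left:
    "twf gdeg (Comp (Add s s') i t) \<Longrightarrow>
      opeq gdeg sw (Comp (Add s s') i t) (Add (Comp s i t) (Comp s' i t))"
| comp_add_right:
    "twf gdeg (Comp s i (Add t t')) \<Longrightarrow>
      opeq gdeg sw (Comp s i (Add t t')) (Add (Comp s i t) (Comp s i t'))"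
| comp_scale_left:
    "twf gdeg (Comp s i t) \<Longrightarrow> opeq gdeg sw (Comp (Scale c s) i t) (Scale c (Comp s i t))"
| comp_scale_right:
    "twf gdeg (Comp s i t) \<Longrightarrow> opeq gdeg sw (Comp s i (Scale c t)) (Scale c (Comp s i t))"
| unit_left: "twf gdeg t \<Longrightarrow> opeq gdeg sw (Comp Unit 1 t) t"
| unit_right: "twf gdeg (Comp t i Unit) \<Longrightarrow> opeq gdeg sw (Comp t i Unit) t"
| comp_sequential:
    "twf gdeg (Comp s i (Comp t j u)) \<Longrightarrow>
      opeq gdeg sw (Comp (Comp s i t) (i + j - 1) u) (Comp s i (Comp t j u))"
| comp_parallel:
    "twf gdeg (Comp s i t) \<Longrightarrow> twf gdeg (Comp s k u) \<Longrightarrow> i < k \<Longrightarrow>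
      opeq gdeg sw (Comp (Comp s i t) (k + tar t - 1) u)
        (Scale (koszul_sign (tdeg gdeg t) (tdeg gdeg u)) (Comp (Comp s k u) i t))"
| act_add:
    "twf gdeg (Act (Add s t) \<sigma>) \<Longrightarrow> opeq gdeg sw (Act (Add s t) \<sigma>) (Add (Act s \<sigma>) (Act t \<sigma>))"
| act_scale: "twf gdeg (Act t \<sigma>) \<Longrightarrow> opeq gdeg sw (Act (Scale c t) \<sigma>) (Scale c (Act t \<sigma>))"
| act_id: "twf gdeg t \<Longrightarrow> opeq gdeg sw (Act t id) t"
| act_act:
    "twf gdeg (Act (Act t \<sigma>) \<tau>) \<Longrightarrow> opeq gdeg sw (Act (Act t \<sigma>) \<tau>) (Act t (\<sigma> \<circ> \<tau>))"
| comp_act_left: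
    "twf gdeg (Comp (Act s \<sigma>) i t) \<Longrightarrow>
      opeq gdeg sw (Comp (Act s \<sigma>) i t)
        (Act (Comp s (\<sigma> i) t) (outer_perm (tar s) (tar t) i \<sigma>))"
| comp_act_right:
    "twf gdeg (Comp s i (Act t \<tau>)) \<Longrightarrow>
      opeq gdeg sw (Comp s i (Act t \<tau>)) (Act (Comp s i t) (inner_perm (tar t) i \<tau>))"
| gen_swap:
    "opeq gdeg sw (Act (Gen g) (transpose 1 2)) (Scale (fst (sw g)) (Gen (snd (sw g))))"

definition opcls ::
    "('g \<Rightarrow> int) \<Rightarrow> ('g \<Rightarrow> 'k::field \<times> 'g) \<Rightarrow> ('k, 'g) opterm \<Rightarrow> ('k, 'g) opterm set"
  where "opcls gdeg sw t = {s. opeq gdeg sw t s}"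

definition free_component ::
    "('g \<Rightarrow> int) \<Rightarrow> ('g \<Rightarrow> 'k::field \<times> 'g) \<Rightarrow> nat \<Rightarrow> int \<Rightarrow> ('k, ('k, 'g) opterm set) module"
  where "free_component gdeg sw n d =
    \<lparr>carrier = opcls gdeg sw ` {t. twf gdeg t \<and> tar t = n \<and> tdeg gdeg t = d},
     monoid.mult = undefined, one = undefined,
     ring.zero = opcls gdeg sw (Zero n d),
     add = (\<lambda>A B. \<Union>s\<in>A. \<Union>t\<in>B. opcls gdeg sw (Add s t)),
     module.smult = (\<lambda>c A. \<Union>t\<in>A. opcls gdeg sw (Scale c t))\<rparr>"

definition free_operad ::
    "('g \<Rightarrow> int) \<Rightarrow> ('g \<Rightarrow> 'k::field \<times> 'g) \<Rightarrow> ('k, ('k, 'g) opterm set) operad"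
  where "free_operad gdeg sw =
    \<lparr>cpt = free_component gdeg sw,
     ounit = opcls gdeg sw Unit,
     pcomp = (\<lambda>A i B. \<Union>s\<in>A. \<Union>t\<in>B. opcls gdeg sw (Comp s i t)),
     act = (\<lambda>A \<sigma>. \<Union>t\<in>A. opcls gdeg sw (Act t \<sigma>))\<rparr>"


section \<open>The operad Lie\<close>

datatype lie_gen = GenL

definition lie_deg :: "lie_gen \<Rightarrow> int"
  where "lie_deg g = 0"

definition lie_swap :: "lie_gen \<Rightarrow> 'k::field \<times> lie_gen"
  where "lie_swap g = (-1, GenL)"

type_synonym 'k lie_free = "('k, lie_gen) opterm set"

definition lie_T :: "('k::field, 'k lie_free) operad"
  where "lie_T = free_operad lie_deg lie_swap"

definition lie_T_l :: "'k::field lie_free"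
  where "lie_T_l = opcls lie_deg lie_swap (Gen GenL)"

definition jacobi_relation :: "'k::field lie_free"
  where "jacobi_relation =
    (let M = cpt lie_T 3 0; u = pcomp lie_T lie_T_l 1 lie_T_l
     in (u \<oplus>\<^bsub>M\<^esub> act lie_T u (cycle_of_list [1, 2, 3])) \<oplus>\<^bsub>M\<^esub> act lie_T u (cycle_of_list [1, 3, 2]))"

definition lie_ideal :: "nat \<Rightarrow> int \<Rightarrow> 'k::field lie_free set"
  where "lie_ideal = ideal_generated lie_T {jacobi_relation}"

definition Lie :: "('k::field, 'k lie_free set) operad"
  where "Lie = quotient_operad lie_T lie_ideal"

definition lie_l :: "'k::field lie_free set"
  where "lie_l = op_coset lie_T lie_ideal lie_T_l"

definition Lie_dg :: "('k::field, 'k lie_free set) dg_operad"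
  where "Lie_dg = with_differential Lie (zero_differential Lie)"


section \<open>The differential graded operad \<open>Greg\<^sub>-\<^sub>1\<close>\<close>

datatype greg_gen = GenX | GenY | GenG

primrec greg_deg :: "greg_gen \<Rightarrow> int" where
  "greg_deg GenX = 0"
| "greg_deg GenY = 0"
| "greg_deg GenG = 1"

primrec greg_swap :: "greg_gen \<Rightarrow> 'k::field \<times> greg_gen" where
  "greg_swap GenX = (1, GenY)"
| "greg_swap GenY = (1, GenX)"
| "greg_swap GenG = (1, GenG)"

type_synonym 'k greg_free = "('k, greg_gen) opterm set"

definition greg_T :: "('k::field, 'k greg_free) operad"
  where "greg_T = free_operad greg_deg greg_swap"

definition greg_T_gen :: "greg_gen \<Rightarrow> 'k::field greg_free"
  where "greg_T_gen g = opcls greg_deg greg_swap (Gen g)"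

definition prelie_relation :: "'k::field greg_free"
  where "prelie_relation =
    (let M = cpt greg_T 3 0; x = greg_T_gen GenX;
         u = pcomp greg_T x 1 x \<ominus>\<^bsub>M\<^esub> pcomp greg_T x 2 x
     in u \<ominus>\<^bsub>M\<^esub> act greg_T u (transpose 2 3))"

definition greg_relation :: "'k::field greg_free"
  where "greg_relation =
    (let M = cpt greg_T 3 1; x = greg_T_gen GenX; g = greg_T_gen GenG;
         u = (pcomp greg_T x 1 g \<ominus>\<^bsub>M\<^esub> act greg_T (pcomp greg_T g 1 x) (transpose 2 3))
               \<ominus>\<^bsub>M\<^esub> pcomp greg_T g 2 x
     in u \<ominus>\<^bsub>M\<^esub> act greg_T u (transpose 2 3))"

definition greg_ideal :: "nat \<Rightarrow> int \<Rightarrow> 'k::field greg_free set"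
  where "greg_ideal = ideal_generated greg_T {prelie_relation, greg_relation}"

text \<open>The underlying graded operad, with \<open>g\<close> placed in degree \<open>1\<close>.\<close>

definition Greg1 :: "('k::field, 'k greg_free set) operad"
  where "Greg1 = quotient_operad greg_T greg_ideal"

definition greg_x :: "'k::field greg_free set"
  where "greg_x = op_coset greg_T greg_ideal (greg_T_gen GenX)"

definition greg_y :: "'k::field greg_free set"
  where "greg_y = op_coset greg_T greg_ideal (greg_T_gen GenY)"

definition greg_g :: "'k::field greg_free set"
  where "greg_g = op_coset greg_T greg_ideal (greg_T_gen GenG)"

text \<open>
  A derivation is determined on all operations by its values on the generators; the choice below
  only concerns values outside of the components of the operad.
\<close>

definition greg_d :: "'k::field greg_free set \<Rightarrow> 'k greg_free set"
  where "greg_d = (SOME D. operadic_derivation Greg1 D \<and>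
    D greg_x = \<ominus>\<^bsub>cpt Greg1 2 1\<^esub> greg_g \<and>
    D greg_y = \<ominus>\<^bsub>cpt Greg1 2 1\<^esub> greg_g \<and>
    D greg_g = \<zero>\<^bsub>cpt Greg1 2 2\<^esub>)"

definition Greg_minus1 :: "('k::field, 'k greg_free set) dg_operad"
  where "Greg_minus1 = with_differential Greg1 greg_d"

end

theory Submission
  imports Defs "HOL-Library.Poly_Mapping"
begin

text \<open>
  Operations are represented by linear combinations of binary trees with vertices \<open>x\<close>, \<open>y\<close>, \<open>g\<close> and
  leaves labelled \<open>1, \<dots>, n\<close>, modulo the relations. Singling out the leaf \<open>n\<close> yields operators on trees:
  an explicit homotopy \<open>h\<close>, the substitutions \<open>E\<^sub>j\<close> of the bracket \<open>[j, n] = x(j, n) - x(n, j)\<close> for the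
  leaf \<open>j < n\<close>, and operators \<open>C\<^sub>j\<close> that remove the leaf \<open>n\<close>. They all respect the relations, and
  \<open>d h + h d = id - \<Sum>\<^sub>j E\<^sub>j C\<^sub>j\<close>, \<open>C\<^sub>i E\<^sub>j = \<delta>\<^sub>i\<^sub>j\<close>, while \<open>d\<close> commutes with \<open>C\<^sub>j\<close> and, modulo relations, with \<open>E\<^sub>j\<close>.
  Hence a cocycle of arity \<open>n\<close> is cohomologous to \<open>\<Sum>\<^sub>j E\<^sub>j z\<^sub>j\<close> with cocycles \<open>z\<^sub>j = C\<^sub>j z\<close> of arity \<open>n - 1\<close>,
  and by induction to the image of a Lie operation. By the Jacobi identity every Lie operation of
  arity \<open>n \<ge> 2\<close> has the form \<open>\<Sum>\<^sub>j E\<^sub>j \<lambda>\<^sub>j\<close>; if its image is a boundary, then applying \<open>C\<^sub>i\<close> shows that the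
  image of each \<open>\<lambda>\<^sub>i\<close> is a boundary, so \<open>\<lambda>\<^sub>i = 0\<close> by induction.
\<close>

section \<open>Linear combinations of labelled binary trees\<close>

text \<open>The homotopy is forced by the vertex next to the leaf \<open>n\<close>. As
  \<open>d\<close> turns x(n, w) into -g(n, w) up to terms inside w, sending g(n, w) to -x(n, w)
  removes both. What survives is x(u, n) corrected by -x(n, u), that is, the bracket [u, n]. In Lie
  the Jacobi identity makes bracketing with \<open>n\<close> a derivation, so [u, n] is the sum of
  its substitutions into the leaves of u. In Greg this holds only up to a second homotopy, which
  replaces a vertex g by the associator of \<open>n\<close> with the two arguments of g; its value
  on u is what h must assign to x(u, n). The argument works without a basis of Greg. It rests on an
  equivalence: a combination of trees represents zero exactly when it lies in the span of explicit
  relations. Labels may repeat, so that operators are defined by recursion on subtrees; bijective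
  labellings matter only where operations are meant. Operators act from the right, hence descending
  into a child costs at most the degree of its right sibling, and the differential on trees differs
  from that of the operad by the parity of the degree.\<close>

datatype 'g mon = Lf nat | Nd 'g "'g mon" "'g mon"

primrec leaves :: "'g mon \<Rightarrow> nat list" where
  "leaves (Lf j) = [j]"
| "leaves (Nd g a b) = leaves a @ leaves b"

primrec relabel :: "(nat \<Rightarrow> nat) \<Rightarrow> 'g mon \<Rightarrow> 'g mon" where
  "relabel f (Lf j) = Lf (f j)"
| "relabel f (Nd g a b) = Nd g (relabel f a) (relabel f b)"

lemma leaves_relabel [simp]: "leaves (relabel f a) = map f (leaves a)"
  by (induction a) auto

lemma leaves_nonempty [simp]: "leaves a \<noteq> []"
  by (induction a) auto

lemma relabel_relabel [simp]: "relabel f (relabel h a) = relabel (\<lambda>j. f (h j)) a"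
  by (induction a) auto

lemma relabel_cong: "(\<And>j. j \<in> set (leaves a) \<Longrightarrow> f j = h j) \<Longrightarrow> relabel f a = relabel h a"
  by (induction a) auto

lemma relabel_ident [simp]: "relabel (\<lambda>j. j) a = a" "relabel id a = a"
  by (induction a) auto

type_synonym ('k, 'g) lin = "'g mon \<Rightarrow>\<^sub>0 'k"

abbreviation lookup where "lookup \<equiv> Poly_Mapping.lookup"
abbreviation keys where "keys \<equiv> Poly_Mapping.keys"

definition scl :: "'k::field \<Rightarrow> ('b \<Rightarrow>\<^sub>0 'k) \<Rightarrow> ('b \<Rightarrow>\<^sub>0 'k)" (infixr \<open>\<star>\<close> 75)
  where "c \<star> u = Poly_Mapping.map ((*) c) u"

abbreviation bas :: "'b \<Rightarrow> ('b \<Rightarrow>\<^sub>0 'k::field)"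
  where "bas m \<equiv> Poly_Mapping.single m 1"

lemma lookup_scl [simp]: "lookup (c \<star> u) m = c * lookup u m"
  unfolding scl_def by (simp add: Poly_Mapping.map.rep_eq when_def)

lemma scl_simps [simp]:
  "c \<star> 0 = 0" "0 \<star> u = 0" "1 \<star> u = u" "b \<star> (c \<star> u) = (b * c) \<star> u"
  "(- c) \<star> u = - (c \<star> u)" "c \<star> (- u) = - (c \<star> u)"
  by (auto intro!: poly_mapping_eqI simp: mult.assoc)

lemma scl_add_right: "c \<star> (u + v) = c \<star> u + c \<star> v"
  and scl_add_left: "(b + c) \<star> u = b \<star> u + c \<star> u"
  and scl_diff_right: "c \<star> (u - v) = c \<star> u - c \<star> v"
  by (auto intro!: poly_mapping_eqI simp: lookup_add lookup_minus algebra_simps)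

lemmas scl_distribs = scl_add_right scl_diff_right

lemma scl_sum: "c \<star> (\<Sum>x\<in>A. f x) = (\<Sum>x\<in>A. c \<star> f x)"
  by (induction A rule: infinite_finite_induct) (auto simp: scl_add_right)

lemma scl_single: "c \<star> bas m = Poly_Mapping.single m c"
  by (auto intro!: poly_mapping_eqI simp: lookup_single when_def)

lemma lin_expansion: "(u :: 'b \<Rightarrow>\<^sub>0 'k::field) = (\<Sum>m\<in>keys u. lookup u m \<star> bas m)"
  by (rule poly_mapping_eqI)
     (auto simp: lookup_sum lookup_single when_def in_keys_iff if_distrib sum.delta cong: if_cong)

text \<open>The support of the tail stays inside \<open>A\<close>, so hypotheses stated through
  \<open>keys\<close>, such as homogeneity or a fixed arity, remain available for the tail.\<close>

lemma keys_induct [consumes 1, case_names zero add]: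
  fixes u :: "'b \<Rightarrow>\<^sub>0 'k::field"
  assumes "keys u \<subseteq> A"
    and "P 0"
    and add: "\<And>c m v. m \<in> A \<Longrightarrow> P v \<Longrightarrow> keys v \<subseteq> A \<Longrightarrow> P (c \<star> bas m + v)"
  shows "P u"
proof -
  have "P (\<Sum>m\<in>B. lookup u m \<star> bas m) \<and> keys (\<Sum>m\<in>B. lookup u m \<star> bas m) \<subseteq> A"
    if "finite B" "B \<subseteq> A" for B
    using that
  proof (induction B rule: finite_induct)
    case (insert m B)
    have "keys (lookup u m \<star> bas m + (\<Sum>m\<in>B. lookup u m \<star> bas m)) \<subseteq> A"
      using insert keys_add[of "lookup u m \<star> bas m" "\<Sum>m\<in>B. lookup u m \<star> bas m"]
      by (auto simp: scl_single split: if_splits)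
    then show ?case using insert by (auto intro!: add)
  qed (simp add: assms)
  from this[of "keys u"] show ?thesis using assms(1) by (simp flip: lin_expansion)
qed

lemma lin_induct [case_names zero add]:
  fixes u :: "'b \<Rightarrow>\<^sub>0 'k::field"
  assumes "P 0" "\<And>c m v. P v \<Longrightarrow> P (c \<star> bas m + v)"
  shows "P u"
  by (rule keys_induct[of u UNIV]) (use assms in auto)

lemma keys_scl_subset: "keys (c \<star> u) \<subseteq> keys u"
  by (auto simp: in_keys_iff)

lemma keys_uminus [simp]: "keys (- u) = keys (u :: 'b \<Rightarrow>\<^sub>0 'k::field)"
  by (auto simp: in_keys_iff)

lemma keys_diff_subset: "keys (u - v :: 'b \<Rightarrow>\<^sub>0 'k::field) \<subseteq> keys u \<union> keys v"
  by (auto simp: in_keys_iff lookup_minus)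

definition lext :: "('a \<Rightarrow> ('b \<Rightarrow>\<^sub>0 'k::field)) \<Rightarrow> ('a \<Rightarrow>\<^sub>0 'k) \<Rightarrow> ('b \<Rightarrow>\<^sub>0 'k)"
  where "lext f u = (\<Sum>m\<in>keys u. lookup u m \<star> f m)"

lemma lext_superset: "finite A \<Longrightarrow> keys u \<subseteq> A \<Longrightarrow> lext f u = (\<Sum>m\<in>A. lookup u m \<star> f m)"
  unfolding lext_def by (rule sum.mono_neutral_left) (auto simp: in_keys_iff)

definition linear_map :: "(('a \<Rightarrow>\<^sub>0 'k::field) \<Rightarrow> ('b \<Rightarrow>\<^sub>0 'k)) \<Rightarrow> bool"
  where "linear_map F \<longleftrightarrow> (\<forall>u v. F (u + v) = F u + F v) \<and> (\<forall>c u. F (c \<star> u) = c \<star> F u)"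

lemma linear_mapD:
  assumes "linear_map F"
  shows "F (u + v) = F u + F v" "F (c \<star> u) = c \<star> F u" "F 0 = 0" "F (- u) = - F u"
    "F (u - v) = F u - F v"
proof -
  show *: "F (u + v) = F u + F v" "F (c \<star> u) = c \<star> F u" for u v c
    using assms by (auto simp: linear_map_def)
  show "F 0 = 0" using *(2)[of 0 0] by simp
  show **: "F (- u) = - F u" for u using *(2)[of "-1" u] by simp
  show "F (u - v) = F u - F v" using *(1)[of u "- v"] ** by simp
qed

lemma linear_map_lext [intro!, simp]: "linear_map (lext f)"
proof -
  have "lext f (u + v) = lext f u + lext f v" for u v
    using keys_add[of u v]
    by (subst (1 2 3) lext_superset[where A = "keys u \<union> keys v"])
       (auto simp: lookup_add scl_add_left sum.distrib)
  moreover have "lext f (c \<star> u) = c \<star> lext f u" for c u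
    using keys_scl_subset[of c u]
    by (subst (1 2) lext_superset[where A = "keys u"]) (auto simp: scl_sum)
  ultimately show ?thesis by (auto simp: linear_map_def)
qed

lemmas lext_linear [simp] = linear_mapD[OF linear_map_lext]

lemma lext_bas [simp]: "lext f (bas m) = f m"
  by (simp add: lext_def)

lemma lext_cong: "(\<And>m. m \<in> keys u \<Longrightarrow> f m = h m) \<Longrightarrow> lext f u = lext h u"
  by (simp add: lext_def)

lemma lin_eqI:
  assumes "linear_map F" "linear_map G" "\<And>m. m \<in> keys u \<Longrightarrow> F (bas m) = G (bas m)"
  shows "F u = G u"
  by (rule keys_induct[of u "keys u"]) (use assms in \<open>auto simp: linear_mapD\<close>)

lemma linear_map_id [intro!, simp]: "linear_map (\<lambda>u. u)"
  and linear_map_zero [intro!, simp]: "linear_map (\<lambda>u. 0)"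
  by (auto simp: linear_map_def)

lemma linear_map_comp: "linear_map F \<Longrightarrow> linear_map G \<Longrightarrow> linear_map (\<lambda>u. F (G u))"
  by (auto simp: linear_map_def)

lemma linear_map_add: "linear_map F \<Longrightarrow> linear_map G \<Longrightarrow> linear_map (\<lambda>u. F u + G u)"
  and linear_map_diff: "linear_map F \<Longrightarrow> linear_map G \<Longrightarrow> linear_map (\<lambda>u. F u - G u)"
  and linear_map_uminus: "linear_map F \<Longrightarrow> linear_map (\<lambda>u. - F u)"
  and linear_map_scl: "linear_map F \<Longrightarrow> linear_map (\<lambda>u. c \<star> F u)"
  by (auto simp: linear_map_def scl_distribs algebra_simps)

lemma linear_map_sum:
  "(\<And>x. x \<in> A \<Longrightarrow> linear_map (F x)) \<Longrightarrow> linear_map (\<lambda>u. \<Sum>x\<in>A. F x u)"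
  by (auto simp: linear_map_def sum.distrib scl_sum)

lemma linear_sum: "linear_map F \<Longrightarrow> F (\<Sum>x\<in>A. h x) = (\<Sum>x\<in>A. F (h x))"
  by (induction A rule: infinite_finite_induct) (auto simp: linear_mapD)

definition nd :: "'g \<Rightarrow> ('k::field, 'g) lin \<Rightarrow> ('k, 'g) lin \<Rightarrow> ('k, 'g) lin"
  where "nd g u w = lext (\<lambda>a. lext (\<lambda>b. bas (Nd g a b)) w) u"

lemma linear_map_nd [intro!, simp]:
  fixes g :: 'g
  shows "linear_map (nd g u)" "linear_map (\<lambda>u. nd g u w)"
proof -
  have "linear_map (\<lambda>w. lext (\<lambda>b. bas (Nd g a b)) w)" for a
    by simp
  then show "linear_map (nd g u)" unfolding nd_def lext_def[of _ u]
    by (intro linear_map_sum linear_map_scl)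
  show "linear_map (\<lambda>u. nd g u w)" unfolding nd_def by (rule linear_map_lext)
qed

lemmas nd_linear [simp] = linear_mapD[OF linear_map_nd(1)] linear_mapD[OF linear_map_nd(2)]

lemma nd_bas [simp]: "nd g (bas a) (bas b) = bas (Nd g a b)"
  by (simp add: nd_def)

lemma keys_nd: "keys (nd g u w) \<subseteq> (\<lambda>(a, b). Nd g a b) ` (keys u \<times> keys w)"
proof -
  have "keys (nd g u w) \<subseteq> (\<Union>a\<in>keys u. \<Union>b\<in>keys w. {Nd g a b})"
    unfolding nd_def lext_def
    by (rule order.trans[OF keys_sum] UN_mono order.refl order.trans[OF keys_scl_subset])+
       (auto split: if_splits)
  then show ?thesis by auto
qed

definition ren :: "(nat \<Rightarrow> nat) \<Rightarrow> ('k::field, 'g) lin \<Rightarrow> ('k, 'g) lin"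
  where "ren f = lext (\<lambda>m. bas (relabel f m))"

lemma linear_map_ren [intro!, simp]: "linear_map (ren f)"
  by (simp add: ren_def)

lemmas ren_linear [simp] = linear_mapD[OF linear_map_ren]

lemma ren_bas [simp]: "ren f (bas m) = bas (relabel f m)"
  by (simp add: ren_def)

lemma ren_nd [simp]: "ren f (nd g u w) = nd g (ren f u) (ren f w)"
proof (induction u rule: lin_induct)
  case (add c m v)
  have "ren f (nd g (bas m) w) = nd g (ren f (bas m)) (ren f w)"
    by (induction w rule: lin_induct) auto
  with add show ?case by simp
qed simp

lemma ren_ren [simp]: "ren f (ren h u) = ren (\<lambda>j. f (h j)) u"
  by (induction u rule: lin_induct) auto

lemma ren_ident [simp]: "ren (\<lambda>j. j) u = u" "ren id u = u"
  by (induction u rule: lin_induct) auto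

lemma ren_cong:
  assumes "\<And>m j. m \<in> keys u \<Longrightarrow> j \<in> set (leaves m) \<Longrightarrow> f j = h j"
  shows "ren f u = ren h u"
  unfolding ren_def by (rule lext_cong) (auto intro: relabel_cong assms arg_cong[where f = bas])

lemma keys_lext: "keys (lext f u) \<subseteq> (\<Union>m\<in>keys u. keys (f m))"
  unfolding lext_def by (rule order.trans[OF keys_sum]) (rule UN_mono[OF order.refl], rule keys_scl_subset)

lemma keys_ren: "keys (ren f u) \<subseteq> relabel f ` keys u"
  unfolding ren_def using keys_lext[of "\<lambda>m. bas (relabel f m)" u] by (auto split: if_splits)

text \<open>Encoded by parity, so that case splits on \<open>even\<close> decide identities of
  signs; \<open>koszul_sign_eq\<close> links it to the sign in the operad axioms.\<close>

definition sg :: "int \<Rightarrow> 'k::field"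
  where "sg e = (if even e then 1 else - 1)"

lemma sg_simps [simp]: "sg 0 = 1" "sg 1 = -1" "sg a * sg a = 1" "sg a * (sg a * x) = x" "sg (a + a) = 1"
  by (auto simp: sg_def)

lemma sg_add: "sg (a + b) = sg a * sg b"
  by (auto simp: sg_def)

lemma koszul_sign_eq: "koszul_sign p q = sg (p * q)"
  by (auto simp: koszul_sign_def sg_def power_int_minus_left)

section \<open>Degrees, Koszul signs and operators that act on trees from the right\<close>

locale graded_generators =
  fixes gdeg :: "'g \<Rightarrow> int"
begin

primrec mdeg :: "'g mon \<Rightarrow> int" where
  "mdeg (Lf j) = 0"
| "mdeg (Nd g a b) = gdeg g + mdeg a + mdeg b"

lemma mdeg_relabel [simp]: "mdeg (relabel f a) = mdeg a"
  by (induction a) auto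

text \<open>The Koszul sign for moving an operator of degree \<open>q\<close> past a tree; only the
  parity of \<open>q\<close> matters (\<open>eps_even\<close>, \<open>eps_odd\<close>).\<close>

definition eps :: "int \<Rightarrow> ('k::field, 'g) lin \<Rightarrow> ('k, 'g) lin"
  where "eps q = lext (\<lambda>m. sg (q * mdeg m) \<star> bas m)"

lemma linear_map_eps [intro!, simp]: "linear_map (eps q)"
  by (simp add: eps_def)

lemmas eps_linear [simp] = linear_mapD[OF linear_map_eps]

lemma eps_bas: "eps q (bas m) = sg (q * mdeg m) \<star> bas m"
  by (simp add: eps_def)

lemma eps_Lf [simp]: "eps q (bas (Lf j)) = bas (Lf j)"
  by (simp add: eps_bas)

lemma eps_nd: "eps q (nd g u w) = sg (q * gdeg g) \<star> nd g (eps q u) (eps q w)"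
proof (induction u rule: lin_induct)
  case (add c m v)
  have "eps q (nd g (bas m) w) = sg (q * gdeg g) \<star> nd g (eps q (bas m)) (eps q w)"
    by (induction w rule: lin_induct)
      (auto simp: eps_bas sg_add distrib_left scl_distribs mult.commute mult.left_commute)
  with add show ?case by (simp add: scl_distribs mult.commute mult.left_commute)
qed simp

lemma eps_eps: "eps p (eps q u) = eps (p + q) u"
  by (induction u rule: lin_induct)
     (auto simp: eps_bas sg_add distrib_left distrib_right scl_distribs mult.commute mult.left_commute)

lemma eps_commute: "eps p (eps q u) = eps q (eps p u)"
  by (simp add: eps_eps add.commute)

lemma eps_even: "even q \<Longrightarrow> eps q u = u"
  by (induction u rule: lin_induct) (auto simp: eps_bas sg_def)

lemma eps_odd: "odd q \<Longrightarrow> eps q u = eps 1 u"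
  by (induction u rule: lin_induct) (auto simp: eps_bas sg_def)

lemma eps_involution [simp]: "eps q (eps q u) = u" "eps 0 u = u"
  by (auto simp: eps_eps eps_even)

lemma eps_ren [simp]: "eps q (ren f u) = ren f (eps q u)"
  by (induction u rule: lin_induct) (auto simp: eps_bas)

definition homog :: "int \<Rightarrow> ('k::field, 'g) lin \<Rightarrow> bool"
  where "homog d u \<longleftrightarrow> (\<forall>m\<in>keys u. mdeg m = d)"

lemma homog_zero [simp]: "homog d 0"
  and homog_bas [simp]: "homog d (bas m) \<longleftrightarrow> mdeg m = d"
  by (simp_all add: homog_def)

lemma homog_scl: "homog d u \<Longrightarrow> homog d (c \<star> u)"
  using keys_scl_subset[of c u] by (auto simp: homog_def)

lemma homog_add: "homog d u \<Longrightarrow> homog d v \<Longrightarrow> homog d (u + v)"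
  using keys_add[of u v] by (auto simp: homog_def)

lemma homog_uminus: "homog d u \<Longrightarrow> homog d (- u)"
  by (simp add: homog_def)

lemma homog_diff: "homog d u \<Longrightarrow> homog d v \<Longrightarrow> homog d (u - v)"
  using keys_diff_subset[of u v] by (auto simp: homog_def)

lemma homog_ren: "homog d u \<Longrightarrow> homog d (ren f u)"
  using keys_ren[of f u] by (auto simp: homog_def)

lemma homog_nd: "homog d u \<Longrightarrow> homog e v \<Longrightarrow> gdeg g + d + e = c \<Longrightarrow> homog c (nd g u v)"
  using keys_nd[of g u v] by (auto simp: homog_def)

lemma eps_homog: "homog d u \<Longrightarrow> eps q u = sg (q * d) \<star> u"
  by (rule lin_eqI[where F = "eps q" and G = "\<lambda>u. sg (q * d) \<star> u"])
     (simp_all add: linear_map_scl eps_bas homog_def)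

lemma homog_eps: "homog d u \<Longrightarrow> homog d (eps q u)"
  by (simp add: eps_homog homog_scl)

primrec der_mon ::
    "int \<Rightarrow> (nat \<Rightarrow> nat) \<Rightarrow> (nat \<Rightarrow> ('k::field, 'g) lin) \<Rightarrow>
      ('g \<Rightarrow> ('k, 'g) lin \<Rightarrow> ('k, 'g) lin \<Rightarrow> ('k, 'g) lin) \<Rightarrow> 'g mon \<Rightarrow> ('k, 'g) lin" where
  "der_mon q f e \<gamma> (Lf j) = e j"
| "der_mon q f e \<gamma> (Nd g a b) =
    nd g (der_mon q f e \<gamma> a) (eps q (bas (relabel f b))) +
    nd g (bas (relabel f a)) (der_mon q f e \<gamma> b) + \<gamma> g (bas a) (bas b)"

text \<open>
  Derivations along the relabelling \<open>f\<close> that act from the right: passing the second argument of a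
  node costs the Koszul sign, passing its generator does not.
\<close>

definition der where "der q f e \<gamma> = lext (der_mon q f e \<gamma>)"

text \<open>The term \<gamma> receives both subtrees and may inspect or transform them, so
  \<open>der\<close> covers more than derivations given by values on generators. Bilinearity is what
  lets the recursion on trees pass to linear combinations in \<open>der_nd\<close>.\<close>

definition bilinear_family ::
    "('g \<Rightarrow> ('k::field, 'g) lin \<Rightarrow> ('k, 'g) lin \<Rightarrow> ('k, 'g) lin) \<Rightarrow> bool"
  where "bilinear_family \<gamma> \<longleftrightarrow>
    (\<forall>g u. linear_map (\<gamma> g u)) \<and> (\<forall>g w. linear_map (\<lambda>u. \<gamma> g u w))"

lemma bilinear_family_zero [simp]: "bilinear_family (\<lambda>g u w. 0)"
  by (simp add: bilinear_family_def)

lemma linear_map_der [intro!, simp]: "linear_map (der q f e \<gamma>)"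
  by (simp add: der_def)

lemmas der_linear [simp] = linear_mapD[OF linear_map_der]

lemma der_Lf [simp]: "der q f e \<gamma> (bas (Lf j)) = e j"
  by (simp add: der_def)

lemma der_Nd: "der q f e \<gamma> (bas (Nd g a b)) =
    nd g (der q f e \<gamma> (bas a)) (eps q (bas (relabel f b))) +
    nd g (bas (relabel f a)) (der q f e \<gamma> (bas b)) + \<gamma> g (bas a) (bas b)"
  by (simp add: der_def)

lemma der_nd:
  assumes "bilinear_family \<gamma>"
  shows "der q f e \<gamma> (nd g u w) =
    nd g (der q f e \<gamma> u) (eps q (ren f w)) + nd g (ren f u) (der q f e \<gamma> w) + \<gamma> g u w"
proof (induction u rule: lin_induct)
  case zero
  show ?case using assms by (simp add: bilinear_family_def linear_mapD[of "\<lambda>u. \<gamma> g u w" for w])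
next
  case (add c m v)
  have lin: "linear_map (\<gamma> g u)" "linear_map (\<lambda>u. \<gamma> g u w)" for u w
    using assms by (auto simp: bilinear_family_def)
  have "der q f e \<gamma> (nd g (bas m) w) = nd g (der q f e \<gamma> (bas m)) (eps q (ren f w)) +
      nd g (ren f (bas m)) (der q f e \<gamma> w) + \<gamma> g (bas m) w"
  proof (induction w rule: lin_induct)
    case (add c m v)
    then show ?case by (simp add: linear_mapD[OF lin(1)] der_Nd scl_distribs)
  qed (simp add: linear_mapD[OF lin(1)])
  with add show ?case by (simp add: linear_mapD[OF lin(2)] scl_distribs)
qed

lemmas der0_nd [simp] = der_nd[OF bilinear_family_zero, simplified]

end

context graded_generators
begin

text \<open>Not a simultaneous substitution: one leaf at a time is replaced by its value under
  \<open>e\<close>, the others are relabelled by \<open>f\<close>, and the results are summed over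
  all leaves. If \<open>e\<close> is nonzero at a single label that occurs once, the sum is a single
  graft.\<close>

abbreviation subst :: "int \<Rightarrow> (nat \<Rightarrow> nat) \<Rightarrow> (nat \<Rightarrow> ('k::field, 'g) lin) \<Rightarrow> ('k, 'g) lin \<Rightarrow> ('k, 'g) lin"
  where "subst q f e \<equiv> der q f e (\<lambda>g u w. 0)"

lemma der_cong:
  assumes "\<And>m j. m \<in> keys u \<Longrightarrow> j \<in> set (leaves m) \<Longrightarrow> f j = f' j \<and> e j = e' j"
  shows "der q f e \<gamma> u = der q f' e' \<gamma> u"
proof -
  have "der_mon q f e \<gamma> m = der_mon q f' e' \<gamma> m"
    if "\<And>j. j \<in> set (leaves m) \<Longrightarrow> f j = f' j \<and> e j = e' j" for m
    using that
  proof (induction m)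
    case (Nd g a b)
    then have "relabel f a = relabel f' a" "relabel f b = relabel f' b"
      by (auto intro!: relabel_cong)
    with Nd show ?case by simp
  qed simp
  then show ?thesis unfolding der_def using assms by (intro lext_cong) blast
qed

lemma ren_subst: "ren h (subst q f e u) = subst q (\<lambda>j. h (f j)) (\<lambda>j. ren h (e j)) u"
proof (induction u rule: lin_induct)
  case (add c m v)
  have "ren h (subst q f e (bas m)) = subst q (\<lambda>j. h (f j)) (\<lambda>j. ren h (e j)) (bas m)"
    by (induction m) (simp_all add: der_Nd eps_bas)
  with add show ?case by simp
qed simp

lemma subst_ren: "subst q f e (ren h u) = subst q (\<lambda>j. f (h j)) (\<lambda>j. e (h j)) u"
proof (induction u rule: lin_induct)
  case (add c m v)
  have "subst q f e (ren h (bas m)) = subst q (\<lambda>j. f (h j)) (\<lambda>j. e (h j)) (bas m)"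
    by (induction m) (simp_all add: der_Nd)
  with add show ?case by simp
qed simp

lemma eps_subst:
  assumes "\<And>j. homog q (e j)"
  shows "eps r (subst q f e u) = sg (r * q) \<star> subst q f e (eps r u)"
proof (induction u rule: lin_induct)
  case (add c m v)
  have "eps r (subst q f e (bas m)) = sg (r * q) \<star> subst q f e (eps r (bas m))"
  proof (induction m)
    case (Nd g a b)
    then show ?case
      by (simp add: der_Nd eps_nd eps_bas sg_add distrib_left scl_distribs ac_simps)
  qed (simp add: eps_homog assms)
  with add show ?case by (simp add: scl_distribs mult.commute)
qed simp

definition homogeneous_family ::
    "int \<Rightarrow> ('g \<Rightarrow> ('k::field, 'g) lin \<Rightarrow> ('k, 'g) lin \<Rightarrow> ('k, 'g) lin) \<Rightarrow> bool"
  where "homogeneous_family q \<gamma> \<longleftrightarrow>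
    (\<forall>g u w d e. homog d u \<longrightarrow> homog e w \<longrightarrow> homog (gdeg g + d + e + q) (\<gamma> g u w))"

lemma homogeneous_family_zero [simp]: "homogeneous_family q (\<lambda>g u w. 0)"
  by (simp add: homogeneous_family_def)

lemma homog_lext:
  assumes "homog d u" "\<And>m. mdeg m = d \<Longrightarrow> homog e (f m)"
  shows "homog e (lext f u)"
  using keys_lext[of f u] assms unfolding homog_def by blast

lemma homog_der:
  assumes "\<And>j. homog q (e j)" "homogeneous_family q \<gamma>" "homog d u"
  shows "homog (d + q) (der q f e \<gamma> u)"
proof -
  have "homog (mdeg m + q) (der_mon q f e \<gamma> m)" for m
  proof (induction m)
    case (Nd g a b)
    have "homog (gdeg g + mdeg a + mdeg b + q) (\<gamma> g (bas a) (bas b))"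
      using assms(2) by (auto simp: homogeneous_family_def)
    moreover have "homog (gdeg g + mdeg a + mdeg b + q)
        (nd g (der_mon q f e \<gamma> a) (eps q (bas (relabel f b))))"
      by (rule homog_nd[OF Nd(1) homog_eps[of "mdeg b"]]) auto
    moreover have "homog (gdeg g + mdeg a + mdeg b + q) (nd g (bas (relabel f a)) (der_mon q f e \<gamma> b))"
      by (rule homog_nd[of "mdeg a", OF _ Nd(2)]) auto
    ultimately show ?case by (auto intro!: homog_add)
  qed (simp add: assms)
  then show ?thesis unfolding der_def by (intro homog_lext[OF assms(3)]) auto
qed

text \<open>The hypothesis makes the second substitution vanish on every leaf that was merely
  relabelled by the first. It can only act inside an inserted term, so the double sum collapses to
  one insertion of degree \<open>q + r\<close>. This is the source of the sequential axiom.\<close>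

lemma subst_subst:
  assumes "\<And>j. e2 (f1 j) = 0"
  shows "subst r f2 e2 (subst q f1 e1 u) = subst (q + r) (\<lambda>j. f2 (f1 j)) (\<lambda>j. subst r f2 e2 (e1 j)) u"
proof (induction u rule: lin_induct)
  case (add c m v)
  have z: "subst r f2 e2 (bas (relabel f1 a)) = 0" for a
    by (induction a) (auto simp: der_Nd assms)
  have "subst r f2 e2 (subst q f1 e1 (bas m)) =
      subst (q + r) (\<lambda>j. f2 (f1 j)) (\<lambda>j. subst r f2 e2 (e1 j)) (bas m)"
  proof (induction m)
    case (Nd g a b)
    then show ?case by (simp add: der_Nd z eps_bas ring_distribs sg_add ac_simps)
  qed simp
  with add show ?case by simp
qed simp

text \<open>The assumptions \<open>z\<close> forbid hitting a term that has just been inserted, so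
  the two insertions always take place at different leaves of \<open>u\<close>. They then commute up
  to the Koszul sign; the primed data describe the same insertions in the opposite order. This is
  the source of the parallel axiom.\<close>

lemma subst_commute:
  fixes e1 e2 e1' e2' :: "nat \<Rightarrow> ('k::field, 'g) lin"
  assumes f: "\<And>j. f2 (f1 j) = f1' (f2' j)"
    and e1: "\<And>j. ren f2 (e1 j) = e1' (f2' j)" and e2: "\<And>j. e2 (f1 j) = ren f1' (e2' j)"
    and z: "\<And>j. subst r f2 e2 (e1 j) = 0" "\<And>j. subst q f1' e1' (e2' j) = 0"
    and h: "\<And>j. homog q (e1 j)" "\<And>j. homog r (e2' j)"
  shows "subst r f2 e2 (subst q f1 e1 u) = sg (q * r) \<star> subst q f1' e1' (subst r f2' e2' u)"
proof (induction u rule: lin_induct)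
  case (add c m v)
  have 1: "ren f2 (subst q f1 e1 u) = subst q f1' e1' (ren f2' u)" for u
    by (simp add: ren_subst subst_ren) (intro der_cong, simp add: f e1)
  have 2: "subst r f2 e2 (ren f1 u) = ren f1' (subst r f2' e2' u)" for u
    by (simp add: ren_subst subst_ren) (intro der_cong, simp add: f e2)
  have 3: "ren f2 (ren f1 u) = ren f1' (ren f2' u)" for u :: "('k, 'g) lin"
    using f by simp
  have "subst r f2 e2 (subst q f1 e1 (bas m)) = sg (q * r) \<star> subst q f1' e1' (subst r f2' e2' (bas m))"
  proof (induction m)
    case (Nd g a b)
    note E = eps_subst[OF h(1)] eps_subst[OF h(2)]
    let ?D1 = "subst q f1 e1" and ?D2 = "subst r f2 e2" and ?D1' = "subst q f1' e1'"
      and ?D2' = "subst r f2' e2'"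
    have "?D2 (?D1 (bas (Nd g a b))) =
        nd g (?D2 (?D1 (bas a))) (eps r (eps q (ren f2 (ren f1 (bas b))))) +
        nd g (ren f2 (?D1 (bas a))) (?D2 (eps q (ren f1 (bas b)))) +
        nd g (?D2 (ren f1 (bas a))) (eps r (ren f2 (?D1 (bas b)))) +
        nd g (ren f2 (ren f1 (bas a))) (?D2 (?D1 (bas b)))"
      by (simp add: der_Nd eps_bas scl_distribs del: ren_ren)
    \<comment> \<open>The outer terms are the induction hypotheses. The two mixed terms, with one
      insertion in each child, trade places, and the sign appears when \<open>eps\<close> of one
      operator meets the inserted term of the other.\<close>
    also have "\<dots> = sg (q * r) \<star> (
        nd g (?D1' (?D2' (bas a))) (eps q (eps r (ren f1' (ren f2' (bas b))))) +
        nd g (ren f1' (?D2' (bas a))) (?D1' (eps r (ren f2' (bas b)))) +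
        nd g (?D1' (ren f2' (bas a))) (eps q (ren f1' (?D2' (bas b)))) +
        nd g (ren f1' (ren f2' (bas a))) (?D1' (?D2' (bas b))))"
    proof -
      have "eps r (ren f2 (?D1 (bas b))) = sg (q * r) \<star> ?D1' (eps r (ren f2' (bas b)))"
        using 1[of "eps r (bas b)"] by (simp add: E mult.commute del: ren_bas)
      moreover have "eps q (ren f1' (?D2' (bas b))) = sg (q * r) \<star> ?D2 (eps q (ren f1 (bas b)))"
        using 2[of "eps q (bas b)"] by (simp add: E del: ren_bas)
      ultimately show ?thesis
        unfolding Nd.IH 1[of "bas a"] 2[of "bas a"] 3 by (simp add: eps_commute[of r q] scl_distribs)
    qed
    also have "nd g (?D1' (?D2' (bas a))) (eps q (eps r (ren f1' (ren f2' (bas b))))) +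
        nd g (ren f1' (?D2' (bas a))) (?D1' (eps r (ren f2' (bas b)))) +
        nd g (?D1' (ren f2' (bas a))) (eps q (ren f1' (?D2' (bas b)))) +
        nd g (ren f1' (ren f2' (bas a))) (?D1' (?D2' (bas b))) = ?D1' (?D2' (bas (Nd g a b)))"
      by (simp add: der_Nd eps_bas scl_distribs del: ren_ren)
    finally show ?case .
  qed (simp add: z)
  with add show ?case by (simp add: scl_distribs mult.commute)
qed simp

end

section \<open>Relations between trees: symmetry of the generators and a base set, closed under
  contexts\<close>

locale binary_generators = graded_generators gdeg
  for gdeg :: "'g \<Rightarrow> int" +
  fixes sw :: "'g \<Rightarrow> 'k::field \<times> 'g"
  assumes gdeg_sw: "gdeg (snd (sw g)) = gdeg g"
begin

text \<open>A subspace of all combinations of trees, with arbitrary labels, that is stable under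
  placing a tree on either side. Exchanging the inputs of a generator exchanges the subtrees below
  it, hence the Koszul sign in \<open>rel_swap\<close>. Stability under relabelling and substitution
  is derived from the base set.\<close>

inductive_set rel :: "('k, 'g) lin set \<Rightarrow> ('k, 'g) lin set" for B
  where
    rel_base: "r \<in> B \<Longrightarrow> r \<in> rel B"
  | rel_swap: "bas (Nd g a b) - (fst (sw g) * sg (mdeg a * mdeg b)) \<star> bas (Nd (snd (sw g)) b a) \<in> rel B"
  | rel_add: "u \<in> rel B \<Longrightarrow> v \<in> rel B \<Longrightarrow> u + v \<in> rel B"
  | rel_scl: "u \<in> rel B \<Longrightarrow> c \<star> u \<in> rel B"
  | rel_left_bas: "u \<in> rel B \<Longrightarrow> nd g u (bas m) \<in> rel B"
  | rel_right_bas: "u \<in> rel B \<Longrightarrow> nd g (bas m) u \<in> rel B"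

lemma rel_zero [simp]: "0 \<in> rel B"
  using rel_scl[OF rel_swap, of 0] by simp

lemma rel_uminus: "u \<in> rel B \<Longrightarrow> - u \<in> rel B"
  using rel_scl[of u B "-1"] by simp

lemma rel_diff: "u \<in> rel B \<Longrightarrow> v \<in> rel B \<Longrightarrow> u - v \<in> rel B"
  using rel_add[OF _ rel_uminus] by fastforce

lemma rel_left: "u \<in> rel B \<Longrightarrow> nd g u w \<in> rel B"
  by (induction w rule: lin_induct) (auto intro!: rel_add rel_scl rel_left_bas)

lemma rel_right: "u \<in> rel B \<Longrightarrow> nd g w u \<in> rel B"
  by (induction w rule: lin_induct) (auto intro!: rel_add rel_scl rel_right_bas)

lemmas rel_closed = rel_zero rel_add rel_uminus rel_diff rel_scl rel_left rel_right

lemma rel_swap_homog: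
  assumes "homog d u" "homog e w"
  shows "nd g u w - (fst (sw g) * sg (d * e)) \<star> nd (snd (sw g)) w u \<in> rel B"
proof -
  have "keys u \<subseteq> {m. mdeg m = d}" "keys w \<subseteq> {m. mdeg m = e}"
    using assms by (auto simp: homog_def)
  then show ?thesis
  proof (induction u rule: keys_induct)
    case (add c m v)
    have "nd g (bas m) w - (fst (sw g) * sg (d * e)) \<star> nd (snd (sw g)) w (bas m) \<in> rel B"
      using add.prems
    proof (induction w rule: keys_induct)
      case (add c' m' v')
      then have "c' \<star> (nd g (bas m) (bas m') - (fst (sw g) * sg (d * e)) \<star> nd (snd (sw g)) (bas m') (bas m)) +
           (nd g (bas m) v' - (fst (sw g) * sg (d * e)) \<star> nd (snd (sw g)) v' (bas m)) \<in> rel B"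
        using rel_swap[of g m m' B] \<open>m \<in> _\<close> by (intro rel_add rel_scl) auto
      then show ?case by (simp add: scl_distribs algebra_simps)
    qed simp
    then have "c \<star> (nd g (bas m) w - (fst (sw g) * sg (d * e)) \<star> nd (snd (sw g)) w (bas m)) +
        (nd g v w - (fst (sw g) * sg (d * e)) \<star> nd (snd (sw g)) w v) \<in> rel B"
      using add by (intro rel_add rel_scl) auto
    then show ?case by (simp add: scl_distribs algebra_simps)
  qed simp
qed

lemma ren_rel:
  assumes base: "\<And>r. r \<in> B \<Longrightarrow> ren f r \<in> rel B" and u: "u \<in> rel B"
  shows "ren f u \<in> rel B"
  using u
proof (induction rule: rel.induct)
  case (rel_swap g a b)
  show ?case using rel.rel_swap[of g "relabel f a" "relabel f b" B] by simp
qed (auto intro: base rel_closed)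

lemma eps_rel:
  assumes base: "\<And>r. r \<in> B \<Longrightarrow> eps q r \<in> rel B" and u: "u \<in> rel B"
  shows "eps q u \<in> rel B"
  using u
proof (induction rule: rel.induct)
  case (rel_swap g a b)
  have "sg (q * (gdeg g + mdeg a + mdeg b)) \<star> (bas (Nd g a b) -
      (fst (sw g) * sg (mdeg a * mdeg b)) \<star> bas (Nd (snd (sw g)) b a)) \<in> rel B"
    by (intro rel_scl rel.rel_swap)
  then show ?case by (simp add: eps_bas gdeg_sw scl_distribs ac_simps)
qed (auto intro: base rel_closed simp: eps_nd eps_bas)

text \<open>By the product rule \<open>der_nd\<close>, a relation placed in a context yields a
  relation in each summand. So the operator has to be tested on \<open>B\<close> only, together with
  the compatibility of \<gamma> with relations and with the symmetry of the generators.\<close>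

lemma der_rel:
  assumes bil: "bilinear_family \<gamma>" and hom: "homogeneous_family q \<gamma>" "\<And>j. homog q (e j)"
    and base: "\<And>r. r \<in> B \<Longrightarrow> der q f e \<gamma> r \<in> rel B" "\<And>r. r \<in> B \<Longrightarrow> ren f r \<in> rel B"
      "\<And>r. r \<in> B \<Longrightarrow> eps q r \<in> rel B"
    and ctx: "\<And>g u w. u \<in> rel B \<Longrightarrow> \<gamma> g u w \<in> rel B" "\<And>g u w. u \<in> rel B \<Longrightarrow> \<gamma> g w u \<in> rel B"
    and swap: "\<And>g a b. \<gamma> g (bas a) (bas b) -
        (fst (sw g) * sg (mdeg a * mdeg b)) \<star> \<gamma> (snd (sw g)) (bas b) (bas a) \<in> rel B"
    and u: "u \<in> rel B"
  shows "der q f e \<gamma> u \<in> rel B"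
  using u
proof (induction rule: rel.induct)
  case (rel_swap g a b)
  let ?D = "der q f e \<gamma>" and ?c = "fst (sw g)" and ?h = "snd (sw g)"
  have ha: "homog (mdeg a + q) (?D (bas a))" and hb: "homog (mdeg b + q) (?D (bas b))"
    by (intro homog_der hom; simp)+
  \<comment> \<open>The first two summands are swap relations in which one child is already
    transformed, hence the shift of its degree by \<open>q\<close>. The leading sign is the one that
    \<open>eps\<close> puts on the right child \<open>b\<close>.\<close>
  have "sg (q * mdeg b) \<star> (nd g (?D (bas a)) (bas (relabel f b))
        - (?c * sg ((mdeg a + q) * mdeg b)) \<star> nd ?h (bas (relabel f b)) (?D (bas a)))
      + (nd g (bas (relabel f a)) (?D (bas b))
        - (?c * sg (mdeg a * (mdeg b + q))) \<star> nd ?h (?D (bas b)) (bas (relabel f a)))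
      + (\<gamma> g (bas a) (bas b) - (?c * sg (mdeg a * mdeg b)) \<star> \<gamma> ?h (bas b) (bas a)) \<in> rel B"
    by (intro rel_add rel_scl rel_swap_homog ha hb swap; simp)
  then show ?case
    by (simp add: der_Nd eps_bas scl_distribs sg_add algebra_simps)
next
  case (rel_left_bas u g m)
  show ?case
    unfolding der_nd[OF bil]
    by (intro rel_add rel_left[OF rel_left_bas.IH] rel_left[OF ren_rel[OF base(2) rel_left_bas.hyps]]
        ctx(1) rel_left_bas.hyps)
next
  case (rel_right_bas u g m)
  show ?case
    unfolding der_nd[OF bil]
    by (intro rel_add rel_right[OF rel_right_bas.IH]
        rel_right[OF eps_rel[OF base(3) ren_rel[OF base(2) rel_right_bas.hyps]]]
        ctx(2) rel_right_bas.hyps)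
qed (auto intro: base rel_closed)

end

section \<open>The operators on labelled Greg trees\<close>

interpretation greg: binary_generators greg_deg "greg_swap :: greg_gen \<Rightarrow> 'k::field \<times> greg_gen"
proof
  show "greg_deg (snd (greg_swap g :: 'k \<times> greg_gen)) = greg_deg g" for g
    by (cases g) auto
qed

abbreviation "nx \<equiv> nd GenX"
abbreviation "ny \<equiv> nd GenY"
abbreviation "ng \<equiv> nd GenG"
abbreviation lf :: "nat \<Rightarrow> ('k::field, 'g) lin" where "lf j \<equiv> bas (Lf j)"
abbreviation ep :: "('k::field, greg_gen) lin \<Rightarrow> ('k, greg_gen) lin" where "ep \<equiv> greg.eps 1"

text \<open>The associator of \<open>u\<close>, \<open>v\<close>, \<open>w\<close> compared with the
  one in which \<open>v\<close> and \<open>w\<close> are exchanged. The scalar \<open>k\<close>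
  stands for the Koszul sign of the exchange; it is a parameter because operators shift the degrees
  of the arguments.\<close>

definition pl :: "'k::field \<Rightarrow> ('k, greg_gen) lin \<Rightarrow> ('k, greg_gen) lin \<Rightarrow> ('k, greg_gen) lin \<Rightarrow> ('k, greg_gen) lin"
  where "pl k u v w = nx (nx u v) w - nx u (nx v w) - k \<star> (nx (nx u w) v - nx u (nx w v))"

text \<open>The mixed relator of Greg at \<open>u\<close>, \<open>v\<close>, \<open>w\<close>. The
  factor \<open>k\<close> marks the terms in which \<open>w\<close> stands before \<open>v\<close>;
  thus g(x(u, w), v), the value of \<open>(g \<circ>\<^sub>1 x).(2 3)\<close>, carries it.\<close>

definition gr :: "'k::field \<Rightarrow> ('k, greg_gen) lin \<Rightarrow> ('k, greg_gen) lin \<Rightarrow> ('k, greg_gen) lin \<Rightarrow> ('k, greg_gen) lin"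
  where "gr k u v w = nx (ng u v) w - k \<star> ng (nx u w) v - ng u (nx v w)
    - k \<star> nx (ng u w) v + ng (nx u v) w + k \<star> ng u (nx w v)"

text \<open>Instances at all trees are included. Together with the closure of \<open>rel\<close>
  under contexts this takes the place of closure under operadic composition.\<close>

definition greg_base :: "('k::field, greg_gen) lin set"
  where "greg_base =
    (\<Union>a b c. {pl (sg (greg.mdeg b * greg.mdeg c)) (bas a) (bas b) (bas c),
              gr (sg (greg.mdeg b * greg.mdeg c)) (bas a) (bas b) (bas c)})"

abbreviation greg_rel :: "('k::field, greg_gen) lin set" where "greg_rel \<equiv> greg.rel greg_base"

lemma pl_linear:
  "linear_map (\<lambda>u. pl k u v w)" "linear_map (\<lambda>v. pl k u v w)" "linear_map (\<lambda>w. pl k u v w)"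
  and gr_linear:
  "linear_map (\<lambda>u. gr k u v w)" "linear_map (\<lambda>v. gr k u v w)" "linear_map (\<lambda>w. gr k u v w)"
  by (auto simp: linear_map_def pl_def gr_def scl_distribs algebra_simps)

lemma rel_linear:
  assumes "linear_map F" "\<And>m. m \<in> keys u \<Longrightarrow> F (bas m) \<in> greg_rel"
  shows "F u \<in> greg_rel"
  by (rule keys_induct[of u "keys u"]) (use assms in \<open>auto simp: linear_mapD intro: greg.rel_closed\<close>)

lemma pl_base: "pl (sg (greg.mdeg b * greg.mdeg c)) (bas a) (bas b) (bas c) \<in> greg_rel"
  and gr_base: "gr (sg (greg.mdeg b * greg.mdeg c)) (bas a) (bas b) (bas c) \<in> greg_rel"
  unfolding greg_base_def by (rule greg.rel_base; blast)+

text \<open>Multilinear extension from trees. The sign involves \<open>v\<close> and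
  \<open>w\<close> alone, so these are the arguments that have to be homogeneous.\<close>

lemma pl_rel:
  assumes "greg.homog p v" "greg.homog q w"
  shows "pl (sg (p * q)) u v w \<in> greg_rel"
  by (rule rel_linear[OF pl_linear(1)], rule rel_linear[OF pl_linear(2)], rule rel_linear[OF pl_linear(3)])
     (use assms in \<open>metis greg.homog_def pl_base\<close>)

lemma gr_rel:
  assumes "greg.homog p v" "greg.homog q w"
  shows "gr (sg (p * q)) u v w \<in> greg_rel"
  by (rule rel_linear[OF gr_linear(1)], rule rel_linear[OF gr_linear(2)], rule rel_linear[OF gr_linear(3)])
     (use assms in \<open>metis greg.homog_def gr_base\<close>)

lemma ren_pl [simp]: "ren f (pl k u v w) = pl k (ren f u) (ren f v) (ren f w)"
  and ren_gr [simp]: "ren f (gr k u v w) = gr k (ren f u) (ren f v) (ren f w)"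
  by (simp_all add: pl_def gr_def)

lemma greg_base_cases:
  assumes "r \<in> greg_base"
  obtains (pl) a b c where "r = pl (sg (greg.mdeg b * greg.mdeg c)) (bas a) (bas b) (bas c)"
    | (gr) a b c where "r = gr (sg (greg.mdeg b * greg.mdeg c)) (bas a) (bas b) (bas c)"
  using assms by (auto simp: greg_base_def)

lemma ren_greg_rel: "u \<in> greg_rel \<Longrightarrow> ren f u \<in> greg_rel"
proof (rule greg.ren_rel)
  show "ren f r \<in> greg_rel" if "r \<in> greg_base" for r
    using that by (cases rule: greg_base_cases) (simp_all add: pl_rel gr_rel)
qed

lemma eps_greg_rel:
  fixes u :: "('k::field, greg_gen) lin"
  shows "u \<in> greg_rel \<Longrightarrow> greg.eps q u \<in> greg_rel"
proof (rule greg.eps_rel)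
  show "greg.eps q r \<in> greg_rel" if r: "r \<in> greg_base" for r :: "('k, greg_gen) lin"
  proof -
    have "greg.eps q (pl k u v w) = pl k (greg.eps q u) (greg.eps q v) (greg.eps q w)"
      "greg.eps q (gr k u v w) = sg q \<star> gr k (greg.eps q u) (greg.eps q v) (greg.eps q w)"
      for k :: 'k and u v w
      by (simp_all add: pl_def gr_def greg.eps_nd scl_distribs mult.commute)
    with r show ?thesis
      by (cases rule: greg_base_cases) (simp_all add: greg.rel_scl pl_rel gr_rel greg.homog_eps)
  qed
qed

text \<open>The part of the image of \<open>pl\<close> in which \<gamma> acts at one of the two
  vertices. The terms in which the operator reaches an argument are again relators, so this is all
  that has to be checked; \<open>gr_defect\<close> plays the same role for
  \<open>gr\<close>.\<close>

definition pl_defect where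
  "pl_defect \<gamma> q f k u v w =
    \<gamma> GenX (nx u v) w + nx (\<gamma> GenX u v) (greg.eps q (ren f w))
    - (\<gamma> GenX u (nx v w) + nx (ren f u) (\<gamma> GenX v w))
    - k \<star> (\<gamma> GenX (nx u w) v + nx (\<gamma> GenX u w) (greg.eps q (ren f v))
      - (\<gamma> GenX u (nx w v) + nx (ren f u) (\<gamma> GenX w v)))"

definition gr_defect where
  "gr_defect \<gamma> q f k u v w =
    \<gamma> GenX (ng u v) w + nx (\<gamma> GenG u v) (greg.eps q (ren f w))
    - k \<star> (\<gamma> GenG (nx u w) v + ng (\<gamma> GenX u w) (greg.eps q (ren f v)))
    - (\<gamma> GenG u (nx v w) + ng (ren f u) (\<gamma> GenX v w))
    - k \<star> (\<gamma> GenX (ng u w) v + nx (\<gamma> GenG u w) (greg.eps q (ren f v)))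
    + (\<gamma> GenG (nx u v) w + ng (\<gamma> GenX u v) (greg.eps q (ren f w)))
    + k \<star> (\<gamma> GenG u (nx w v) + ng (ren f u) (\<gamma> GenX w v))"

text \<open>When the operator reaches \<open>b\<close> or \<open>c\<close>, the degree of that
  argument rises by \<open>q\<close>, so the relator reappears with the adapted signs
  \<open>k1\<close> and \<open>k2\<close>. The leading signs come from the arguments to the
  right.\<close>

lemma der_greg_base:
  fixes a b c :: "greg_gen mon" and e :: "nat \<Rightarrow> ('k::field, greg_gen) lin"
    and f :: "nat \<Rightarrow> nat" and q :: int
  assumes bil: "greg.bilinear_family \<gamma>"
  defines "D \<equiv> greg.der q f e \<gamma>"
  defines "k \<equiv> sg (greg.mdeg b * greg.mdeg c)"
    and "k1 \<equiv> sg ((greg.mdeg b + q) * greg.mdeg c)" and "k2 \<equiv> sg (greg.mdeg b * (greg.mdeg c + q))"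
  shows "D (pl k (bas a) (bas b) (bas c)) =
      sg (q * (greg.mdeg b + greg.mdeg c)) \<star> pl k (D (bas a)) (ren f (bas b)) (ren f (bas c))
      + sg (q * greg.mdeg c) \<star> pl k1 (ren f (bas a)) (D (bas b)) (ren f (bas c))
      + pl k2 (ren f (bas a)) (ren f (bas b)) (D (bas c))
      + pl_defect \<gamma> q f k (bas a) (bas b) (bas c)" (is ?P)
    and "D (gr k (bas a) (bas b) (bas c)) =
      sg (q * (greg.mdeg b + greg.mdeg c)) \<star> gr k (D (bas a)) (ren f (bas b)) (ren f (bas c))
      + sg (q * greg.mdeg c) \<star> gr k1 (ren f (bas a)) (D (bas b)) (ren f (bas c))
      + gr k2 (ren f (bas a)) (ren f (bas b)) (D (bas c))
      + gr_defect \<gamma> q f k (bas a) (bas b) (bas c)" (is ?G)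
proof -
  define A B C where "A = (bas a :: ('k, greg_gen) lin)" and "B = (bas b :: ('k, greg_gen) lin)"
    and "C = (bas c :: ('k, greg_gen) lin)"
  note defs = A_def[symmetric] B_def[symmetric] C_def[symmetric]
  have E: "greg.eps q B = sg (q * greg.mdeg b) \<star> B" "greg.eps q C = sg (q * greg.mdeg c) \<star> C"
    by (simp_all add: B_def C_def greg.eps_bas)
  have R: "greg.eps q (ren f u) = ren f (greg.eps q u)" for u :: "('k, greg_gen) lin"
    by simp
  show ?P
    unfolding defs pl_def pl_defect_def D_def
    by (cases "even q"; cases "even (greg.mdeg b)"; cases "even (greg.mdeg c)")
       (simp_all add: greg.der_nd[OF bil] greg.eps_nd R E k_def k1_def k2_def sg_def algebra_simps)
  show ?G
    unfolding defs gr_def gr_defect_def D_def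
    by (cases "even q"; cases "even (greg.mdeg b)"; cases "even (greg.mdeg c)")
       (simp_all add: greg.der_nd[OF bil] greg.eps_nd R E k_def k1_def k2_def sg_def algebra_simps)
qed

text \<open>The form of \<open>der_rel\<close> that is applied to every operator on Greg trees: what
  remains to be seen is that the two defects are relations and that \<gamma> agrees with the
  symmetries of x, y and g.\<close>

lemma der_greg_rel:
  fixes e :: "nat \<Rightarrow> ('k::field, greg_gen) lin"
  assumes bil: "greg.bilinear_family \<gamma>"
    and hom: "greg.homogeneous_family q \<gamma>" "\<And>j. greg.homog q (e j)"
    and pl: "\<And>a b c. pl_defect \<gamma> q f (sg (greg.mdeg b * greg.mdeg c)) (bas a) (bas b) (bas c) \<in> greg_rel"
    and gr: "\<And>a b c. gr_defect \<gamma> q f (sg (greg.mdeg b * greg.mdeg c)) (bas a) (bas b) (bas c) \<in> greg_rel"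
    and ctx: "\<And>g u w. u \<in> greg_rel \<Longrightarrow> \<gamma> g u w \<in> greg_rel" "\<And>g u w. u \<in> greg_rel \<Longrightarrow> \<gamma> g w u \<in> greg_rel"
    and swap: "\<And>a b. \<gamma> GenX (bas a) (bas b) - sg (greg.mdeg a * greg.mdeg b) \<star> \<gamma> GenY (bas b) (bas a) \<in> greg_rel"
      "\<And>a b. \<gamma> GenG (bas a) (bas b) - sg (greg.mdeg a * greg.mdeg b) \<star> \<gamma> GenG (bas b) (bas a) \<in> greg_rel"
    and u: "u \<in> greg_rel"
  shows "greg.der q f e \<gamma> u \<in> greg_rel"
proof (rule greg.der_rel[OF bil hom])
  show "greg.der q f e \<gamma> r \<in> greg_rel" if r: "r \<in> greg_base" for r
  proof -
    have h: "greg.homog (greg.mdeg m + q) (greg.der q f e \<gamma> (bas m))" for m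
      by (rule greg.homog_der[OF hom(2,1)]) simp
    show ?thesis
      using r
      by (cases rule: greg_base_cases)
        (simp_all add: der_greg_base[OF bil] greg.rel_add greg.rel_scl pl_rel gr_rel pl gr h)
  qed
  show "\<gamma> g (bas a) (bas b) - (fst (greg_swap g) * sg (greg.mdeg a * greg.mdeg b)) \<star>
      \<gamma> (snd (greg_swap g)) (bas b) (bas a) \<in> greg_rel" for g a b
  proof (cases g)
    case GenY
    \<comment> \<open>The condition at y is the one at x for the exchanged subtrees, multiplied by
      the negative of the sign.\<close>
    have "- (sg (greg.mdeg a * greg.mdeg b) \<star> (\<gamma> GenX (bas b) (bas a) -
        sg (greg.mdeg b * greg.mdeg a) \<star> \<gamma> GenY (bas a) (bas b))) \<in> greg_rel"
      by (intro greg.rel_uminus greg.rel_scl swap)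
    then show ?thesis using GenY by (simp add: scl_distribs mult.commute)
  qed (use swap in simp_all)
qed (use ctx u in \<open>auto intro: ren_greg_rel eps_greg_rel greg.rel_base\<close>)

lemma subst_greg_rel:
  assumes "\<And>j. greg.homog q (e j)" "u \<in> greg_rel"
  shows "greg.subst q f e u \<in> greg_rel"
  by (rule der_greg_rel) (use assms in \<open>auto simp: pl_defect_def gr_defect_def\<close>)

lemma eps_minus1 [simp]: "greg.eps (- 1) u = ep u"
  by (rule greg.eps_odd) simp

lemma ep_nd [simp]: "ep (nx u w) = nx (ep u) (ep w)" "ep (ny u w) = ny (ep u) (ep w)"
  "ep (ng u w) = - ng (ep u) (ep w)"
  by (simp_all add: greg.eps_nd)

text \<open>
  With respect to a fixed leaf \<open>s\<close>, the homotopy of the introduction is \<open>hh s\<close>, while \<open>ee s j\<close> and \<open>cc s j\<close>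
  are \<open>E\<^sub>j\<close> and \<open>C\<^sub>j\<close>; \<open>nn j\<close> multiplies a tree by the number of its leaves with label \<open>j\<close>. The operator
  \<open>pp s\<close> is a homotopy between the bracketing \<open>u \<mapsto> x(u, s) - x(s, u)\<close> and the sum of the \<open>ee s j\<close>.
\<close>

definition dgam :: "greg_gen \<Rightarrow> ('k::field, greg_gen) lin \<Rightarrow> ('k, greg_gen) lin \<Rightarrow> ('k, greg_gen) lin"
  where "dgam g u w = (if g = GenG then 0 else - ng (ep u) (ep w))"

definition dd :: "('k::field, greg_gen) lin \<Rightarrow> ('k, greg_gen) lin"
  where "dd = greg.der 1 (\<lambda>j. j) (\<lambda>j. 0) dgam"

text \<open>The associator of the leaf \<open>s\<close> with \<open>u\<close> and \<open>w\<close>.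
  Modulo the pre-Lie relation it is graded symmetric in \<open>u\<close> and \<open>w\<close>, as g
  is, and so may be substituted for a vertex g.\<close>

definition brace :: "nat \<Rightarrow> ('k::field, greg_gen) lin \<Rightarrow> ('k, greg_gen) lin \<Rightarrow> ('k, greg_gen) lin"
  where "brace s u w = nx (nx (lf s) u) w - nx (lf s) (nx u w)"

definition pgam :: "nat \<Rightarrow> greg_gen \<Rightarrow> ('k::field, greg_gen) lin \<Rightarrow> ('k, greg_gen) lin \<Rightarrow> ('k, greg_gen) lin"
  where "pgam s g u w = (if g = GenG then - brace s (ep u) (ep w) else 0)"

definition pp :: "nat \<Rightarrow> ('k::field, greg_gen) lin \<Rightarrow> ('k, greg_gen) lin"
  where "pp s = greg.der (- 1) (\<lambda>j. j) (\<lambda>j. 0) (pgam s)"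

text \<open>The test \<open>lookup _ (Lf s)\<close> detects in a bilinear way that a child is the
  leaf \<open>s\<close>. The clause for g inverts the differential of x(s, w); x(s, w) itself is
  sent to no extra term; x(u, s) is sent to \<open>pp s u\<close>, which corrects the passage from
  [u, s] to substitutions into the leaves of u. The clause for y is the one for x with inputs
  exchanged.\<close>

definition hgam :: "nat \<Rightarrow> greg_gen \<Rightarrow> ('k::field, greg_gen) lin \<Rightarrow> ('k, greg_gen) lin \<Rightarrow> ('k, greg_gen) lin"
  where "hgam s g u w = (case g of
      GenX \<Rightarrow> lookup w (Lf s) \<star> pp s u
    | GenY \<Rightarrow> lookup u (Lf s) \<star> pp s w
    | GenG \<Rightarrow> - (lookup u (Lf s) \<star> nx (lf s) (ep w) + lookup w (Lf s) \<star> nx (lf s) (ep u)))"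

definition hh :: "nat \<Rightarrow> ('k::field, greg_gen) lin \<Rightarrow> ('k, greg_gen) lin"
  where "hh s = greg.der (- 1) (\<lambda>j. j) (\<lambda>j. 0) (hgam s)"

definition nn :: "nat \<Rightarrow> ('k::field, greg_gen) lin \<Rightarrow> ('k, greg_gen) lin"
  where "nn i = greg.subst 0 (\<lambda>j. j) (\<lambda>j. if j = i then lf i else 0)"

text \<open>Cutting \<open>s\<close> off x(u, s) should give \<open>u\<close> if the label
  \<open>i\<close> occurs in \<open>u\<close>, and zero otherwise. Counting the leaves with label
  \<open>i\<close> expresses this condition by a linear operator that satisfies the product
  rule.\<close>

definition cgam :: "nat \<Rightarrow> nat \<Rightarrow> greg_gen \<Rightarrow> ('k::field, greg_gen) lin \<Rightarrow> ('k, greg_gen) lin \<Rightarrow> ('k, greg_gen) lin"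
  where "cgam s i g u w = (case g of
      GenX \<Rightarrow> lookup w (Lf s) \<star> nn i u
    | GenY \<Rightarrow> lookup u (Lf s) \<star> nn i w
    | GenG \<Rightarrow> 0)"

definition cc :: "nat \<Rightarrow> nat \<Rightarrow> ('k::field, greg_gen) lin \<Rightarrow> ('k, greg_gen) lin"
  where "cc s i = greg.der 0 (\<lambda>j. j) (\<lambda>j. 0) (cgam s i)"

definition ee :: "nat \<Rightarrow> nat \<Rightarrow> ('k::field, greg_gen) lin \<Rightarrow> ('k, greg_gen) lin"
  where "ee s i = greg.subst 0 (\<lambda>j. j) (\<lambda>j. if j = i then nx (lf i) (lf s) - nx (lf s) (lf i) else 0)"

lemma linear_map_ops [intro!, simp]:
  "linear_map dd" "linear_map (pp s)" "linear_map (hh s)" "linear_map (nn i)" "linear_map (cc s i)" "linear_map (ee s i)"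
  by (simp_all add: dd_def pp_def hh_def nn_def cc_def ee_def)

lemmas ops_linear [simp] =
  linear_mapD[OF linear_map_ops(1)] linear_mapD[OF linear_map_ops(2)] linear_mapD[OF linear_map_ops(3)]
  linear_mapD[OF linear_map_ops(4)] linear_mapD[OF linear_map_ops(5)] linear_mapD[OF linear_map_ops(6)]

lemma bilinear_dgam: "greg.bilinear_family dgam"
  and bilinear_pgam: "greg.bilinear_family (pgam s)"
  and bilinear_hgam: "greg.bilinear_family (hgam s)"
  and bilinear_cgam: "greg.bilinear_family (cgam s i)"
  by (auto simp: greg.bilinear_family_def linear_map_def dgam_def pgam_def hgam_def cgam_def brace_def
      lookup_add scl_distribs scl_add_left algebra_simps split: greg_gen.split)

lemma dd_simps [simp]:
  "dd (lf j) = 0"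
  "dd (nx u w) = nx (dd u) (ep w) + nx u (dd w) - ng (ep u) (ep w)"
  "dd (ny u w) = ny (dd u) (ep w) + ny u (dd w) - ng (ep u) (ep w)"
  "dd (ng u w) = ng (dd u) (ep w) + ng u (dd w)"
  by (simp_all add: dd_def greg.der_nd[OF bilinear_dgam] dgam_def)

lemma pp_simps [simp]:
  "pp s (lf j) = 0"
  "pp s (nx u w) = nx (pp s u) (ep w) + nx u (pp s w)"
  "pp s (ny u w) = ny (pp s u) (ep w) + ny u (pp s w)"
  "pp s (ng u w) = ng (pp s u) (ep w) + ng u (pp s w) - brace s (ep u) (ep w)"
  by (simp_all add: pp_def greg.der_nd[OF bilinear_pgam] pgam_def)

lemma hh_simps [simp]:
  "hh s (lf j) = 0"
  "hh s (nx u w) = nx (hh s u) (ep w) + nx u (hh s w) + lookup w (Lf s) \<star> pp s u"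
  "hh s (ny u w) = ny (hh s u) (ep w) + ny u (hh s w) + lookup u (Lf s) \<star> pp s w"
  "hh s (ng u w) = ng (hh s u) (ep w) + ng u (hh s w)
    - lookup u (Lf s) \<star> nx (lf s) (ep w) - lookup w (Lf s) \<star> nx (lf s) (ep u)"
  by (simp_all add: hh_def greg.der_nd[OF bilinear_hgam] hgam_def)

lemma nn_simps [simp]:
  "nn i (lf j) = (if j = i then lf i else 0)"
  "nn i (nd g u w) = nd g (nn i u) w + nd g u (nn i w)"
  by (simp_all add: nn_def)

lemma cc_simps [simp]:
  "cc s i (lf j) = 0"
  "cc s i (nx u w) = nx (cc s i u) w + nx u (cc s i w) + lookup w (Lf s) \<star> nn i u"
  "cc s i (ny u w) = ny (cc s i u) w + ny u (cc s i w) + lookup u (Lf s) \<star> nn i w"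
  "cc s i (ng u w) = ng (cc s i u) w + ng u (cc s i w)"
  by (simp_all add: cc_def greg.der_nd[OF bilinear_cgam] cgam_def)

lemma ee_simps [simp]:
  "ee s i (lf j) = (if j = i then nx (lf i) (lf s) - nx (lf s) (lf i) else 0)"
  "ee s i (nd g u w) = nd g (ee s i u) w + nd g u (ee s i w)"
  by (simp_all add: ee_def)

lemma lookup_nd_Lf [simp]: "lookup (nd g u w) (Lf j) = 0"
  using keys_nd[of g u w] by (force simp: in_keys_iff)

lemma lookup_bas_Lf [simp]: "lookup (bas m :: ('k::field, 'g) lin) (Lf j) = (if m = Lf j then 1 else 0)"
  by (simp add: lookup_single when_def)

lemma lookup_ep_Lf [simp]: "lookup (ep u) (Lf j) = lookup u (Lf j)"
  by (induction u rule: lin_induct) (auto simp: lookup_add greg.eps_bas)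

text \<open>Every relation lives on trees with at least one vertex. Hence the leaf tests in
  \<open>hgam\<close> and \<open>cgam\<close> are well defined modulo relations, and a nonzero
  multiple of a leaf is never a relation.\<close>

lemma greg_rel_lookup_Lf: "u \<in> greg_rel \<Longrightarrow> lookup u (Lf j) = 0"
  by (induction rule: greg.rel.induct)
     (auto simp: greg_base_def pl_def gr_def lookup_add lookup_minus)

lemma greg_deg_eq: "greg_deg g = (if g = GenG then 1 else 0)"
  by (cases g) auto

lemma homogeneous_dgam: "greg.homogeneous_family 1 dgam"
  and homogeneous_pgam: "greg.homogeneous_family (- 1) (pgam s)"
  by (auto simp: greg.homogeneous_family_def greg_deg_eq dgam_def pgam_def brace_def
      intro!: greg.homog_uminus greg.homog_diff greg.homog_nd greg.homog_eps)

lemma homog_dd: "greg.homog d u \<Longrightarrow> greg.homog (d + 1) (dd u)"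
  and homog_pp: "greg.homog d u \<Longrightarrow> greg.homog (d - 1) (pp s u)"
  and homog_nn: "greg.homog d u \<Longrightarrow> greg.homog d (nn i u)"
  using greg.homog_der[OF _ homogeneous_dgam, of "\<lambda>_. 0" d u]
    greg.homog_der[OF _ homogeneous_pgam, of "\<lambda>_. 0" d u]
    greg.homog_der[OF _ greg.homogeneous_family_zero, of 0 "\<lambda>j. if j = i then lf i else 0" d u]
  by (auto simp: dd_def pp_def nn_def)

text \<open>A leaf has degree 0, so an argument that passes the leaf test contributes nothing to the
  degree. This is why \<open>hgam\<close> and \<open>cgam\<close>, which drop that argument, are
  homogeneous.\<close>

lemma homog_lookup: "greg.homog d u \<Longrightarrow> lookup u (Lf j) \<noteq> 0 \<Longrightarrow> d = 0"
  by (force simp: greg.homog_def in_keys_iff)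

lemma homogeneous_hgam:
  "greg.homogeneous_family (- 1) (hgam s :: greg_gen \<Rightarrow> ('k::field, greg_gen) lin \<Rightarrow> _)"
proof -
  have "greg.homog (greg_deg g + d + e - 1) (hgam s g u w)"
    if "greg.homog d u" "greg.homog e w" for g d e and u w :: "('k, greg_gen) lin"
  proof (cases g)
    case GenX
    then show ?thesis
      using homog_pp[OF that(1)] homog_lookup[OF that(2)]
      by (cases "lookup w (Lf s) = 0") (auto simp: hgam_def intro!: greg.homog_scl)
  next
    case GenY
    then show ?thesis
      using homog_pp[OF that(2)] homog_lookup[OF that(1)]
      by (cases "lookup u (Lf s) = 0") (auto simp: hgam_def intro!: greg.homog_scl)
  next
    case GenG
    have "greg.homog (d + e) (lookup u (Lf s) \<star> nx (lf s) (ep w))"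
      using greg.homog_nd[of 0 "lf s" e "ep w" GenX e] greg.homog_eps[OF that(2)] homog_lookup[OF that(1)]
      by (cases "lookup u (Lf s) = 0") (auto intro!: greg.homog_scl)
    moreover have "greg.homog (d + e) (lookup w (Lf s) \<star> nx (lf s) (ep u))"
      using greg.homog_nd[of 0 "lf s" d "ep u" GenX d] greg.homog_eps[OF that(1)] homog_lookup[OF that(2)]
      by (cases "lookup w (Lf s) = 0") (auto intro!: greg.homog_scl)
    ultimately show ?thesis
      using GenG by (auto simp: hgam_def intro!: greg.homog_diff[unfolded diff_conv_add_uminus] greg.homog_diff greg.homog_uminus)
  qed
  then show ?thesis by (auto simp: greg.homogeneous_family_def)
qed

lemma homogeneous_cgam:
  "greg.homogeneous_family 0 (cgam s i :: greg_gen \<Rightarrow> ('k::field, greg_gen) lin \<Rightarrow> _)"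
proof -
  have "greg.homog (greg_deg g + d + e) (cgam s i g u w)"
    if "greg.homog d u" "greg.homog e w" for g d e and u w :: "('k, greg_gen) lin"
  proof (cases g)
    case GenX
    then show ?thesis
      using homog_nn[OF that(1)] homog_lookup[OF that(2)]
      by (cases "lookup w (Lf s) = 0") (auto simp: cgam_def intro!: greg.homog_scl)
  next
    case GenY
    then show ?thesis
      using homog_nn[OF that(2)] homog_lookup[OF that(1)]
      by (cases "lookup u (Lf s) = 0") (auto simp: cgam_def intro!: greg.homog_scl)
  qed (simp add: cgam_def)
  then show ?thesis by (auto simp: greg.homogeneous_family_def)
qed

section \<open>The operators respect the relations\<close>

lemma swap_rel:
  assumes "greg.homog d u" "greg.homog e w"
  shows "ng u w - sg (d * e) \<star> ng w u \<in> greg_rel" "nx u w - sg (d * e) \<star> ny w u \<in> greg_rel"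
    "ny u w - sg (d * e) \<star> nx w u \<in> greg_rel"
  using greg.rel_swap_homog[OF assms, of GenG] greg.rel_swap_homog[OF assms, of GenX]
    greg.rel_swap_homog[OF assms, of GenY] by auto

lemma homog_ep_bas: "greg.homog (greg.mdeg m) (ep (bas m))"
  by (rule greg.homog_eps) simp

text \<open>Differentiating the vertices of the pre-Lie relator gives minus the mixed relator, up to
  the symmetry of g; this is the role of the second relation of Greg. Differentiating the vertices
  of the mixed relator leaves only a term that vanishes by the symmetry of g.\<close>

lemma dd_rel: assumes "u \<in> greg_rel" shows "dd u \<in> greg_rel"
  unfolding dd_def
proof (rule der_greg_rel[OF bilinear_dgam homogeneous_dgam])
  fix a b c :: "greg_gen mon"
  let ?k = "sg (greg.mdeg b * greg.mdeg c) :: 'a"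
  let ?a = "bas a :: ('a, greg_gen) lin" and ?b = "bas b :: ('a, greg_gen) lin" and ?c = "bas c :: ('a, greg_gen) lin"
  have s: "ng (ep ?b) (ep ?c) - ?k \<star> ng (ep ?c) (ep ?b) \<in> greg_rel"
    by (rule swap_rel; rule homog_ep_bas)
  have "nx ?a (ng (ep ?b) (ep ?c) - ?k \<star> ng (ep ?c) (ep ?b)) - gr ?k (ep ?a) (ep ?b) (ep ?c) \<in> greg_rel"
    by (intro greg.rel_diff greg.rel_right s gr_rel homog_ep_bas)
  then show "pl_defect dgam 1 (\<lambda>j. j) ?k ?a ?b ?c \<in> greg_rel"
    by (simp add: pl_defect_def dgam_def gr_def scl_distribs algebra_simps del: nd_bas)
  have "ng ?a (ng (ep ?b) (ep ?c) - ?k \<star> ng (ep ?c) (ep ?b)) \<in> greg_rel"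
    by (intro greg.rel_right s)
  then show "gr_defect dgam 1 (\<lambda>j. j) ?k ?a ?b ?c \<in> greg_rel"
    by (simp add: gr_defect_def dgam_def scl_distribs algebra_simps del: nd_bas)
next
  fix a b :: "greg_gen mon"
  have "- (ng (ep (bas a)) (ep (bas b)) - sg (greg.mdeg a * greg.mdeg b) \<star> ng (ep (bas b)) (ep (bas a))) \<in> greg_rel"
    by (intro greg.rel_uminus swap_rel homog_ep_bas)
  then show "dgam GenX (bas a) (bas b) - sg (greg.mdeg a * greg.mdeg b) \<star> dgam GenY (bas b) (bas a) \<in> greg_rel"
    by (simp add: dgam_def)
qed (use assms in \<open>auto simp: dgam_def intro!: greg.rel_uminus intro: greg.rel_left greg.rel_right eps_greg_rel\<close>)

lemma brace_rel:
  assumes "u \<in> greg_rel"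
  shows "brace s u w \<in> greg_rel" "brace s w u \<in> greg_rel"
  using assms by (auto simp: brace_def intro!: greg.rel_diff intro: greg.rel_left greg.rel_right)

lemma brace_swap:
  assumes "greg.homog d u" "greg.homog e w"
  shows "brace s u w - sg (d * e) \<star> brace s w u \<in> greg_rel"
  using pl_rel[OF assms, of "lf s"] by (simp add: pl_def brace_def algebra_simps scl_distribs)

text \<open>Substituting associators with \<open>s\<close> for the vertices g of the mixed relator
  leaves x(s, -) applied to the pre-Lie relator, minus the pre-Lie relator whose first argument is
  x(s, a).\<close>

lemma pp_rel: assumes "u \<in> greg_rel" shows "pp s u \<in> greg_rel"
  unfolding pp_def
proof (rule der_greg_rel[OF bilinear_pgam homogeneous_pgam])
  fix a b c :: "greg_gen mon"
  let ?k = "sg (greg.mdeg b * greg.mdeg c) :: 'a"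
  let ?a = "bas a :: ('a, greg_gen) lin" and ?b = "bas b :: ('a, greg_gen) lin" and ?c = "bas c :: ('a, greg_gen) lin"
  show "pl_defect (pgam s) (- 1) (\<lambda>j. j) ?k ?a ?b ?c \<in> greg_rel"
    by (simp add: pl_defect_def pgam_def)
  have "nx (lf s) (pl ?k (ep ?a) (ep ?b) (ep ?c)) - pl ?k (nx (lf s) (ep ?a)) (ep ?b) (ep ?c) \<in> greg_rel"
    by (intro greg.rel_diff greg.rel_right pl_rel homog_ep_bas)
  then show "gr_defect (pgam s) (- 1) (\<lambda>j. j) ?k ?a ?b ?c \<in> greg_rel"
    by (simp add: gr_defect_def pgam_def pl_def brace_def scl_distribs algebra_simps del: nd_bas)
next
  fix a b :: "greg_gen mon"
  have "- (brace s (ep (bas a)) (ep (bas b)) - sg (greg.mdeg a * greg.mdeg b) \<star> brace s (ep (bas b)) (ep (bas a))) \<in> greg_rel"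
    by (intro greg.rel_uminus brace_swap homog_ep_bas)
  then show "pgam s GenG (bas a) (bas b) - sg (greg.mdeg a * greg.mdeg b) \<star> pgam s GenG (bas b) (bas a) \<in> greg_rel"
    by (simp add: pgam_def)
qed (use assms in \<open>auto simp: pgam_def intro!: greg.rel_uminus intro: brace_rel eps_greg_rel\<close>)

lemma nn_rel: "u \<in> greg_rel \<Longrightarrow> nn i u \<in> greg_rel"
  and ee_rel: "u \<in> greg_rel \<Longrightarrow> ee s i u \<in> greg_rel"
  unfolding nn_def ee_def by (auto intro!: subst_greg_rel greg.homog_diff greg.homog_nd[of 0 _ 0])

text \<open>If \<open>s\<close> is the second or third argument of the mixed relator, the terms
  x(x(s, u), w) and x(s, x(u, w)) produced at g must cancel against \<open>pp s\<close> of a vertex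
  g; this dictates the brace in \<open>pgam\<close>. If \<open>s\<close> is the first argument,
  minus a pre-Lie relator based at \<open>s\<close> remains.\<close>

lemma hh_rel: assumes "u \<in> greg_rel" shows "hh s u \<in> greg_rel"
  unfolding hh_def
proof (rule der_greg_rel[OF bilinear_hgam homogeneous_hgam])
  fix a b c :: "greg_gen mon"
  let ?k = "sg (greg.mdeg b * greg.mdeg c) :: 'a"
  let ?a = "bas a :: ('a, greg_gen) lin" and ?b = "bas b :: ('a, greg_gen) lin" and ?c = "bas c :: ('a, greg_gen) lin"
  show "pl_defect (hgam s) (- 1) (\<lambda>j. j) ?k ?a ?b ?c \<in> greg_rel"
    by (auto simp: pl_defect_def hgam_def scl_distribs algebra_simps simp del: nd_bas)
  have "- pl ?k (lf s) (ep ?b) (ep ?c) \<in> greg_rel"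
    by (intro greg.rel_uminus pl_rel homog_ep_bas)
  then show "gr_defect (hgam s) (- 1) (\<lambda>j. j) ?k ?a ?b ?c \<in> greg_rel"
    by (auto simp: gr_defect_def hgam_def pl_def brace_def scl_distribs algebra_simps simp del: nd_bas)
qed (use assms in \<open>auto simp: hgam_def greg_rel_lookup_Lf scl_distribs algebra_simps
      intro!: greg.rel_uminus greg.rel_scl greg.rel_right pp_rel eps_greg_rel split: greg_gen.split\<close>)

text \<open>Both defects cancel because \<open>nn i\<close> satisfies the product rule and because
  the exchange sign is 1 as soon as one of the exchanged arguments is the leaf
  \<open>s\<close>.\<close>

lemma cc_rel: assumes "u \<in> greg_rel" shows "cc s i u \<in> greg_rel"
  unfolding cc_def
proof (rule der_greg_rel[OF bilinear_cgam homogeneous_cgam])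
  fix a b c :: "greg_gen mon"
  let ?k = "sg (greg.mdeg b * greg.mdeg c) :: 'a"
  let ?a = "bas a :: ('a, greg_gen) lin" and ?b = "bas b :: ('a, greg_gen) lin" and ?c = "bas c :: ('a, greg_gen) lin"
  show "pl_defect (cgam s i) 0 (\<lambda>j. j) ?k ?a ?b ?c \<in> greg_rel"
    by (auto simp: pl_defect_def cgam_def scl_distribs algebra_simps simp del: nd_bas)
  show "gr_defect (cgam s i) 0 (\<lambda>j. j) ?k ?a ?b ?c \<in> greg_rel"
    by (auto simp: gr_defect_def cgam_def scl_distribs algebra_simps simp del: nd_bas)
qed (use assms in \<open>auto simp: cgam_def greg_rel_lookup_Lf scl_distribs algebra_simps
      intro!: greg.rel_scl nn_rel split: greg_gen.split\<close>)

lemma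
  fixes u :: "('k::field, greg_gen) lin"
  shows ep_dd: "ep (dd u) = - dd (ep u)"
    and ep_pp: "ep (pp s u) = - pp s (ep u)"
    and ep_hh: "ep (hh s u) = - hh s (ep u)"
    and ep_nn: "ep (nn i u) = nn i (ep u)"
    and ep_cc: "ep (cc s i u) = cc s i (ep u)"
proof -
  have m: "ep (dd (bas m)) = - dd (ep (bas m :: ('k, greg_gen) lin)) \<and>
    ep (pp s (bas m)) = - pp s (ep (bas m :: ('k, greg_gen) lin)) \<and>
    ep (nn i (bas m)) = nn i (ep (bas m :: ('k, greg_gen) lin))" for m
  proof (induction m)
    case (Nd g a b)
    then show ?case
      by (cases g) (simp_all add: nd_bas[symmetric] brace_def algebra_simps del: nd_bas)
  qed simp
  show *: "ep (dd u) = - dd (ep u)" "ep (pp s u) = - pp s (ep u)" "ep (nn i u) = nn i (ep u)"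
    for u :: "('k, greg_gen) lin"
    by (induction u rule: lin_induct; simp add: m)+
  have m: "ep (hh s (bas m)) = - hh s (ep (bas m :: ('k, greg_gen) lin)) \<and>
    ep (cc s i (bas m)) = cc s i (ep (bas m :: ('k, greg_gen) lin))" for m
  proof (induction m)
    case (Nd g a b)
    then show ?case
      by (cases g) (simp_all add: nd_bas[symmetric] * scl_distribs algebra_simps del: nd_bas lookup_bas_Lf)
  qed simp
  show "ep (hh s u) = - hh s (ep u)" "ep (cc s i u) = cc s i (ep u)"
    by (induction u rule: lin_induct; simp add: m)+
qed

lemma
  fixes u :: "('k::field, greg_gen) lin"
  shows lookup_dd_Lf [simp]: "lookup (dd u) (Lf j) = 0"
    and lookup_ee_Lf [simp]: "lookup (ee s i u) (Lf j) = 0"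
proof -
  have m: "lookup (dd (bas m :: ('k, greg_gen) lin)) (Lf j) = 0 \<and>
    lookup (ee s i (bas m :: ('k, greg_gen) lin)) (Lf j) = 0" for m
    by (cases m; cases "case m of Nd g a b \<Rightarrow> g | Lf j \<Rightarrow> GenX")
       (simp_all add: nd_bas[symmetric] lookup_add lookup_minus del: nd_bas)
  show "lookup (dd u) (Lf j) = 0" "lookup (ee s i u) (Lf j) = 0"
    by (induction u rule: lin_induct; simp add: lookup_add m)+
qed

lemma dd_nn:
  fixes u :: "('k::field, greg_gen) lin"
  shows "dd (nn i u) = nn i (dd u)"
proof (induction u rule: lin_induct)
  case (add c m v)
  have "dd (nn i (bas m)) = nn i (dd (bas m :: ('k, greg_gen) lin))"
  proof (induction m)
    case (Nd g a b)
    then show ?case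
      by (cases g) (simp_all add: nd_bas[symmetric] ep_nn algebra_simps del: nd_bas)
  qed simp
  with add show ?case by simp
qed simp

text \<open>An equality of combinations of trees and not just modulo relations: the operator adds
  nothing at vertices g, at x(u, s) it adds \<open>nn i u\<close>, and \<open>nn i\<close> commutes
  with the differential.\<close>

lemma dd_cc:
  fixes u :: "('k::field, greg_gen) lin"
  shows "dd (cc s i u) = cc s i (dd u)"
proof (induction u rule: lin_induct)
  case (add c m v)
  have "dd (cc s i (bas m)) = cc s i (dd (bas m :: ('k, greg_gen) lin))"
  proof (induction m)
    case (Nd g a b)
    then show ?case
      by (cases g) (simp_all add: nd_bas[symmetric] ep_cc dd_nn scl_distribs algebra_simps del: nd_bas lookup_bas_Lf)
  qed simp
  with add show ?case by simp
qed simp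

text \<open>In a multilinear tree a label occurs on one side of each vertex, so these vanishing
  statements switch off the other child. The differential of a tree is a combination of trees, which
  is why \<open>hh s (dd A)\<close> is listed separately.\<close>

lemma absent:
  fixes A :: "('k::field, greg_gen) lin"
  assumes "s \<notin> set (leaves a)" and "A = bas a"
  shows "hh s A = 0" "hh s (dd A) = 0" "cc s i A = 0" "nn s A = 0" "ee t s A = 0" "lookup A (Lf s) = 0"
proof -
  have "hh s (bas a :: ('k, greg_gen) lin) = 0 \<and> hh s (dd (bas a :: ('k, greg_gen) lin)) = 0 \<and>
    cc s i (bas a :: ('k, greg_gen) lin) = 0 \<and> nn s (bas a :: ('k, greg_gen) lin) = 0 \<and>
    ee t s (bas a :: ('k, greg_gen) lin) = 0"
    using assms(1)
  proof (induction a)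
    case (Nd g a b)
    let ?a = "bas a :: ('k, greg_gen) lin" and ?b = "bas b :: ('k, greg_gen) lin"
    have s: "lookup ?a (Lf s) = 0" "lookup ?b (Lf s) = 0"
      using Nd.prems by auto
    have IH: "hh s ?a = 0" "hh s (dd ?a) = 0" "cc s i ?a = 0" "nn s ?a = 0" "ee t s ?a = 0"
      "hh s ?b = 0" "hh s (dd ?b) = 0" "cc s i ?b = 0" "nn s ?b = 0" "ee t s ?b = 0"
      using Nd by auto
    then have "hh s (ep ?a) = 0" "hh s (ep ?b) = 0"
      by (simp_all add: greg.eps_bas)
    with s IH show ?case
      by (cases g) (simp_all add: nd_bas[symmetric] del: nd_bas lookup_bas_Lf)
  qed auto
  then show "hh s A = 0" "hh s (dd A) = 0" "cc s i A = 0" "nn s A = 0" "ee t s A = 0"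
    by (simp_all add: assms(2))
  show "lookup A (Lf s) = 0" using assms by auto
qed

lemmas absent_bas = absent[OF _ HOL.refl]

lemma nn_distinct:
  "distinct (leaves a) \<Longrightarrow> i \<in> set (leaves a) \<Longrightarrow> nn i (bas a) = (bas a :: ('k::field, greg_gen) lin)"
proof (induction a)
  case (Nd g a b)
  let ?a = "bas a :: ('k, greg_gen) lin" and ?b = "bas b :: ('k, greg_gen) lin"
  have "nn i (nd g ?a ?b) = nd g ?a ?b"
  proof (cases "i \<in> set (leaves a)")
    case True
    then have "nn i ?a = ?a" "nn i ?b = 0" using Nd by (auto intro: absent_bas)
    then show ?thesis by (simp del: nd_bas)
  next
    case False
    then have "nn i ?a = 0" "nn i ?b = ?b" using Nd by (auto intro: absent_bas)
    then show ?thesis by (simp del: nd_bas)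
  qed
  then show ?case by simp
qed auto

section \<open>Bracketing with a leaf is a derivation up to homotopy\<close>

definition theta_defect :: "nat set \<Rightarrow> nat \<Rightarrow> ('k::field, greg_gen) lin \<Rightarrow> ('k, greg_gen) lin"
  where "theta_defect J s u =
    nx u (lf s) - nx (lf s) u - (dd (pp s u) + pp s (dd u)) - (\<Sum>j\<in>J. ee s j u)"

lemma theta_defect_linear: "linear_map (theta_defect J s)"
  by (auto simp: linear_map_def theta_defect_def scl_distribs sum.distrib scl_sum algebra_simps)

lemma theta_defect_rel:
  assumes u: "u \<in> greg_rel"
  shows "theta_defect J s u \<in> greg_rel"
proof -
  have "(\<Sum>j\<in>J. ee s j u) \<in> greg_rel"
    by (induction J rule: infinite_finite_induct) (auto intro: greg.rel_add ee_rel u)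
  with u show ?thesis
    unfolding theta_defect_def
    by (intro greg.rel_diff greg.rel_add greg.rel_left greg.rel_right dd_rel pp_rel)
qed

text \<open>The differential creates g(u, w), and \<open>pp s\<close> turns it into the brace of
  \<open>u\<close> and \<open>w\<close>, which trades x(s, x(u, w)) for x(x(s, u), w). The failure
  of the product rule is then exactly the pre-Lie relator with \<open>s\<close> in the last
  place.\<close>

lemma theta_defect_nx:
  "theta_defect J s (nx u w) =
    nx (theta_defect J s u) w + nx u (theta_defect J s w) + pl 1 u w (lf s)"
  by (simp add: theta_defect_def pl_def brace_def ep_dd ep_pp sum.distrib linear_sum[OF linear_map_nd(1)]
      linear_sum[OF linear_map_nd(2)] algebra_simps)

text \<open>As for x, with the mixed relator in place of the pre-Lie relator. The bracket is formed
  with x, so terms in which \<open>s\<close> is an input of g occur on both sides of g and are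
  matched by its symmetry.\<close>

lemma theta_defect_ng:
  "theta_defect J s (ng u w) =
    ng (theta_defect J s u) w + ng u (theta_defect J s w) + gr 1 u w (lf s)
    + nx (ng u (lf s) - ng (lf s) u) w - (ng (nx u w) (lf s) - ng (lf s) (nx u w))"
  by (simp add: theta_defect_def gr_def brace_def ep_dd ep_pp sum.distrib linear_sum[OF linear_map_nd(1)]
      linear_sum[OF linear_map_nd(2)] algebra_simps)

lemma swap_lf:
  fixes u :: "('k::field, greg_gen) lin"
  shows "ng u (lf s) - ng (lf s) u \<in> greg_rel" "nx u (lf s) - ny (lf s) u \<in> greg_rel" "ny u (lf s) - nx (lf s) u \<in> greg_rel"
proof -
  have *: "ng (bas m) (lf s) - ng (lf s) (bas m :: ('k, greg_gen) lin) \<in> greg_rel"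
    "nx (bas m) (lf s) - ny (lf s) (bas m :: ('k, greg_gen) lin) \<in> greg_rel"
    "ny (bas m) (lf s) - nx (lf s) (bas m :: ('k, greg_gen) lin) \<in> greg_rel" for m
    using swap_rel[of "greg.mdeg m" "bas m" 0 "lf s"] by auto
  show "ng u (lf s) - ng (lf s) u \<in> greg_rel" "nx u (lf s) - ny (lf s) u \<in> greg_rel" "ny u (lf s) - nx (lf s) u \<in> greg_rel"
    by (rule rel_linear[of "\<lambda>u. ng u (lf s) - ng (lf s) u"] rel_linear[of "\<lambda>u. nx u (lf s) - ny (lf s) u"]
        rel_linear[of "\<lambda>u. ny u (lf s) - nx (lf s) u"]; (rule *)?;
        simp add: linear_map_def scl_distribs)+
qed

text \<open>Induction with the two product rules. At a vertex y the swap relation leads back to x,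
  since \<open>theta_defect\<close> preserves relations. The set \<open>J\<close> stays fixed while
  subtrees shrink; labels outside the subtree contribute nothing to the sum.\<close>

lemma theta:
  assumes "finite J" "set (leaves a) \<subseteq> J"
  shows "theta_defect J s (bas a :: ('k::field, greg_gen) lin) \<in> greg_rel"
  using assms(2)
proof (induction a)
  case (Lf j)
  have "theta_defect J s (lf j :: ('k, greg_gen) lin) = 0"
    using assms(1) Lf by (simp add: theta_defect_def del: nd_bas)
  then show ?case by simp
next
  case (Nd g a b)
  let ?bas = "\<lambda>a. bas a :: ('k, greg_gen) lin"
  have IH: "theta_defect J s (?bas a) \<in> greg_rel" "theta_defect J s (?bas b) \<in> greg_rel"
    using Nd by auto
  have X: "theta_defect J s (nx (?bas a) (?bas b)) \<in> greg_rel"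
    if "theta_defect J s (?bas a) \<in> greg_rel" "theta_defect J s (?bas b) \<in> greg_rel" for a b
    unfolding theta_defect_nx using that pl_rel[of "greg.mdeg b" "?bas b" 0 "lf s" "?bas a"]
    by (intro greg.rel_add greg.rel_left greg.rel_right) auto
  show ?case
  proof (cases g)
    case GenX
    then show ?thesis using X IH by simp
  next
    case GenY
    let ?k = "sg (greg.mdeg a * greg.mdeg b) :: 'k"
    have "theta_defect J s (ny (?bas a) (?bas b) - ?k \<star> nx (?bas b) (?bas a)) \<in> greg_rel"
      by (intro theta_defect_rel swap_rel) auto
    then have "theta_defect J s (ny (?bas a) (?bas b) - ?k \<star> nx (?bas b) (?bas a)) +
        ?k \<star> theta_defect J s (nx (?bas b) (?bas a)) \<in> greg_rel"
      by (intro greg.rel_add greg.rel_scl X IH)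
    then show ?thesis using GenY by (simp add: linear_mapD[OF theta_defect_linear])
  next
    case GenG
    have "theta_defect J s (ng (?bas a) (?bas b)) \<in> greg_rel"
      unfolding theta_defect_ng using gr_rel[of "greg.mdeg b" "?bas b" 0 "lf s" "?bas a"]
      by (intro greg.rel_add greg.rel_diff greg.rel_left greg.rel_right IH swap_lf(1)) auto
    then show ?thesis using GenG by simp
  qed
qed

section \<open>The homotopy formula and the orthogonality of removal and substitution\<close>

definition homotopy_defect :: "nat set \<Rightarrow> nat \<Rightarrow> ('k::field, greg_gen) lin \<Rightarrow> ('k, greg_gen) lin"
  where "homotopy_defect J s u = dd (hh s u) + hh s (dd u) - u + (\<Sum>j\<in>J. ee s j (cc s j u))"

text \<open>No child is the leaf \<open>s\<close> itself, and the homotopy kills \<open>w\<close>,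
  so everything happens inside \<open>u\<close>. The mixed terms, with \<open>dd\<close> and
  \<open>hh s\<close> at different places, cancel because both anticommute with
  \<open>ep\<close>.\<close>

lemma homotopy_left:
  assumes "hh s w = 0" "hh s (dd w) = 0" "lookup u (Lf s) = 0" "lookup w (Lf s) = 0"
  shows "dd (hh s (nd g u w)) + hh s (dd (nd g u w)) = nd g (dd (hh s u) + hh s (dd u)) w"
proof -
  have "hh s (ep w) = 0" "ep (hh s (ep w)) = 0" using ep_hh[of s w] assms(1) by auto
  then show ?thesis
    using assms by (cases g) (simp_all add: ep_hh ep_dd algebra_simps)
qed

lemma homotopy_right:
  assumes "hh s u = 0" "hh s (dd u) = 0" "lookup u (Lf s) = 0" "lookup w (Lf s) = 0"
  shows "dd (hh s (nd g u w)) + hh s (dd (nd g u w)) = nd g u (dd (hh s w) + hh s (dd w))"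
proof -
  have "hh s (ep u) = 0" using ep_hh[of s u] assms(1) by auto
  then show ?thesis
    using assms by (cases g) (simp_all add: ep_hh ep_dd algebra_simps)
qed

text \<open>Induction along the path to the leaf \<open>s\<close>. Above its parent the formula is
  inherited from the child that contains \<open>s\<close>. At the parent, the trees x(s, b) and g(s,
  b) satisfy it identically, x(a, s) is the statement \<open>theta\<close>, and the other three
  positions follow from the symmetry of the generators.\<close>

lemma homotopy:
  assumes "finite J"
  shows "distinct (leaves a) \<Longrightarrow> s \<in> set (leaves a) \<Longrightarrow> a \<noteq> Lf s \<Longrightarrow> set (leaves a) - {s} \<subseteq> J \<Longrightarrow> s \<notin> J \<Longrightarrow>
    homotopy_defect J s (bas a :: ('k::field, greg_gen) lin) \<in> greg_rel"
proof (induction a)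
  case (Nd g a b)
  let ?a = "bas a :: ('k, greg_gen) lin" and ?b = "bas b :: ('k, greg_gen) lin"
  \<comment> \<open>For a label in \<open>m\<close> the counting operator is the identity; for a
    label outside \<open>m\<close> both sides vanish.\<close>
  have EN: "(\<Sum>j\<in>J. ee s j (nn j (bas m :: ('k, greg_gen) lin))) = (\<Sum>j\<in>J. ee s j (bas m))"
    if "distinct (leaves m)" for m
  proof (intro sum.cong HOL.refl)
    show "ee s j (nn j (bas m :: ('k, greg_gen) lin)) = ee s j (bas m)" for j
      by (cases "j \<in> set (leaves m)") (simp_all add: nn_distinct that absent_bas)
  qed
  have C0: "cc s j (bas m :: ('k, greg_gen) lin) = 0" if "j \<notin> set (leaves m)" "j \<noteq> s" for j m
    using that(1)
  proof (induction m)
    case (Nd g a b)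
    let ?a = "bas a :: ('k, greg_gen) lin" and ?b = "bas b :: ('k, greg_gen) lin"
    have "cc s j ?a = 0" "cc s j ?b = 0" "nn j ?a = 0" "nn j ?b = 0"
      using Nd by (auto intro: absent_bas)
    then show ?case by (cases g) (simp_all add: nd_bas[symmetric] del: nd_bas)
  qed simp
  show ?case
  proof (cases "s \<in> set (leaves a)")
    case True
    then have b: "s \<notin> set (leaves b)" using Nd.prems by auto
    note ab = absent[OF b, of ?b, OF HOL.refl]
    show ?thesis
    proof (cases "a = Lf s")
      case True
      have th: "theta_defect J s ?b \<in> greg_rel"
        using Nd.prems b by (intro theta assms) auto
      have "hh s (ep ?b) = 0" using ep_hh[of s ?b] ab by auto
      show ?thesis
      proof (cases g)
        case GenX
        then show ?thesis using True ab \<open>hh s (ep ?b) = 0\<close>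
          by (simp add: homotopy_defect_def nd_bas[symmetric] del: nd_bas)
      next
        case GenY
        have "- theta_defect J s ?b + (nx ?b (lf s) - ny (lf s) ?b) \<in> greg_rel"
          by (intro greg.rel_add greg.rel_uminus th swap_lf)
        also have "- theta_defect J s ?b + (nx ?b (lf s) - ny (lf s) ?b) = homotopy_defect J s (ny (lf s) ?b)"
          using ab \<open>hh s (ep ?b) = 0\<close> EN[of b] Nd.prems(1)
          by (simp add: homotopy_defect_def theta_defect_def algebra_simps del: nd_bas)
        finally show ?thesis using True GenY by simp
      next
        case GenG
        then show ?thesis using True ab \<open>hh s (ep ?b) = 0\<close>
          by (simp add: homotopy_defect_def nd_bas[symmetric] ep_dd del: nd_bas)
      qed
    next
      case False
      have "ee s j (cc s j (nd g ?a ?b)) = nd g (ee s j (cc s j ?a)) ?b" if "j \<in> J" for j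
      proof (cases "j \<in> set (leaves a)")
        case True
        then have "ee s j ?b = 0" using Nd.prems(1) by (intro absent_bas) auto
        then show ?thesis using ab False by (cases g) (simp_all del: nd_bas)
      next
        case j: False
        then have "cc s j ?a = 0" using that Nd.prems by (intro C0) auto
        then show ?thesis using ab False by (cases g) (simp_all del: nd_bas)
      qed
      then have "homotopy_defect J s (nd g ?a ?b) = nd g (homotopy_defect J s ?a) ?b"
        using homotopy_left[OF ab(1,2) _ ab(6), of ?a g] False
        by (simp add: homotopy_defect_def linear_sum[OF linear_map_nd(2)] del: nd_bas)
      moreover have "homotopy_defect J s ?a \<in> greg_rel"
        using Nd.prems True False by (intro Nd.IH(1)) auto
      ultimately show ?thesis by (simp add: greg.rel_left)
    qed
  next
    case False
    note ab = absent[OF False, of ?a, OF HOL.refl]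
    have sb: "s \<in> set (leaves b)" using False Nd.prems by auto
    show ?thesis
    proof (cases "b = Lf s")
      case True
      have th: "theta_defect J s ?a \<in> greg_rel"
        using Nd.prems False by (intro theta assms) auto
      have "hh s (ep ?a) = 0" using ep_hh[of s ?a] ab by auto
      show ?thesis
      proof (cases g)
        case GenX
        have "- theta_defect J s ?a \<in> greg_rel"
          by (intro greg.rel_uminus th)
        also have "- theta_defect J s ?a = homotopy_defect J s (nx ?a (lf s))"
          using ab \<open>hh s (ep ?a) = 0\<close> EN[of a] Nd.prems(1)
          by (simp add: homotopy_defect_def theta_defect_def algebra_simps del: nd_bas)
        finally show ?thesis using True GenX by simp
      next
        case GenY
        have "- (ny ?a (lf s) - nx (lf s) ?a) = homotopy_defect J s (ny ?a (lf s))"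
          using ab \<open>hh s (ep ?a) = 0\<close> by (simp add: homotopy_defect_def del: nd_bas)
        then show ?thesis using True GenY greg.rel_uminus[OF swap_lf(3)] by (metis nd_bas)
      next
        case GenG
        have "- (ng ?a (lf s) - ng (lf s) ?a) = homotopy_defect J s (ng ?a (lf s))"
          using ab \<open>hh s (ep ?a) = 0\<close> by (simp add: homotopy_defect_def ep_dd del: nd_bas)
        then show ?thesis using True GenG greg.rel_uminus[OF swap_lf(1)] by (metis nd_bas)
      qed
    next
      case b: False
      have "ee s j (cc s j (nd g ?a ?b)) = nd g ?a (ee s j (cc s j ?b))" if "j \<in> J" for j
      proof (cases "j \<in> set (leaves b)")
        case True
        then have "ee s j ?a = 0" using Nd.prems(1) by (intro absent_bas) auto
        then show ?thesis using ab b by (cases g) (simp_all del: nd_bas)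
      next
        case j: False
        then have "cc s j ?b = 0" using that Nd.prems by (intro C0) auto
        then show ?thesis using ab b by (cases g) (simp_all del: nd_bas)
      qed
      then have "homotopy_defect J s (nd g ?a ?b) = nd g ?a (homotopy_defect J s ?b)"
        using homotopy_right[OF ab(1,2,6), of ?b g] b
        by (simp add: homotopy_defect_def linear_sum[OF linear_map_nd(1)] del: nd_bas)
      moreover have "homotopy_defect J s ?b \<in> greg_rel"
        using Nd.prems sb b by (intro Nd.IH(2)) auto
      ultimately show ?thesis by (simp add: greg.rel_right)
    qed
  qed
qed simp

text \<open>Substitution plants x(j, s) - x(s, j), and this is the only place where \<open>s\<close>
  occurs. Removal sees x(j, s), where counting the label \<open>i\<close> in the leaf
  \<open>j\<close> gives the Kronecker symbol; in x(s, j) the right input is not \<open>s\<close>,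
  so it gives nothing.\<close>

lemma cc_ee:
  assumes "distinct (leaves a)" "s \<notin> set (leaves a)" "j \<in> set (leaves a)"
  shows "cc s i (ee s j (bas a :: ('k::field, greg_gen) lin)) = (if i = j then bas a else 0)"
  using assms
proof (induction a)
  case (Nd g a b)
  let ?a = "bas a :: ('k, greg_gen) lin" and ?b = "bas b :: ('k, greg_gen) lin"
  have s: "s \<notin> set (leaves a)" "s \<notin> set (leaves b)" using Nd.prems by auto
  note ab = absent[OF s(1), of ?a, OF HOL.refl] absent[OF s(2), of ?b, OF HOL.refl]
  have E: "cc s i (ee s j (nd g ?a ?b)) = nd g (cc s i (ee s j ?a)) ?b + nd g ?a (cc s i (ee s j ?b))"
    using ab by (cases g) (simp_all del: nd_bas lookup_bas_Lf)
  show ?case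
  proof (cases "j \<in> set (leaves a)")
    case True
    then have "ee s j ?b = 0" using Nd.prems by (intro absent_bas) auto
    then show ?thesis using E Nd True by (simp flip: nd_bas)
  next
    case False
    then have "ee s j ?a = 0" by (intro absent_bas) auto
    then show ?thesis using E Nd False by (simp flip: nd_bas)
  qed
qed (auto simp del: nd_bas)

section \<open>Free operads and quotient operads\<close>

lemma base_field_simps [simp]:
  "carrier (base_field :: 'k::field ring) = UNIV"
  "x \<oplus>\<^bsub>base_field\<^esub> y = x + (y :: 'k::field)" "x \<otimes>\<^bsub>base_field\<^esub> y = x * (y :: 'k::field)"
  "\<one>\<^bsub>base_field\<^esub> = (1 :: 'k::field)" "\<zero>\<^bsub>base_field\<^esub> = (0 :: 'k::field)"
  by (simp_all add: ring_of_type_algebra_def)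

lemma a_inv_base_field [simp]: "\<ominus>\<^bsub>base_field\<^esub> x = - (x :: 'k::field)"
proof -
  interpret cring "base_field :: 'k ring" by (rule cring_from_type_algebra)
  show ?thesis by (rule minus_equality) auto
qed

lemma inner_perm_permutes:
  assumes "\<tau> permutes {1..n}" "i \<in> {1..m}"
  shows "inner_perm n i \<tau> permutes {1..m + n - 1}"
proof (rule bij_imp_permutes)
  have in_range: "\<tau> j \<in> {1..n}" if "j \<in> {1..n}" for j
    using permutes_in_image[OF assms(1)] that by blast
  have "inj_on (inner_perm n i \<tau>) {1..m + n - 1}"
  proof (rule inj_onI)
    fix j k assume jk: "inner_perm n i \<tau> j = inner_perm n i \<tau> k"
    have J: "\<tau> (j + 1 - i) \<in> {1..n}" if "i \<le> j" "j < i + n"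
      using that by (intro in_range) auto
    have K: "\<tau> (k + 1 - i) \<in> {1..n}" if "i \<le> k" "k < i + n"
      using that by (intro in_range) auto
    have "\<tau> (j + 1 - i) = \<tau> (k + 1 - i) \<Longrightarrow> j + 1 - i = k + 1 - i"
      using permutes_inj[OF assms(1)] by (auto dest: injD)
    moreover have "\<tau> (j + 1 - i) = \<tau> (k + 1 - i)"
      if "i \<le> j" "j < i + n" "i \<le> k" "k < i + n"
    proof -
      have *: "a = b" if "a + i - 1 = b + i - 1" for a b :: nat
        using that assms(2) by auto
      have "\<tau> (j + 1 - i) + i - 1 = \<tau> (k + 1 - i) + i - 1"
        using that jk by (simp add: inner_perm_def)
      then show ?thesis by (rule *)
    qed
    ultimately show "j = k"
      using jk J K assms(2) by (cases "i \<le> j \<and> j < i + n"; cases "i \<le> k \<and> k < i + n")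
        (auto simp: inner_perm_def)
  qed
  moreover have "inner_perm n i \<tau> ` {1..m + n - 1} \<subseteq> {1..m + n - 1}"
  proof -
    have *: "x + i - 1 \<in> {1..m + n - 1}" if "x \<in> {1..n}" for x
      using that assms(2) by auto
    have "inner_perm n i \<tau> j \<in> {1..m + n - 1}" if j: "j \<in> {1..m + n - 1}" for j
    proof (cases "i \<le> j \<and> j < i + n")
      case True
      then have "\<tau> (j + 1 - i) \<in> {1..n}" by (intro in_range) auto
      with True show ?thesis unfolding inner_perm_def by (simp only: * if_True simp_thms)
    next
      case False
      then have "inner_perm n i \<tau> j = j" by (simp only: inner_perm_def if_False)
      with j show ?thesis by (simp only:)
    qed
    then show ?thesis by blast
  qed
  ultimately show "bij_betw (inner_perm n i \<tau>) {1..m + n - 1} {1..m + n - 1}"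
    by (simp add: bij_betw_def endo_inj_surj)
qed (use assms(2) in \<open>auto simp: inner_perm_def\<close>)

lemma outer_perm_permutes:
  assumes "\<sigma> permutes {1..m}" "i \<in> {1..m}"
  shows "outer_perm m n i \<sigma> permutes {1..m + n - 1}"
proof (rule bij_imp_permutes)
  have in_range: "\<sigma> j \<in> {1..m}" if "j \<in> {1..m}" for j
    using permutes_in_image[OF assms(1)] that by blast
  have inj: "\<sigma> j = \<sigma> k \<longleftrightarrow> j = k" for j k
    using permutes_inj[OF assms(1)] by (auto dest: injD)
  define pos where "pos j = (if j < i then j else j + 1 - n)" for j
  have pos: "pos j \<in> {1..m} \<and> pos j \<noteq> i" if "j \<in> {1..m + n - 1}" "\<not> (i \<le> j \<and> j < i + n)" for j
    using that assms(2) by (auto simp: pos_def)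
  have out: "outer_perm m n i \<sigma> j = (if i \<le> j \<and> j < i + n then \<sigma> i + (j - i)
      else if \<sigma> (pos j) < \<sigma> i then \<sigma> (pos j) else \<sigma> (pos j) + n - 1)"
    if "j \<in> {1..m + n - 1}" for j
    using that by (auto simp: outer_perm_def pos_def Let_def)
  have "inj_on (outer_perm m n i \<sigma>) {1..m + n - 1}"
  proof (rule inj_onI)
    fix j k assume j: "j \<in> {1..m + n - 1}" and k: "k \<in> {1..m + n - 1}"
      and eq: "outer_perm m n i \<sigma> j = outer_perm m n i \<sigma> k"
    have pj: "\<sigma> (pos j) \<in> {1..m} \<and> \<sigma> (pos j) \<noteq> \<sigma> i" if "\<not> (i \<le> j \<and> j < i + n)"
      using pos[OF j that] in_range by (simp add: inj)
    have pk: "\<sigma> (pos k) \<in> {1..m} \<and> \<sigma> (pos k) \<noteq> \<sigma> i" if "\<not> (i \<le> k \<and> k < i + n)"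
      using pos[OF k that] in_range by (simp add: inj)
    have *: "\<sigma> (pos j) = \<sigma> (pos k) \<Longrightarrow> pos j = pos k" by (simp add: inj)
    show "j = k"
    proof (cases "i \<le> j \<and> j < i + n"; cases "i \<le> k \<and> k < i + n")
      assume a: "\<not> (i \<le> j \<and> j < i + n)" "\<not> (i \<le> k \<and> k < i + n)"
      then have "\<sigma> (pos j) = \<sigma> (pos k)"
        using eq pj pk by (auto simp: out[OF j] out[OF k] split: if_splits)
      then show ?thesis using * a by (auto simp: pos_def split: if_splits)
    qed (use eq pj pk in \<open>auto simp: out[OF j] out[OF k] split: if_splits\<close>)
  qed
  moreover have "outer_perm m n i \<sigma> ` {1..m + n - 1} \<subseteq> {1..m + n - 1}"
  proof -
    have "outer_perm m n i \<sigma> j \<in> {1..m + n - 1}" if j: "j \<in> {1..m + n - 1}" for j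
    proof (cases "i \<le> j \<and> j < i + n")
      case True
      then show ?thesis using in_range[OF assms(2)] by (auto simp: out[OF j])
    next
      case False
      then show ?thesis using in_range[of "pos j"] pos[OF j] inj[of "pos j" i] in_range[OF assms(2)]
        by (auto simp: out[OF j])
    qed
    then show ?thesis by blast
  qed
  ultimately show "bij_betw (outer_perm m n i \<sigma>) {1..m + n - 1} {1..m + n - 1}"
    by (simp add: bij_betw_def endo_inj_surj)
qed (auto simp: outer_perm_def)

sublocale graded_operad \<subseteq> md: module base_field "cpt P n d" for n d
  by (rule module_cpt)

lemma (in graded_operad) smult_simps:
  assumes "a \<in> ops P n d"
  shows "c \<odot>\<^bsub>cpt P n d\<^esub> a \<in> ops P n d"
    and "(b + c) \<odot>\<^bsub>cpt P n d\<^esub> a = b \<odot>\<^bsub>cpt P n d\<^esub> a \<oplus>\<^bsub>cpt P n d\<^esub> c \<odot>\<^bsub>cpt P n d\<^esub> a"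
    and "(b * c) \<odot>\<^bsub>cpt P n d\<^esub> a = b \<odot>\<^bsub>cpt P n d\<^esub> (c \<odot>\<^bsub>cpt P n d\<^esub> a)"
    and "1 \<odot>\<^bsub>cpt P n d\<^esub> a = a"
    and "0 \<odot>\<^bsub>cpt P n d\<^esub> a = \<zero>\<^bsub>cpt P n d\<^esub>"
    and "(- c) \<odot>\<^bsub>cpt P n d\<^esub> a = \<ominus>\<^bsub>cpt P n d\<^esub> (c \<odot>\<^bsub>cpt P n d\<^esub> a)"
  using assms md.smult_closed[of c a n d] md.smult_l_distr[of b c a n d] md.smult_assoc1[of b c a n d]
    md.smult_one[of a n d] md.smult_l_null[of a n d] md.smult_l_minus[of c a n d]
  by simp_all

lemma (in graded_operad) arity_degree:
  assumes "a \<in> ops P n d"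
  shows "arity P a = n" "degree_of P a = d"
  using assms disjoint_cpt unfolding arity_def degree_of_def by (blast intro!: the_equality)+

context binary_generators
begin

abbreviation eqv (infix \<open>\<approx>\<close> 50) where "s \<approx> t \<equiv> opeq gdeg sw s t"
abbreviation cls where "cls \<equiv> opcls gdeg sw"
abbreviation wf where "wf t n d \<equiv> twf gdeg t \<and> tar t = n \<and> tdeg gdeg t = d"
abbreviation T where "T \<equiv> free_operad gdeg sw"

text \<open>The rules ask for well-formedness only where it cannot be inferred from the other side.
  That it is inherited, with arity and degree, makes the components of the free operad disjoint and
  its operations well defined.\<close>

lemma opeq_wf: "s \<approx> t \<Longrightarrow> twf gdeg s \<and> twf gdeg t \<and> tar s = tar t \<and> tdeg gdeg s = tdeg gdeg t"
proof (induction rule: opeq.induct)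
  case (comp_act_left s \<sigma> i t)
  then show ?case
    using outer_perm_permutes[of \<sigma> "tar s" i "tar t"] permutes_in_image[of \<sigma> "{1..tar s}" i] by auto
next
  case (comp_act_right s i t \<tau>)
  then show ?case using inner_perm_permutes[of \<tau> "tar t" i "tar s"] by auto
next
  case (act_act t \<sigma> \<tau>)
  then show ?case by (auto intro: permutes_compose)
next
  case (gen_swap g)
  then show ?case
    using permutes_swap_id[of 1 "{1..2::nat}" 2] by (auto simp: gdeg_sw)
next
  case (comp_parallel s i t k u)
  then show ?case by auto
next
  case (comp_sequential s i t j u)
  then show ?case by auto
qed (auto intro: permutes_id)

lemma cls_eq: "twf gdeg s \<Longrightarrow> cls s = cls t \<longleftrightarrow> s \<approx> t"
  unfolding opcls_def by (auto intro: opeq.refl opeq.trans opeq.sym)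

lemma cls_eqI: "s \<approx> t \<Longrightarrow> cls s = cls t"
  using cls_eq opeq_wf by blast

lemma mem_cls: "s \<in> cls t \<longleftrightarrow> t \<approx> s"
  by (simp add: opcls_def)

lemma self_mem_cls: "twf gdeg t \<Longrightarrow> t \<in> cls t"
  by (simp add: mem_cls opeq.refl)

lemma ops_T: "A \<in> ops T n d \<longleftrightarrow> (\<exists>t. A = cls t \<and> wf t n d)"
  by (auto simp: free_operad_def free_component_def)

lemma ops_T_cases:
  assumes "A \<in> ops T n d"
  obtains t where "A = cls t" "twf gdeg t" "tar t = n" "tdeg gdeg t = d"
  using assms by (auto simp: ops_T)

lemmas opeq_axioms =
  opeq.add_assoc opeq.add_comm opeq.add_zero opeq.scale_zero opeq.scale_one opeq.scale_scale opeq.scale_scale[THEN opeq.sym]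
  opeq.scale_add_left opeq.scale_add_right opeq.comp_add_left opeq.comp_add_right
  opeq.comp_scale_left opeq.comp_scale_right opeq.unit_left opeq.unit_right opeq.comp_sequential
  opeq.act_add opeq.act_scale opeq.act_id opeq.act_act

lemma add_zero': "twf gdeg t \<Longrightarrow> tar t = n \<Longrightarrow> tdeg gdeg t = d \<Longrightarrow> Add (Zero n d) t \<approx> t"
  using opeq.add_zero by blast

lemma cls_ops: "wf t n d \<Longrightarrow> cls t \<in> ops T n d"
  by (auto simp: ops_T)

text \<open>Operations on classes are defined as unions over all representatives. Once the summand
  does not depend on the representative, the union equals its value at any one of them.\<close>

lemma UN_cls:
  assumes "twf gdeg t" "\<And>s. t \<approx> s \<Longrightarrow> F s = F t"
  shows "(\<Union>s\<in>cls t. F s) = F t"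
proof -
  have "(\<Union>s\<in>cls t. F s) = (\<Union>s\<in>cls t. F t)"
    by (rule SUP_cong[OF HOL.refl]) (simp only: mem_cls assms(2))
  moreover have "cls t \<noteq> {}" using self_mem_cls[OF assms(1)] by blast
  ultimately show ?thesis by simp
qed

lemma T_zero [simp]: "\<zero>\<^bsub>cpt T n d\<^esub> = cls (Zero n d)"
  and T_unit [simp]: "ounit T = cls Unit"
  by (simp_all add: free_operad_def free_component_def)

lemma T_add [simp]:
  assumes "twf gdeg (Add s t)"
  shows "cls s \<oplus>\<^bsub>cpt T n d\<^esub> cls t = cls (Add s t)"
proof -
  have "(\<Union>s'\<in>cls s. \<Union>t'\<in>cls t. cls (Add s' t')) = (\<Union>s'\<in>cls s. cls (Add s' t))"
    using assms by (intro SUP_cong HOL.refl UN_cls)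
      (auto simp: mem_cls dest: opeq_wf intro!: cls_eqI[symmetric] opeq.cong_add intro: opeq.refl)
  also have "\<dots> = cls (Add s t)"
    using assms by (intro UN_cls) (auto intro!: cls_eqI[symmetric] opeq.cong_add intro: opeq.refl)
  finally show ?thesis by (simp add: free_operad_def free_component_def)
qed

lemma T_smult [simp]:
  assumes "twf gdeg t"
  shows "c \<odot>\<^bsub>cpt T n d\<^esub> cls t = cls (Scale c t)"
proof -
  have "(\<Union>t'\<in>cls t. cls (Scale c t')) = cls (Scale c t)"
    using assms by (intro UN_cls) (auto intro!: cls_eqI[symmetric] opeq.cong_scale)
  then show ?thesis by (simp add: free_operad_def free_component_def)
qed

lemma T_pcomp [simp]:
  assumes "twf gdeg (Comp s i t)"
  shows "pcomp T (cls s) i (cls t) = cls (Comp s i t)"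
proof -
  have "(\<Union>s'\<in>cls s. \<Union>t'\<in>cls t. cls (Comp s' i t')) = (\<Union>s'\<in>cls s. cls (Comp s' i t))"
    using assms by (intro SUP_cong HOL.refl UN_cls)
      (auto simp: mem_cls dest: opeq_wf intro!: cls_eqI[symmetric] opeq.cong_comp intro: opeq.refl)
  also have "\<dots> = cls (Comp s i t)"
    using assms by (intro UN_cls) (auto intro!: cls_eqI[symmetric] opeq.cong_comp intro: opeq.refl)
  finally show ?thesis by (simp add: free_operad_def)
qed

lemma T_act [simp]:
  assumes "twf gdeg (Act t \<sigma>)"
  shows "act T (cls t) \<sigma> = cls (Act t \<sigma>)"
proof -
  have "(\<Union>t'\<in>cls t. cls (Act t' \<sigma>)) = cls (Act t \<sigma>)"
    using assms by (intro UN_cls) (auto intro!: cls_eqI[symmetric] opeq.cong_act)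
  then show ?thesis by (simp add: free_operad_def)
qed

lemma module_T: "module base_field (cpt T n d)"
proof (rule moduleI)
  show "cring (base_field :: 'k ring)" by (rule cring_from_type_algebra)
  show "abelian_group (cpt T n d)"
  proof (rule abelian_groupI)
    show "\<exists>y\<in>ops T n d. y \<oplus>\<^bsub>cpt T n d\<^esub> x = \<zero>\<^bsub>cpt T n d\<^esub>" if "x \<in> ops T n d" for x
    proof -
      obtain t where t: "x = cls t" "wf t n d" using \<open>x \<in> _\<close> by (auto simp: ops_T)
      \<comment> \<open>Expressions have no constructor for negation; the inverse is the multiple by
        -1, and the scalar axioms reduce the sum to the zero expression.\<close>
      have "Scale (- 1 + 1) t \<approx> Add (Scale (- 1) t) (Scale 1 t)"
        using t by (intro opeq.scale_add_left) auto
      moreover have "Add (Scale (- 1) t) (Scale 1 t) \<approx> Add (Scale (- 1) t) t"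
        using t by (intro opeq.cong_add opeq.scale_one opeq.refl) auto
      moreover have "Scale 0 t \<approx> Zero n d"
        using opeq.scale_zero[of gdeg t sw] t by auto
      ultimately have "Add (Scale (- 1) t) t \<approx> Zero n d"
        by (metis (no_types) add.left_inverse opeq.sym opeq.trans)
      then show ?thesis using t
        by (intro bexI[of _ "cls (Scale (- 1) t)"]) (auto intro: cls_ops simp: cls_eqI)
    qed
  qed ((elim ops_T_cases)?; simp add: cls_eq cls_ops opeq_axioms add_zero')+
qed ((elim ops_T_cases)?; simp add: cls_eq cls_ops opeq_axioms)+

lemma graded_operad_T: "graded_operad T"
proof (rule graded_operad.intro)
  show "module base_field (cpt T n d)" for n d by (rule module_T)
  show "n = m \<and> d = e" if ab: "a \<in> ops T n d" "a \<in> ops T m e" for a n m d e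
  proof -
    obtain s t where "a = cls s" "wf s n d" "a = cls t" "wf t m e" using ab by (auto simp: ops_T)
    then show ?thesis using opeq_wf[of s t] cls_eq[of s t] by auto
  qed
  show "pcomp T (pcomp T a i b) (k + m - 1) h
        = koszul_sign q r \<odot>\<^bsub>cpt T (l + m + n - 2) (p + q + r)\<^esub> pcomp T (pcomp T a k h) i b"
    if H: "a \<in> ops T l p" "b \<in> ops T m q" "h \<in> ops T n r" "i \<in> {1..l}" "k \<in> {1..l}" "i < k"
    for a l p b m q h n r i k
  proof -
    obtain s t u where "a = cls s" "wf s l p" "b = cls t" "wf t m q" "h = cls u" "wf u n r"
      using H by (auto simp: ops_T)
    moreover have "i \<in> {1..l}" "k \<in> {1..l}" "k + m - 1 \<in> {1..l + m - 1}" "i \<in> {1..l + n - 1}"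
      using H by auto
    moreover have "Comp (Comp s i t) (k + tar t - 1) u \<approx>
        Scale (koszul_sign (tdeg gdeg t) (tdeg gdeg u)) (Comp (Comp s k u) i t)"
      using calculation H by (intro opeq.comp_parallel) simp_all
    ultimately show ?thesis by (simp add: cls_eq del: atLeastAtMost_iff One_nat_def)
  qed
  show "pcomp T (pcomp T a i b) (i + j - 1) h = pcomp T a i (pcomp T b j h)"
    if H: "a \<in> ops T l p" "b \<in> ops T m q" "h \<in> ops T n r" "i \<in> {1..l}" "j \<in> {1..m}"
    for a l p b m q h n r i j
  proof -
    obtain s t u where "a = cls s" "wf s l p" "b = cls t" "wf t m q" "h = cls u" "wf u n r"
      using H by (auto simp: ops_T)
    moreover have "i \<in> {1..l}" "j \<in> {1..m}" "i + j - 1 \<in> {1..l + m - 1}"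
      using H by auto
    moreover have "Comp (Comp s i t) (i + j - 1) u \<approx> Comp s i (Comp t j u)"
      using calculation H by (intro opeq.comp_sequential) simp_all
    ultimately show ?thesis by (simp add: cls_eq del: atLeastAtMost_iff One_nat_def)
  qed
  show "pcomp T (act T a \<sigma>) i b = act T (pcomp T a (\<sigma> i) b) (outer_perm m n i \<sigma>)"
    if H: "a \<in> ops T m p" "b \<in> ops T n q" "i \<in> {1..m}" "\<sigma> permutes {1..m}" for a m p b n q i \<sigma>
  proof -
    obtain s t where st: "a = cls s" "wf s m p" "b = cls t" "wf t n q"
      using H by (auto simp: ops_T)
    have "\<sigma> i \<in> {1..m}" using H permutes_in_image by metis
    moreover have "outer_perm m n i \<sigma> permutes {1..m + n - 1}" using H by (intro outer_perm_permutes)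
    ultimately show ?thesis using H st opeq.comp_act_left[of gdeg s \<sigma> i t sw]
      by (simp add: cls_eq)
  qed
  show "pcomp T a i (act T b \<tau>) = act T (pcomp T a i b) (inner_perm n i \<tau>)"
    if H: "a \<in> ops T m p" "b \<in> ops T n q" "i \<in> {1..m}" "\<tau> permutes {1..n}" for a m p b n q i \<tau>
  proof -
    obtain s t where st: "a = cls s" "wf s m p" "b = cls t" "wf t n q"
      using H by (auto simp: ops_T)
    have "inner_perm n i \<tau> permutes {1..m + n - 1}" using H by (intro inner_perm_permutes)
    then show ?thesis using H st opeq.comp_act_right[of gdeg s i t \<tau> sw]
      by (simp add: cls_eq)
  qed
  show "pcomp T (ounit T) 1 a = a" if "a \<in> ops T n d" for a n d
    using that by (elim ops_T_cases) (simp add: cls_eq opeq.unit_left[simplified])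
qed ((elim ops_T_cases)?; simp add: permutes_compose cls_eq cls_ops opeq_axioms)+

end

section \<open>Transport of the operad axioms along a surjection\<close>

locale graded_operad_image = graded_operad P
  for P :: "('k::field, 'a, 'm) operad_scheme" +
  fixes Q :: "('k, 'b, 'n) operad_scheme" and f :: "'a \<Rightarrow> 'b"
  assumes f_onto: "ops Q n d = f ` ops P n d"
    and f_disjoint: "x \<in> ops Q n d \<Longrightarrow> x \<in> ops Q m e \<Longrightarrow> n = m \<and> d = e"
    and f_zero: "\<zero>\<^bsub>cpt Q n d\<^esub> = f \<zero>\<^bsub>cpt P n d\<^esub>"
    and f_add: "a \<in> ops P n d \<Longrightarrow> b \<in> ops P n d \<Longrightarrow> f a \<oplus>\<^bsub>cpt Q n d\<^esub> f b = f (a \<oplus>\<^bsub>cpt P n d\<^esub> b)"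
    and f_smult: "a \<in> ops P n d \<Longrightarrow> c \<odot>\<^bsub>cpt Q n d\<^esub> f a = f (c \<odot>\<^bsub>cpt P n d\<^esub> a)"
    and f_unit: "ounit Q = f (ounit P)"
    and f_comp: "a \<in> ops P m p \<Longrightarrow> b \<in> ops P n q \<Longrightarrow> i \<in> {1..m} \<Longrightarrow> pcomp Q (f a) i (f b) = f (pcomp P a i b)"
    and f_act: "a \<in> ops P n d \<Longrightarrow> \<sigma> permutes {1..n} \<Longrightarrow> act Q (f a) \<sigma> = f (act P a \<sigma>)"
begin

text \<open>Every axiom for \<open>Q\<close> is the image of the one for \<open>P\<close>, since
  each operation of \<open>Q\<close> has a preimage and \<open>f\<close> is compatible with all
  structure. Injectivity does not enter, which is what makes this applicable to quotients.\<close>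

lemma module_image: "module base_field (cpt Q n d)"
proof (rule moduleI)
  show "cring (base_field :: 'k ring)" by (rule cring_from_type_algebra)
  show "abelian_group (cpt Q n d)"
  proof (rule abelian_groupI)
    show "\<exists>y\<in>ops Q n d. y \<oplus>\<^bsub>cpt Q n d\<^esub> x = \<zero>\<^bsub>cpt Q n d\<^esub>" if "x \<in> ops Q n d" for x
    proof -
      obtain a where a: "a \<in> ops P n d" "x = f a" using \<open>x \<in> _\<close> by (auto simp: f_onto)
      then show ?thesis
        by (intro bexI[of _ "f (\<ominus>\<^bsub>cpt P n d\<^esub> a)"]) (auto simp: f_onto f_zero f_add md.l_neg)
    qed
  qed (auto simp: f_onto f_zero f_add md.a_assoc md.a_comm md.a_lcomm)
qed (auto simp: f_onto f_add f_smult smult_simps md.smult_r_distr)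

lemma comp_closed': "a \<in> ops P m p \<Longrightarrow> b \<in> ops P n q \<Longrightarrow> 1 \<le> i \<Longrightarrow> i \<le> m \<Longrightarrow>
        pcomp P a i b \<in> ops P (m + n - 1) (p + q)"
  by (rule comp_closed) auto

lemma graded_operad_Q: "graded_operad Q"
proof (rule graded_operad.intro)
  show "module base_field (cpt Q n d)" for n d by (rule module_image)
  show "pcomp Q (pcomp Q a i b) (k + m - 1) h
        = koszul_sign q r \<odot>\<^bsub>cpt Q (l + m + n - 2) (p + q + r)\<^esub> pcomp Q (pcomp Q a k h) i b"
    if H: "a \<in> ops Q l p" "b \<in> ops Q m q" "h \<in> ops Q n r" "i \<in> {1..l}" "k \<in> {1..l}" "i < k"
    for a l p b m q h n r i k
  proof -
    obtain s t u where st: "a = f s" "s \<in> ops P l p" "b = f t" "t \<in> ops P m q" "h = f u" "u \<in> ops P n r"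
      using H by (auto simp: f_onto)
    have 1: "pcomp P s i t \<in> ops P (l + m - 1) (p + q)" "pcomp P s k u \<in> ops P (l + n - 1) (p + r)"
      using H st by (auto intro!: comp_closed'[simplified])
    have 2: "k + m - 1 \<in> {1..l + m - 1}" "i \<in> {1..l + n - 1}" using H by auto
    have "pcomp P (pcomp P s k u) i t \<in> ops P (l + n - 1 + m - 1) (p + r + q)"
      by (rule comp_closed[OF 1(2) st(4) 2(2)])
    moreover have "l + n - 1 + m - 1 = l + m + n - 2" "p + r + q = p + q + r" using H by auto
    ultimately show ?thesis
      using H st comp_parallel[OF st(2,4,6) H(4-6)]
      by (simp add: f_comp f_comp[OF 1(1) st(6) 2(1)] f_comp[OF 1(2) st(4) 2(2)] f_smult del: One_nat_def)
  qed
  show "pcomp Q (pcomp Q a i b) (i + j - 1) h = pcomp Q a i (pcomp Q b j h)"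
    if H: "a \<in> ops Q l p" "b \<in> ops Q m q" "h \<in> ops Q n r" "i \<in> {1..l}" "j \<in> {1..m}"
    for a l p b m q h n r i j
  proof -
    obtain s t u where st: "a = f s" "s \<in> ops P l p" "b = f t" "t \<in> ops P m q" "h = f u" "u \<in> ops P n r"
      using H by (auto simp: f_onto)
    have 1: "pcomp P s i t \<in> ops P (l + m - 1) (p + q)" "pcomp P t j u \<in> ops P (m + n - 1) (q + r)"
      using H st by (auto intro!: comp_closed'[simplified])
    have 2: "i + j - 1 \<in> {1..l + m - 1}" using H by auto
    show ?thesis
      using H st comp_sequential[OF st(2,4,6) H(4,5)]
      by (simp add: f_comp f_comp[OF 1(1) st(6) 2] f_comp[OF st(2) 1(2) H(4)] del: One_nat_def)
  qed
  show "pcomp Q (act Q a \<sigma>) i b = act Q (pcomp Q a (\<sigma> i) b) (outer_perm m n i \<sigma>)"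
    if H: "a \<in> ops Q m p" "b \<in> ops Q n q" "i \<in> {1..m}" "\<sigma> permutes {1..m}" for a m p b n q i \<sigma>
  proof -
    obtain s t where st: "a = f s" "s \<in> ops P m p" "b = f t" "t \<in> ops P n q"
      using H by (auto simp: f_onto)
    have i: "\<sigma> i \<in> {1..m}" using H permutes_in_image by metis
    show ?thesis
      using H st f_comp[OF act_closed[OF st(2) H(4)] st(4) H(3)] f_comp[OF st(2,4) i]
        f_act[OF comp_closed[OF st(2,4) i] outer_perm_permutes[OF H(4,3)]] comp_act_left[OF st(2,4) H(3,4)]
      by (simp add: f_act)
  qed
  show "pcomp Q a i (act Q b \<tau>) = act Q (pcomp Q a i b) (inner_perm n i \<tau>)"
    if H: "a \<in> ops Q m p" "b \<in> ops Q n q" "i \<in> {1..m}" "\<tau> permutes {1..n}" for a m p b n q i \<tau>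
  proof -
    obtain s t where st: "a = f s" "s \<in> ops P m p" "b = f t" "t \<in> ops P n q"
      using H by (auto simp: f_onto)
    show ?thesis
      using H st f_comp[OF st(2) act_closed[OF st(4) H(4)] H(3)] f_comp[OF st(2,4) H(3)]
        f_act[OF comp_closed[OF st(2,4) H(3)] inner_perm_permutes[OF H(4,3)]] comp_act_right[OF st(2,4) H(3,4)]
      by (simp add: f_act)
  qed
  show "act Q (act Q a \<sigma>) \<tau> = act Q a (\<sigma> \<circ> \<tau>)"
    if H: "a \<in> ops Q n d" "\<sigma> permutes {1..n}" "\<tau> permutes {1..n}" for a n d \<sigma> \<tau>
  proof -
    obtain s where st: "a = f s" "s \<in> ops P n d"
      using H by (auto simp: f_onto)
    show ?thesis
      using H st f_act[OF act_closed[OF st(2) H(2)] H(3)] act_act[OF st(2) H(2,3)]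
      by (simp add: f_act permutes_compose)
  qed
  show "n = m \<and> d = e" if "a \<in> ops Q n d" "a \<in> ops Q m e" for a n m d e
    using f_disjoint that .
  show "pcomp Q (ounit Q) 1 a = a" if "a \<in> ops Q n d" for a n d
    using that unit_closed unit_left by (auto simp: f_onto f_unit f_comp[where m = 1])
  show "pcomp Q a i (ounit Q) = a" if "a \<in> ops Q n d" "i \<in> {1..n}" for a n d i
    using that unit_closed unit_right by (auto simp: f_onto f_unit f_comp)
  show "act Q a id = a" if "a \<in> ops Q n d" for a n d
    using that act_id by (auto simp: f_onto f_act permutes_id)
  show "ounit Q \<in> ops Q 1 0" using unit_closed by (auto simp: f_onto f_unit)
  show "pcomp Q a i b \<in> ops Q (m + n - 1) (p + q)"
    if "a \<in> ops Q m p" "b \<in> ops Q n q" "i \<in> {1..m}" for a m p b n q i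
    using that comp_closed by (auto simp: f_onto f_comp)
  show "act Q a \<sigma> \<in> ops Q n d" if "a \<in> ops Q n d" "\<sigma> permutes {1..n}" for a n d \<sigma>
    using that act_closed by (auto simp: f_onto f_act)
  show "pcomp Q (a \<oplus>\<^bsub>cpt Q m p\<^esub> a') i b = pcomp Q a i b \<oplus>\<^bsub>cpt Q (m + n - 1) (p + q)\<^esub> pcomp Q a' i b"
    if "a \<in> ops Q m p" "a' \<in> ops Q m p" "b \<in> ops Q n q" "i \<in> {1..m}" for a a' b m n p q i
  proof -
    obtain s s' t where "a = f s" "s \<in> ops P m p" "a' = f s'" "s' \<in> ops P m p" "b = f t" "t \<in> ops P n q"
      using \<open>a \<in> _\<close> \<open>a' \<in> _\<close> \<open>b \<in> _\<close> by (auto simp: f_onto)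
    then show ?thesis using \<open>i \<in> _\<close>
      by (simp add: f_comp[where i = i and m = m and p = p and n = n and q = q] f_add comp_closed[simplified]
          comp_add_left[simplified])
  qed
  show "pcomp Q b i (a \<oplus>\<^bsub>cpt Q m p\<^esub> a') = pcomp Q b i a \<oplus>\<^bsub>cpt Q (n + m - 1) (q + p)\<^esub> pcomp Q b i a'"
    if "b \<in> ops Q n q" "a \<in> ops Q m p" "a' \<in> ops Q m p" "i \<in> {1..n}" for a a' b m n p q i
  proof -
    obtain s s' t where "a = f s" "s \<in> ops P m p" "a' = f s'" "s' \<in> ops P m p" "b = f t" "t \<in> ops P n q"
      using \<open>a \<in> _\<close> \<open>a' \<in> _\<close> \<open>b \<in> _\<close> by (auto simp: f_onto)
    then show ?thesis using \<open>i \<in> _\<close>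
      by (simp add: f_comp[where i = i and m = n and p = q and n = m and q = p] f_add comp_closed[simplified]
          comp_add_right[simplified])
  qed
  show "pcomp Q (c \<odot>\<^bsub>cpt Q m p\<^esub> a) i b = c \<odot>\<^bsub>cpt Q (m + n - 1) (p + q)\<^esub> pcomp Q a i b"
    if "a \<in> ops Q m p" "b \<in> ops Q n q" "i \<in> {1..m}" for a b m n p q i c
  proof -
    obtain s t where "a = f s" "s \<in> ops P m p" "b = f t" "t \<in> ops P n q"
      using \<open>a \<in> _\<close> \<open>b \<in> _\<close> by (auto simp: f_onto)
    then show ?thesis using \<open>i \<in> _\<close>
      by (simp add: f_comp[where i = i and m = m and p = p and n = n and q = q] f_smult comp_closed[simplified]
          comp_smult_left[simplified] smult_simps(1))
  qed
  show "pcomp Q a i (c \<odot>\<^bsub>cpt Q n q\<^esub> b) = c \<odot>\<^bsub>cpt Q (m + n - 1) (p + q)\<^esub> pcomp Q a i b"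
    if "a \<in> ops Q m p" "b \<in> ops Q n q" "i \<in> {1..m}" for a b m n p q i c
  proof -
    obtain s t where "a = f s" "s \<in> ops P m p" "b = f t" "t \<in> ops P n q"
      using \<open>a \<in> _\<close> \<open>b \<in> _\<close> by (auto simp: f_onto)
    then show ?thesis using \<open>i \<in> _\<close>
      by (simp add: f_comp[where i = i and m = m and p = p and n = n and q = q] f_smult comp_closed[simplified]
          comp_smult_right[simplified] smult_simps(1))
  qed
  show "act Q (a \<oplus>\<^bsub>cpt Q n d\<^esub> b) \<sigma> = act Q a \<sigma> \<oplus>\<^bsub>cpt Q n d\<^esub> act Q b \<sigma>"
    if "a \<in> ops Q n d" "b \<in> ops Q n d" "\<sigma> permutes {1..n}" for a b n d \<sigma>
  proof -
    obtain s t where "a = f s" "s \<in> ops P n d" "b = f t" "t \<in> ops P n d"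
      using \<open>a \<in> _\<close> \<open>b \<in> _\<close> by (auto simp: f_onto)
    then show ?thesis using \<open>\<sigma> permutes _\<close>
      by (simp add: f_act[where n = n and d = d] f_add act_closed act_add)
  qed
  show "act Q (c \<odot>\<^bsub>cpt Q n d\<^esub> a) \<sigma> = c \<odot>\<^bsub>cpt Q n d\<^esub> act Q a \<sigma>"
    if "a \<in> ops Q n d" "\<sigma> permutes {1..n}" for a n d \<sigma> c
  proof -
    obtain s where "a = f s" "s \<in> ops P n d"
      using \<open>a \<in> _\<close> by (auto simp: f_onto)
    then show ?thesis using \<open>\<sigma> permutes _\<close>
      by (simp add: f_act[where n = n and d = d] f_smult act_closed act_smult smult_simps(1))
  qed
qed

end

section \<open>Quotients by operadic ideals and generated ideals\<close>

locale operad_with_ideal = graded_operad P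
  for P :: "('k::field, 'a, 'm) operad_scheme" +
  fixes I :: "nat \<Rightarrow> int \<Rightarrow> 'a set"
  assumes ideal: "operadic_ideal P I"
begin

abbreviation "Q \<equiv> quotient_operad P I"
abbreviation "coset \<equiv> op_coset P I"

lemma ideal_submodule: "submodule (I n d) base_field (cpt P n d)"
  and ideal_act: "a \<in> I n d \<Longrightarrow> \<sigma> permutes {1..n} \<Longrightarrow> act P a \<sigma> \<in> I n d"
  and ideal_comp_left: "a \<in> I m p \<Longrightarrow> b \<in> ops P n q \<Longrightarrow> i \<in> {1..m} \<Longrightarrow> pcomp P a i b \<in> I (m + n - 1) (p + q)"
  and ideal_comp_right: "a \<in> ops P m p \<Longrightarrow> b \<in> I n q \<Longrightarrow> i \<in> {1..m} \<Longrightarrow> pcomp P a i b \<in> I (m + n - 1) (p + q)"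
  using ideal unfolding operadic_ideal_def by blast+

lemma ideal_subset: "a \<in> I n d \<Longrightarrow> a \<in> ops P n d"
  using md.submoduleE(1)[OF ideal_submodule] by blast

lemma ideal_add: "a \<in> I n d \<Longrightarrow> b \<in> I n d \<Longrightarrow> a \<oplus>\<^bsub>cpt P n d\<^esub> b \<in> I n d"
  and ideal_uminus: "a \<in> I n d \<Longrightarrow> \<ominus>\<^bsub>cpt P n d\<^esub> a \<in> I n d"
  and ideal_smult: "a \<in> I n d \<Longrightarrow> c \<odot>\<^bsub>cpt P n d\<^esub> a \<in> I n d"
  using md.submoduleE(3,4,5)[OF ideal_submodule] by simp_all

lemma ideal_subgroup: "subgroup (I n d) (add_monoid (cpt P n d))"
  using ideal_submodule by (rule submodule.axioms)

lemma ideal_zero: "\<zero>\<^bsub>cpt P n d\<^esub> \<in> I n d"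
  using subgroup.one_closed[OF ideal_subgroup] by simp

lemma cos_eq: "a \<in> ops P n d \<Longrightarrow> coset a = I n d +>\<^bsub>cpt P n d\<^esub> a"
  by (simp add: op_coset_def arity_degree)

lemma mem_cos: "a \<in> ops P n d \<Longrightarrow> x \<in> coset a \<longleftrightarrow> (\<exists>h\<in>I n d. x = h \<oplus>\<^bsub>cpt P n d\<^esub> a)"
  by (auto simp: cos_eq a_r_coset_def')

lemma cos_cong:
  assumes a: "a \<in> ops P n d" and h: "h \<in> I n d"
  shows "coset (h \<oplus>\<^bsub>cpt P n d\<^esub> a) = coset a"
proof -
  have ha: "h \<oplus>\<^bsub>cpt P n d\<^esub> a \<in> ops P n d" using a ideal_subset[OF h] by simp
  have "h \<oplus>\<^bsub>cpt P n d\<^esub> a \<in> I n d +>\<^bsub>cpt P n d\<^esub> a" using h by (auto simp: a_r_coset_def')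
  from md.a_repr_independence[OF this a ideal_subgroup] show ?thesis
    by (simp add: cos_eq[OF a] cos_eq[OF ha])
qed

lemma self_mem_cos: "a \<in> ops P n d \<Longrightarrow> a \<in> coset a"
  using ideal_zero by (force simp: mem_cos)

lemma cos_eq_iff:
  assumes "a \<in> ops P n d" "b \<in> ops P n d"
  shows "coset a = coset b \<longleftrightarrow> a \<ominus>\<^bsub>cpt P n d\<^esub> b \<in> I n d"
proof
  assume "coset a = coset b"
  then obtain h where "h \<in> I n d" "a = h \<oplus>\<^bsub>cpt P n d\<^esub> b"
    using self_mem_cos[OF assms(1)] mem_cos[OF assms(2)] by auto
  then show "a \<ominus>\<^bsub>cpt P n d\<^esub> b \<in> I n d"
    using assms ideal_subset by (simp add: md.a_assoc md.r_neg md.minus_eq)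
next
  assume "a \<ominus>\<^bsub>cpt P n d\<^esub> b \<in> I n d"
  moreover have "a = (a \<ominus>\<^bsub>cpt P n d\<^esub> b) \<oplus>\<^bsub>cpt P n d\<^esub> b"
    using assms by (simp add: md.a_assoc md.l_neg md.minus_eq)
  ultimately show "coset a = coset b" using cos_cong[OF assms(2)] by metis
qed

lemma cos_zero_iff: "a \<in> ops P n d \<Longrightarrow> coset a = \<zero>\<^bsub>cpt Q n d\<^esub> \<longleftrightarrow> a \<in> I n d"
proof -
  assume a: "a \<in> ops P n d"
  have "\<zero>\<^bsub>cpt Q n d\<^esub> = I n d" by (simp add: quotient_operad_def quotient_module_def)
  moreover have "a \<in> I n d \<Longrightarrow> coset a = I n d"
    using md.a_coset_join2[OF a ideal_subgroup] a by (simp add: cos_eq)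
  moreover have "coset a = I n d \<Longrightarrow> a \<in> I n d" using self_mem_cos[OF a] by simp
  ultimately show ?thesis by auto
qed

lemma UN_cos:
  assumes "a \<in> ops P n d" "\<And>h. h \<in> I n d \<Longrightarrow> F (h \<oplus>\<^bsub>cpt P n d\<^esub> a) = v"
  shows "(\<Union>x\<in>coset a. F x) = v"
proof -
  have "(\<Union>x\<in>coset a. F x) = (\<Union>x\<in>coset a. v)"
    by (rule SUP_cong[OF HOL.refl]) (use assms in \<open>auto simp: mem_cos\<close>)
  moreover have "coset a \<noteq> {}" using self_mem_cos[OF assms(1)] by blast
  ultimately show ?thesis by simp
qed

lemma quotient_image: "graded_operad_image P Q coset"
proof
  show ops_Q: "ops Q n d = coset ` ops P n d" for n d
    by (auto simp: quotient_operad_def quotient_module_def A_RCOSETS_def' cos_eq)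
  show "n = m \<and> d = e" if H: "x \<in> ops Q n d" "x \<in> ops Q m e" for x n m d e
  proof -
    obtain a b where "x = coset a" "a \<in> ops P n d" "x = coset b" "b \<in> ops P m e"
      using H unfolding ops_Q by blast
    then obtain h where "h \<in> I m e" "a = h \<oplus>\<^bsub>cpt P m e\<^esub> b"
      using self_mem_cos[of a n d] mem_cos[of b m e a] by auto
    then have "a \<in> ops P m e" using ideal_subset \<open>b \<in> _\<close> by simp
    then show ?thesis using disjoint_cpt \<open>a \<in> ops P n d\<close> by blast
  qed
  show "\<zero>\<^bsub>cpt Q n d\<^esub> = coset \<zero>\<^bsub>cpt P n d\<^esub>" for n d
    using cos_zero_iff[of "\<zero>\<^bsub>cpt P n d\<^esub>" n d] ideal_zero by simp
  show "coset a \<oplus>\<^bsub>cpt Q n d\<^esub> coset b = coset (a \<oplus>\<^bsub>cpt P n d\<^esub> b)" if "a \<in> ops P n d" "b \<in> ops P n d" for a b n d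
  proof -
    interpret abelian_subgroup "I n d" "cpt P n d"
      by (intro abelian_subgroupI3 additive_subgroupI ideal_subgroup md.abelian_group_axioms)
    show ?thesis using a_rcos_sum[OF that]
      by (simp add: quotient_operad_def quotient_module_def cos_eq[OF that(1)] cos_eq[OF that(2)]
          cos_eq[OF md.a_closed[OF that]])
  qed
  show "c \<odot>\<^bsub>cpt Q n d\<^esub> coset a = coset (c \<odot>\<^bsub>cpt P n d\<^esub> a)" if a: "a \<in> ops P n d" for a c n d
  proof -
    have "(\<Union>x\<in>coset a. I n d +>\<^bsub>cpt P n d\<^esub> (c \<odot>\<^bsub>cpt P n d\<^esub> x)) = coset (c \<odot>\<^bsub>cpt P n d\<^esub> a)"
    proof (rule UN_cos[OF a])
      fix h assume h: "h \<in> I n d"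
      have "I n d +>\<^bsub>cpt P n d\<^esub> (c \<odot>\<^bsub>cpt P n d\<^esub> (h \<oplus>\<^bsub>cpt P n d\<^esub> a)) = coset (c \<odot>\<^bsub>cpt P n d\<^esub> (h \<oplus>\<^bsub>cpt P n d\<^esub> a))"
        using a ideal_subset[OF h] by (intro cos_eq[symmetric] smult_simps) simp
      moreover have "c \<odot>\<^bsub>cpt P n d\<^esub> (h \<oplus>\<^bsub>cpt P n d\<^esub> a) = c \<odot>\<^bsub>cpt P n d\<^esub> h \<oplus>\<^bsub>cpt P n d\<^esub> c \<odot>\<^bsub>cpt P n d\<^esub> a"
        using a ideal_subset[OF h] md.smult_r_distr[where a = c and x = h and y = a and n = n and d = d] by simp
      moreover have "coset (c \<odot>\<^bsub>cpt P n d\<^esub> h \<oplus>\<^bsub>cpt P n d\<^esub> c \<odot>\<^bsub>cpt P n d\<^esub> a) = coset (c \<odot>\<^bsub>cpt P n d\<^esub> a)"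
        by (rule cos_cong[OF smult_simps(1)[OF a] ideal_smult[OF h]])
      ultimately show "I n d +>\<^bsub>cpt P n d\<^esub> (c \<odot>\<^bsub>cpt P n d\<^esub> (h \<oplus>\<^bsub>cpt P n d\<^esub> a)) = coset (c \<odot>\<^bsub>cpt P n d\<^esub> a)"
        by metis
    qed
    then show ?thesis by (simp add: quotient_operad_def quotient_module_def)
  qed
  show "ounit Q = coset (ounit P)" by (simp add: quotient_operad_def)
  show "pcomp Q (coset a) i (coset b) = coset (pcomp P a i b)"
    if a: "a \<in> ops P m p" and b: "b \<in> ops P n q" and i: "i \<in> {1..m}" for a b m p n q i
  proof -
    have "(\<Union>x\<in>coset a. \<Union>y\<in>coset b. coset (pcomp P x i y)) = coset (pcomp P a i b)"
    proof (intro UN_cos[OF a] UN_cos[OF b])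
      fix h k assume h: "h \<in> I m p" and k: "k \<in> I n q"
      let ?h = "h \<oplus>\<^bsub>cpt P m p\<^esub> a"
      have "?h \<in> ops P m p" using a ideal_subset[OF h] by simp
      \<comment> \<open>Representatives are changed one factor at a time: the error is a composite
        with \<open>k\<close> on the right plus a composite with \<open>h\<close> on the left, and
        both lie in the ideal.\<close>
      then have "pcomp P ?h i (k \<oplus>\<^bsub>cpt P n q\<^esub> b) =
          pcomp P ?h i k \<oplus>\<^bsub>cpt P (m + n - 1) (p + q)\<^esub> pcomp P ?h i b" "pcomp P ?h i k \<in> I (m + n - 1) (p + q)"
        "pcomp P ?h i b \<in> ops P (m + n - 1) (p + q)"
        using b i ideal_subset[OF k] k by (intro comp_add_right ideal_comp_right comp_closed; simp)+
      moreover have "pcomp P ?h i b = pcomp P h i b \<oplus>\<^bsub>cpt P (m + n - 1) (p + q)\<^esub> pcomp P a i b"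
        "pcomp P h i b \<in> I (m + n - 1) (p + q)" "pcomp P a i b \<in> ops P (m + n - 1) (p + q)"
        using a b i ideal_subset[OF h] h by (intro comp_add_left ideal_comp_left comp_closed; simp)+
      ultimately show "coset (pcomp P ?h i (k \<oplus>\<^bsub>cpt P n q\<^esub> b)) = coset (pcomp P a i b)"
        using cos_cong by metis
    qed
    then show ?thesis by (simp add: quotient_operad_def)
  qed
  show "act Q (coset a) \<sigma> = coset (act P a \<sigma>)" if a: "a \<in> ops P n d" and s: "\<sigma> permutes {1..n}" for a n d \<sigma>
  proof -
    have "(\<Union>x\<in>coset a. coset (act P x \<sigma>)) = coset (act P a \<sigma>)"
      using a s act_add ideal_subset ideal_act act_closed cos_cong by (intro UN_cos[OF a]) metis
    then show ?thesis by (simp add: quotient_operad_def)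
  qed
qed

sublocale qt: graded_operad_image P Q coset by (rule quotient_image)

lemma graded_operad_quotient: "graded_operad Q"
  by (rule qt.graded_operad_Q)

end

context graded_operad
begin

lemma comp_zero_left: "b \<in> ops P n q \<Longrightarrow> i \<in> {1..m} \<Longrightarrow> pcomp P \<zero>\<^bsub>cpt P m p\<^esub> i b = \<zero>\<^bsub>cpt P (m + n - 1) (p + q)\<^esub>"
  using comp_smult_left[of "\<zero>\<^bsub>cpt P m p\<^esub>" m p b n q i 0] comp_closed[of "\<zero>\<^bsub>cpt P m p\<^esub>" m p b n q i]
  by (simp add: smult_simps)

lemma comp_zero_right: "a \<in> ops P m p \<Longrightarrow> i \<in> {1..m} \<Longrightarrow> pcomp P a i \<zero>\<^bsub>cpt P n q\<^esub> = \<zero>\<^bsub>cpt P (m + n - 1) (p + q)\<^esub>"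
  using comp_smult_right[of a m p "\<zero>\<^bsub>cpt P n q\<^esub>" n q i 0] comp_closed[of a m p "\<zero>\<^bsub>cpt P n q\<^esub>" n q i]
  by (simp add: smult_simps)

lemma act_zero: "\<sigma> permutes {1..n} \<Longrightarrow> act P \<zero>\<^bsub>cpt P n d\<^esub> \<sigma> = \<zero>\<^bsub>cpt P n d\<^esub>"
  using act_smult[of "\<zero>\<^bsub>cpt P n d\<^esub>" n d \<sigma> 0] act_closed[of "\<zero>\<^bsub>cpt P n d\<^esub>" n d \<sigma>]
  by (simp add: smult_simps)

lemma full_ideal: "operadic_ideal P (\<lambda>n d. ops P n d)"
  by (auto simp: operadic_ideal_def md.carrier_is_submodule act_closed intro: comp_closed[simplified])

text \<open>The intersection is taken over a nonempty family, since all operations together form an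
  ideal containing \<open>R\<close>; each closure property is then inherited componentwise.\<close>

lemma ideal_generated_ideal:
  assumes R: "\<And>a. a \<in> R \<Longrightarrow> \<exists>n d. a \<in> ops P n d"
  shows "operadic_ideal P (ideal_generated P R)"
proof -
  define S where "S = {I. operadic_ideal P I \<and> (\<forall>m e. R \<inter> ops P m e \<subseteq> I m e)}"
  have S: "(\<lambda>n d. ops P n d) \<in> S" using full_ideal by (auto simp: S_def)
  have gen: "ideal_generated P R n d = (\<Inter>I\<in>S. I n d)" for n d
    by (auto simp: ideal_generated_def S_def)
  have loc: "operad_with_ideal P I" if "I \<in> S" for I
    using that graded_operad_axioms by (simp add: S_def operad_with_ideal_def operad_with_ideal_axioms_def)
  show ?thesis
    unfolding operadic_ideal_def
  proof (intro conjI allI ballI impI)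
    show "submodule (ideal_generated P R n d) base_field (cpt P n d)" for n d
    proof (rule md.submoduleI)
      show "ideal_generated P R n d \<subseteq> ops P n d" using S by (auto simp: gen)
      show "\<zero>\<^bsub>cpt P n d\<^esub> \<in> ideal_generated P R n d"
        using operad_with_ideal.ideal_zero[OF loc] by (auto simp: gen)
      show "\<ominus>\<^bsub>cpt P n d\<^esub> a \<in> ideal_generated P R n d" if "a \<in> ideal_generated P R n d" for a
        using that operad_with_ideal.ideal_uminus[OF loc] by (auto simp: gen)
      show "a \<oplus>\<^bsub>cpt P n d\<^esub> b \<in> ideal_generated P R n d"
        if "a \<in> ideal_generated P R n d" "b \<in> ideal_generated P R n d" for a b
        using that operad_with_ideal.ideal_add[OF loc] by (auto simp: gen)
      show "c \<odot>\<^bsub>cpt P n d\<^esub> a \<in> ideal_generated P R n d" if "a \<in> ideal_generated P R n d" for c a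
        using that operad_with_ideal.ideal_smult[OF loc] by (auto simp: gen)
    qed
    show "act P a \<sigma> \<in> ideal_generated P R n d"
      if "a \<in> ideal_generated P R n d" "\<sigma> permutes {1..n}" for a n d \<sigma>
      using that operad_with_ideal.ideal_act[OF loc] by (auto simp: gen)
    show "pcomp P a i b \<in> ideal_generated P R (m + n - 1) (p + q)"
      if "a \<in> ideal_generated P R m p" "b \<in> ops P n q" "i \<in> {1..m}" for a m p b n q i
      using that operad_with_ideal.ideal_comp_left[OF loc, OF _ _ that(2,3)] by (auto simp: gen)
    show "pcomp P a i b \<in> ideal_generated P R (m + n - 1) (p + q)"
      if "a \<in> ops P m p" "b \<in> ideal_generated P R n q" "i \<in> {1..m}" for a m p b n q i
      using that operad_with_ideal.ideal_comp_right[OF loc, OF _ that(1) _ that(3)] by (auto simp: gen)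
  qed
qed

lemma ideal_generated_least:
  assumes "operadic_ideal P I" "\<And>m e. R \<inter> ops P m e \<subseteq> I m e"
  shows "ideal_generated P R n d \<subseteq> I n d"
  unfolding ideal_generated_def by (rule Inter_lower) (use assms in blast)

lemma ideal_generated_mem: "a \<in> R \<Longrightarrow> a \<in> ops P n d \<Longrightarrow> a \<in> ideal_generated P R n d"
  by (auto simp: ideal_generated_def)

end

section \<open>Cohomology of differential graded operads\<close>

context operadic_derivation
begin

lemma der_zero: "D \<zero>\<^bsub>cpt P n d\<^esub> = \<zero>\<^bsub>cpt P n (d + 1)\<^esub>"
proof -
  have "D (0 \<odot>\<^bsub>cpt P n d\<^esub> \<zero>\<^bsub>cpt P n d\<^esub>) = 0 \<odot>\<^bsub>cpt P n (d + 1)\<^esub> D \<zero>\<^bsub>cpt P n d\<^esub>"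
    by (rule der_smult) simp
  then show ?thesis using der_closed[of "\<zero>\<^bsub>cpt P n d\<^esub>" n d] by (simp add: smult_simps)
qed

text \<open>Leibniz applied to 1 = 1 o 1 gives D(1) = D(1) + D(1), and one copy cancels.\<close>

lemma der_unit: "D (ounit P) = \<zero>\<^bsub>cpt P 1 1\<^esub>"
proof -
  have u: "ounit P \<in> ops P 1 0" "D (ounit P) \<in> ops P 1 1"
    using unit_closed der_closed[OF unit_closed] by auto
  have "D (pcomp P (ounit P) 1 (ounit P)) = pcomp P (D (ounit P)) 1 (ounit P) \<oplus>\<^bsub>cpt P 1 1\<^esub>
      koszul_sign 1 0 \<odot>\<^bsub>cpt P 1 1\<^esub> pcomp P (ounit P) 1 (D (ounit P))"
    using der_comp[OF u(1,1), of 1] by simp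
  then have "D (ounit P) = D (ounit P) \<oplus>\<^bsub>cpt P 1 1\<^esub> D (ounit P)"
    using u unit_left[OF u(1)] unit_left[OF u(2)] unit_right[OF u(2), of 1]
    by (simp add: smult_simps koszul_sign_def)
  then show ?thesis using u(2) md.add.l_cancel_one' by metis
qed

end

context differential_graded_operad
begin

abbreviation "Z \<equiv> cocycle_operad P"

lemma Z_simps [simp]:
  "ops Z n d = cocycles P n d" "add (cpt Z n d) = add (cpt P n d)" "\<zero>\<^bsub>cpt Z n d\<^esub> = \<zero>\<^bsub>cpt P n d\<^esub>"
  "module.smult (cpt Z n d) = module.smult (cpt P n d)" "ounit Z = ounit P" "pcomp Z = pcomp P" "act Z = act P"
  by (simp_all add: cocycle_operad_def)

lemma cocycles_submodule: "submodule (cocycles P n d) base_field (cpt P n d)"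
proof (rule md.submoduleI)
  show "\<ominus>\<^bsub>cpt P n d\<^esub> a \<in> cocycles P n d" if "a \<in> cocycles P n d" for a
    using that der_smult[of a n d "- 1"] smult_simps(6)[of a n d 1] by (simp add: cocycles_def smult_simps)
qed (auto simp: cocycles_def der_zero der_add der_smult)

lemma cocycles_comp:
  assumes "a \<in> cocycles P m p" "b \<in> cocycles P n q" "i \<in> {1..m}"
  shows "pcomp P a i b \<in> cocycles P (m + n - 1) (p + q)"
proof -
  have "a \<in> ops P m p" "b \<in> ops P n q" using assms by (auto simp: cocycles_def)
  then show ?thesis
    using assms der_comp[of a m p b n q i] comp_closed[of a m p b n q i]
      comp_zero_left[of b n q i m "p + 1"] comp_zero_right[of a m p i n "q + 1"]
    by (simp add: cocycles_def add.assoc add.commute[of 1])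
qed

lemma graded_operad_Z: "graded_operad Z"
proof (rule graded_operad.intro)
  show "module base_field (cpt Z n d)" for n d
    using submodule.submodule_is_module[OF cocycles_submodule md.module_axioms]
    by (simp add: cocycle_operad_def)
  show "pcomp Z (pcomp Z a i b) (k + m - 1) h
        = koszul_sign q r \<odot>\<^bsub>cpt Z (l + m + n - 2) (p + q + r)\<^esub> pcomp Z (pcomp Z a k h) i b"
    if "a \<in> ops Z l p" "b \<in> ops Z m q" "h \<in> ops Z n r" "i \<in> {1..l}" "k \<in> {1..l}" "i < k"
    for a l p b m q h n r i k
    using that comp_parallel[of a l p b m q h n r i k] by (simp add: cocycles_def)
  show "pcomp Z (pcomp Z a i b) (i + j - 1) h = pcomp Z a i (pcomp Z b j h)"
    if "a \<in> ops Z l p" "b \<in> ops Z m q" "h \<in> ops Z n r" "i \<in> {1..l}" "j \<in> {1..m}"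
    for a l p b m q h n r i j
    using that comp_sequential[of a l p b m q h n r i j] by (simp add: cocycles_def)
  show "act Z a \<sigma> \<in> ops Z n d" if "a \<in> ops Z n d" "\<sigma> permutes {1..n}" for a n d \<sigma>
    using that der_act[of a n d \<sigma>] act_closed[of a n d \<sigma>] act_zero[of \<sigma> n "d + 1"]
    by (simp add: cocycles_def)
  show "pcomp Z a i b \<in> ops Z (m + n - 1) (p + q)"
    if "a \<in> ops Z m p" "b \<in> ops Z n q" "i \<in> {1..m}" for a m p b n q i
    using that cocycles_comp by simp
  show "ounit Z \<in> ops Z 1 0" using unit_closed der_unit by (simp add: cocycles_def)
  show "n = m \<and> d = e" if "a \<in> ops Z n d" "a \<in> ops Z m e" for a n m d e
    using that disjoint_cpt by (auto simp: cocycles_def)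
  show "pcomp Z (act Z a \<sigma>) i b = act Z (pcomp Z a (\<sigma> i) b) (outer_perm m n i \<sigma>)"
    if "a \<in> ops Z m p" "b \<in> ops Z n q" "i \<in> {1..m}" "\<sigma> permutes {1..m}" for a m p b n q i \<sigma>
    using that comp_act_left by (auto simp: cocycles_def)
  show "pcomp Z a i (act Z b \<tau>) = act Z (pcomp Z a i b) (inner_perm n i \<tau>)"
    if "a \<in> ops Z m p" "b \<in> ops Z n q" "i \<in> {1..m}" "\<tau> permutes {1..n}" for a m p b n q i \<tau>
    using that comp_act_right by (auto simp: cocycles_def)
  show "pcomp Z (ounit Z) 1 a = a" if "a \<in> ops Z n d" for a n d
    using that unit_left by (auto simp: cocycles_def)
  show "pcomp Z a i (ounit Z) = a" if "a \<in> ops Z n d" "i \<in> {1..n}" for a n d i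
    using that unit_right by (auto simp: cocycles_def)
  show "act Z a id = a" if "a \<in> ops Z n d" for a n d
    using that act_id by (auto simp: cocycles_def)
  show "act Z (act Z a \<sigma>) \<tau> = act Z a (\<sigma> \<circ> \<tau>)"
    if "a \<in> ops Z n d" "\<sigma> permutes {1..n}" "\<tau> permutes {1..n}" for a n d \<sigma> \<tau>
    using that act_act by (auto simp: cocycles_def)
qed (simp_all add: cocycles_def comp_add_left[simplified] comp_add_right[simplified] comp_smult_left[simplified]
    comp_smult_right[simplified] act_add act_smult)

lemma coboundaries_ideal: "operadic_ideal Z (coboundaries P)"
  unfolding operadic_ideal_def
proof (intro conjI allI ballI impI)
  interpret Z: graded_operad Z by (rule graded_operad_Z)
  have sub: "coboundaries P n d \<subseteq> cocycles P n d" for n d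
    using der_closed[of _ n "d - 1"] dif_dif[of _ n "d - 1"] by (auto simp: coboundaries_def cocycles_def add.commute)
  have B: "dif P y \<in> coboundaries P n d" if "y \<in> ops P n (d - 1)" for y n d
    using that by (auto simp: coboundaries_def)
  show "submodule (coboundaries P n d) base_field (cpt Z n d)" for n d
  proof (rule Z.md.submoduleI)
    show "coboundaries P n d \<subseteq> ops Z n d" using sub by simp
    show "\<zero>\<^bsub>cpt Z n d\<^esub> \<in> coboundaries P n d"
      using der_zero[of n "d - 1"] B[of "\<zero>\<^bsub>cpt P n (d - 1)\<^esub>" n d] by simp
    show add: "a \<oplus>\<^bsub>cpt Z n d\<^esub> b \<in> coboundaries P n d"
      if H: "a \<in> coboundaries P n d" "b \<in> coboundaries P n d" for a b
    proof -
      obtain x y where "a = dif P x" "x \<in> ops P n (d - 1)" "b = dif P y" "y \<in> ops P n (d - 1)"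
        using H by (auto simp: coboundaries_def)
      then show ?thesis using der_add[of x n "d - 1" y] B[of "x \<oplus>\<^bsub>cpt P n (d - 1)\<^esub> y" n d] by simp
    qed
    show smult: "c \<odot>\<^bsub>cpt Z n d\<^esub> a \<in> coboundaries P n d" if H: "a \<in> coboundaries P n d" for c a
    proof -
      obtain x where "a = dif P x" "x \<in> ops P n (d - 1)"
        using H by (auto simp: coboundaries_def)
      then show ?thesis using der_smult[of x n "d - 1" c] B[of "c \<odot>\<^bsub>cpt P n (d - 1)\<^esub> x" n d]
        by (simp add: smult_simps)
    qed
    show "\<ominus>\<^bsub>cpt Z n d\<^esub> a \<in> coboundaries P n d" if "a \<in> coboundaries P n d" for a
    proof -
      have "a \<in> ops Z n d" using sub that by auto
      then show ?thesis
        using smult[OF that, of "- 1"] Z.smult_simps(4)[of a n d] Z.smult_simps(6)[of a n d 1] by metis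
    qed
  qed
  show "act Z a \<sigma> \<in> coboundaries P n d" if H: "a \<in> coboundaries P n d" "\<sigma> permutes {1..n}" for a n d \<sigma>
  proof -
    obtain x where x: "a = dif P x" "x \<in> ops P n (d - 1)"
      using H by (auto simp: coboundaries_def)
    then show ?thesis
      using der_act[of x n "d - 1" \<sigma>] B[OF act_closed[OF x(2) H(2)]] H by simp
  qed
  show "pcomp Z a i b \<in> coboundaries P (m + n - 1) (p + q)"
    if H: "a \<in> coboundaries P m p" "b \<in> ops Z n q" "i \<in> {1..m}" for a m p b n q i
  proof -
    obtain x where x: "a = dif P x" "x \<in> ops P m (p - 1)"
      using H by (auto simp: coboundaries_def)
    have b: "b \<in> ops P n q" "dif P b = \<zero>\<^bsub>cpt P n (q + 1)\<^esub>" using H by (auto simp: cocycles_def)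
    have a: "a \<in> ops P m p" using der_closed[OF x(2)] x(1) by simp
    have "dif P (pcomp P x i b) = pcomp P a i b"
      using der_comp[OF x(2) b(1) H(3)] comp_zero_right[OF x(2) H(3), of n "q + 1"] comp_closed[OF a b(1) H(3)]
      by (simp add: x(1) b(2))
    moreover have "pcomp P x i b \<in> ops P (m + n - 1) (p + q - 1)"
      using comp_closed[OF x(2) b(1) H(3)] by (simp add: algebra_simps)
    ultimately show ?thesis using B[of "pcomp P x i b" "m + n - 1" "p + q"] by simp
  qed
  show "pcomp Z a i b \<in> coboundaries P (m + n - 1) (p + q)"
    if H: "a \<in> ops Z m p" "b \<in> coboundaries P n q" "i \<in> {1..m}" for a m p b n q i
  proof -
    obtain x where x: "b = dif P x" "x \<in> ops P n (q - 1)"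
      using H by (auto simp: coboundaries_def)
    have a: "a \<in> ops P m p" "dif P a = \<zero>\<^bsub>cpt P m (p + 1)\<^esub>" using H by (auto simp: cocycles_def)
    have b: "b \<in> ops P n q" using der_closed[OF x(2)] x(1) by simp
    have ab: "pcomp P a i b \<in> ops P (m + n - 1) (p + q)" by (rule comp_closed[OF a(1) b H(3)])
    have "dif P (pcomp P a i x) = koszul_sign 1 p \<odot>\<^bsub>cpt P (m + n - 1) (p + q)\<^esub> pcomp P a i b"
      using der_comp[OF a(1) x(2) H(3)] comp_zero_left[OF x(2) H(3), of "p + 1"] ab
      by (simp add: x(1) a(2) smult_simps)
    moreover have y: "pcomp P a i x \<in> ops P (m + n - 1) (p + q - 1)"
      using comp_closed[OF a(1) x(2) H(3)] by (simp add: algebra_simps)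
    \<comment> \<open>For a cocycle \<open>a\<close> of degree \<open>p\<close> the differential of
      a o x is a o dx up to the sign of \<open>p\<close>. The sign is moved into the primitive,
      where its square disappears.\<close>
    ultimately have "dif P (koszul_sign 1 p \<odot>\<^bsub>cpt P (m + n - 1) (p + q - 1)\<^esub> pcomp P a i x) =
        koszul_sign 1 p \<odot>\<^bsub>cpt P (m + n - 1) (p + q)\<^esub>
          (koszul_sign 1 p \<odot>\<^bsub>cpt P (m + n - 1) (p + q)\<^esub> pcomp P a i b)"
      using der_smult[OF y, of "koszul_sign 1 p"] by simp
    also have "\<dots> = (koszul_sign 1 p * koszul_sign 1 p) \<odot>\<^bsub>cpt P (m + n - 1) (p + q)\<^esub> pcomp P a i b"
      by (rule smult_simps(3)[OF ab, symmetric])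
    also have "\<dots> = pcomp P a i b"
      using smult_simps(4)[OF ab] by (simp add: koszul_sign_eq)
    finally have "dif P (koszul_sign 1 p \<odot>\<^bsub>cpt P (m + n - 1) (p + q - 1)\<^esub> pcomp P a i x) = pcomp P a i b" .
    then show ?thesis
      using B[OF smult_simps(1)[OF y, of "koszul_sign 1 p"]] by simp
  qed
qed

sublocale coh: operad_with_ideal Z "coboundaries P"
  by (intro operad_with_ideal.intro graded_operad_Z operad_with_ideal_axioms.intro coboundaries_ideal)

end

section \<open>Operad expressions as linear combinations of labelled trees\<close>

primrec graft :: "nat \<Rightarrow> 'g mon \<Rightarrow> (nat \<Rightarrow> nat) \<Rightarrow> 'g mon \<Rightarrow> 'g mon" where
  "graft i b f (Lf j) = (if j = i then b else Lf (f j))"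
| "graft i b f (Nd g a c) = Nd g (graft i b f a) (graft i b f c)"

lemma leaves_graft: "leaves (graft i b f m) = concat (map (\<lambda>j. if j = i then leaves b else [f j]) (leaves m))"
  by (induction m) auto

lemma graft_absent: "i \<notin> set (leaves m) \<Longrightarrow> graft i b f m = relabel f m"
  by (induction m) auto

lemma leaves_graft_split:
  assumes "leaves m = A @ i # B" "distinct (leaves m)"
  shows "leaves (graft i b f m) = map f A @ leaves b @ map f B"
proof -
  have "concat (map (\<lambda>j. if j = i then leaves b else [f j]) C) = map f C" if "i \<notin> set C" for C
    using that by (induction C) auto
  then show ?thesis using assms by (auto simp: leaves_graft)
qed

text \<open>Inputs after position \<open>i\<close> move up to make room for \<open>n\<close> inputs.
  The value at \<open>i\<close> is a placeholder: 0 is not the number of an input, so no later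
  insertion takes place at it.\<close>

definition shift :: "nat \<Rightarrow> nat \<Rightarrow> nat \<Rightarrow> nat"
  where "shift n i j = (if j < i then j else if j = i then 0 else j + n - 1)"

definition insertion :: "nat \<Rightarrow> ('k::field, 'g) lin \<Rightarrow> nat \<Rightarrow> ('k, 'g) lin"
  where "insertion i v j = (if j = i then ren (\<lambda>q. q + i - 1) v else 0)"

abbreviation pinv :: "(nat \<Rightarrow> nat) \<Rightarrow> nat \<Rightarrow> nat" where "pinv \<equiv> inv_into UNIV"

lemma leaves_insertion:
  assumes "m \<in> keys (insertion i v j)" "x \<in> set (leaves m)"
  obtains y q where "y \<in> keys v" "q \<in> set (leaves y)" "x = q + i - 1"
proof -
  have "m \<in> relabel (\<lambda>q. q + i - 1) ` keys v"
    using assms(1) keys_ren[of "\<lambda>q. q + i - 1" v] by (auto simp: insertion_def split: if_splits)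
  then show ?thesis using assms(2) that by auto
qed

lemma keys_scl_add: "keys v \<subseteq> A \<Longrightarrow> keys w \<subseteq> A \<Longrightarrow> keys (c \<star> v + w) \<subseteq> A"
  using keys_add[of "c \<star> v" w] keys_scl_subset[of c v] by blast

lemma insertion_linear:
  "insertion i (u + v) = (\<lambda>j. insertion i u j + insertion i v j)"
  "insertion i (c \<star> u) = (\<lambda>j. c \<star> insertion i u j)"
  "insertion i (u - v) = (\<lambda>j. insertion i u j - insertion i v j)" "insertion i 0 = (\<lambda>j. 0)"
  by (auto simp: insertion_def fun_eq_iff)

context graded_generators
begin

text \<open>The exponent collected when a tree of degree \<open>q\<close> enters from the right: it
  passes every right sibling along the path to the leaf \<open>i\<close>.\<close>

primrec graft_exponent :: "int \<Rightarrow> nat \<Rightarrow> 'g mon \<Rightarrow> int" where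
  "graft_exponent q i (Lf j) = 0"
| "graft_exponent q i (Nd g a c) =
    (if i \<in> set (leaves a) then graft_exponent q i a + q * mdeg c else graft_exponent q i c)"

lemma mdeg_graft: "distinct (leaves m) \<Longrightarrow> i \<in> set (leaves m) \<Longrightarrow> mdeg (graft i b f m) = mdeg m + mdeg b"
proof (induction m)
  case (Nd g a c)
  then show ?case by (cases "i \<in> set (leaves a)"; cases "i \<in> set (leaves c)") (auto simp: graft_absent)
qed simp

lemma subst_zero: "(\<And>m j. m \<in> keys u \<Longrightarrow> j \<in> set (leaves m) \<Longrightarrow> e j = 0) \<Longrightarrow> subst q f e u = 0"
proof -
  assume z: "\<And>m j. m \<in> keys u \<Longrightarrow> j \<in> set (leaves m) \<Longrightarrow> e j = 0"
  have "der_mon q f e (\<lambda>g u w. 0) m = 0" if "\<And>j. j \<in> set (leaves m) \<Longrightarrow> e j = 0" for m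
    using that by (induction m) auto
  then have "subst q f e u = lext (\<lambda>m. 0) u"
    unfolding der_def using z by (intro lext_cong) blast
  then show ?thesis by (simp add: lext_def)
qed

lemma subst_bas_absent: "i \<notin> set (leaves m) \<Longrightarrow> (\<And>j. j \<noteq> i \<Longrightarrow> e j = 0) \<Longrightarrow> subst q f e (bas m) = 0"
  by (rule subst_zero) (simp, metis)

text \<open>As \<open>i\<close> occurs exactly once, the sum hidden in \<open>subst\<close> has a
  single nonzero term, a graft with its Koszul sign.\<close>

lemma subst_bas:
  assumes "e i = bas b" "\<And>j. j \<noteq> i \<Longrightarrow> e j = 0"
  shows "distinct (leaves m) \<Longrightarrow> i \<in> set (leaves m) \<Longrightarrow>
    subst q f e (bas m) = sg (graft_exponent q i m) \<star> bas (graft i b f m)"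
proof (induction m)
  case (Nd g a c)
  show ?case
  proof (cases "i \<in> set (leaves a)")
    case True
    then have c: "i \<notin> set (leaves c)" using Nd by auto
    then have "subst q f e (bas c) = 0" by (intro subst_bas_absent[of i] assms)
    then show ?thesis using Nd True c
      by (simp add: der_Nd eps_bas sg_add graft_absent mult.commute)
  next
    case False
    then have "subst q f e (bas a) = 0" by (intro subst_bas_absent[of i] assms)
    then show ?thesis using Nd False by (simp add: der_Nd graft_absent)
  qed
qed (simp add: assms)

text \<open>The relabelling is applied to the subtrees beside the path to the replaced leaf. By
  distinctness \<open>i\<close> does not occur there, so the two relabellings may differ at
  \<open>i\<close>.\<close>

lemma subst_cong:
  assumes "\<And>m. m \<in> keys u \<Longrightarrow> distinct (leaves m)"
    and "\<And>m j. m \<in> keys u \<Longrightarrow> j \<in> set (leaves m) \<Longrightarrow> j \<noteq> i \<Longrightarrow> f j = f' j"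
    and e: "e i = e' i" "\<And>j. j \<noteq> i \<Longrightarrow> e j = 0" "\<And>j. j \<noteq> i \<Longrightarrow> e' j = 0"
  shows "subst q f e u = subst q f' e' u"
proof -
  have "subst q f e (bas m) = subst q f' e' (bas m)"
    if "distinct (leaves m)" "\<And>j. j \<in> set (leaves m) \<Longrightarrow> j \<noteq> i \<Longrightarrow> f j = f' j" for m
    using that
  proof (induction m)
    case (Lf j)
    then show ?case using e by (cases "j = i") auto
  next
    case (Nd g a c)
    have abs: "subst q f e (bas m) = 0 \<and> subst q f' e' (bas m) = 0" if "i \<notin> set (leaves m)" for m
      using subst_bas_absent[OF that] e by blast
    show ?case
    proof (cases "i \<in> set (leaves a)")
      case True
      then have c: "i \<notin> set (leaves c)" using Nd by auto
      then have "relabel f c = relabel f' c" using Nd.prems by (intro relabel_cong) auto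
      then show ?thesis using Nd abs[OF c] by (simp add: der_Nd)
    next
      case False
      then have "relabel f a = relabel f' a" using Nd.prems by (intro relabel_cong) auto
      then show ?thesis using Nd abs[OF False] by (simp add: der_Nd)
    qed
  qed
  then have "der_mon q f e (\<lambda>g u w. 0) m = der_mon q f' e' (\<lambda>g u w. 0) m" if "m \<in> keys u" for m
    using assms that by (simp add: der_def)
  then show ?thesis unfolding der_def by (rule lext_cong)
qed

lemma subst_add_arg: "subst q f (\<lambda>j. e j + e' j) u = subst q f e u + subst q f e' u"
  and subst_scl_arg: "subst q f (\<lambda>j. c \<star> e j) u = c \<star> subst q f e u"
proof -
  have "subst q f (\<lambda>j. e j + e' j) (bas m) = subst q f e (bas m) + subst q f e' (bas m)" for m
    by (induction m) (simp_all add: der_Nd)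
  then show "subst q f (\<lambda>j. e j + e' j) u = subst q f e u + subst q f e' u"
    by (induction u rule: lin_induct) (simp_all add: scl_distribs)
  have "subst q f (\<lambda>j. c \<star> e j) (bas m) = c \<star> subst q f e (bas m)" for m
    by (induction m) (simp_all add: der_Nd scl_distribs)
  then show "subst q f (\<lambda>j. c \<star> e j) u = c \<star> subst q f e u"
    by (induction u rule: lin_induct) (simp_all add: scl_distribs mult.commute)
qed

lemma subst_diff_arg: "subst q f (\<lambda>j. e j - e' j) u = subst q f e u - subst q f e' u"
  using subst_add_arg[of q f e "\<lambda>j. (- 1) \<star> e' j" u] subst_scl_arg[of q f "- 1" e' u] by simp

text \<open>The multilinear trees. Only these stand for operations of arity \<open>n\<close>,
  whereas relations and operators live on all trees.\<close>

definition Mon :: "nat \<Rightarrow> int \<Rightarrow> 'g mon set"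
  where "Mon n d = {m. distinct (leaves m) \<and> set (leaves m) = {1..n} \<and> mdeg m = d}"

lemma MonD:
  assumes "m \<in> Mon n d"
  shows "distinct (leaves m)" "set (leaves m) = {1..n}" "mdeg m = d" "length (leaves m) = n"
  using assms distinct_card[of "leaves m"] by (auto simp: Mon_def)

lemma Mon_empty: "Mon 0 d = {}"
proof -
  have "set (leaves m) \<noteq> {}" for m :: "'g mon" by simp
  then show ?thesis by (fastforce simp: Mon_def)
qed

lemma Mon_homog: "keys u \<subseteq> Mon n d \<Longrightarrow> homog d u"
  by (auto simp: homog_def Mon_def)

lemma Mon_relabel:
  assumes "\<sigma> permutes {1..n}"
  shows "relabel \<sigma> m \<in> Mon n d \<longleftrightarrow> m \<in> Mon n d"
proof -
  have "inj \<sigma>" using assms by (rule permutes_inj)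
  moreover have "\<sigma> ` set (leaves m) = {1..n} \<longleftrightarrow> set (leaves m) = {1..n}"
    using permutes_image[OF assms] inj_image_eq_iff[OF \<open>inj \<sigma>\<close>] by metis
  ultimately show ?thesis by (auto simp: Mon_def distinct_map inj_on_def inj_def)
qed

text \<open>The labels of the grafted tree fill the block from \<open>i\<close> to
  \<open>i + n - 1\<close>, and \<open>shift n i\<close> enumerates the complement of this
  block.\<close>

lemma graft_Mon:
  assumes m: "m \<in> Mon k p" and b: "b \<in> Mon n q" and i: "i \<in> {1..k}"
  shows "graft i (relabel (\<lambda>x. x + i - 1) b) (shift n i) m \<in> Mon (k + n - 1) (p + q)"
proof -
  note M = MonD[OF m] MonD[OF b]
  obtain A B where AB: "leaves m = A @ i # B" using M(2) i split_list by metis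
  then have iAB: "i \<notin> set A" "i \<notin> set B" "set A \<inter> set B = {}" "distinct A" "distinct B"
    using M(1) by auto
  have setAB: "set A \<union> set B = {1..k} - {i}" using AB iAB M(2) by auto
  have L: "leaves (graft i (relabel (\<lambda>x. x + i - 1) b) (shift n i) m) =
      map (shift n i) A @ map (\<lambda>x. x + i - 1) (leaves b) @ map (shift n i) B" (is "?L = _")
    using leaves_graft_split[OF AB M(1)] by simp
  have n: "n > 0"
    using b Mon_empty by (cases n) auto
  have inj: "inj_on (shift n i) ({1..k} - {i})"
    using n by (auto simp: inj_on_def shift_def split: if_splits)
  have img: "shift n i ` ({1..k} - {i}) = {1..k + n - 1} - {i..<i + n}"
  proof (intro equalityI subsetI)
    fix x assume x: "x \<in> {1..k + n - 1} - {i..<i + n}"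
    show "x \<in> shift n i ` ({1..k} - {i})"
    proof (cases "x < i")
      case True
      with x i show ?thesis by (intro image_eqI[of _ _ x]) (auto simp: shift_def)
    next
      case False
      with x i n show ?thesis by (intro image_eqI[of _ _ "x + 1 - n"]) (auto simp: shift_def)
    qed
  qed (use n i in \<open>auto simp: shift_def split: if_splits\<close>)
  have img2: "(\<lambda>x. x + i - 1) ` {1..n} = {i..<i + n}"
  proof (intro equalityI subsetI)
    fix x assume x: "x \<in> {i..<i + n}"
    with i show "x \<in> (\<lambda>x. x + i - 1) ` {1..n}" by (intro image_eqI[of _ _ "x + 1 - i"]) auto
  qed (use i in auto)
  have inj2: "inj_on (\<lambda>x. x + i - 1) {1..n}" using i by (auto simp: inj_on_def)
  have "set ?L = shift n i ` ({1..k} - {i}) \<union> (\<lambda>x. x + i - 1) ` {1..n}"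
    unfolding L set_append set_map M(6) setAB[symmetric] image_Un by blast
  also have "\<dots> = {1..k + n - 1}" unfolding img img2 using i by auto
  finally have set: "set ?L = {1..k + n - 1}" .
  have "distinct ?L"
  proof -
    have sub: "set A \<subseteq> {1..k} - {i}" "set B \<subseteq> {1..k} - {i}" using setAB by auto
    have "inj_on (shift n i) (set A)" "inj_on (shift n i) (set B)"
      using inj_on_subset[OF inj sub(1)] inj_on_subset[OF inj sub(2)] .
    moreover have "shift n i ` set A \<inter> shift n i ` set B = {}"
      using inj_on_image_Int[OF inj sub] iAB(3) by simp
    moreover have "shift n i ` set A \<subseteq> {1..k + n - 1} - {i..<i + n}"
      "shift n i ` set B \<subseteq> {1..k + n - 1} - {i..<i + n}"
      unfolding img[symmetric] using sub by (intro image_mono; simp)+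
    moreover have "set (map (\<lambda>x. x + i - 1) (leaves b)) = {i..<i + n}"
      unfolding set_map M(6) img2 ..
    moreover have "distinct (map (\<lambda>x. x + i - 1) (leaves b))"
      using M(5) inj2 unfolding distinct_map M(6) by simp
    ultimately show ?thesis
      unfolding L distinct_append set_append set_map distinct_map using iAB(4,5) by blast
  qed
  with set show ?thesis
    using mdeg_graft[OF M(1), of i "relabel (\<lambda>x. x + i - 1) b" "shift n i"] M i by (auto simp: Mon_def)
qed

text \<open>The partial composite on the level of trees. Degree and arity of the inserted
  combination are arguments, because the zero combination does not determine them.\<close>

definition cmp :: "int \<Rightarrow> nat \<Rightarrow> nat \<Rightarrow> ('k::field, 'g) lin \<Rightarrow> ('k, 'g) lin \<Rightarrow> ('k, 'g) lin"
  where "cmp q n i u v = subst q (shift n i) (insertion i v) u"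

lemma cmp_linear [simp]:
  "cmp q n i (u + u') v = cmp q n i u v + cmp q n i u' v" "cmp q n i (c \<star> u) v = c \<star> cmp q n i u v"
  "cmp q n i 0 v = 0" "cmp q n i (u - u') v = cmp q n i u v - cmp q n i u' v"
  "cmp q n i u (v + v') = cmp q n i u v + cmp q n i u v'" "cmp q n i u (c \<star> v) = c \<star> cmp q n i u v"
  "cmp q n i u 0 = 0" "cmp q n i u (v - v') = cmp q n i u v - cmp q n i u v'"
  by (simp_all add: cmp_def insertion_linear subst_add_arg subst_scl_arg subst_diff_arg subst_zero)

lemma cmp_bas:
  assumes "a \<in> Mon m p" "i \<in> {1..m}"
  shows "cmp q n i (bas a) (bas b) =
    sg (graft_exponent q i a) \<star> bas (graft i (relabel (\<lambda>x. x + i - 1) b) (shift n i) a)"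
  unfolding cmp_def using MonD[OF assms(1)] assms(2)
  by (intro subst_bas) (auto simp: insertion_def)

lemma keys_cmp:
  fixes u v :: "('k::field, 'g) lin"
  assumes "keys u \<subseteq> Mon m p" "keys v \<subseteq> Mon n q" "i \<in> {1..m}"
  shows "keys (cmp q n i u v) \<subseteq> Mon (m + n - 1) (p + q)"
  using assms(1)
proof (induction u rule: keys_induct)
  case (add c a u)
  have "keys (cmp q n i (bas a :: ('k, 'g) lin) v) \<subseteq> Mon (m + n - 1) (p + q)"
    using assms(2)
  proof (induction v rule: keys_induct)
    case (add c' b v)
    have "keys (cmp q n i (bas a) (bas b :: ('k, 'g) lin)) \<subseteq> Mon (m + n - 1) (p + q)"
      using keys_scl_subset graft_Mon[OF \<open>a \<in> _\<close> \<open>b \<in> _\<close> assms(3)]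
      by (fastforce simp: cmp_bas[OF \<open>a \<in> _\<close> assms(3)] split: if_splits)
    then show ?case using add by (simp add: keys_scl_add)
  qed simp
  then show ?case using add by (simp add: keys_scl_add)
qed simp

end

context binary_generators
begin

text \<open>The \<open>j\<close>-th input of a.\<sigma> is the input \<sigma> j of a. Hence a leaf
  with label \<open>k\<close> receives the label that \<sigma> sends to \<open>k\<close>, and the
  inverse appears in the clause for \<open>Act\<close>.\<close>

primrec psi :: "('k, 'g) opterm \<Rightarrow> ('k, 'g) lin" where
  "psi (Gen g) = bas (Nd g (Lf 1) (Lf 2))"
| "psi Unit = bas (Lf 1)"
| "psi (Zero n d) = 0"
| "psi (Add s t) = psi s + psi t"
| "psi (Scale c t) = c \<star> psi t"
| "psi (Comp s i t) = cmp (tdeg gdeg t) (tar t) i (psi s) (psi t)"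
| "psi (Act t \<sigma>) = ren (pinv \<sigma>) (psi t)"

lemma keys_ren_Mon:
  assumes "keys u \<subseteq> Mon n d" "\<sigma> permutes {1..n}"
  shows "keys (ren \<sigma> u) \<subseteq> Mon n d"
proof
  fix x assume "x \<in> keys (ren \<sigma> u)"
  then obtain y where "y \<in> keys u" "x = relabel \<sigma> y" using keys_ren by blast
  then show "x \<in> Mon n d" using assms by (auto simp: Mon_relabel[OF assms(2)])
qed

lemma keys_psi: "twf gdeg t \<Longrightarrow> keys (psi t) \<subseteq> Mon (tar t) (tdeg gdeg t)"
proof (induction t)
  case (Add s t)
  then show ?case using keys_add[of "psi s" "psi t"] by auto
next
  case (Scale c t)
  then show ?case using keys_scl_subset[of c "psi t"] by auto
next
  case (Comp s i t)
  then show ?case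
    using keys_cmp[of "psi s" "tar s" "tdeg gdeg s" "psi t" "tar t" "tdeg gdeg t" i] by simp
next
  case (Act t \<sigma>)
  then show ?case
    using keys_ren_Mon[OF _ permutes_inv, of "psi t" "tar t" "tdeg gdeg t" \<sigma>] by simp
qed (auto simp: Mon_def split: if_splits)

lemma homog_psi: "twf gdeg t \<Longrightarrow> homog (tdeg gdeg t) (psi t)"
  by (rule Mon_homog[OF keys_psi])

lemma homog_insertion: "twf gdeg t \<Longrightarrow> homog (tdeg gdeg t) (insertion i (psi t) j)"
  by (simp add: insertion_def homog_ren homog_psi)

lemma psi_leaves:
  assumes "twf gdeg t" "m \<in> keys (psi t)"
  shows "set (leaves m) = {1..tar t}" "distinct (leaves m)"
  using keys_psi[OF assms(1)] assms(2) by (auto simp: Mon_def)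

text \<open>The position \<open>i + j - 1\<close> lies in the block occupied by the inputs of
  \<open>t\<close>, so the outer insertion never meets a leaf that stems from \<open>s\<close>; this
  is the situation of \<open>subst_subst\<close>.\<close>

lemma psi_sequential:
  assumes "twf gdeg (Comp s i (Comp t j u))"
  shows "psi (Comp (Comp s i t) (i + j - 1) u) = psi (Comp s i (Comp t j u))"
proof -
  let ?l = "tar s" and ?m = "tar t" and ?n = "tar u" and ?q = "tdeg gdeg t" and ?r = "tdeg gdeg u"
  have wf: "twf gdeg s" "twf gdeg t" "twf gdeg u" "1 \<le> i" "i \<le> ?l" "1 \<le> j" "j \<le> ?m"
    using assms by auto
  let ?e2 = "insertion (i + j - 1) (psi u)" and ?f2 = "shift ?n (i + j - 1)"
  have "psi (Comp (Comp s i t) (i + j - 1) u) =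
      subst (?q + ?r) (\<lambda>k. ?f2 (shift ?m i k)) (\<lambda>k. subst ?r ?f2 ?e2 (insertion i (psi t) k)) (psi s)"
    unfolding psi.simps cmp_def
    by (rule subst_subst) (use wf in \<open>auto simp: insertion_def shift_def\<close>)
  also have "\<dots> = subst (?q + ?r) (shift (?m + ?n - 1) i) (insertion i (psi (Comp t j u))) (psi s)"
  proof (rule der_cong, intro conjI)
    fix k
    show "?f2 (shift ?m i k) = shift (?m + ?n - 1) i k"
      using wf by (auto simp: shift_def)
    have "subst ?r ?f2 ?e2 (ren (\<lambda>q. q + i - 1) (psi t)) = ren (\<lambda>q. q + i - 1) (psi (Comp t j u))"
      unfolding psi.simps cmp_def subst_ren ren_subst
    proof (rule subst_cong[where i = j])
      show "?e2 (j + i - 1) = ren (\<lambda>q. q + i - 1) (insertion j (psi u) j)"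
        using wf by (auto simp: insertion_def add_ac intro!: ren_cong)
      show "?e2 (k + i - 1) = 0" if "k \<noteq> j" for k using that wf by (auto simp: insertion_def)
    qed (use wf in \<open>auto simp: psi_leaves insertion_def shift_def\<close>)
    then show "subst ?r ?f2 ?e2 (insertion i (psi t) k) = insertion i (psi (Comp t j u)) k"
      by (simp add: insertion_def)
  qed
  finally show ?thesis by (simp add: cmp_def)
qed

text \<open>Since \<open>i < k\<close>, both insertions take place at leaves of \<open>s\<close>,
  and the shifts in the two orders agree; this is the situation of
  \<open>subst_commute\<close>.\<close>

lemma psi_parallel:
  assumes "twf gdeg (Comp s i t)" "twf gdeg (Comp s k u)" "i < k"
  shows "psi (Comp (Comp s i t) (k + tar t - 1) u) =
    sg (tdeg gdeg t * tdeg gdeg u) \<star> psi (Comp (Comp s k u) i t)"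
  unfolding psi.simps cmp_def
proof (rule subst_commute)
  have wf: "twf gdeg s" "twf gdeg t" "twf gdeg u" "1 \<le> i" "i \<le> tar s" "1 \<le> k" "k \<le> tar s"
    using assms by auto
  let ?m = "tar t" and ?n = "tar u"
  show "shift ?n (k + ?m - 1) (shift ?m i j) = shift ?m i (shift ?n k j)" for j
    using wf assms(3) by (auto simp: shift_def)
  show "ren (shift ?n (k + ?m - 1)) (insertion i (psi t) j) = insertion i (psi t) (shift ?n k j)" for j
    using wf assms(3) by (auto simp: insertion_def shift_def psi_leaves intro!: ren_cong)
  show "insertion (k + ?m - 1) (psi u) (shift ?m i j) = ren (shift ?m i) (insertion k (psi u) j)" for j
    using wf assms(3) by (auto simp: insertion_def shift_def psi_leaves intro!: ren_cong)
  show "subst (tdeg gdeg u) (shift ?n (k + ?m - 1)) (insertion (k + ?m - 1) (psi u)) (insertion i (psi t) j) = 0"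
    for j
  proof (rule subst_zero)
    fix m x assume "m \<in> keys (insertion i (psi t) j)" "x \<in> set (leaves m)"
    then obtain y q where "y \<in> keys (psi t)" "q \<in> set (leaves y)" "x = q + i - 1"
      by (rule leaves_insertion)
    then show "insertion (k + ?m - 1) (psi u) x = 0"
      using psi_leaves[OF wf(2)] wf assms(3) by (auto simp: insertion_def)
  qed
  show "subst (tdeg gdeg t) (shift ?m i) (insertion i (psi t)) (insertion k (psi u) j) = 0" for j
  proof (rule subst_zero)
    fix m x assume "m \<in> keys (insertion k (psi u) j)" "x \<in> set (leaves m)"
    then obtain y q where "y \<in> keys (psi u)" "q \<in> set (leaves y)" "x = q + k - 1"
      by (rule leaves_insertion)
    then show "insertion i (psi t) x = 0"
      using psi_leaves[OF wf(3)] wf assms(3) by (auto simp: insertion_def)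
  qed
qed (use assms in \<open>auto intro: homog_insertion\<close>)

lemma psi_act_left:
  assumes "twf gdeg (Comp (Act s \<sigma>) i t)"
  shows "psi (Comp (Act s \<sigma>) i t) = psi (Act (Comp s (\<sigma> i) t) (outer_perm (tar s) (tar t) i \<sigma>))"
proof -
  let ?m = "tar s" and ?n = "tar t"
  let ?O = "outer_perm ?m ?n i \<sigma>"
  have wf: "twf gdeg s" "twf gdeg t" "\<sigma> permutes {1..?m}" "i \<in> {1..?m}" using assms by auto
  have O: "?O permutes {1..?m + ?n - 1}" using wf by (intro outer_perm_permutes)
  \<comment> \<open>Equations for the inverse permutation are verified by applying
    \<open>outer_perm\<close>, whose values are explicit.\<close>
  have invO: "pinv ?O y = x" if "?O x = y" for x y
    using that permutes_inv_eq[OF O] by auto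
  have si: "\<sigma> i \<in> {1..?m}" using permutes_in_image[OF wf(3)] wf(4) by blast
  show ?thesis
    unfolding psi.simps cmp_def subst_ren ren_subst tdeg.simps tar.simps
  proof (rule subst_cong[where i = "\<sigma> i"])
    show "distinct (leaves a)" if "a \<in> keys (psi s)" for a using psi_leaves[OF wf(1) that] by simp
    show "shift ?n i (pinv \<sigma> j) = pinv ?O (shift ?n (\<sigma> i) j)"
      if "a \<in> keys (psi s)" "j \<in> set (leaves a)" "j \<noteq> \<sigma> i" for a j
    proof -
      define x where "x = pinv \<sigma> j"
      have x: "\<sigma> x = j" using wf(3) by (simp add: x_def permutes_inverses)
      have "j \<in> {1..?m}" using that psi_leaves[OF wf(1)] by auto
      then have "x \<in> {1..?m}" using permutes_in_image[OF wf(3)] x by blast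
      then have "?O (shift ?n i x) = shift ?n (\<sigma> i) j"
        using x that wf(4) by (auto simp: outer_perm_def shift_def Let_def)
      then show ?thesis by (simp add: invO x_def[symmetric])
    qed
    have "ren (pinv ?O) (ren (\<lambda>q. q + \<sigma> i - 1) (psi t)) = ren (\<lambda>q. q + i - 1) (psi t)"
      unfolding ren_ren
    proof (rule ren_cong, rule invO)
      fix a j assume "a \<in> keys (psi t)" "j \<in> set (leaves a)"
      then have "j \<in> {1..?n}" using psi_leaves[OF wf(2)] by auto
      then show "?O (j + i - 1) = j + \<sigma> i - 1"
        using wf(4) si by (auto simp: outer_perm_def)
    qed
    then show "insertion i (psi t) (pinv \<sigma> (\<sigma> i)) = ren (pinv ?O) (insertion (\<sigma> i) (psi t) (\<sigma> i))"
      using wf(3) by (simp add: insertion_def permutes_inverses)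
    show "insertion i (psi t) (pinv \<sigma> j) = 0" if "j \<noteq> \<sigma> i" for j
      using that permutes_inv_eq[OF wf(3)] by (auto simp: insertion_def)
  qed (simp add: insertion_def)
qed

lemma psi_act_right:
  assumes "twf gdeg (Comp s i (Act t \<tau>))"
  shows "psi (Comp s i (Act t \<tau>)) = psi (Act (Comp s i t) (inner_perm (tar t) i \<tau>))"
proof -
  let ?m = "tar s" and ?n = "tar t"
  let ?I = "inner_perm ?n i \<tau>"
  have wf: "twf gdeg s" "twf gdeg t" "\<tau> permutes {1..?n}" "i \<in> {1..?m}" using assms by auto
  have I: "?I permutes {1..?m + ?n - 1}" using wf by (intro inner_perm_permutes)
  have invI: "pinv ?I y = x" if "?I x = y" for x y
    using that permutes_inv_eq[OF I] by auto
  show ?thesis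
    unfolding psi.simps cmp_def subst_ren ren_subst tdeg.simps tar.simps
  proof (rule subst_cong[where i = i])
    show "distinct (leaves a)" if "a \<in> keys (psi s)" for a using psi_leaves[OF wf(1) that] by simp
    show "shift ?n i j = pinv ?I (shift ?n i j)"
      if "a \<in> keys (psi s)" "j \<in> set (leaves a)" "j \<noteq> i" for a j
      using that(3) wf(4) by (intro invI[symmetric]) (auto simp: inner_perm_def shift_def)
    have "ren (\<lambda>q. q + i - 1) (ren (pinv \<tau>) (psi t)) = ren (pinv ?I) (ren (\<lambda>q. q + i - 1) (psi t))"
      unfolding ren_ren
    proof (rule ren_cong, rule invI[symmetric])
      fix a j assume "a \<in> keys (psi t)" "j \<in> set (leaves a)"
      then have "j \<in> {1..?n}" using psi_leaves[OF wf(2)] by auto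
      then have "pinv \<tau> j \<in> {1..?n}" "\<tau> (pinv \<tau> j) = j"
        using permutes_in_image[OF permutes_inv[OF wf(3)]] permutes_inverses[OF wf(3)] by auto
      then show "?I (pinv \<tau> j + i - 1) = j + i - 1"
        using wf(4) by (auto simp: inner_perm_def)
    qed
    then show "insertion i (ren (pinv \<tau>) (psi t)) i = ren (pinv ?I) (insertion i (psi t) i)"
      by (simp add: insertion_def)
  qed (auto simp: insertion_def)
qed

lemma psi_unit_right:
  assumes "twf gdeg t" "i \<in> {1..tar t}"
  shows "psi (Comp t i Unit) = psi t"
proof -
  have "subst 0 (shift 1 i) (insertion i (bas (Lf 1))) u = u" if "keys u \<subseteq> Mon (tar t) (tdeg gdeg t)"
    for u :: "('k, 'g) lin"
    using that
  proof (induction u rule: keys_induct)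
    case (add c m u)
    have "graft i (Lf i) (shift 1 i) m = m" for m :: "'g mon"
      by (induction m) (auto simp: shift_def)
    moreover have "graft_exponent 0 i m = 0" by (induction m) auto
    moreover have "subst 0 (shift 1 i) (insertion i (bas (Lf 1))) (bas m :: ('k, 'g) lin) =
        sg (graft_exponent 0 i m) \<star> bas (graft i (Lf i) (shift 1 i) m)"
      using MonD[OF add(1)] assms(2) by (intro subst_bas) (auto simp: insertion_def)
    ultimately show ?case using add by simp
  qed simp
  from this[OF keys_psi[OF assms(1)]] show ?thesis by (simp add: cmp_def)
qed

lemma subst_arg_rel: "(\<And>j. e j \<in> rel B) \<Longrightarrow> subst q f e u \<in> rel B"
proof -
  assume e: "\<And>j. e j \<in> rel B"
  have "subst q f e (bas m) \<in> rel B" for m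
    by (induction m) (simp_all add: der_Nd rel_add rel_left rel_right e)
  then show ?thesis by (induction u rule: lin_induct) (auto intro: rel_closed)
qed

text \<open>All operad axioms hold as equalities between combinations of trees, except the symmetry
  of the generators, which becomes a swap relation. Passing this through the congruence rules
  requires only that the relations are stable under substitution and relabelling.\<close>

theorem psi_rel:
  assumes subst_closed: "\<And>q f e u. (\<And>j. homog q (e j)) \<Longrightarrow> u \<in> rel B \<Longrightarrow> subst q f e u \<in> rel B"
    and ren_closed: "\<And>f u. u \<in> rel B \<Longrightarrow> ren f u \<in> rel B"
    and eq: "s \<approx> t"
  shows "psi s - psi t \<in> rel B"
  using eq
proof (induction rule: opeq.induct)
  case (sym s t)
  then show ?case using rel_uminus by fastforce
next
  case (trans s t u)
  then show ?case using rel_add[of "psi s - psi t" B "psi t - psi u"] by simp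
next
  case (cong_add s t s' t')
  then show ?case using rel_add[of "psi s - psi s'" B "psi t - psi t'"] by (simp add: algebra_simps)
next
  case (cong_scale t t' c)
  then show ?case using rel_scl[of "psi t - psi t'" B c] by (simp add: scl_distribs)
next
  case (cong_comp s i t s' t')
  have t: "tar t' = tar t" "tdeg gdeg t' = tdeg gdeg t" "twf gdeg t"
    using opeq_wf[OF cong_comp(3)] by auto
  have "cmp (tdeg gdeg t) (tar t) i (psi s - psi s') (psi t) \<in> rel B"
    unfolding cmp_def by (rule subst_closed[OF homog_insertion[OF t(3)] cong_comp(4)])
  moreover have "cmp (tdeg gdeg t) (tar t) i (psi s') (psi t - psi t') \<in> rel B"
  proof -
    have "insertion i v j \<in> rel B" if "v \<in> rel B" for v j
      using ren_closed[OF that] by (simp add: insertion_def)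
    then show ?thesis unfolding cmp_def by (intro subst_arg_rel) (use cong_comp(5) in blast)
  qed
  ultimately have "cmp (tdeg gdeg t) (tar t) i (psi s - psi s') (psi t)
      + cmp (tdeg gdeg t) (tar t) i (psi s') (psi t - psi t') \<in> rel B"
    by (rule rel_add)
  then show ?case by (simp add: t)
next
  case (cong_act t \<sigma> t')
  then show ?case using ren_closed[OF cong_act(3), of "pinv \<sigma>"] by simp
next
  case (comp_sequential s i t j u)
  then show ?case using psi_sequential by simp
next
  case (comp_parallel s i t k u)
  then show ?case using psi_parallel by (simp add: koszul_sign_eq)
next
  case (comp_act_left s \<sigma> i t)
  then show ?case using psi_act_left by simp
next
  case (comp_act_right s i t \<tau>)
  then show ?case using psi_act_right by simp
next
  case (unit_left t)
  then show ?case by (simp add: cmp_def insertion_def)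
next
  case (unit_right t i)
  then show ?case using psi_unit_right by simp
next
  case (act_act t \<sigma> \<tau>)
  then have "bij \<sigma>" "bij \<tau>" by (auto intro: permutes_bij)
  then have inv: "pinv (\<sigma> \<circ> \<tau>) = pinv \<tau> \<circ> pinv \<sigma>" by (rule o_inv_distrib)
  show ?case unfolding psi.simps inv by (simp add: comp_def)
next
  case (gen_swap g)
  have "pinv (transpose 1 2) = (transpose 1 2 :: nat \<Rightarrow> nat)"
    by (rule inv_unique_comp) (simp_all add: fun_eq_iff)
  then show ?case using rel_swap[of g "Lf 2" "Lf 1" B] by simp
qed (simp_all add: scl_distribs scl_add_left algebra_simps)

end

section \<open>Evaluating labelled trees in an operad\<close>

text \<open>Under the convention for the action, this is the permutation that turns the planar tree
  with leaf list \<open>L\<close> into the labelled one: input \<open>j\<close> of the result is the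
  input at the place of \<open>j\<close> in \<open>L\<close>. Places count from 1, and labels
  outside the list are fixed so that a permutation results.\<close>

definition label_pos :: "nat list \<Rightarrow> nat \<Rightarrow> nat"
  where "label_pos L j = (if j \<in> set L then Suc (length (takeWhile (\<lambda>x. x \<noteq> j) L)) else j)"

lemma label_pos_split: "j \<notin> set A \<Longrightarrow> label_pos (A @ j # B) j = Suc (length A)"
proof -
  assume j: "j \<notin> set A"
  then have "takeWhile (\<lambda>x. x \<noteq> j) (A @ j # B) = A"
    by (induction A) auto
  then show ?thesis by (simp add: label_pos_def)
qed

lemma label_pos_eq:
  assumes "distinct L" "k < length L" "L ! k = j"
  shows "label_pos L j = Suc k"
proof -
  have "L = take k L @ j # drop (Suc k) L" using id_take_nth_drop[OF assms(2)] assms(3) by simp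
  moreover from this have "j \<notin> set (take k L)"
    using assms(1) by (metis distinct.simps(2) distinct_append disjoint_iff list.set_intros(1))
  ultimately show ?thesis
    using label_pos_split[of j "take k L" "drop (Suc k) L"] assms(2) by simp
qed

lemma label_pos_nth:
  assumes "j \<in> set L"
  shows "1 \<le> label_pos L j" "label_pos L j \<le> length L" "L ! (label_pos L j - 1) = j"
proof -
  obtain A B where "L = A @ j # B" "j \<notin> set A" using assms split_list_first by metis
  then show "1 \<le> label_pos L j" "label_pos L j \<le> length L" "L ! (label_pos L j - 1) = j"
    by (simp_all add: label_pos_split)
qed

lemma label_pos_append:
  assumes "j \<in> set A \<union> set B" "distinct (A @ B)"
  shows "label_pos (A @ B) j = (if j \<in> set A then label_pos A j else length A + label_pos B j)"
proof (cases "j \<in> set A")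
  case True
  then have "takeWhile (\<lambda>x. x \<noteq> j) (A @ B) = takeWhile (\<lambda>x. x \<noteq> j) A" by (intro takeWhile_append1) auto
  with True show ?thesis by (simp add: label_pos_def)
next
  case False
  then have "takeWhile (\<lambda>x. x \<noteq> j) (A @ B) = A @ takeWhile (\<lambda>x. x \<noteq> j) B"
    by (intro takeWhile_append2) auto
  with False assms(1) show ?thesis by (simp add: label_pos_def)
qed

lemma label_pos_map: "map (label_pos L) L = [1..<Suc (length L)]" if "distinct L"
  using that by (intro nth_equalityI) (auto simp: label_pos_eq simp del: upt_Suc)

lemma label_pos_permutes:
  assumes "distinct L" "set L = {1..n}"
  shows "label_pos L permutes {1..n}"
proof (rule bij_imp_permutes)
  have len: "length L = n" using assms distinct_card[of L] by simp
  have "label_pos L ` {1..n} = set (map (label_pos L) L)" using assms by simp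
  also have "\<dots> = {1..n}" unfolding label_pos_map[OF assms(1)] len by auto
  finally have "label_pos L ` {1..n} = {1..n}" .
  then show "bij_betw (label_pos L) {1..n} {1..n}"
    by (simp add: bij_betw_def eq_card_imp_inj_on)
qed (use assms in \<open>auto simp: label_pos_def\<close>)

lemma label_pos_unique:
  assumes "distinct L" "set L = {1..n}" "\<sigma> permutes {1..n}"
    and "\<And>j. j \<in> {1..n} \<Longrightarrow> L ! (\<sigma> j - 1) = j"
  shows "\<sigma> = label_pos L"
proof
  fix j
  have len: "length L = n" using assms(1,2) distinct_card[of L] by simp
  show "\<sigma> j = label_pos L j"
  proof (cases "j \<in> {1..n}")
    case True
    then have "\<sigma> j \<in> {1..n}" using permutes_in_image[OF assms(3)] by blast
    then show ?thesis using label_pos_eq[OF assms(1), of "\<sigma> j - 1" j] assms(4)[OF True] len by auto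
  next
    case False
    then have "\<sigma> j = j" using assms(3) by (auto simp: permutes_def)
    then show ?thesis using False assms(2) by (auto simp: label_pos_def)
  qed
qed

lemma label_pos_relabel:
  assumes "distinct L" "set L = {1..n}" "\<sigma> permutes {1..n}"
  shows "label_pos (map (pinv \<sigma>) L) = label_pos L \<circ> \<sigma>"
proof (rule label_pos_unique[symmetric])
  have inv: "pinv \<sigma> permutes {1..n}" using assms(3) by (rule permutes_inv)
  show "distinct (map (pinv \<sigma>) L)"
    using assms(1) permutes_inj[OF inv] by (auto simp: distinct_map inj_on_def inj_def)
  show "set (map (pinv \<sigma>) L) = {1..n}"
    using assms(2) permutes_image[OF inv] by simp
  show "(label_pos L \<circ> \<sigma>) permutes {1..n}"
    by (intro permutes_compose assms label_pos_permutes)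
  show "map (pinv \<sigma>) L ! ((label_pos L \<circ> \<sigma>) j - 1) = j" if "j \<in> {1..n}" for j
  proof -
    have "\<sigma> j \<in> set L" using permutes_in_image[OF assms(3)] that assms(2) by blast
    from label_pos_nth[OF this] show ?thesis
      using assms(3) by (simp add: permutes_inverses)
  qed
qed

text \<open>An operad with chosen operations that have the degrees and the symmetries prescribed for
  the generators, that is, a possible target for evaluating expressions and trees.\<close>

locale operad_generators =
  graded_operad P + binary_generators gdeg sw
  for P :: "('k::field, 'a, 'm) operad_scheme" and gdeg :: "'g \<Rightarrow> int" and sw :: "'g \<Rightarrow> 'k \<times> 'g" +
  fixes gen :: "'g \<Rightarrow> 'a"
  assumes gen_closed: "gen g \<in> ops P 2 (gdeg g)"
    and gen_act: "act P (gen g) (transpose 1 2) = fst (sw g) \<odot>\<^bsub>cpt P 2 (gdeg g)\<^esub> gen (snd (sw g))"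
begin

primrec interp :: "('k, 'g) opterm \<Rightarrow> 'a" where
  "interp (Gen g) = gen g"
| "interp Unit = ounit P"
| "interp (Zero n d) = \<zero>\<^bsub>cpt P n d\<^esub>"
| "interp (Add s t) = interp s \<oplus>\<^bsub>cpt P (tar s) (tdeg gdeg s)\<^esub> interp t"
| "interp (Scale c t) = c \<odot>\<^bsub>cpt P (tar t) (tdeg gdeg t)\<^esub> interp t"
| "interp (Comp s i t) = pcomp P (interp s) i (interp t)"
| "interp (Act t \<sigma>) = act P (interp t) \<sigma>"

lemma interp_closed: "twf gdeg t \<Longrightarrow> interp t \<in> ops P (tar t) (tdeg gdeg t)"
proof (induction t)
  case (Comp s i t)
  then show ?case by (auto intro!: comp_closed[simplified])
next
  case (Act t \<sigma>)
  then show ?case by (auto intro!: act_closed[simplified])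
qed (auto simp: gen_closed unit_closed[simplified] smult_simps)

lemma interp_cong: "s \<approx> t \<Longrightarrow> interp s = interp t"
proof (induction rule: opeq.induct)
  case (trans s t u)
  then show ?case by simp
next
  case (cong_add s t s' t')
  then show ?case using opeq_wf[OF cong_add(2)] by simp
next
  case (cong_scale t t' c)
  then show ?case using opeq_wf[OF cong_scale(1)] by simp
next
  case (add_assoc s t u)
  then have eq: "tar t = tar s" "tar u = tar s" "tdeg gdeg t = tdeg gdeg s" "tdeg gdeg u = tdeg gdeg s"
    and wf: "twf gdeg s" "twf gdeg t" "twf gdeg u" by auto
  have "interp t \<in> ops P (tar s) (tdeg gdeg s)" "interp u \<in> ops P (tar s) (tdeg gdeg s)"
    using interp_closed[OF wf(2)] interp_closed[OF wf(3)] by (simp_all add: eq)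
  then show ?case using interp_closed[OF wf(1)] by (simp add: eq md.a_assoc)
next
  case (add_comm s t)
  then show ?case using interp_closed[of s] interp_closed[of t] by (simp add: md.a_comm)
next
  case (add_zero t)
  then show ?case using interp_closed[of t] by simp
next
  case (scale_zero t)
  then show ?case using interp_closed[of t] by (simp add: smult_simps)
next
  case (scale_one t)
  then show ?case using interp_closed[of t] by (simp add: smult_simps)
next
  case (scale_scale t b c)
  then show ?case using interp_closed[of t] by (simp add: smult_simps)
next
  case (scale_add_left t b c)
  then show ?case using interp_closed[of t] by (simp add: smult_simps)
next
  case (scale_add_right s t c)
  then show ?case using interp_closed[of s] interp_closed[of t] by (simp add: md.smult_r_distr)
next
  case (comp_add_left s s' i t)
  then show ?case
    using interp_closed[of s] interp_closed[of s'] interp_closed[of t]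
      graded_operad.comp_add_left[OF graded_operad_axioms, of "interp s" "tar s" "tdeg gdeg s" "interp s'" "interp t" "tar t" "tdeg gdeg t" i]
    by simp
next
  case (comp_add_right s i t t')
  then show ?case
    using interp_closed[of s] interp_closed[of t'] interp_closed[of t]
      graded_operad.comp_add_right[OF graded_operad_axioms, of "interp s" "tar s" "tdeg gdeg s" "interp t" "tar t" "tdeg gdeg t" "interp t'" i]
    by simp
next
  case (comp_scale_left s i t c)
  then show ?case
    using interp_closed[of s] interp_closed[of t]
      comp_smult_left[of "interp s" "tar s" "tdeg gdeg s" "interp t" "tar t" "tdeg gdeg t" i c]
    by simp
next
  case (comp_scale_right s i t c)
  then show ?case
    using interp_closed[of s] interp_closed[of t]
      comp_smult_right[of "interp s" "tar s" "tdeg gdeg s" "interp t" "tar t" "tdeg gdeg t" i c]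
    by simp
next
  case (unit_left t)
  then show ?case
    using graded_operad.unit_left[OF graded_operad_axioms interp_closed[of t]] by simp
next
  case (unit_right t i)
  then show ?case
    using graded_operad.unit_right[OF graded_operad_axioms interp_closed[of t], of i] by simp
next
  case (comp_sequential s i t j u)
  then show ?case
    using graded_operad.comp_sequential[OF graded_operad_axioms interp_closed[of s] interp_closed[of t] interp_closed[of u], of i j]
    by simp
next
  case (comp_parallel s i t k u)
  have "tar s + tar u - 1 + tar t - 1 = tar s + tar t + tar u - 2"
    "tdeg gdeg s + tdeg gdeg u + tdeg gdeg t = tdeg gdeg s + tdeg gdeg t + tdeg gdeg u"
    using comp_parallel by auto
  then show ?case
    using comp_parallel
      graded_operad.comp_parallel[OF graded_operad_axioms interp_closed[of s] interp_closed[of t] interp_closed[of u], of i k]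
    by (simp add: add_ac)
next
  case (act_add s t \<sigma>)
  then have eq: "tar t = tar s" "tdeg gdeg t = tdeg gdeg s"
    and wf: "twf gdeg s" "twf gdeg t" "\<sigma> permutes {1..tar s}" by auto
  have "interp t \<in> ops P (tar s) (tdeg gdeg s)" using interp_closed[OF wf(2)] by (simp add: eq)
  then show ?case
    using graded_operad.act_add[OF graded_operad_axioms interp_closed[OF wf(1)] _ wf(3)] by (simp add: eq)
next
  case (act_scale t \<sigma> c)
  then show ?case using interp_closed[of t] act_smult[of "interp t" "tar t" "tdeg gdeg t" \<sigma> c] by simp
next
  case (act_id t)
  then show ?case using graded_operad.act_id[OF graded_operad_axioms interp_closed[of t]] by simp
next
  case (act_act t \<sigma> \<tau>)
  then show ?case using graded_operad.act_act[OF graded_operad_axioms interp_closed[of t], of \<sigma> \<tau>] by simp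
next
  case (comp_act_left s \<sigma> i t)
  then show ?case
    using graded_operad.comp_act_left[OF graded_operad_axioms interp_closed[of s] interp_closed[of t], of i \<sigma>] by simp
next
  case (comp_act_right s i t \<tau>)
  then show ?case
    using graded_operad.comp_act_right[OF graded_operad_axioms interp_closed[of s] interp_closed[of t], of i \<tau>] by simp
next
  case (gen_swap g)
  then show ?case using gen_act[of g] by (simp add: gdeg_sw)
qed simp_all

text \<open>The labels are forgotten and the inputs numbered from left to right. After the left
  subtree has been inserted at 1, the second input of the generator sits just behind its
  leaves.\<close>

primrec planar :: "'g mon \<Rightarrow> 'a" where
  "planar (Lf j) = ounit P"
| "planar (Nd g a b) = pcomp P (pcomp P (gen g) 1 (planar a)) (length (leaves a) + 1) (planar b)"

lemma planar_relabel [simp]: "planar (relabel f m) = planar m"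
  by (induction m) auto

lemma planar_left_closed:
  assumes "planar a \<in> ops P (length (leaves a)) (mdeg a)"
  shows "pcomp P (gen g) 1 (planar a) \<in> ops P (length (leaves a) + 1) (gdeg g + mdeg a)"
  using comp_closed[OF gen_closed assms, of 1] by simp

lemma planar_closed: "planar m \<in> ops P (length (leaves m)) (mdeg m)"
proof (induction m)
  case (Nd g a b)
  then show ?case
    using comp_closed[OF planar_left_closed[OF Nd.IH(1)] Nd.IH(2), of "length (leaves a) + 1"] by simp
qed (use unit_closed in simp)

text \<open>In the right child the sequential axiom suffices. In the left child the grafted tree was
  composed after the right child \<open>c\<close> and has to be moved before it by the parallel
  axiom, which costs the sign of |b||c|; this reproduces the recursion of
  \<open>graft_exponent\<close>.\<close>

lemma planar_graft:
  assumes "leaves m = A @ i # B" "distinct (leaves m)"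
  shows "pcomp P (planar m) (length A + 1) (planar b) =
    sg (graft_exponent (mdeg b) i m) \<odot>\<^bsub>cpt P (length (leaves m) + length (leaves b) - 1) (mdeg m + mdeg b)\<^esub>
      planar (graft i b f m)"
  using assms
proof (induction m arbitrary: A B)
  case (Lf j)
  then have "A = []" "j = i" by (auto simp: Cons_eq_append_conv)
  then show ?case
    using unit_left[OF planar_closed[of b]] smult_simps(4)[OF planar_closed[of b]] by simp
next
  case (Nd g a c)
  let ?na = "length (leaves a)" and ?nc = "length (leaves c)" and ?nb = "length (leaves b)"
  let ?L = "pcomp P (gen g) 1 (planar a)"
  have L: "?L \<in> ops P (?na + 1) (gdeg g + mdeg a)" by (rule planar_left_closed[OF planar_closed])
  have na: "?na > 0" "?nc > 0" by auto
  show ?case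
  proof (cases "i \<in> set (leaves a)")
    case True
    then obtain A' B' where a: "leaves a = A' @ i # B'" using split_list by metis
    then have c: "i \<notin> set (leaves c)" using Nd.prems(2) True by auto
    have "A = A'"
      using Nd.prems a append_Cons_eq_iff[of i A B A' "B' @ leaves c"] by simp
    let ?p = "length A + 1" and ?k = "sg (graft_exponent (mdeg b) i a)"
    have p: "?p \<in> {1..?na}" "?p \<in> {1..?na + 1}" using a \<open>A = A'\<close> by auto
    have ga: "length (leaves (graft i b f a)) = ?na + ?nb - 1" "mdeg (graft i b f a) = mdeg a + mdeg b"
    proof -
      have "distinct (leaves a)" using Nd.prems(2) by simp
      then show "length (leaves (graft i b f a)) = ?na + ?nb - 1" "mdeg (graft i b f a) = mdeg a + mdeg b"
        using leaves_graft_split[OF a, of b f] mdeg_graft[of a i b f] True by (simp_all add: a)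
    qed
    have G: "planar (graft i b f a) \<in> ops P (?na + ?nb - 1) (mdeg a + mdeg b)"
      using planar_closed[of "graft i b f a"] ga by simp
    have IH: "pcomp P (planar a) ?p (planar b) =
        ?k \<odot>\<^bsub>cpt P (?na + ?nb - 1) (mdeg a + mdeg b)\<^esub> planar (graft i b f a)"
    proof -
      have "distinct (leaves a)" using Nd.prems(2) by simp
      from Nd.IH(1)[OF a this] show ?thesis by (simp only: \<open>A = A'\<close>)
    qed
    have "pcomp P ?L ?p (planar b) = pcomp P (gen g) 1 (pcomp P (planar a) ?p (planar b))"
      using comp_sequential[OF gen_closed planar_closed planar_closed, of 1 ?p a g b] p by simp
    also have "\<dots> = ?k \<odot>\<^bsub>cpt P (?na + ?nb) (gdeg g + mdeg a + mdeg b)\<^esub> pcomp P (gen g) 1 (planar (graft i b f a))"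
      unfolding IH using comp_smult_right[OF gen_closed G, of 1 g ?k] na by (simp add: add.assoc)
    finally have E: "pcomp P ?L ?p (planar b) =
      ?k \<odot>\<^bsub>cpt P (?na + ?nb) (gdeg g + mdeg a + mdeg b)\<^esub> pcomp P (gen g) 1 (planar (graft i b f a))" .
    have M: "pcomp P (gen g) 1 (planar (graft i b f a)) \<in> ops P (?na + ?nb) (gdeg g + mdeg a + mdeg b)"
      using comp_closed[OF gen_closed G, of 1 g] na by (simp add: add.assoc)
    have N: "planar (graft i b f (Nd g a c)) \<in> ops P (?na + ?nc + ?nb - 1) (gdeg g + mdeg a + mdeg c + mdeg b)"
      using comp_closed[OF M planar_closed[of c], of "?na + ?nb"] na ga c
      by (simp add: graft_absent add_ac)
    have q: "?na + ?nb \<in> {1..?na + ?nb}" unfolding atLeastAtMost_iff using na by linarith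
    have "pcomp P (pcomp P ?L ?p (planar b)) (?na + ?nb) (planar c) =
        ?k \<odot>\<^bsub>cpt P (?na + ?nc + ?nb - 1) (gdeg g + mdeg a + mdeg c + mdeg b)\<^esub> planar (graft i b f (Nd g a c))"
      unfolding E using comp_smult_left[OF M planar_closed[of c] q, of ?k] na ga c
      by (simp add: graft_absent add_ac)
    moreover have "pcomp P (pcomp P ?L ?p (planar b)) (?na + ?nb) (planar c) =
        koszul_sign (mdeg b) (mdeg c) \<odot>\<^bsub>cpt P (?na + ?nc + ?nb - 1) (gdeg g + mdeg a + mdeg c + mdeg b)\<^esub>
          pcomp P (planar (Nd g a c)) ?p (planar b)"
      using comp_parallel[OF L planar_closed[of b] planar_closed[of c], of ?p "?na + 1"] p na
      by (simp add: add_ac)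
    moreover have X: "pcomp P (planar (Nd g a c)) ?p (planar b) \<in>
        ops P (?na + ?nc + ?nb - 1) (gdeg g + mdeg a + mdeg c + mdeg b)"
      using comp_closed[OF planar_closed[of "Nd g a c"] planar_closed[of b], of ?p] p na by auto
    \<comment> \<open>The parallel axiom gives the wanted composite up to a sign; applying the same
      sign once more removes it.\<close>
    ultimately have "koszul_sign (mdeg b) (mdeg c) \<odot>\<^bsub>cpt P (?na + ?nc + ?nb - 1) (gdeg g + mdeg a + mdeg c + mdeg b)\<^esub>
        (koszul_sign (mdeg b) (mdeg c) \<odot>\<^bsub>cpt P (?na + ?nc + ?nb - 1) (gdeg g + mdeg a + mdeg c + mdeg b)\<^esub>
          pcomp P (planar (Nd g a c)) ?p (planar b)) =
        koszul_sign (mdeg b) (mdeg c) \<odot>\<^bsub>cpt P (?na + ?nc + ?nb - 1) (gdeg g + mdeg a + mdeg c + mdeg b)\<^esub>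
        (?k \<odot>\<^bsub>cpt P (?na + ?nc + ?nb - 1) (gdeg g + mdeg a + mdeg c + mdeg b)\<^esub> planar (graft i b f (Nd g a c)))"
      by simp
    then have "pcomp P (planar (Nd g a c)) ?p (planar b) =
        (koszul_sign (mdeg b) (mdeg c) * ?k) \<odot>\<^bsub>cpt P (?na + ?nc + ?nb - 1) (gdeg g + mdeg a + mdeg c + mdeg b)\<^esub>
        planar (graft i b f (Nd g a c))"
      unfolding smult_simps(3)[OF X, symmetric] smult_simps(3)[OF N, symmetric]
      using smult_simps(4)[OF X] by (simp add: koszul_sign_eq)
    then show ?thesis using True by (simp add: koszul_sign_eq sg_add mult.commute)
  next
    case False
    have "i \<in> set (leaves (Nd g a c))" unfolding Nd.prems(1) by simp
    then have "i \<in> set (leaves c)" using False by simp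
    then obtain A' B' where c: "leaves c = A' @ i # B'" using split_list by metis
    have "A = leaves a @ A'"
      using Nd.prems c append_Cons_eq_iff[of i A B "leaves a @ A'" B'] by simp
    let ?p = "length A' + 1" and ?k = "sg (graft_exponent (mdeg b) i c)"
    have p: "?p \<in> {1..?nc}" using c by auto
    have gc: "length (leaves (graft i b f c)) = ?nc + ?nb - 1" "mdeg (graft i b f c) = mdeg c + mdeg b"
    proof -
      have "distinct (leaves c)" using Nd.prems(2) by simp
      then show "length (leaves (graft i b f c)) = ?nc + ?nb - 1" "mdeg (graft i b f c) = mdeg c + mdeg b"
        using leaves_graft_split[OF c, of b f] mdeg_graft[of c i b f] \<open>i \<in> set (leaves c)\<close> by (simp_all add: c)
    qed
    have G: "planar (graft i b f c) \<in> ops P (?nc + ?nb - 1) (mdeg c + mdeg b)"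
      using planar_closed[of "graft i b f c"] gc by simp
    have IH: "pcomp P (planar c) ?p (planar b) =
        ?k \<odot>\<^bsub>cpt P (?nc + ?nb - 1) (mdeg c + mdeg b)\<^esub> planar (graft i b f c)"
    proof -
      have "distinct (leaves c)" using Nd.prems(2) by simp
      from Nd.IH(2)[OF c this] show ?thesis .
    qed
    have "pcomp P (planar (Nd g a c)) (?na + ?p) (planar b) =
        pcomp P ?L (?na + 1) (pcomp P (planar c) ?p (planar b))"
      using comp_sequential[OF L planar_closed planar_closed, of "?na + 1" ?p c b] p by simp
    also have "\<dots> = ?k \<odot>\<^bsub>cpt P (?na + ?nc + ?nb - 1) (gdeg g + mdeg a + mdeg c + mdeg b)\<^esub>
        pcomp P ?L (?na + 1) (planar (graft i b f c))"
      unfolding IH using comp_smult_right[OF L G, of "?na + 1" ?k] na by (simp add: add_ac)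
    finally show ?thesis using False \<open>A = leaves a @ A'\<close> by (simp add: graft_absent)
  qed
qed

definition tau :: "'g mon \<Rightarrow> 'a"
  where "tau m = act P (planar m) (label_pos (leaves m))"

lemma planar_Mon: "m \<in> Mon n d \<Longrightarrow> planar m \<in> ops P n d"
  using planar_closed[of m] MonD[of m n d] by simp

lemma label_pos_Mon: "m \<in> Mon n d \<Longrightarrow> label_pos (leaves m) permutes {1..n}"
  by (intro label_pos_permutes) (auto dest: MonD)

lemma tau_closed: "m \<in> Mon n d \<Longrightarrow> tau m \<in> ops P n d"
  unfolding tau_def by (intro act_closed planar_Mon label_pos_Mon)

lemma tau_act:
  assumes "m \<in> Mon n d" "\<sigma> permutes {1..n}"
  shows "act P (tau m) \<sigma> = tau (relabel (pinv \<sigma>) m)"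
  unfolding tau_def
  using act_act[OF planar_Mon[OF assms(1)] label_pos_Mon[OF assms(1)] assms(2)]
    label_pos_relabel[OF MonD(1,2)[OF assms(1)] assms(2)]
  by simp

text \<open>The equivariance axioms pull the position permutations out of both factors, which leaves
  \<open>planar_graft\<close>. It remains to identify the resulting product of permutations with the
  position permutation of the grafted tree.\<close>

lemma tau_graft:
  assumes m: "m \<in> Mon k p" and b: "b \<in> Mon n q" and i: "i \<in> {1..k}"
  shows "pcomp P (tau m) i (tau b) = sg (graft_exponent q i m) \<odot>\<^bsub>cpt P (k + n - 1) (p + q)\<^esub>
    tau (graft i (relabel (\<lambda>x. x + i - 1) b) (shift n i) m)"
proof -
  note M = MonD[OF m] MonD[OF b]
  let ?b = "relabel (\<lambda>x. x + i - 1) b"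
  let ?m = "graft i ?b (shift n i) m"
  define \<sigma> \<tau> where "\<sigma> = label_pos (leaves m)" and "\<tau> = label_pos (leaves b)"
  have \<sigma>: "\<sigma> permutes {1..k}" and \<tau>: "\<tau> permutes {1..n}"
    unfolding \<sigma>_def \<tau>_def using label_pos_Mon m b by auto
  have i_leaf: "i \<in> set (leaves m)" using M(2) i by simp
  obtain A B where AB: "leaves m = A @ i # B" "i \<notin> set A" using split_list_first[OF i_leaf] by metis
  have \<sigma>i: "\<sigma> i = length A + 1" unfolding \<sigma>_def AB(1) using label_pos_split[OF AB(2)] by simp
  have si: "\<sigma> i \<in> {1..k}" using permutes_in_image[OF \<sigma>] i by blast
  let ?O = "outer_perm k n i \<sigma>" and ?I = "inner_perm n (\<sigma> i) \<tau>"
  have O: "?O permutes {1..k + n - 1}" and I: "?I permutes {1..k + n - 1}"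
    using outer_perm_permutes[OF \<sigma> i] inner_perm_permutes[OF \<tau> si] .
  have mM: "?m \<in> Mon (k + n - 1) (p + q)" by (rule graft_Mon[OF m b i])
  have pc: "pcomp P (planar m) (\<sigma> i) (planar b) \<in> ops P (k + n - 1) (p + q)"
    by (rule comp_closed[OF planar_Mon[OF m] planar_Mon[OF b] si])
  have "pcomp P (tau m) i (tau b) = act P (pcomp P (planar m) (\<sigma> i) (act P (planar b) \<tau>)) ?O"
    unfolding tau_def \<sigma>_def[symmetric] \<tau>_def[symmetric]
    using comp_act_left[OF planar_Mon[OF m] act_closed[OF planar_Mon[OF b] \<tau>] i \<sigma>] .
  also have "pcomp P (planar m) (\<sigma> i) (act P (planar b) \<tau>) = act P (pcomp P (planar m) (\<sigma> i) (planar b)) ?I"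
    by (rule comp_act_right[OF planar_Mon[OF m] planar_Mon[OF b] si \<tau>])
  also have "act P (act P (pcomp P (planar m) (\<sigma> i) (planar b)) ?I) ?O =
      act P (pcomp P (planar m) (\<sigma> i) (planar b)) (?I \<circ> ?O)"
    by (rule act_act[OF pc I O])
  also have "pcomp P (planar m) (\<sigma> i) (planar b) =
      sg (graft_exponent q i m) \<odot>\<^bsub>cpt P (k + n - 1) (p + q)\<^esub> planar ?m"
    using planar_graft[OF AB(1) M(1), of ?b "shift n i"] M by (simp add: \<sigma>i)
  also have "act P \<dots> (?I \<circ> ?O) = sg (graft_exponent q i m) \<odot>\<^bsub>cpt P (k + n - 1) (p + q)\<^esub> act P (planar ?m) (?I \<circ> ?O)"
    by (rule act_smult[OF planar_Mon[OF mM] permutes_compose[OF O I]])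
  \<comment> \<open>A position permutation is determined by reading the leaf list at the image of
    each label. The label \<open>j\<close> lies in the inserted block, before it, or behind it, and
    the three cases are read off separately.\<close>
  also have "?I \<circ> ?O = label_pos (leaves ?m)"
  proof (rule label_pos_unique)
    note mm = MonD[OF mM]
    show "distinct (leaves ?m)" "set (leaves ?m) = {1..k + n - 1}" by (fact mm)+
    show "(?I \<circ> ?O) permutes {1..k + n - 1}" by (rule permutes_compose[OF O I])
    have L: "leaves ?m = map (shift n i) A @ map (\<lambda>x. x + i - 1) (leaves b) @ map (shift n i) B"
      using leaves_graft_split[OF AB(1) M(1), of ?b "shift n i"] by simp
    have n: "length (leaves b) = n" "n > 0" using M(8) by (auto intro: Nat.gr0I)
    show "leaves ?m ! ((?I \<circ> ?O) j - 1) = j" if j: "j \<in> {1..k + n - 1}" for j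
    proof (cases "i \<le> j \<and> j < i + n")
      case True
      define x where "x = j + 1 - i"
      have x: "x \<in> set (leaves b)" "j = x + i - 1" using True M(6) i by (auto simp: x_def)
      have \<tau>x: "\<tau> x \<ge> 1" "\<tau> x \<le> n" "leaves b ! (\<tau> x - 1) = x"
        unfolding \<tau>_def using label_pos_nth[OF x(1)] n by auto
      have "?O j = \<sigma> i + (x - 1)" using True j by (auto simp: outer_perm_def x_def)
      moreover have "?I (\<sigma> i + (x - 1)) = \<tau> x + \<sigma> i - 1"
      proof -
        have "\<sigma> i + (x - 1) + 1 - \<sigma> i = x" "\<sigma> i + (x - 1) < \<sigma> i + n" using x M(6) by auto
        then show ?thesis by (simp add: inner_perm_def)
      qed
      ultimately have "(?I \<circ> ?O) j - 1 = length A + (\<tau> x - 1)" using \<tau>x by (simp add: \<sigma>i)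
      moreover have "leaves ?m ! (length A + (\<tau> x - 1)) = x + i - 1"
      proof -
        obtain y where "\<tau> x = Suc y" using \<tau>x(1) by (cases "\<tau> x") auto
        then show ?thesis unfolding L using \<tau>x n by (simp add: nth_append)
      qed
      ultimately show ?thesis using x by simp
    next
      case False
      define x where "x = (if j < i then j else j + 1 - n)"
      have x: "x \<in> {1..k}" "x \<noteq> i" "shift n i x = j" using False j n i by (auto simp: x_def shift_def)
      have xl: "x \<in> set (leaves m)" using x M(2) by simp
      have \<sigma>x: "\<sigma> x \<ge> 1" "\<sigma> x \<le> k" "leaves m ! (\<sigma> x - 1) = x"
        unfolding \<sigma>_def using label_pos_nth[OF xl] M by auto
      have ne: "\<sigma> x \<noteq> \<sigma> i" using x permutes_inj[OF \<sigma>] by (auto dest: injD)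
      have O: "?O j = (if \<sigma> x < \<sigma> i then \<sigma> x else \<sigma> x + n - 1)"
        using False j by (auto simp: outer_perm_def x_def Let_def)
      show ?thesis
      proof (cases "\<sigma> x < \<sigma> i")
        case True
        then have "(?I \<circ> ?O) j = \<sigma> x" by (simp add: O inner_perm_def)
        moreover have "\<sigma> x - 1 < length A" "A ! (\<sigma> x - 1) = x"
          using True \<sigma>x \<sigma>i AB(1) by (auto simp: nth_append split: if_splits)
        ultimately show ?thesis unfolding L using x by (simp add: nth_append)
      next
        case False
        then have gt: "\<sigma> x > \<sigma> i" using ne by simp
        then have "\<not> \<sigma> x + n - 1 < \<sigma> i + n" using n by linarith
        then have IO: "(?I \<circ> ?O) j = \<sigma> x + n - 1" using gt by (simp add: O inner_perm_def)
        \<comment> \<open>The index of \<open>x\<close> in \<open>B\<close>: the entries of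
          \<open>A\<close> and the leaf \<open>i\<close> precede \<open>B\<close>, and one more is
          lost because positions count from 1.\<close>
        define y where "y = \<sigma> x - length A - 2"
        have y: "\<sigma> x = y + length A + 2" using gt \<sigma>i by (simp add: y_def)
        have "k = length A + 1 + length B" using M(4) AB(1) by simp
        then have "y < length B" using y \<sigma>x(2) by simp
        moreover have "B ! y = x" using \<sigma>x(3) AB(1) y by (simp add: nth_append)
        moreover have "\<sigma> x + n - 1 - 1 = length A + (n + y)" using y by simp
        ultimately show ?thesis unfolding L IO using x n by (simp add: nth_append)
      qed
    qed
  qed
  finally show ?thesis by (simp add: tau_def)
qed

text \<open>Trees that are not multilinear of the given arity and degree are discarded, which makes
  the evaluation linear on all combinations without side conditions.\<close>

definition tauh :: "nat \<Rightarrow> int \<Rightarrow> ('k, 'g) lin \<Rightarrow> 'a"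
  where "tauh n d w = finsum (cpt P n d) (\<lambda>m. lookup w m \<odot>\<^bsub>cpt P n d\<^esub> tau m) (keys w \<inter> Mon n d)"

lemma tauh_superset:
  assumes "finite F" "keys w \<inter> Mon n d \<subseteq> F" "F \<subseteq> Mon n d"
  shows "tauh n d w = finsum (cpt P n d) (\<lambda>m. lookup w m \<odot>\<^bsub>cpt P n d\<^esub> tau m) F"
  unfolding tauh_def
  by (rule md.add.finprod_mono_neutral_cong_left)
     (use assms in \<open>auto simp: in_keys_iff smult_simps tau_closed subset_iff\<close>)

lemma tauh_closed [simp]: "tauh n d w \<in> ops P n d"
  unfolding tauh_def by (rule md.finsum_closed) (auto simp: smult_simps tau_closed)

lemma tauh_add: "tauh n d (u + v) = tauh n d u \<oplus>\<^bsub>cpt P n d\<^esub> tauh n d v"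
proof -
  let ?F = "(keys u \<union> keys v) \<inter> Mon n d"
  have "tauh n d (u + v) = finsum (cpt P n d) (\<lambda>m. lookup (u + v) m \<odot>\<^bsub>cpt P n d\<^esub> tau m) ?F"
    using keys_add[of u v] by (intro tauh_superset) auto
  also have "\<dots> = finsum (cpt P n d)
      (\<lambda>m. lookup u m \<odot>\<^bsub>cpt P n d\<^esub> tau m \<oplus>\<^bsub>cpt P n d\<^esub> lookup v m \<odot>\<^bsub>cpt P n d\<^esub> tau m) ?F"
    by (rule md.finsum_cong') (auto simp: lookup_add smult_simps tau_closed)
  also have "\<dots> = finsum (cpt P n d) (\<lambda>m. lookup u m \<odot>\<^bsub>cpt P n d\<^esub> tau m) ?F \<oplus>\<^bsub>cpt P n d\<^esub>
      finsum (cpt P n d) (\<lambda>m. lookup v m \<odot>\<^bsub>cpt P n d\<^esub> tau m) ?F"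
    by (rule md.finsum_addf) (auto simp: smult_simps tau_closed)
  also have "\<dots> = tauh n d u \<oplus>\<^bsub>cpt P n d\<^esub> tauh n d v"
    by (subst (1 2) tauh_superset[of ?F]) auto
  finally show ?thesis .
qed

lemma tauh_scl: "tauh n d (c \<star> u) = c \<odot>\<^bsub>cpt P n d\<^esub> tauh n d u"
proof -
  let ?F = "keys u \<inter> Mon n d"
  have "tauh n d (c \<star> u) = finsum (cpt P n d) (\<lambda>m. lookup (c \<star> u) m \<odot>\<^bsub>cpt P n d\<^esub> tau m) ?F"
    using keys_scl_subset[of c u] by (intro tauh_superset) auto
  also have "\<dots> = finsum (cpt P n d)
      (\<lambda>m. c \<odot>\<^bsub>cpt P n d\<^esub> (lookup u m \<odot>\<^bsub>cpt P n d\<^esub> tau m)) ?F"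
    by (rule md.finsum_cong') (auto simp: smult_simps tau_closed)
  also have "\<dots> = c \<odot>\<^bsub>cpt P n d\<^esub> finsum (cpt P n d) (\<lambda>m. lookup u m \<odot>\<^bsub>cpt P n d\<^esub> tau m) ?F"
    by (rule md.finsum_smult_ldistr[symmetric]) (auto simp: smult_simps tau_closed)
  finally show ?thesis by (simp add: tauh_def)
qed

lemma tauh_bas: "tauh n d (bas m) = (if m \<in> Mon n d then tau m else \<zero>\<^bsub>cpt P n d\<^esub>)"
proof (cases "m \<in> Mon n d")
  case True
  then have "keys (bas m :: ('k, 'g) lin) \<inter> Mon n d = insert m {}" by auto
  then show ?thesis using True tau_closed[OF True]
    by (simp add: tauh_def smult_simps)
qed (simp add: tauh_def)

lemma tauh_zero [simp]: "tauh n d 0 = \<zero>\<^bsub>cpt P n d\<^esub>"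
  by (simp add: tauh_def)

lemma tauh_uminus: "tauh n d (- u) = \<ominus>\<^bsub>cpt P n d\<^esub> tauh n d u"
  using tauh_scl[of n d "- 1" u] smult_simps(4)[of "tauh n d u" n d] smult_simps(6)[of "tauh n d u" n d 1] by (simp add: smult_simps)

lemma tauh_diff: "tauh n d (u - v) = tauh n d u \<ominus>\<^bsub>cpt P n d\<^esub> tauh n d v"
  using tauh_add[of n d u "- v"] by (simp add: tauh_uminus md.minus_eq)

lemma tauh_ren:
  assumes "\<sigma> permutes {1..n}"
  shows "act P (tauh n d u) \<sigma> = tauh n d (ren (pinv \<sigma>) u)"
proof (induction u rule: lin_induct)
  case zero
  then show ?case using act_zero[OF assms] by simp
next
  case (add c m v)
  have "act P (tauh n d (bas m)) \<sigma> = tauh n d (ren (pinv \<sigma>) (bas m))"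
    using assms tau_act[of m n d \<sigma>] act_zero[OF assms]
    by (simp add: tauh_bas Mon_relabel[OF permutes_inv[OF assms]])
  then show ?case
    using add assms
    by (simp add: tauh_add tauh_scl act_add act_smult smult_simps)
qed

lemma tauh_comp:
  assumes u: "keys u \<subseteq> Mon k p" and v: "keys v \<subseteq> Mon n q" and i: "i \<in> {1..k}"
  shows "pcomp P (tauh k p u) i (tauh n q v) = tauh (k + n - 1) (p + q) (cmp q n i u v)"
  using u
proof (induction u rule: keys_induct)
  case zero
  show ?case using comp_zero_left[of "tauh n q v" n q i k p] i by simp
next
  case (add c a u)
  have "pcomp P (tauh k p (bas a)) i (tauh n q v) = tauh (k + n - 1) (p + q) (cmp q n i (bas a) v)"
    using v
  proof (induction v rule: keys_induct)
    case zero
    show ?case using comp_zero_right[of "tauh k p (bas a)" k p i n q] i by simp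
  next
    case (add c b v)
    have "pcomp P (tauh k p (bas a)) i (tauh n q (bas b)) =
        tauh (k + n - 1) (p + q) (cmp q n i (bas a) (bas b))"
      using tau_graft[OF \<open>a \<in> _\<close> \<open>b \<in> _\<close> i] graft_Mon[OF \<open>a \<in> _\<close> \<open>b \<in> _\<close> i] \<open>a \<in> _\<close> \<open>b \<in> _\<close>
      by (simp add: cmp_bas[OF \<open>a \<in> _\<close> i] tauh_bas tauh_scl)
    then show ?case
      using add i comp_add_right[of "tauh k p (bas a)" k p "c \<odot>\<^bsub>cpt P n q\<^esub> tauh n q (bas b)" n q "tauh n q v" i]
        comp_smult_right[of "tauh k p (bas a)" k p "tauh n q (bas b)" n q i c]
      by (simp add: tauh_add tauh_scl smult_simps)
  qed
  then show ?case
    using add i comp_add_left[of "c \<odot>\<^bsub>cpt P k p\<^esub> tauh k p (bas a)" k p "tauh k p u" "tauh n q v" n q i]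
      comp_smult_left[of "tauh k p (bas a)" k p "tauh n q v" n q i c]
    by (simp add: tauh_add tauh_scl smult_simps)
qed

text \<open>The value of an expression depends on its combination of trees only. In the free operad
  this shows that expressions with the same image under \<open>psi\<close> are equal.\<close>

lemma interp_eq_tauh: "twf gdeg t \<Longrightarrow> interp t = tauh (tar t) (tdeg gdeg t) (psi t)"
proof (induction t)
  case (Gen g)
  have "Nd g (Lf 1) (Lf 2) \<in> Mon 2 (gdeg g)" by (auto simp: Mon_def)
  moreover have "label_pos [1, 2] = id"
    by (rule label_pos_unique[where n = 2, symmetric]) (auto simp: permutes_id nth_Cons')
  moreover have "pcomp P (pcomp P (gen g) 1 (ounit P)) 2 (ounit P) = gen g"
    using unit_right[OF gen_closed, of 1] unit_right[OF gen_closed, of 2] by simp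
  ultimately show ?case
    using act_id[OF gen_closed] by (simp add: tauh_bas tau_def numeral_2_eq_2)
next
  case Unit
  have "Lf 1 \<in> Mon 1 0" by (auto simp: Mon_def)
  moreover have "label_pos [1] = id"
    by (rule label_pos_unique[where n = 1, symmetric]) (auto simp: permutes_id)
  ultimately show ?case using act_id[OF unit_closed] by (simp add: tauh_bas tau_def)
next
  case (Comp s i t)
  then show ?case using tauh_comp[OF keys_psi keys_psi, of s t i] by simp
next
  case (Act t \<sigma>)
  then show ?case using tauh_ren[of \<sigma> "tar t"] by simp
qed (simp_all add: tauh_add tauh_scl)

end

section \<open>Permuting labels into consecutive blocks\<close>

lemma label_pos_blocks:
  assumes "distinct (A @ B @ C)" "set (A @ B @ C) = {1..n}"
  defines "\<pi> \<equiv> label_pos (A @ B @ C)"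
  shows "\<pi> permutes {1..n}" "map \<pi> A = [1..<length A + 1]"
    "map \<pi> B = map (\<lambda>x. x + length A) [1..<length B + 1]"
    "map \<pi> C = map (\<lambda>x. x + (length A + length B)) [1..<length C + 1]"
proof -
  show "\<pi> permutes {1..n}" unfolding \<pi>_def by (rule label_pos_permutes[OF assms(1,2)])
  have m: "map (label_pos A) A = [1..<length A + 1]" "map (label_pos B) B = [1..<length B + 1]"
    "map (label_pos C) C = [1..<length C + 1]"
    using assms(1) label_pos_map[of A] label_pos_map[of B] label_pos_map[of C] by (simp_all del: upt_Suc)
  have "map \<pi> A = map (label_pos A) A"
    using assms(1) by (auto simp: \<pi>_def label_pos_append)
  then show "map \<pi> A = [1..<length A + 1]" unfolding m .
  have "map \<pi> B = map (\<lambda>x. x + length A) (map (label_pos B) B)"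
    using assms(1) by (auto simp: \<pi>_def label_pos_append)
  then show "map \<pi> B = map (\<lambda>x. x + length A) [1..<length B + 1]" unfolding m .
  have "map \<pi> C = map (\<lambda>x. x + (length A + length B)) (map (label_pos C) C)"
    using assms(1) by (auto simp: \<pi>_def label_pos_append)
  then show "map \<pi> C = map (\<lambda>x. x + (length A + length B)) [1..<length C + 1]" unfolding m .
qed

lemma relabel_block:
  assumes "map \<pi> (leaves m) = map (\<lambda>x. x + k) [1..<length (leaves m) + 1]"
  obtains m' where "relabel \<pi> m = relabel (\<lambda>x. x + k) m'" "leaves m' = [1..<length (leaves m) + 1]"
proof
  have "\<pi> x \<ge> k" if "x \<in> set (leaves m)" for x
  proof -
    have "\<pi> x \<in> set (map \<pi> (leaves m))" using that by simp
    then show ?thesis unfolding assms by auto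
  qed
  then show "relabel \<pi> m = relabel (\<lambda>x. x + k) (relabel (\<lambda>x. \<pi> x - k) m)"
    by (auto intro!: relabel_cong)
  have "leaves (relabel (\<lambda>x. \<pi> x - k) m) = map (\<lambda>x. x - k) (map \<pi> (leaves m))"
    by simp
  then show "leaves (relabel (\<lambda>x. \<pi> x - k) m) = [1..<length (leaves m) + 1]"
    unfolding assms by (simp add: comp_def)
qed

context graded_generators
begin

lemma Mon_upt: "leaves m = [1..<n + 1] \<Longrightarrow> m \<in> Mon n (mdeg m)"
  by (auto simp: Mon_def)

text \<open>In a composite the inputs of the factors form consecutive blocks. A permutation of the
  labels brings the subtrees of an arbitrary labelled tree into this form, so that they can be split
  off by partial composition.\<close>

lemma consecutive_blocks:
  assumes "distinct (leaves a @ leaves b @ leaves c)" "set (leaves a @ leaves b @ leaves c) = {1..n}"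
  obtains \<pi> a' b' c' where "\<pi> permutes {1..n}"
    "relabel \<pi> a = a'" "a' \<in> Mon (length (leaves a)) (mdeg a)"
    "relabel \<pi> b = relabel (\<lambda>x. x + length (leaves a)) b'" "b' \<in> Mon (length (leaves b)) (mdeg b)"
    "relabel \<pi> c = relabel (\<lambda>x. x + (length (leaves a) + length (leaves b))) c'"
    "c' \<in> Mon (length (leaves c)) (mdeg c)"
proof -
  define \<pi> where "\<pi> = label_pos (leaves a @ leaves b @ leaves c)"
  note B = label_pos_blocks[OF assms, folded \<pi>_def]
  obtain b' where b: "relabel \<pi> b = relabel (\<lambda>x. x + length (leaves a)) b'" "leaves b' = [1..<length (leaves b) + 1]"
    using relabel_block[OF B(3)] .
  obtain c' where c: "relabel \<pi> c = relabel (\<lambda>x. x + (length (leaves a) + length (leaves b))) c'"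
    "leaves c' = [1..<length (leaves c) + 1]"
    using relabel_block[OF B(4)] .
  have "mdeg b' = mdeg b" "mdeg c' = mdeg c"
    using arg_cong[OF b(1), of mdeg] arg_cong[OF c(1), of mdeg] by simp_all
  moreover have "relabel \<pi> a \<in> Mon (length (leaves a)) (mdeg a)"
    using Mon_upt[of "relabel \<pi> a" "length (leaves a)"] B(2) by simp
  ultimately show thesis using that[OF B(1) HOL.refl _ b(1) _ c(1)] Mon_upt[OF b(2)] Mon_upt[OF c(2)] by simp
qed

lemma consecutive_blocks2:
  assumes "distinct (leaves a @ leaves b)" "set (leaves a @ leaves b) = {1..n}"
  obtains \<pi> a' b' where "\<pi> permutes {1..n}"
    "relabel \<pi> a = a'" "a' \<in> Mon (length (leaves a)) (mdeg a)"
    "relabel \<pi> b = relabel (\<lambda>x. x + length (leaves a)) b'" "b' \<in> Mon (length (leaves b)) (mdeg b)"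
proof -
  define \<pi> where "\<pi> = label_pos (leaves a @ leaves b @ [])"
  note B = label_pos_blocks[of "leaves a" "leaves b" "[]" n, folded \<pi>_def]
  obtain b' where b: "relabel \<pi> b = relabel (\<lambda>x. x + length (leaves a)) b'" "leaves b' = [1..<length (leaves b) + 1]"
    using relabel_block[OF B(3)] assms by auto
  have "mdeg b' = mdeg b" using arg_cong[OF b(1), of mdeg] by simp
  moreover have "relabel \<pi> a \<in> Mon (length (leaves a)) (mdeg a)"
    using Mon_upt[of "relabel \<pi> a" "length (leaves a)"] B(2) assms by simp
  moreover have "\<pi> permutes {1..n}" using B(1) assms by simp
  ultimately show thesis using that[OF _ HOL.refl _ b(1)] Mon_upt[OF b(2)] by simp
qed

lemma cmp_corolla:
  "cmp p k 1 (bas (Nd g (Lf 1) (Lf 2))) u = nd g u (bas (Lf (k + 1)))"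
  "cmp p k 1 (bas (Nd g (Lf 2) (Lf 1))) u = nd g (bas (Lf (k + 1))) u"
  by (simp_all add: cmp_def der_Nd insertion_def shift_def)

lemma subst_below:
  assumes "keys u \<subseteq> Mon k p" "k < i"
  shows "subst q (shift n i) (insertion i v) u = 0" "ren (shift n i) u = u"
proof -
  have l: "j < i" if "m \<in> keys u" "j \<in> set (leaves m)" for m j
    using that assms by (auto simp: Mon_def)
  show "subst q (shift n i) (insertion i v) u = 0"
    by (rule subst_zero) (use l in \<open>auto simp: insertion_def\<close>)
  have "ren (shift n i) u = ren (\<lambda>j. j) u"
    by (rule ren_cong) (use l in \<open>auto simp: shift_def\<close>)
  then show "ren (shift n i) u = u" by simp
qed

lemma cmp_nd_right:
  assumes "keys u \<subseteq> Mon k p"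
  shows "cmp q n (k + 1) (nd g u (bas (Lf (k + 1)))) v = nd g u (ren (\<lambda>x. x + k) v)"
  using subst_below[OF assms, of "k + 1"] by (simp add: cmp_def insertion_def)

text \<open>Here the inserted combination stands to the left of \<open>u\<close> and has to pass it,
  hence \<open>eps q u\<close>; in \<open>cmp_nd_right\<close> nothing stands to its right.\<close>

lemma cmp_nd_left:
  assumes "keys u \<subseteq> Mon k p"
  shows "cmp q n (k + 1) (nd g (bas (Lf (k + 1))) u) v = nd g (ren (\<lambda>x. x + k) v) (eps q u)"
  using subst_below[OF assms, of "k + 1"] subst_below(2)[of "eps q u" k p "k + 1" n]
  by (simp add: cmp_def insertion_def flip: eps_ren)

end

section \<open>Tree relations evaluate to zero\<close>

context operad_generators
begin

lemma gen_eq_tauh: "gen g = tauh 2 (gdeg g) (bas (Nd g (Lf 1) (Lf 2)))"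
  using interp_eq_tauh[of "Gen g"] by simp

lemma corolla_Mon: "Nd g (Lf 1) (Lf 2) \<in> Mon 2 (gdeg g)" "Nd g (Lf 2) (Lf 1) \<in> Mon 2 (gdeg g)"
  by (auto simp: Mon_def)

lemma tauh_inst2:
  assumes r: "keys r \<subseteq> Mon 2 e" and a: "keys u \<subseteq> Mon k p" and b: "keys v \<subseteq> Mon n q"
  shows "tauh (k + n) (e + p + q) (cmp q n (k + 1) (cmp p k 1 r u) v) =
    pcomp P (pcomp P (tauh 2 e r) 1 (tauh k p u)) (k + 1) (tauh n q v)"
  using tauh_comp[OF r a, of 1] keys_cmp[OF r a, of 1]
    tauh_comp[of "cmp p k 1 r u" "k + 1" "e + p" v n q "k + 1"] b by simp

lemma tauh_nd:
  assumes a: "keys u \<subseteq> Mon k p" and b: "keys v \<subseteq> Mon n q"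
  shows "tauh (k + n) (gdeg g + p + q) (nd g u (ren (\<lambda>x. x + k) v)) =
    pcomp P (pcomp P (gen g) 1 (tauh k p u)) (k + 1) (tauh n q v)"
proof -
  have "keys (bas (Nd g (Lf 1) (Lf 2)) :: ('k, 'g) lin) \<subseteq> Mon 2 (gdeg g)" using corolla_Mon by simp
  from tauh_inst2[OF this a b] show ?thesis
    by (simp add: cmp_corolla[simplified] cmp_nd_right[OF a, simplified] gen_eq_tauh del: nd_bas)
qed

lemma tauh_outside: "keys w \<inter> Mon n d = {} \<Longrightarrow> tauh n d w = \<zero>\<^bsub>cpt P n d\<^esub>"
  by (simp add: tauh_def)

text \<open>Relabelling by a permutation is invertible and corresponds to the action, so vanishing
  may be tested after any convenient permutation.\<close>

lemma tauh_zero_permute: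
  assumes "\<pi> permutes {1..n}" "tauh n d (ren \<pi> u) = \<zero>\<^bsub>cpt P n d\<^esub>"
  shows "tauh n d u = \<zero>\<^bsub>cpt P n d\<^esub>"
proof -
  have "ren (pinv \<pi>) (ren \<pi> u) = u"
    using permutes_inverses[OF assms(1)] by simp
  then show ?thesis using tauh_ren[OF assms(1), of d "ren \<pi> u"] assms act_zero by simp
qed

lemma gen_comp_closed:
  "y \<in> ops P k p \<Longrightarrow> pcomp P (gen g) 1 y \<in> ops P (k + 1) (gdeg g + p)"
  using comp_closed[OF gen_closed, of y k p 1 g] by simp

lemma gen_comp_zero: "pcomp P (gen g) 1 \<zero>\<^bsub>cpt P k p\<^esub> = \<zero>\<^bsub>cpt P (k + 1) (gdeg g + p)\<^esub>"
  using comp_zero_right[where a = "gen g" and m = 2 and p = "gdeg g" and i = 1 and n = k and q = p] gen_closed[of g]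
  by simp

lemma comp_nd_zero:
  assumes "z \<in> ops P n q"
  shows "pcomp P \<zero>\<^bsub>cpt P (k + 1) p\<^esub> (k + 1) z = \<zero>\<^bsub>cpt P (k + n) (p + q)\<^esub>"
  using comp_zero_left[OF assms, where m = "k + 1" and p = p and i = "k + 1"] by simp

text \<open>True for every \<open>u\<close>: as the right subtree already occupies the labels from
  \<open>k + 1\<close> to \<open>k + n\<close>, a tree of \<open>u\<close> outside of
  \<open>Mon k p\<close> makes the whole tree non-multilinear or of the wrong degree, and then both
  sides vanish.\<close>

lemma tauh_nd_left:
  assumes m: "m \<in> Mon n q"
  shows "tauh (k + n) (gdeg g + p + q) (nd g u (bas (relabel (\<lambda>x. x + k) m))) =
    pcomp P (pcomp P (gen g) 1 (tauh k p u)) (k + 1) (tau m)"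
proof -
  have c1: "1 \<in> {1..2::nat}" "k + 1 \<in> {1..k + 1}" by auto
  note t = tau_closed[OF m]
  show ?thesis
  proof (induction u rule: lin_induct)
    case zero
    show ?case
      using gen_comp_zero[of g k p] comp_nd_zero[OF t, of k "gdeg g + p"] by simp
  next
    case (add c a u)
    have "tauh (k + n) (gdeg g + p + q) (nd g (bas a) (bas (relabel (\<lambda>x. x + k) m))) =
      pcomp P (pcomp P (gen g) 1 (tauh k p (bas a))) (k + 1) (tau m)"
    proof (cases "a \<in> Mon k p")
      case True
      then show ?thesis using tauh_nd[of "bas a" k p "bas m" n q g] m by (simp add: tauh_bas)
    next
      case False
      have "Nd g a (relabel (\<lambda>x. x + k) m) \<notin> Mon (k + n) (gdeg g + p + q)"
      proof
        assume *: "Nd g a (relabel (\<lambda>x. x + k) m) \<in> Mon (k + n) (gdeg g + p + q)"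
        have "set (leaves (relabel (\<lambda>x. x + k) m)) = {k + 1..k + n}"
          using MonD(2)[OF m] by (simp add: image_add_atLeastAtMost)
        then have "set (leaves a) = {1..k + n} - {k + 1..k + n}"
          using * by (auto simp: Mon_def)
        then have "a \<in> Mon k p" using * MonD(3)[OF m] by (auto simp: Mon_def)
        then show False using False by simp
      qed
      then show ?thesis
        using False gen_comp_zero[of g k p] comp_nd_zero[OF t, of k "gdeg g + p"]
        by (simp add: tauh_bas)
    qed
    moreover have "pcomp P (gen g) 1 (c \<odot>\<^bsub>cpt P k p\<^esub> x \<oplus>\<^bsub>cpt P k p\<^esub> y) =
        c \<odot>\<^bsub>cpt P (k + 1) (gdeg g + p)\<^esub> pcomp P (gen g) 1 x \<oplus>\<^bsub>cpt P (k + 1) (gdeg g + p)\<^esub> pcomp P (gen g) 1 y"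
      if "x \<in> ops P k p" "y \<in> ops P k p" for x y
      using comp_add_right[OF gen_closed[of g] _ that(2) c1(1), of "c \<odot>\<^bsub>cpt P k p\<^esub> x"]
        comp_smult_right[OF gen_closed[of g] that(1) c1(1), of c] that by (simp add: smult_simps)
    moreover have "pcomp P (c \<odot>\<^bsub>cpt P (k + 1) e\<^esub> x \<oplus>\<^bsub>cpt P (k + 1) e\<^esub> y) (k + 1) (tau m) =
        c \<odot>\<^bsub>cpt P (k + n) (e + q)\<^esub> pcomp P x (k + 1) (tau m) \<oplus>\<^bsub>cpt P (k + n) (e + q)\<^esub> pcomp P y (k + 1) (tau m)"
      if "x \<in> ops P (k + 1) e" "y \<in> ops P (k + 1) e" for x y e
      using comp_add_left[OF _ that(2) t c1(2), of "c \<odot>\<^bsub>cpt P (k + 1) e\<^esub> x"]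
        comp_smult_left[OF that(1) t c1(2), of c] that by (simp add: smult_simps)
    ultimately show ?case
      using add gen_comp_closed[of _ k p g] by (simp add: tauh_add tauh_scl)
  qed
qed

lemma tauh_nd_right:
  assumes m: "m \<in> Mon k p"
  shows "tauh (k + n) (gdeg g + p + q) (nd g (bas m) u) =
    pcomp P (pcomp P (gen g) 1 (tau m)) (k + 1) (tauh n q (ren (\<lambda>x. x - k) u))"
proof -
  have c1: "k + 1 \<in> {1..k + 1}" by auto
  note t = gen_comp_closed[OF tau_closed[OF m], of g]
  show ?thesis
  proof (induction u rule: lin_induct)
    case zero
    show ?case
      using comp_zero_right[OF t c1(1), where n = n and q = q] by simp
  next
    case (add c a u)
    have "tauh (k + n) (gdeg g + p + q) (nd g (bas m) (bas a)) =
      pcomp P (pcomp P (gen g) 1 (tau m)) (k + 1) (tauh n q (ren (\<lambda>x. x - k) (bas a)))"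
    proof (cases "relabel (\<lambda>x. x - k) a \<in> Mon n q")
      case True
      have "x > k" if x: "x \<in> set (leaves a)" for x
      proof -
        have "x - k \<in> set (leaves (relabel (\<lambda>x. x - k) a))" using x by simp
        then have "x - k \<in> {1..n}" using MonD(2)[OF True] by blast
        then show ?thesis by auto
      qed
      then have "relabel (\<lambda>x. x + k) (relabel (\<lambda>x. x - k) a) = relabel (\<lambda>x. x) a"
        unfolding relabel_relabel by (intro relabel_cong) (simp add: less_imp_le)
      then show ?thesis
        using True tauh_nd[of "bas m" k p "bas (relabel (\<lambda>x. x - k) a)" n q g] m by (simp add: tauh_bas)
    next
      case False
      have "Nd g m a \<notin> Mon (k + n) (gdeg g + p + q)"
      proof
        assume *: "Nd g m a \<in> Mon (k + n) (gdeg g + p + q)"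
        then have s: "set (leaves a) = {1..k + n} - {1..k}"
          using MonD(2)[OF m] by (auto simp: Mon_def)
        moreover have "(\<lambda>x. x - k) ` ({1..k + n} - {1..k}) = {1..n}"
        proof (intro equalityI subsetI)
          fix x assume "x \<in> {1..n}"
          then show "x \<in> (\<lambda>x. x - k) ` ({1..k + n} - {1..k})" by (intro image_eqI[of _ _ "x + k"]) auto
        qed auto
        moreover have "inj_on (\<lambda>x. x - k) (set (leaves a))" unfolding s by (auto simp: inj_on_def)
        ultimately have "relabel (\<lambda>x. x - k) a \<in> Mon n q"
          using * MonD(3)[OF m] by (auto simp: Mon_def distinct_map)
        then show False using False by simp
      qed
      then show ?thesis using False comp_zero_right[OF t c1(1), where n = n and q = q] by (simp add: tauh_bas)
    qed
    moreover have "pcomp P (pcomp P (gen g) 1 (tau m)) (k + 1) (c \<odot>\<^bsub>cpt P n q\<^esub> x \<oplus>\<^bsub>cpt P n q\<^esub> y) =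
        c \<odot>\<^bsub>cpt P (k + n) (gdeg g + p + q)\<^esub> pcomp P (pcomp P (gen g) 1 (tau m)) (k + 1) x
        \<oplus>\<^bsub>cpt P (k + n) (gdeg g + p + q)\<^esub> pcomp P (pcomp P (gen g) 1 (tau m)) (k + 1) y"
      if "x \<in> ops P n q" "y \<in> ops P n q" for x y
      using comp_add_right[OF t _ that(2) c1(1), of "c \<odot>\<^bsub>cpt P n q\<^esub> x"]
        comp_smult_right[OF t that(1) c1(1), of c] that by (simp add: smult_simps)
    ultimately show ?case
      using add by (simp add: tauh_add tauh_scl)
  qed
qed

text \<open>Inside a context the labels of \<open>u\<close> are an arbitrary subset and its arity is
  not the total one, so the vanishing of \<open>u\<close> is assumed for all relabellings, arities
  and degrees.\<close>

lemma tauh_context_left: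
  assumes "\<And>n d f. tauh n d (ren f u) = \<zero>\<^bsub>cpt P n d\<^esub>"
  shows "tauh n d (nd g u (bas m)) = \<zero>\<^bsub>cpt P n d\<^esub>"
proof (cases "distinct (leaves m) \<and> set (leaves m) \<subseteq> {1..n}")
  case True
  \<comment> \<open>\<open>S\<close> lists the labels that are left for \<open>u\<close>; the
    permutation moves them to the front and the labels of \<open>m\<close> behind them.\<close>
  define S where "S = sorted_list_of_set ({1..n} - set (leaves m))"
  define \<pi> where "\<pi> = label_pos (S @ leaves m @ [])"
  have S: "distinct (S @ leaves m @ [])" "set (S @ leaves m @ []) = {1..n}"
    using True by (auto simp: S_def)
  note B = label_pos_blocks[OF S, folded \<pi>_def]
  obtain m' where m': "relabel \<pi> m = relabel (\<lambda>x. x + length S) m'" "leaves m' = [1..<length (leaves m) + 1]"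
    using relabel_block[OF B(3)] .
  have M: "m' \<in> Mon (length (leaves m)) (mdeg m)"
    using Mon_upt[OF m'(2)] arg_cong[OF m'(1), of mdeg] by simp
  have n: "n = length S + length (leaves m)"
    using S distinct_card[OF S(1)] by simp
  let ?p = "d - gdeg g - mdeg m"
  have "tauh n d (ren \<pi> (nd g u (bas m))) =
      pcomp P (pcomp P (gen g) 1 (tauh (length S) ?p (ren \<pi> u))) (length S + 1) (tau m')"
    using tauh_nd_left[OF M, of "length S" g ?p "ren \<pi> u"] by (simp add: m'(1) n)
  also have "\<dots> = \<zero>\<^bsub>cpt P n d\<^esub>"
    using gen_comp_zero[of g "length S" ?p] comp_nd_zero[OF tau_closed[OF M], of "length S" "gdeg g + ?p"]
    by (simp add: assms n)
  finally show ?thesis by (rule tauh_zero_permute[OF B(1)])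
next
  case False
  have "keys (nd g u (bas m)) \<inter> Mon n d = {}"
    using keys_nd[of g u "bas m"] False by (fastforce simp: Mon_def)
  then show ?thesis by (rule tauh_outside)
qed

lemma tauh_context_right:
  assumes "\<And>n d f. tauh n d (ren f u) = \<zero>\<^bsub>cpt P n d\<^esub>"
  shows "tauh n d (nd g (bas m) u) = \<zero>\<^bsub>cpt P n d\<^esub>"
proof (cases "distinct (leaves m) \<and> set (leaves m) \<subseteq> {1..n}")
  case True
  define S where "S = sorted_list_of_set ({1..n} - set (leaves m))"
  define \<pi> where "\<pi> = label_pos (leaves m @ S @ [])"
  have S: "distinct (leaves m @ S @ [])" "set (leaves m @ S @ []) = {1..n}"
    using True by (auto simp: S_def)
  note B = label_pos_blocks[OF S, folded \<pi>_def]
  have M: "relabel \<pi> m \<in> Mon (length (leaves m)) (mdeg m)"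
    using Mon_upt[of "relabel \<pi> m" "length (leaves m)"] B(2) by simp
  have n: "n = length (leaves m) + length S"
    using S distinct_card[OF S(1)] by simp
  let ?q = "d - gdeg g - mdeg m" and ?k = "length (leaves m)"
  have c: "?k + 1 \<in> {1..?k + 1}" by auto
  have "tauh n d (ren \<pi> (nd g (bas m) u)) =
      pcomp P (pcomp P (gen g) 1 (tau (relabel \<pi> m))) (?k + 1) (tauh (length S) ?q (ren (\<lambda>x. x - ?k) (ren \<pi> u)))"
    using tauh_nd_right[OF M, of "length S" g ?q "ren \<pi> u"] by (simp add: n)
  also have "\<dots> = \<zero>\<^bsub>cpt P n d\<^esub>"
    using comp_zero_right[OF gen_comp_closed[OF tau_closed[OF M], of g] c, where n = "length S" and q = ?q]
    by (simp add: assms n)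
  finally show ?thesis by (rule tauh_zero_permute[OF B(1)])
next
  case False
  have "keys (nd g (bas m) u) \<inter> Mon n d = {}"
    using keys_nd[of g "bas m" u] False by (fastforce simp: Mon_def)
  then show ?thesis by (rule tauh_outside)
qed

lemma tauh_swap:
  "tauh n d (bas (Nd g a b) - (fst (sw g) * sg (mdeg a * mdeg b)) \<star> bas (Nd (snd (sw g)) b a)) = \<zero>\<^bsub>cpt P n d\<^esub>"
    (is "tauh n d ?r = _")
proof (cases "distinct (leaves a @ leaves b) \<and> set (leaves a @ leaves b) = {1..n} \<and> d = gdeg g + mdeg a + mdeg b")
  case True
  then obtain \<pi> a' b' where \<pi>: "\<pi> permutes {1..n}"
    "relabel \<pi> a = a'" "a' \<in> Mon (length (leaves a)) (mdeg a)"
    "relabel \<pi> b = relabel (\<lambda>x. x + length (leaves a)) b'" "b' \<in> Mon (length (leaves b)) (mdeg b)"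
    using consecutive_blocks2[of a b n] by metis
  let ?k = "length (leaves a)" and ?h = "snd (sw g)" and ?c = "fst (sw g)"
  have n: "n = ?k + length (leaves b)"
    using True distinct_card[of "leaves a @ leaves b"] by simp
  \<comment> \<open>The swap relator at two bare leaves. Inserting the two subtrees, relabelled into
    consecutive blocks, recovers the general relator.\<close>
  define r0 :: "('k, 'g) lin" where "r0 = bas (Nd g (Lf 1) (Lf 2)) - ?c \<star> bas (Nd ?h (Lf 2) (Lf 1))"
  have K: "keys r0 \<subseteq> Mon 2 (gdeg g)"
    using keys_diff_subset[of "bas (Nd g (Lf 1) (Lf 2))" "?c \<star> bas (Nd ?h (Lf 2) (Lf 1)) :: ('k, 'g) lin"]
      keys_scl_subset[of ?c "bas (Nd ?h (Lf 2) (Lf 1)) :: ('k, 'g) lin"] corolla_Mon[of g] corolla_Mon[of ?h]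
    by (auto simp: r0_def gdeg_sw split: if_splits)
  have t12: "transpose 1 2 permutes {1..2::nat}" by (rule permutes_swap_id) auto
  have inv: "pinv (transpose 1 2) = (transpose 1 2 :: nat \<Rightarrow> nat)"
    by (rule inv_unique_comp) (simp_all add: fun_eq_iff)
  have hc: "gen ?h \<in> ops P 2 (gdeg g)" using gen_closed[of ?h] by (simp add: gdeg_sw)
  \<comment> \<open>The transposition is an involution; evaluating its first application by the
    prescribed symmetry shows that \<open>r0\<close> evaluates to zero.\<close>
  have "gen g = act P (act P (gen g) (transpose 1 2)) (transpose 1 2)"
    using act_act[OF gen_closed t12 t12, of g] act_id[OF gen_closed, of g] by simp
  also have "\<dots> = ?c \<odot>\<^bsub>cpt P 2 (gdeg g)\<^esub> act P (gen ?h) (transpose 1 2)"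
    by (simp only: gen_act[of g] act_smult[OF hc t12])
  also have "act P (gen ?h) (transpose 1 2) = tauh 2 (gdeg g) (bas (Nd ?h (Lf 2) (Lf 1)))"
    unfolding gen_eq_tauh[of ?h] gdeg_sw tauh_ren[OF t12] inv by simp
  finally have "tauh 2 (gdeg g) r0 = \<zero>\<^bsub>cpt P 2 (gdeg g)\<^esub>"
    unfolding r0_def tauh_diff gen_eq_tauh[symmetric] tauh_scl
    by (metis gen_closed md.r_neg md.minus_eq)
  moreover have A: "keys (bas a' :: ('k, 'g) lin) \<subseteq> Mon ?k (mdeg a)"
    and B: "keys (bas b' :: ('k, 'g) lin) \<subseteq> Mon (length (leaves b)) (mdeg b)"
    using \<pi> by auto
  ultimately have "tauh n d (cmp (mdeg b) (length (leaves b)) (?k + 1) (cmp (mdeg a) ?k 1 r0 (bas a')) (bas b')) = \<zero>\<^bsub>cpt P n d\<^esub>"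
    using tauh_inst2[OF K A B] comp_zero_left[OF tauh_closed[of ?k "mdeg a" "bas a'"], where i = 1 and m = 2 and p = "gdeg g"]
      comp_nd_zero[OF tauh_closed[of "length (leaves b)" "mdeg b" "bas b'"], of ?k "gdeg g + mdeg a"] True
    by (simp add: n)
  moreover have "cmp (mdeg b) (length (leaves b)) (?k + 1) (cmp (mdeg a) ?k 1 r0 (bas a')) (bas b') =
      nd g (bas a') (bas (relabel \<pi> b)) - (?c * sg (mdeg a * mdeg b)) \<star> nd ?h (bas (relabel \<pi> b)) (bas a')"
    unfolding r0_def cmp_linear cmp_corolla cmp_nd_right[OF A] cmp_nd_left[OF A] \<pi>(4)
    using MonD(3)[OF \<pi>(3)] by (simp add: eps_bas mult.commute)
  ultimately have "tauh n d (ren \<pi> ?r) = \<zero>\<^bsub>cpt P n d\<^esub>"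
    using \<pi>(2) by simp
  then show ?thesis by (rule tauh_zero_permute[OF \<pi>(1)])
next
  case False
  have "Nd g a b \<notin> Mon n d" "Nd (snd (sw g)) b a \<notin> Mon n d"
    using False by (auto simp: Mon_def gdeg_sw)
  then show ?thesis by (simp add: tauh_diff tauh_scl tauh_bas md.minus_eq)
qed

text \<open>The induction is carried out for all relabellings, arities and degrees at once, since
  this is what the two context lemmas demand of the relation inside.\<close>

theorem tauh_rel:
  assumes base: "\<And>n d f r. r \<in> B \<Longrightarrow> tauh n d (ren f r) = \<zero>\<^bsub>cpt P n d\<^esub>" and u: "u \<in> rel B"
  shows "tauh n d (ren f u) = \<zero>\<^bsub>cpt P n d\<^esub>"
  using u
proof (induction arbitrary: n d f rule: rel.induct)
  case (rel_base r)
  then show ?case by (rule base)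
next
  case (rel_swap g a b)
  then show ?case using tauh_swap[of n d g "relabel f a" "relabel f b"] by simp
next
  case (rel_add u v)
  then show ?case by (simp add: tauh_add)
next
  case (rel_scl u c)
  then show ?case using smult_simps(1)[of "\<zero>\<^bsub>cpt P n d\<^esub>" n d c] by (simp add: tauh_scl)
next
  case (rel_left_bas u g m)
  then show ?case using tauh_context_left[of "ren f u" n d g "relabel f m"] by simp
next
  case (rel_right_bas u g m)
  then show ?case using tauh_context_right[of "ren f u" n d g "relabel f m"] by simp
qed

lemma tauh_inst3:
  assumes r: "keys r \<subseteq> Mon 3 e" "tauh 3 e r = \<zero>\<^bsub>cpt P 3 e\<^esub>"
    and a: "keys u \<subseteq> Mon k p" and b: "keys v \<subseteq> Mon l q" and c: "keys w \<subseteq> Mon n s"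
  shows "tauh (k + l + n) (e + p + q + s) (cmp s n (k + l + 1) (cmp q l (k + 1) (cmp p k 1 r u) v) w) =
    \<zero>\<^bsub>cpt P (k + l + n) (e + p + q + s)\<^esub>"
proof -
  have 1: "keys (cmp p k 1 r u) \<subseteq> Mon (k + 2) (e + p)"
    "tauh (k + 2) (e + p) (cmp p k 1 r u) = \<zero>\<^bsub>cpt P (k + 2) (e + p)\<^esub>"
    using keys_cmp[OF r(1) a, of 1] tauh_comp[OF r(1) a, of 1]
      comp_zero_left[OF tauh_closed[of k p u], where i = 1 and m = 3 and p = e] r(2)
    by (simp_all add: numeral_3_eq_3)
  have 2: "keys (cmp q l (k + 1) (cmp p k 1 r u) v) \<subseteq> Mon (k + l + 1) (e + p + q)"
    "tauh (k + l + 1) (e + p + q) (cmp q l (k + 1) (cmp p k 1 r u) v) = \<zero>\<^bsub>cpt P (k + l + 1) (e + p + q)\<^esub>"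
    using keys_cmp[OF 1(1) b, of "k + 1"] tauh_comp[OF 1(1) b, of "k + 1"]
      comp_zero_left[OF tauh_closed[of l q v], where i = "k + 1" and m = "k + 2" and p = "e + p"] 1(2)
    by (simp_all add: add_ac)
  show ?thesis
    using tauh_comp[OF 2(1) c, of "k + l + 1"]
      comp_nd_zero[OF tauh_closed[of n s w], of "k + l" "e + p + q"] 2(2)
    by (simp add: add_ac)
qed

end

context binary_generators
begin

primrec planar_term :: "'g mon \<Rightarrow> ('k, 'g) opterm" where
  "planar_term (Lf j) = Unit"
| "planar_term (Nd g a b) = Comp (Comp (Gen g) 1 (planar_term a)) (length (leaves a) + 1) (planar_term b)"

lemma planar_term_wf: "wf (planar_term m) (length (leaves m)) (mdeg m)"
  by (induction m) auto

lemma psi_planar_term: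
  "distinct (leaves m) \<Longrightarrow> psi (planar_term m) = bas (relabel (label_pos (leaves m)) m)"
proof (induction m)
  case (Lf j)
  then show ?case by (simp add: label_pos_def)
next
  case (Nd g a b)
  let ?k = "length (leaves a)"
  have A: "keys (psi (planar_term a)) \<subseteq> Mon ?k (mdeg a)"
    using keys_psi[of "planar_term a"] planar_term_wf[of a] by simp
  have "psi (planar_term (Nd g a b)) = nd g (psi (planar_term a)) (ren (\<lambda>x. x + ?k) (psi (planar_term b)))"
    using planar_term_wf[of a] planar_term_wf[of b]
    by (simp add: cmp_corolla(1)[simplified] cmp_nd_right[OF A, simplified] del: nd_bas)
  also have "\<dots> = nd g (bas (relabel (label_pos (leaves a)) a)) (bas (relabel (\<lambda>x. label_pos (leaves b) x + ?k) b))"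
    using Nd by simp
  also have "relabel (label_pos (leaves a)) a = relabel (label_pos (leaves (Nd g a b))) a"
    using Nd.prems by (intro relabel_cong) (simp add: label_pos_append)
  also have "relabel (\<lambda>x. label_pos (leaves b) x + ?k) b = relabel (label_pos (leaves (Nd g a b))) b"
    using Nd.prems by (intro relabel_cong) (auto simp: label_pos_append)
  finally show ?case by simp
qed

text \<open>A multilinear tree is its planar expression acted on by the position permutation. Thus
  statements about combinations can be moved to expressions, where congruence and generated ideals
  are defined.\<close>

lemma realize:
  assumes "keys w \<subseteq> Mon n d"
  obtains t where "twf gdeg t" "tar t = n" "tdeg gdeg t = d" "psi t = w"
proof -
  have "\<exists>t. wf t n d \<and> psi t = w" using assms
  proof (induction w rule: keys_induct)
    case zero
    show ?case by (rule exI[of _ "Zero n d"]) simp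
  next
    case (add c m v)
    then obtain t where t: "wf t n d" "psi t = v" by blast
    have p: "label_pos (leaves m) permutes {1..n}"
      using MonD[OF add(1)] by (intro label_pos_permutes)
    have "psi (Act (planar_term m) (label_pos (leaves m))) = bas m"
      using psi_planar_term[of m] MonD[OF add(1)] permutes_inverses[OF p] by simp
    then show ?case
      using t p planar_term_wf[of m] MonD[OF add(1)]
      by (intro exI[of _ "Add (Scale c (Act (planar_term m) (label_pos (leaves m)))) t"]) simp
  qed
  then show thesis using that by blast
qed

end

section \<open>Operads given by generators and relations\<close>

context operad_generators
begin

text \<open>A ternary relator \<open>F\<close>, given as a function of its arguments and of the
  exchange sign, vanishes at all trees once it vanishes at the leaves 1, 2, 3: the subtrees are
  inserted by composition after moving their labels into blocks. If the labels are not those of an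
  operation of arity \<open>n\<close>, nothing survives evaluation. This serves the pre-Lie, the
  mixed and the Jacobi relator alike.\<close>

lemma tauh_vanish3:
  assumes r: "keys r \<subseteq> Mon 3 e" "tauh 3 e r = \<zero>\<^bsub>cpt P 3 e\<^esub>"
    and inst: "\<And>k p a l q b j s c. keys a \<subseteq> Mon k p \<Longrightarrow> keys b \<subseteq> Mon l q \<Longrightarrow>
      cmp s j (k + l + 1) (cmp q l (k + 1) (cmp p k 1 r a) b) c =
        F (sg (q * s)) a (ren (\<lambda>x. x + k) b) (ren (\<lambda>x. x + (k + l)) c)"
    and ren: "\<And>f x a b c. ren f (F x a b c) = F x (ren f a) (ren f b) (ren f c)"
    and keys: "\<And>m x. m \<in> keys (F x (bas a) (bas b) (bas c)) \<Longrightarrow>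
      mset (leaves m) = mset (leaves a) + mset (leaves b) + mset (leaves c) \<and> mdeg m = e + mdeg a + mdeg b + mdeg c"
  shows "tauh n d (F (sg (mdeg b * mdeg c)) (bas a) (bas b) (bas c)) = \<zero>\<^bsub>cpt P n d\<^esub>"
proof (cases "distinct (leaves a @ leaves b @ leaves c) \<and> set (leaves a @ leaves b @ leaves c) = {1..n} \<and>
    d = e + mdeg a + mdeg b + mdeg c")
  case True
  then obtain \<pi> a' b' c' where \<pi>: "\<pi> permutes {1..n}"
    "relabel \<pi> a = a'" "a' \<in> Mon (length (leaves a)) (mdeg a)"
    "relabel \<pi> b = relabel (\<lambda>x. x + length (leaves a)) b'" "b' \<in> Mon (length (leaves b)) (mdeg b)"
    "relabel \<pi> c = relabel (\<lambda>x. x + (length (leaves a) + length (leaves b))) c'"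
    "c' \<in> Mon (length (leaves c)) (mdeg c)"
    using consecutive_blocks[of a b c n] by metis
  let ?k = "length (leaves a)" and ?l = "length (leaves b)"
  have n: "n = ?k + ?l + length (leaves c)"
    using True distinct_card[of "leaves a @ leaves b @ leaves c"] by simp
  have K: "keys (bas a' :: ('k, 'g) lin) \<subseteq> Mon ?k (mdeg a)" "keys (bas b' :: ('k, 'g) lin) \<subseteq> Mon ?l (mdeg b)"
    "keys (bas c' :: ('k, 'g) lin) \<subseteq> Mon (length (leaves c)) (mdeg c)"
    using \<pi> by auto
  have "tauh n d (ren \<pi> (F (sg (mdeg b * mdeg c)) (bas a) (bas b) (bas c))) = \<zero>\<^bsub>cpt P n d\<^esub>"
    using tauh_inst3[OF r K] True unfolding inst[OF K(1,2)] by (simp add: ren \<pi>(2,4,6) n)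
  then show ?thesis by (rule tauh_zero_permute[OF \<pi>(1)])
next
  case False
  have "keys (F (sg (mdeg b * mdeg c)) (bas a) (bas b) (bas c)) \<inter> Mon n d = {}"
  proof (rule ccontr)
    assume "keys (F (sg (mdeg b * mdeg c)) (bas a) (bas b) (bas c)) \<inter> Mon n d \<noteq> {}"
    then obtain m where m: "m \<in> keys (F (sg (mdeg b * mdeg c)) (bas a) (bas b) (bas c))" "m \<in> Mon n d" by blast
    have "mset (leaves m) = mset (leaves a @ leaves b @ leaves c)" using keys[OF m(1)] by simp
    then have "set (leaves m) = set (leaves a @ leaves b @ leaves c)"
      "distinct (leaves m) = distinct (leaves a @ leaves b @ leaves c)"
      using mset_eq_setD mset_eq_imp_distinct_iff by blast+
    then show False using False keys[OF m(1)] MonD[OF m(2)] by auto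
  qed
  then show ?thesis by (rule tauh_outside)
qed

end

context binary_generators
begin

lemma operad_generators_T: "operad_generators T gdeg sw (\<lambda>g. cls (Gen g))"
proof (intro operad_generators.intro graded_operad_T binary_generators_axioms operad_generators_axioms.intro)
  show "cls (Gen g) \<in> ops T 2 (gdeg g)" for g by (rule cls_ops) simp
  have "transpose 1 2 permutes {1..2::nat}" by (rule permutes_swap_id) auto
  then show "act T (cls (Gen g)) (transpose 1 2) = fst (sw g) \<odot>\<^bsub>cpt T 2 (gdeg g)\<^esub> cls (Gen (snd (sw g)))" for g
    by (simp add: cls_eqI[OF opeq.gen_swap] del: One_nat_def)
qed

sublocale free: operad_generators T gdeg sw "\<lambda>g. cls (Gen g)"
  by (rule operad_generators_T)

lemma interp_free: "twf gdeg t \<Longrightarrow> free.interp t = cls t"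
  by (induction t) auto

lemma cls_eq_tauh: "twf gdeg t \<Longrightarrow> cls t = free.tauh (tar t) (tdeg gdeg t) (psi t)"
  using free.interp_eq_tauh[of t] by (simp add: interp_free)

text \<open>A relator is known through its form in the free operad. Any expression for the same
  class is congruent to one realizing \<open>w\<close>, so its value in every other operad can be
  read off from \<open>w\<close>.\<close>

lemma interp_tauh:
  assumes "operad_generators P gdeg sw gen" "twf gdeg t" "keys w \<subseteq> Mon n d" "cls t = free.tauh n d w"
  shows "operad_generators.interp P gdeg gen t = operad_generators.tauh P gdeg gen n d w"
proof -
  interpret P: operad_generators P gdeg sw gen by fact
  obtain s where s: "twf gdeg s" "tar s = n" "tdeg gdeg s = d" "psi s = w" using realize[OF assms(3)] .
  have "cls s = cls t" using cls_eq_tauh[OF s(1)] s assms(4) by simp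
  then show ?thesis using P.interp_cong[of s t] P.interp_eq_tauh[OF s(1)] s cls_eq[OF s(1), of t] by simp
qed

text \<open>The classes of well-formed expressions that satisfy the predicate form an operadic ideal
  containing \<open>R\<close>; minimality of the generated ideal then gives the claim.\<close>

lemma ideal_induct:
  assumes R: "\<And>t. twf gdeg t \<Longrightarrow> cls t \<in> R \<Longrightarrow> \<Phi> t"
    and cong: "\<And>s t. s \<approx> t \<Longrightarrow> \<Phi> s \<Longrightarrow> \<Phi> t"
    and zero: "\<And>n d. \<Phi> (Zero n d)"
    and add: "\<And>s t. twf gdeg (Add s t) \<Longrightarrow> \<Phi> s \<Longrightarrow> \<Phi> t \<Longrightarrow> \<Phi> (Add s t)"
    and scale: "\<And>c t. twf gdeg t \<Longrightarrow> \<Phi> t \<Longrightarrow> \<Phi> (Scale c t)"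
    and act: "\<And>t \<sigma>. twf gdeg (Act t \<sigma>) \<Longrightarrow> \<Phi> t \<Longrightarrow> \<Phi> (Act t \<sigma>)"
    and left: "\<And>s i t. twf gdeg (Comp s i t) \<Longrightarrow> \<Phi> s \<Longrightarrow> \<Phi> (Comp s i t)"
    and right: "\<And>s i t. twf gdeg (Comp s i t) \<Longrightarrow> \<Phi> t \<Longrightarrow> \<Phi> (Comp s i t)"
    and t: "twf gdeg t" "cls t \<in> ideal_generated T R n d"
  shows "\<Phi> t"
proof -
  define I where "I n d = {cls t | t. wf t n d \<and> \<Phi> t}" for n d
  have I: "cls s \<in> I n d \<longleftrightarrow> wf s n d \<and> \<Phi> s" if "twf gdeg s" for s n d
  proof
    assume "cls s \<in> I n d"
    then obtain u where "cls s = cls u" "wf u n d" "\<Phi> u" by (auto simp: I_def)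
    moreover from this have "s \<approx> u" using cls_eq that by blast
    ultimately show "wf s n d \<and> \<Phi> s" using cong opeq.sym opeq_wf[of s u] by metis
  qed (auto simp: I_def)
  have I_cases: "\<exists>s. A = cls s \<and> wf s n d \<and> \<Phi> s" if "A \<in> I n d" for A n d
    using that by (auto simp: I_def)
  have "operadic_ideal T I"
    unfolding operadic_ideal_def
  proof (intro conjI allI ballI impI)
    show "submodule (I n d) base_field (cpt T n d)" for n d
    proof (rule free.md.submoduleI)
      show "I n d \<subseteq> ops T n d" by (auto simp: I_def intro: cls_ops)
      show "\<zero>\<^bsub>cpt T n d\<^esub> \<in> I n d" using zero by (simp add: I)
      show "c \<odot>\<^bsub>cpt T n d\<^esub> A \<in> I n d" if A: "A \<in> I n d" for c A
        using I_cases[OF A] scale by (auto simp: I)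
      then show "\<ominus>\<^bsub>cpt T n d\<^esub> A \<in> I n d" if A: "A \<in> I n d" for A
      proof -
        have "A \<in> ops T n d" using A \<open>I n d \<subseteq> ops T n d\<close> by blast
        then show ?thesis
          using \<open>\<And>c A. A \<in> I n d \<Longrightarrow> c \<odot>\<^bsub>cpt T n d\<^esub> A \<in> I n d\<close>[OF A, of "- 1"]
            free.smult_simps(4)[of A n d] free.smult_simps(6)[of A n d 1] by metis
      qed
      show "A \<oplus>\<^bsub>cpt T n d\<^esub> B \<in> I n d" if "A \<in> I n d" "B \<in> I n d" for A B
        using I_cases[OF that(1)] I_cases[OF that(2)] add by (auto simp: I)
    qed
    show "act T A \<sigma> \<in> I n d" if "A \<in> I n d" "\<sigma> permutes {1..n}" for A n d \<sigma>
      using I_cases[OF that(1)] that(2) act by (auto simp: I)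
    show "pcomp T A i B \<in> I (m + n - 1) (p + q)" if "A \<in> I m p" "B \<in> ops T n q" "i \<in> {1..m}" for A B m p n q i
      using I_cases[OF that(1)] that(2,3) left by (auto simp: I ops_T)
    show "pcomp T A i B \<in> I (m + n - 1) (p + q)" if "A \<in> ops T m p" "B \<in> I n q" "i \<in> {1..m}" for A B m p n q i
      using I_cases[OF that(2)] that(1,3) right by (auto simp: I ops_T)
  qed
  moreover have "R \<inter> ops T m e \<subseteq> I m e" for m e
  proof
    fix A assume "A \<in> R \<inter> ops T m e"
    then show "A \<in> I m e" using R by (auto simp: ops_T I)
  qed
  ultimately have "cls t \<in> I n d" using free.ideal_generated_least t(2) by blast
  then show ?thesis using I[OF t(1)] by blast
qed

end

locale presented_operad = binary_generators gdeg sw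
  for gdeg :: "'g \<Rightarrow> int" and sw :: "'g \<Rightarrow> 'k::field \<times> 'g" +
  fixes R :: "('k, 'g) opterm set set"
  assumes R_ops: "r \<in> R \<Longrightarrow> \<exists>n d. r \<in> ops T n d"
begin

abbreviation "J \<equiv> ideal_generated T R"

sublocale pr: operad_with_ideal T J
  by (intro operad_with_ideal.intro graded_operad_T operad_with_ideal_axioms.intro
      free.ideal_generated_ideal R_ops)

lemma coset_cls_ops: "wf t n d \<Longrightarrow> pr.coset (cls t) \<in> ops pr.Q n d"
  using pr.qt.f_onto cls_ops by blast

lemma operad_generators_Q: "operad_generators pr.Q gdeg sw (\<lambda>g. pr.coset (cls (Gen g)))"
proof (intro operad_generators.intro pr.graded_operad_quotient binary_generators_axioms operad_generators_axioms.intro)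
  show "pr.coset (cls (Gen g)) \<in> ops pr.Q 2 (gdeg g)" for g by (rule coset_cls_ops) simp
  have "transpose 1 2 permutes {1..2::nat}" by (rule permutes_swap_id) auto
  then show "act pr.Q (pr.coset (cls (Gen g))) (transpose 1 2) =
      fst (sw g) \<odot>\<^bsub>cpt pr.Q 2 (gdeg g)\<^esub> pr.coset (cls (Gen (snd (sw g))))" for g
    using free.gen_closed[of g] free.gen_closed[of "snd (sw g)"]
    by (simp only: pr.qt.f_act free.gen_act pr.qt.f_smult gdeg_sw)
qed

sublocale op: operad_generators pr.Q gdeg sw "\<lambda>g. pr.coset (cls (Gen g))"
  by (rule operad_generators_Q)

lemma interp_coset: "twf gdeg t \<Longrightarrow> op.interp t = pr.coset (cls t)"
proof (induction t)
  case Unit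
  then show ?case by (simp add: pr.qt.f_unit)
next
  case (Zero n d)
  then show ?case by (simp add: pr.qt.f_zero)
next
  case (Add s t)
  then show ?case using pr.qt.f_add[of "cls s" "tar s" "tdeg gdeg s" "cls t"] by (simp add: cls_ops)
next
  case (Scale c t)
  then show ?case using pr.qt.f_smult[of "cls t" "tar t" "tdeg gdeg t" c] by (simp add: cls_ops)
next
  case (Comp s i t)
  then show ?case using pr.qt.f_comp[of "cls s" "tar s" "tdeg gdeg s" "cls t" "tar t" "tdeg gdeg t" i] by (simp add: cls_ops)
next
  case (Act t \<sigma>)
  then show ?case using pr.qt.f_act[of "cls t" "tar t" "tdeg gdeg t" \<sigma>] by (simp add: cls_ops)
qed simp

lemma ops_cases:
  assumes "a \<in> ops pr.Q n d"
  obtains t where "wf t n d" "a = op.interp t"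
  using assms interp_coset unfolding pr.qt.f_onto by (auto simp: ops_T)

lemma ops_tauh:
  assumes "a \<in> ops pr.Q n d"
  obtains w where "keys w \<subseteq> Mon n d" "a = op.tauh n d w"
  using assms ops_cases op.interp_eq_tauh keys_psi by metis

lemma interp_zero_iff: "wf t n d \<Longrightarrow> op.interp t = \<zero>\<^bsub>cpt pr.Q n d\<^esub> \<longleftrightarrow> cls t \<in> J n d"
  using pr.cos_zero_iff[OF cls_ops] interp_coset by metis

lemma coset_tauh:
  assumes "keys w \<subseteq> Mon n d"
  shows "pr.coset (free.tauh n d w) = op.tauh n d w"
proof -
  obtain t where t: "twf gdeg t" "tar t = n" "tdeg gdeg t = d" "psi t = w" using realize[OF assms] .
  show ?thesis using cls_eq_tauh[OF t(1)] op.interp_eq_tauh[OF t(1)] interp_coset[OF t(1)] t by simp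
qed

lemma tauh_relator: "keys w \<subseteq> Mon n d \<Longrightarrow> free.tauh n d w \<in> R \<Longrightarrow> op.tauh n d w = \<zero>\<^bsub>cpt pr.Q n d\<^esub>"
  using pr.cos_zero_iff[OF free.tauh_closed[of n d w]] free.ideal_generated_mem[OF _ free.tauh_closed[of n d w]]
    coset_tauh by simp

text \<open>The direction that detects nonzero elements: passing from expressions to trees maps the
  generated ideal into \<open>rel B\<close>. By ideal induction only the relators themselves have to
  be checked, and the congruence is absorbed by \<open>psi_rel\<close>.\<close>

lemma tauh_zero_rel:
  assumes subst_closed: "\<And>q f e u. (\<And>j. homog q (e j)) \<Longrightarrow> u \<in> rel B \<Longrightarrow> subst q f e u \<in> rel B"
    and ren_closed: "\<And>f u. u \<in> rel B \<Longrightarrow> ren f u \<in> rel B"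
    and R: "\<And>r. r \<in> R \<Longrightarrow> \<exists>n d w. keys w \<subseteq> Mon n d \<and> r = free.tauh n d w \<and> w \<in> rel B"
    and w: "keys w \<subseteq> Mon n d" "op.tauh n d w = \<zero>\<^bsub>cpt pr.Q n d\<^esub>"
  shows "w \<in> rel B"
proof -
  have psi_rel': "psi s - psi t \<in> rel B" if "s \<approx> t" for s t
    using subst_closed ren_closed that by (rule psi_rel)
  obtain t where t: "twf gdeg t" "tar t = n" "tdeg gdeg t = d" "psi t = w" using realize[OF w(1)] .
  have "cls t \<in> J n d" using interp_zero_iff[of t n d] op.interp_eq_tauh[OF t(1)] t w(2) by simp
  with t(1) have "psi t \<in> rel B"
  proof (rule ideal_induct[rotated -2])
    show "psi t \<in> rel B" if H: "twf gdeg t" "cls t \<in> R" for t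
    proof -
      obtain n d w where w: "keys w \<subseteq> Mon n d" "cls t = free.tauh n d w" "w \<in> rel B" using R[OF H(2)] by blast
      obtain s where s: "twf gdeg s" "tar s = n" "tdeg gdeg s = d" "psi s = w" using realize[OF w(1)] .
      have "cls s = cls t" using cls_eq_tauh[OF s(1)] s w by simp
      then have "psi s - psi t \<in> rel B" using psi_rel'[of s t] cls_eq[OF s(1), of t] by blast
      then show ?thesis using rel_diff[OF w(3), of "psi s - psi t"] s(4) by simp
    qed
    show "psi t \<in> rel B" if H: "s \<approx> t" "psi s \<in> rel B" for s t
      using rel_diff[OF H(2) psi_rel'[OF H(1)]] by simp
    show "psi (Comp s i t) \<in> rel B" if H: "twf gdeg (Comp s i t)" "psi s \<in> rel B" for s i t
      using H by (auto simp: cmp_def intro!: subst_closed homog_insertion)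
    show "psi (Comp s i t) \<in> rel B" if H: "twf gdeg (Comp s i t)" "psi t \<in> rel B" for s i t
      using H by (auto simp: cmp_def insertion_def intro!: subst_arg_rel ren_closed)
  qed (auto intro: rel_add rel_scl ren_closed)
  then show ?thesis using t by simp
qed

end

lemma (in operad_hom) hom_zero: "f \<zero>\<^bsub>cpt P n d\<^esub> = \<zero>\<^bsub>cpt Q n d\<^esub>"
proof -
  have "f (0 \<odot>\<^bsub>cpt P n d\<^esub> \<zero>\<^bsub>cpt P n d\<^esub>) = 0 \<odot>\<^bsub>cpt Q n d\<^esub> f \<zero>\<^bsub>cpt P n d\<^esub>"
    by (rule hom_smult) simp
  then show ?thesis using hom_closed[of "\<zero>\<^bsub>cpt P n d\<^esub>" n d] by (simp add: P.smult_simps Q.smult_simps)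
qed

context presented_operad
begin

text \<open>The value at an element is computed from any expression for it. Two expressions for the
  same element differ by one whose class lies in the ideal, and ideal induction shows that such a
  difference evaluates to zero in \<open>P\<close>.\<close>

lemma universal_hom:
  assumes P: "operad_generators P gdeg sw gen"
    and R: "\<And>t. twf gdeg t \<Longrightarrow> cls t \<in> R \<Longrightarrow>
      operad_generators.interp P gdeg gen t = \<zero>\<^bsub>cpt P (tar t) (tdeg gdeg t)\<^esub>"
  shows "\<exists>f. operad_hom pr.Q P f \<and> (\<forall>g. f (pr.coset (cls (Gen g))) = gen g)"
proof -
  interpret P: operad_generators P gdeg sw gen by fact
  define f where "f A = P.interp (SOME t. twf gdeg t \<and> A = op.interp t)" for A
  have f: "f (op.interp t) = P.interp t" if t: "twf gdeg t" for t
  proof -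
    define s where "s = (SOME s. twf gdeg s \<and> op.interp t = op.interp s)"
    have s: "twf gdeg s" "op.interp t = op.interp s"
      unfolding s_def using someI[of "\<lambda>s. twf gdeg s \<and> op.interp t = op.interp s" t] t by auto
    have eq: "tar s = tar t" "tdeg gdeg s = tdeg gdeg t"
      using op.disjoint_cpt[OF op.interp_closed[OF s(1)], of "tar t" "tdeg gdeg t"] op.interp_closed[OF t] s(2) by auto
    let ?u = "Add t (Scale (- 1) s)"
    have cl: "op.interp s \<in> ops pr.Q (tar t) (tdeg gdeg t)" "P.interp s \<in> ops P (tar t) (tdeg gdeg t)"
      using op.interp_closed[OF s(1)] P.interp_closed[OF s(1)] eq by auto
    have u: "wf ?u (tar t) (tdeg gdeg t)" using s t eq by simp
    have "op.interp ?u = \<zero>\<^bsub>cpt pr.Q (tar t) (tdeg gdeg t)\<^esub>"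
      using cl op.md.r_neg[of "op.interp s" "tar t" "tdeg gdeg t"] by (simp add: eq s(2) op.smult_simps(4,6))
    then have J: "cls ?u \<in> J (tar t) (tdeg gdeg t)" using interp_zero_iff[OF u] by simp
    have "twf gdeg ?u" using u by simp
    from this J have "P.interp ?u = \<zero>\<^bsub>cpt P (tar ?u) (tdeg gdeg ?u)\<^esub>"
    proof (rule ideal_induct[where \<Phi> = "\<lambda>t. P.interp t = \<zero>\<^bsub>cpt P (tar t) (tdeg gdeg t)\<^esub>", rotated -2])
      show "P.interp v = \<zero>\<^bsub>cpt P (tar v) (tdeg gdeg v)\<^esub>"
        if "u \<approx> v" "P.interp u = \<zero>\<^bsub>cpt P (tar u) (tdeg gdeg u)\<^esub>" for u v
        using that P.interp_cong[OF that(1)] opeq_wf[OF that(1)] by simp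
      show "P.interp (Comp s i t) = \<zero>\<^bsub>cpt P (tar (Comp s i t)) (tdeg gdeg (Comp s i t))\<^esub>"
        if "twf gdeg (Comp s i t)" "P.interp s = \<zero>\<^bsub>cpt P (tar s) (tdeg gdeg s)\<^esub>" for s i t
        using that P.comp_zero_left[OF P.interp_closed[of t]] by simp
      show "P.interp (Comp s i t) = \<zero>\<^bsub>cpt P (tar (Comp s i t)) (tdeg gdeg (Comp s i t))\<^esub>"
        if "twf gdeg (Comp s i t)" "P.interp t = \<zero>\<^bsub>cpt P (tar t) (tdeg gdeg t)\<^esub>" for s i t
        using that P.comp_zero_right[OF P.interp_closed[of s]] by simp
    qed (auto simp: R P.act_zero P.md.smult_r_null[simplified])
    then have "P.interp t \<oplus>\<^bsub>cpt P (tar t) (tdeg gdeg t)\<^esub> (\<ominus>\<^bsub>cpt P (tar t) (tdeg gdeg t)\<^esub> P.interp s) =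
        \<zero>\<^bsub>cpt P (tar t) (tdeg gdeg t)\<^esub>"
      using cl by (simp add: eq P.smult_simps(4,6))
    then have "P.interp t = P.interp s"
      using cl P.interp_closed[OF t] P.md.minus_equality[where y = "P.interp t" and
        x = "\<ominus>\<^bsub>cpt P (tar t) (tdeg gdeg t)\<^esub> P.interp s" and n = "tar t" and d = "tdeg gdeg t"]
      by simp
    then show ?thesis by (simp add: f_def s_def)
  qed
  have "operad_hom pr.Q P f"
  proof (intro operad_hom.intro pr.graded_operad_quotient P.graded_operad_axioms operad_hom_axioms.intro)
    show "f a \<in> ops P n d" if a: "a \<in> ops pr.Q n d" for a n d
      using ops_cases[OF a] f P.interp_closed by metis
    show "f (a \<oplus>\<^bsub>cpt pr.Q n d\<^esub> b) = f a \<oplus>\<^bsub>cpt P n d\<^esub> f b" if H: "a \<in> ops pr.Q n d" "b \<in> ops pr.Q n d" for a b n d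
    proof -
      obtain s t where "wf s n d" "a = op.interp s" "wf t n d" "b = op.interp t"
        using ops_cases[OF H(1)] ops_cases[OF H(2)] by metis
      then show ?thesis using f[of "Add s t"] by (simp add: f)
    qed
    show "f (c \<odot>\<^bsub>cpt pr.Q n d\<^esub> a) = c \<odot>\<^bsub>cpt P n d\<^esub> f a" if H: "a \<in> ops pr.Q n d" for a c n d
    proof -
      obtain s where "wf s n d" "a = op.interp s" using ops_cases[OF H(1)] by metis
      then show ?thesis using f[of "Scale c s"] by (simp add: f)
    qed
    show "f (ounit pr.Q) = ounit P" using f[of Unit] by simp
    show "f (pcomp pr.Q a i b) = pcomp P (f a) i (f b)"
      if H: "a \<in> ops pr.Q m p" "b \<in> ops pr.Q n q" "i \<in> {1..m}" for a b m p n q i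
    proof -
      obtain s t where "wf s m p" "a = op.interp s" "wf t n q" "b = op.interp t"
        using ops_cases[OF H(1)] ops_cases[OF H(2)] by metis
      then show ?thesis using f[of "Comp s i t"] H(3) by (simp add: f)
    qed
    show "f (act pr.Q a \<sigma>) = act P (f a) \<sigma>" if H: "a \<in> ops pr.Q n d" "\<sigma> permutes {1..n}" for a n d \<sigma>
    proof -
      obtain s where "wf s n d" "a = op.interp s" using ops_cases[OF H(1)] by metis
      then show ?thesis using f[of "Act s \<sigma>"] H(2) by (simp add: f)
    qed
  qed
  moreover have "f (pr.coset (cls (Gen g))) = gen g" for g using f[of "Gen g"] by simp
  ultimately show ?thesis by blast
qed

text \<open>The differential of Greg is specified by a choice; agreement on generators identifies it
  with an explicitly constructed derivation.\<close>

lemma derivation_unique: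
  assumes "operadic_derivation pr.Q D" "operadic_derivation pr.Q E"
    and gen: "\<And>g. D (pr.coset (cls (Gen g))) = E (pr.coset (cls (Gen g)))"
    and a: "a \<in> ops pr.Q n d"
  shows "D a = E a"
proof -
  interpret D: operadic_derivation pr.Q D by fact
  interpret E: operadic_derivation pr.Q E by fact
  have "D (op.interp t) = E (op.interp t)" if "twf gdeg t" for t
    using that
  proof (induction t)
    case (Add s t)
    then show ?case
      using D.der_add[OF op.interp_closed[of s]] E.der_add[OF op.interp_closed[of s]] op.interp_closed[of t] by simp
  next
    case (Scale c t)
    then show ?case
      using D.der_smult[OF op.interp_closed[of t]] E.der_smult[OF op.interp_closed[of t]] by simp
  next
    case (Comp s i t)
    then show ?case
      using D.der_comp[OF op.interp_closed[of s] op.interp_closed[of t], of i]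
        E.der_comp[OF op.interp_closed[of s] op.interp_closed[of t], of i] by simp
  next
    case (Act t \<sigma>)
    then show ?case
      using D.der_act[OF op.interp_closed[of t], of \<sigma>] E.der_act[OF op.interp_closed[of t], of \<sigma>] by simp
  next
    case Unit
    show ?case using D.der_unit E.der_unit by simp
  next
    case (Zero n d)
    show ?case using D.der_zero E.der_zero by simp
  qed (simp add: gen)
  then show ?thesis using ops_cases[OF a] by metis
qed

end

section \<open>Operads with a differential attached\<close>

lemma graded_operad_with_differential [simp]:
  "graded_operad (with_differential P D) \<longleftrightarrow> graded_operad P"
  by (simp add: graded_operad_def with_differential_def)

lemma operadic_derivation_with_differential [simp]:
  "operadic_derivation (with_differential P D) E \<longleftrightarrow> operadic_derivation P E"
  unfolding operadic_derivation_def operadic_derivation_axioms_def graded_operad_with_differential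
  by (simp add: with_differential_def)

lemma operad_hom_with_differential [simp]:
  "operad_hom (with_differential P D) (with_differential Q E) f \<longleftrightarrow> operad_hom P Q f"
  unfolding operad_hom_def operad_hom_axioms_def graded_operad_with_differential
  by (simp add: with_differential_def)

lemma with_differential_simps [simp]:
  "cpt (with_differential P D) = cpt P" "ounit (with_differential P D) = ounit P"
  "pcomp (with_differential P D) = pcomp P" "act (with_differential P D) = act P"
  "dif (with_differential P D) = D"
  by (simp_all add: with_differential_def)

lemma zero_differential:
  fixes P :: "('k::field, 'a) operad"
  assumes "graded_operad P"
  shows "differential_graded_operad (with_differential P (zero_differential P))"
proof -
  interpret graded_operad P by fact
  have z: "zero_differential P a = \<zero>\<^bsub>cpt P n (d + 1)\<^esub>" if "a \<in> ops P n d" for a n d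
    using that by (simp add: zero_differential_def arity_degree)
  have zz: "c \<odot>\<^bsub>cpt P n d\<^esub> \<zero>\<^bsub>cpt P n d\<^esub> = \<zero>\<^bsub>cpt P n d\<^esub>" for c n d
    using md.smult_r_null[of c n d] by simp
  have "operadic_derivation P (zero_differential P)"
  proof (intro operadic_derivation.intro graded_operad_axioms operadic_derivation_axioms.intro)
    show "zero_differential P (pcomp P a i b) = pcomp P (zero_differential P a) i b \<oplus>\<^bsub>cpt P (m + n - 1) (p + q + 1)\<^esub>
          koszul_sign 1 p \<odot>\<^bsub>cpt P (m + n - 1) (p + q + 1)\<^esub> pcomp P a i (zero_differential P b)"
      if H: "a \<in> ops P m p" "b \<in> ops P n q" "i \<in> {1..m}" for a b m p n q i
      using comp_zero_left[OF H(2,3), of "p + 1"] comp_zero_right[OF H(1,3), of n "q + 1"]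
      by (simp add: z[OF H(1)] z[OF H(2)] z[OF comp_closed[OF H]] zz add_ac)
    show "zero_differential P (act P a \<sigma>) = act P (zero_differential P a) \<sigma>"
      if H: "a \<in> ops P n d" "\<sigma> permutes {1..n}" for a n d \<sigma>
      using act_zero[OF H(2)] by (simp add: z[OF H(1)] z[OF act_closed[OF H]])
    show "zero_differential P (a \<oplus>\<^bsub>cpt P n d\<^esub> b) =
        zero_differential P a \<oplus>\<^bsub>cpt P n (d + 1)\<^esub> zero_differential P b"
      if H: "a \<in> ops P n d" "b \<in> ops P n d" for a b n d
      by (simp add: z[OF H(1)] z[OF H(2)] z[OF md.a_closed[OF H]])
    show "zero_differential P (c \<odot>\<^bsub>cpt P n d\<^esub> a) = c \<odot>\<^bsub>cpt P n (d + 1)\<^esub> zero_differential P a"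
      if H: "a \<in> ops P n d" for a n d c
      by (simp add: z[OF H] z[OF smult_simps(1)[OF H]] zz)
  qed (simp add: z)
  then show ?thesis
    using z[where a = "\<zero>\<^bsub>cpt P n (d + 1)\<^esub>" and n = n and d = "d + 1" for n d]
    by (intro differential_graded_operad.intro differential_graded_operad_axioms.intro) (simp_all add: z add.assoc)
qed

context graded_generators
begin

lemma cmp_simps:
  "cmp q n i (bas (Lf j)) v = insertion i v j"
  "cmp q n i (nd g u w) v =
    nd g (cmp q n i u v) (eps q (ren (shift n i) w)) + nd g (ren (shift n i) u) (cmp q n i w v)"
  by (simp_all add: cmp_def)

lemma cmp_below:
  assumes "keys u \<subseteq> Mon k p" "k < i"
  shows "cmp q n i u v = 0" "ren (shift n i) u = u"
  using subst_below[OF assms] by (simp_all add: cmp_def)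

lemma cmp_below_shift:
  assumes "keys u \<subseteq> Mon l p" "k + l < i"
  shows "cmp q n i (ren (\<lambda>x. x + k) u) v = 0" "ren (\<lambda>x. shift n i (x + k)) u = ren (\<lambda>x. x + k) u"
proof -
  have l: "j + k < i" if "m \<in> keys u" "j \<in> set (leaves m)" for m j
    using that assms by (auto simp: Mon_def)
  show "cmp q n i (ren (\<lambda>x. x + k) u) v = 0"
    unfolding cmp_def subst_ren by (rule subst_zero) (use l in \<open>auto simp: insertion_def\<close>)
  show "ren (\<lambda>x. shift n i (x + k)) u = ren (\<lambda>x. x + k) u"
    by (rule ren_cong) (use l in \<open>auto simp: shift_def\<close>)
qed

end

section \<open>The operad Greg in terms of labelled trees\<close>

lemma pinv_transpose [simp]: "pinv (transpose a b) = transpose a b"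
  by (rule inv_unique_comp) (simp_all add: fun_eq_iff)

context operad_generators
begin

lemma gen_comp_tauh:
  "pcomp P (gen g) i (gen h) = tauh 3 (gdeg g + gdeg h)
    (cmp (gdeg h) 2 i (bas (Nd g (Lf 1) (Lf 2))) (bas (Nd h (Lf 1) (Lf 2))))"
  if "i \<in> {1..2}" for i
proof -
  have K: "keys (bas (Nd g (Lf 1) (Lf 2)) :: ('k, 'g) lin) \<subseteq> Mon 2 (gdeg g)" for g
    using corolla_Mon by simp
  show ?thesis using tauh_comp[OF K[of g] K[of h] that] by (simp add: gen_eq_tauh)
qed

lemma act_transpose23: "tauh 3 d (ren (transpose 2 3) u) = act P (tauh 3 d u) (transpose 2 3)"
proof -
  have "transpose 2 3 permutes {1..3::nat}" by (rule permutes_swap_id) auto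
  from tauh_ren[OF this, of d u] show ?thesis by simp
qed

end

lemma corolla_nd: "bas (Nd g (Lf i) (Lf j)) = nd g (lf i) (lf j)"
  by simp

lemma prelie_relation_eq:
  "prelie_relation = greg.free.tauh 3 0 (pl 1 (lf 1) (lf 2) (lf 3) :: ('k::field, greg_gen) lin)"
proof -
  note T = greg_T_def greg_T_gen_def
  have "prelie_relation = greg.free.tauh 3 0
     ((nx (nx (lf 1) (lf 2)) (lf 3) - nx (lf 1) (nx (lf 2) (lf 3)))
      - ren (transpose 2 3) (nx (nx (lf 1) (lf 2)) (lf 3) - nx (lf 1) (nx (lf 2) (lf 3))) :: ('k, greg_gen) lin)"
    unfolding greg.free.tauh_diff greg.free.act_transpose23
    unfolding prelie_relation_def Let_def T
    using greg.free.gen_comp_tauh[where 'k = 'k, of 1 GenX GenX] greg.free.gen_comp_tauh[where 'k = 'k, of 2 GenX GenX]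
    by (simp add: corolla_nd numeral_2_eq_2[symmetric] greg.cmp_simps insertion_def shift_def greg.free.tauh_diff del: nd_bas)
  then show ?thesis by (simp add: pl_def algebra_simps del: nd_bas)
qed

lemma greg_relation_eq:
  "greg_relation = greg.free.tauh 3 1 (gr 1 (lf 1) (lf 2) (lf 3) :: ('k::field, greg_gen) lin)"
proof -
  note T = greg_T_def greg_T_gen_def
  define u :: "('k, greg_gen) lin" where
    "u = nx (ng (lf 1) (lf 2)) (lf 3) - ng (nx (lf 1) (lf 3)) (lf 2) - ng (lf 1) (nx (lf 2) (lf 3))"
  have u: "greg.free.tauh 3 1 u = greg.free.tauh 3 1 (nx (ng (lf 1) (lf 2)) (lf 3))
      \<ominus>\<^bsub>cpt greg.T 3 1\<^esub> act greg.T (greg.free.tauh 3 1 (ng (nx (lf 1) (lf 2)) (lf 3))) (transpose 2 3)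
      \<ominus>\<^bsub>cpt greg.T 3 1\<^esub> greg.free.tauh 3 1 (ng (lf 1) (nx (lf 2) (lf 3)))"
    unfolding greg.free.act_transpose23[symmetric] by (simp add: u_def greg.free.tauh_diff del: nd_bas)
  have "greg_relation = greg.free.tauh 3 1 (u - ren (transpose 2 3) u)"
    unfolding greg.free.tauh_diff greg.free.act_transpose23 u
    unfolding greg_relation_def Let_def T
    using greg.free.gen_comp_tauh[where 'k = 'k, of 1 GenX GenG] greg.free.gen_comp_tauh[where 'k = 'k, of 1 GenG GenX]
      greg.free.gen_comp_tauh[where 'k = 'k, of 2 GenG GenX]
    by (simp add: corolla_nd numeral_2_eq_2[symmetric] greg.cmp_simps insertion_def shift_def del: nd_bas)
  then show ?thesis by (simp add: u_def gr_def algebra_simps del: nd_bas)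
qed


text \<open>Here \<open>A\<close> records leaves that an operator has removed and \<open>M\<close>
  the leaves of the original tree plus those added. Keeping \<open>A\<close> on the left-hand side
  avoids subtraction of multisets for \<open>cc\<close>.\<close>

definition content :: "nat multiset \<Rightarrow> nat multiset \<Rightarrow> ('k::field, 'g) lin \<Rightarrow> bool"
  where "content A M u \<longleftrightarrow> (\<forall>m\<in>keys u. mset (leaves m) + A = M)"

lemma content_bas: "content {#} (mset (leaves m)) (bas m)"
  and content_lf: "content {#} {#j#} (lf j)"
  and content_zero: "content A M 0"
  by (auto simp: content_def)

lemma content_add: "content A M u \<Longrightarrow> content A M v \<Longrightarrow> content A M (u + v)"
  and content_diff: "content A M u \<Longrightarrow> content A M v \<Longrightarrow> content A M (u - v)"
  and content_uminus: "content A M u \<Longrightarrow> content A M (- u)"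
  and content_scl: "content A M u \<Longrightarrow> content A M (c \<star> u)"
  using keys_add[of u v] keys_diff_subset[of u v] keys_scl_subset[of c u] unfolding content_def by auto

lemma content_nd:
  assumes "content A M u" "content B N w" "A + B = C" "M + N = P"
  shows "content C P (nd g u w)"
  unfolding content_def
proof
  fix m assume "m \<in> keys (nd g u w)"
  then obtain a b where "a \<in> keys u" "b \<in> keys w" "m = Nd g a b" using keys_nd[of g u w] by auto
  with assms show "mset (leaves m) + C = P" by (force simp: content_def union_ac)
qed

lemma content_lin:
  assumes "linear_map F" "\<And>m. m \<in> keys u \<Longrightarrow> content A M (F (bas m))"
  shows "content A M (F u)"
  by (rule keys_induct[of u "keys u"])
     (use assms in \<open>auto simp: linear_mapD intro: content_add content_scl content_zero\<close>)

lemma content_ep: "content A M u \<Longrightarrow> content A M (ep u)"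
  by (rule content_lin[of "greg.eps 1"]) (auto simp: greg.eps_bas content_def scl_single)

lemmas content_rules = content_add content_diff content_uminus content_scl content_nd content_ep content_bas content_lf content_zero

lemma content_ops_bas:
  fixes m :: "greg_gen mon"
  shows content_dd: "content {#} (mset (leaves m)) (dd (bas m) :: ('k::field, greg_gen) lin)"
    and content_pp: "content {#} (add_mset s (mset (leaves m))) (pp s (bas m) :: ('k, greg_gen) lin)"
    and content_nn: "content {#} (mset (leaves m)) (nn i (bas m) :: ('k, greg_gen) lin)"
    and content_ee: "content {#} (add_mset s (mset (leaves m))) (ee s i (bas m) :: ('k, greg_gen) lin)"
proof (induction m)
  case (Nd g a b)
  note IH = Nd
  { case 1 show ?case by (cases g; simp flip: nd_bas) (rule content_rules IH | simp)+ }
  { case 2 show ?case by (cases g; simp add: brace_def flip: nd_bas) (rule content_rules IH | simp)+ }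
  { case 3 show ?case by (simp flip: nd_bas) (rule content_rules IH | simp)+ }
  { case 4 show ?case by (simp flip: nd_bas) (rule content_rules IH | simp)+ }
next
  case (Lf j)
  { case 1 show ?case by (simp add: content_zero) }
  { case 2 show ?case by (simp add: content_zero) }
  { case 3 show ?case by (simp add: content_zero content_lf) }
  { case 4 show ?case by (simp add: content_zero) (simp flip: nd_bas, rule impI, (rule content_rules | simp)+) }
qed

lemma content_lookup: "(b = Lf s \<Longrightarrow> content A M u) \<Longrightarrow> content A M (lookup (bas b :: ('k::field, 'g) lin) (Lf s) \<star> u)"
  by (cases "b = Lf s") (auto intro: content_scl content_zero)

lemma content_hh_bas: "content {#} (mset (leaves m)) (hh s (bas m) :: ('k::field, greg_gen) lin)"
proof (induction m)
  case (Nd g a b)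
  have "content {#} (mset (leaves a) + mset (leaves b)) (nx (lf s) (ep (bas b)) :: ('k, greg_gen) lin)" if "a = Lf s"
    unfolding that by (rule content_rules | simp)+
  moreover have "content {#} (mset (leaves a) + mset (leaves b)) (nx (lf s) (ep (bas a)) :: ('k, greg_gen) lin)" if "b = Lf s"
    unfolding that by (rule content_rules | simp)+
  moreover have "content {#} (mset (leaves a) + mset (leaves b)) (pp s (bas a) :: ('k, greg_gen) lin)" if "b = Lf s"
    using content_pp[of s a] by (simp add: that)
  moreover have "content {#} (mset (leaves a) + mset (leaves b)) (pp s (bas b) :: ('k, greg_gen) lin)" if "a = Lf s"
    using content_pp[of s b] by (simp add: that)
  ultimately show ?case
    by (cases g; simp del: lookup_bas_Lf flip: nd_bas)
       (rule content_lookup content_add content_diff content_nd content_ep content_bas Nd | simp)+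
qed (simp add: content_zero)

lemma content_cc_bas: "content {#s#} (mset (leaves m)) (cc s i (bas m) :: ('k::field, greg_gen) lin)"
proof (induction m)
  case (Nd g a b)
  have "content {#s#} (mset (leaves a) + mset (leaves b)) (nn i (bas a) :: ('k, greg_gen) lin)" if "b = Lf s"
    using content_nn[of a i, where 'k = 'k] by (simp add: that content_def)
  moreover have "content {#s#} (mset (leaves a) + mset (leaves b)) (nn i (bas b) :: ('k, greg_gen) lin)" if "a = Lf s"
    using content_nn[of b i, where 'k = 'k] by (simp add: that content_def)
  ultimately show ?case
    by (cases g; simp del: lookup_bas_Lf flip: nd_bas)
       (rule content_lookup content_add content_diff content_nd content_bas Nd | simp)+
qed (simp add: content_zero)

context graded_generators
begin

lemma keys_Mon_iff:
  fixes u :: "('k::field, 'g) lin"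
  shows "keys u \<subseteq> Mon n d \<longleftrightarrow> content {#} (mset_set {1..n}) u \<and> homog d u"
proof -
  have "mset (leaves m) = mset_set {1..n} \<longleftrightarrow> distinct (leaves m) \<and> set (leaves m) = {1..n}" for m :: "'g mon"
  proof
    assume *: "mset (leaves m) = mset_set {1..n}"
    then have "mset (leaves m) = mset [1..<Suc n]" by (simp del: upt_Suc add: atLeastLessThanSuc_atLeastAtMost)
    then show "distinct (leaves m) \<and> set (leaves m) = {1..n}"
      using mset_eq_imp_distinct_iff mset_eq_setD
      by (metis atLeastLessThanSuc_atLeastAtMost distinct_upt set_upt)
  qed (metis mset_set_set)
  then show ?thesis by (auto simp: content_def homog_def Mon_def)
qed

end

lemma homog_hh: "greg.homog d u \<Longrightarrow> greg.homog (d - 1) (hh s u)"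
  and homog_cc: "greg.homog d u \<Longrightarrow> greg.homog d (cc s i u)"
  using greg.homog_der[OF _ homogeneous_hgam, of "\<lambda>_. 0" d u]
    greg.homog_der[OF _ homogeneous_cgam, of "\<lambda>_. 0" d u]
  by (simp_all add: hh_def cc_def)

lemma homog_ee:
  assumes "greg.homog d u"
  shows "greg.homog d (ee s i u)"
proof -
  have "greg.homog (d + 0) (ee s i u)"
    unfolding ee_def using assms
    by (intro greg.homog_der greg.homogeneous_family_zero) (auto intro!: greg.homog_diff greg.homog_nd[of 0 _ 0])
  then show ?thesis by simp
qed

lemma upto_split: "n \<ge> 1 \<Longrightarrow> mset_set {1..n} = add_mset n (mset_set {1..n - 1})" for n :: nat
  by (cases n) (simp_all add: atLeastAtMostSuc_conv)

lemma content_keys: "content {#} M u \<Longrightarrow> m \<in> keys u \<Longrightarrow> mset (leaves m) = M"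
  by (auto simp: content_def)

lemma keys_ops:
  fixes u :: "('k::field, greg_gen) lin"
  shows keys_dd: "keys u \<subseteq> greg.Mon n d \<Longrightarrow> keys (dd u) \<subseteq> greg.Mon n (d + 1)"
    and keys_hh: "keys u \<subseteq> greg.Mon n d \<Longrightarrow> keys (hh s u) \<subseteq> greg.Mon n (d - 1)"
    and keys_cc: "keys u \<subseteq> greg.Mon n d \<Longrightarrow> n \<ge> 1 \<Longrightarrow> keys (cc n i u) \<subseteq> greg.Mon (n - 1) d"
    and keys_ee: "keys u \<subseteq> greg.Mon (n - 1) d \<Longrightarrow> n \<ge> 1 \<Longrightarrow> keys (ee n i u) \<subseteq> greg.Mon n d"
proof -
  assume u: "keys u \<subseteq> greg.Mon n d"
  then have c: "\<And>m. m \<in> keys u \<Longrightarrow> mset (leaves m) = mset_set {1..n}" and h: "greg.homog d u"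
    using content_keys unfolding greg.keys_Mon_iff by auto
  have "content {#} (mset_set {1..n}) (dd u)"
  proof (rule content_lin[OF linear_map_ops(1)])
    show "content {#} (mset_set {1..n}) (dd (bas m) :: ('k, greg_gen) lin)" if "m \<in> keys u" for m
      using content_dd[of m] c[OF that] by simp
  qed
  then show "keys (dd u) \<subseteq> greg.Mon n (d + 1)" using homog_dd[OF h] unfolding greg.keys_Mon_iff by blast
  have "content {#} (mset_set {1..n}) (hh s u)"
  proof (rule content_lin[OF linear_map_ops(3)])
    show "content {#} (mset_set {1..n}) (hh s (bas m) :: ('k, greg_gen) lin)" if "m \<in> keys u" for m
      using content_hh_bas[of m s] c[OF that] by simp
  qed
  then show "keys (hh s u) \<subseteq> greg.Mon n (d - 1)" using homog_hh[OF h] unfolding greg.keys_Mon_iff by blast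
  have "content {#n#} (mset_set {1..n}) (cc n i u)"
  proof (rule content_lin[OF linear_map_ops(5)])
    show "content {#n#} (mset_set {1..n}) (cc n i (bas m) :: ('k, greg_gen) lin)" if "m \<in> keys u" for m
      using content_cc_bas[of n m i] c[OF that] by simp
  qed
  then show "keys (cc n i u) \<subseteq> greg.Mon (n - 1) d" if "n \<ge> 1"
    using homog_cc[OF h] unfolding greg.keys_Mon_iff by (simp add: content_def upto_split[OF that] del: One_nat_def)
next
  assume u: "keys u \<subseteq> greg.Mon (n - 1) d" and n: "n \<ge> 1"
  then have c: "\<And>m. m \<in> keys u \<Longrightarrow> mset (leaves m) = mset_set {1..n - 1}" and h: "greg.homog d u"
    using content_keys unfolding greg.keys_Mon_iff by auto
  have "content {#} (mset_set {1..n}) (ee n i u)"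
  proof (rule content_lin[OF linear_map_ops(6)])
    show "content {#} (mset_set {1..n}) (ee n i (bas m) :: ('k, greg_gen) lin)" if "m \<in> keys u" for m
      using content_ee[of n m i] c[OF that] by (simp add: upto_split[OF n] del: One_nat_def)
  qed
  then show "keys (ee n i u) \<subseteq> greg.Mon n d" using homog_ee[OF h] unfolding greg.keys_Mon_iff by blast
qed

lemma pl_keys: "keys (pl 1 (lf 1) (lf 2) (lf 3) :: ('k::field, greg_gen) lin) \<subseteq> greg.Mon 3 0"
  and gr_keys: "keys (gr 1 (lf 1) (lf 2) (lf 3) :: ('k::field, greg_gen) lin) \<subseteq> greg.Mon 3 1"
proof -
  have s: "{1..3} = {1, 2, 3 :: nat}" by auto
  have "content {#} (mset_set {1, 2, 3}) (pl 1 (lf 1) (lf 2) (lf 3) :: ('k, greg_gen) lin)"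
    unfolding pl_def by (rule content_rules | simp)+
  moreover have "greg.homog 0 (pl 1 (lf 1) (lf 2) (lf 3) :: ('k, greg_gen) lin)"
    by (auto simp: pl_def intro!: greg.homog_diff)
  ultimately show "keys (pl 1 (lf 1) (lf 2) (lf 3) :: ('k, greg_gen) lin) \<subseteq> greg.Mon 3 0"
    unfolding greg.keys_Mon_iff s by blast
  have "content {#} (mset_set {1, 2, 3}) (gr 1 (lf 1) (lf 2) (lf 3) :: ('k, greg_gen) lin)"
    unfolding gr_def by (rule content_rules | simp)+
  moreover have "greg.homog 1 (gr 1 (lf 1) (lf 2) (lf 3) :: ('k, greg_gen) lin)"
    by (auto simp: gr_def intro!: greg.homog_diff greg.homog_add)
  ultimately show "keys (gr 1 (lf 1) (lf 2) (lf 3) :: ('k, greg_gen) lin) \<subseteq> greg.Mon 3 1"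
    unfolding greg.keys_Mon_iff s by blast
qed

text \<open>Insertion at 1, then behind the inputs of \<open>a\<close>, then behind those of
  \<open>b\<close> puts the arguments into consecutive blocks. In the terms in which
  \<open>w\<close> precedes \<open>v\<close>, the third argument has to pass the second, which
  creates the exchange sign.\<close>

lemma pl_gr_inst:
  fixes a b c :: "('k::field, greg_gen) lin"
  assumes "keys a \<subseteq> greg.Mon k p" "keys b \<subseteq> greg.Mon l q"
  shows "greg.cmp s j (k + l + 1) (greg.cmp q l (k + 1) (greg.cmp p k 1 (pl 1 (lf 1) (lf 2) (lf 3)) a) b) c =
      pl (sg (q * s)) a (ren (\<lambda>x. x + k) b) (ren (\<lambda>x. x + (k + l)) c)"
    and "greg.cmp s j (k + l + 1) (greg.cmp q l (k + 1) (greg.cmp p k 1 (gr 1 (lf 1) (lf 2) (lf 3)) a) b) c =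
      gr (sg (q * s)) a (ren (\<lambda>x. x + k) b) (ren (\<lambda>x. x + (k + l)) c)"
proof -
  have E: "greg.eps s (ren f b) = sg (q * s) \<star> ren f b" for f
    using assms(2) greg.eps_homog[OF greg.homog_ren[OF greg.Mon_homog[OF assms(2)]]] by (simp add: mult.commute)
  have S: "ren (shift n i) (lf x) = (lf (if x < i then x else if x = i then 0 else x + n - 1) :: ('k, greg_gen) lin)" for n i x
    by (simp add: shift_def)
  note a = greg.cmp_below[OF assms(1)] and b = greg.cmp_below_shift[OF assms(2), of k]
  show "greg.cmp s j (k + l + 1) (greg.cmp q l (k + 1) (greg.cmp p k 1 (pl 1 (lf 1) (lf 2) (lf 3)) a) b) c =
      pl (sg (q * s)) a (ren (\<lambda>x. x + k) b) (ren (\<lambda>x. x + (k + l)) c)"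
    by (simp add: pl_def greg.cmp_simps insertion_def S a b E greg.eps_nd scl_distribs del: nd_bas ren_bas greg.eps_ren)
  show "greg.cmp s j (k + l + 1) (greg.cmp q l (k + 1) (greg.cmp p k 1 (gr 1 (lf 1) (lf 2) (lf 3)) a) b) c =
      gr (sg (q * s)) a (ren (\<lambda>x. x + k) b) (ren (\<lambda>x. x + (k + l)) c)"
    by (simp add: gr_def greg.cmp_simps insertion_def S a b E greg.eps_nd scl_distribs del: nd_bas ren_bas greg.eps_ren)
qed

interpretation gq: presented_operad greg_deg "greg_swap :: greg_gen \<Rightarrow> 'k::field \<times> greg_gen"
  "{prelie_relation, greg_relation}"
proof
  show "\<exists>n d. r \<in> ops greg.T n d" if "r \<in> {prelie_relation, greg_relation :: 'k greg_free}" for r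
    using that greg.free.tauh_closed unfolding prelie_relation_eq greg_relation_eq by blast
qed

abbreviation greg_of :: "nat \<Rightarrow> int \<Rightarrow> ('k::field, greg_gen) lin \<Rightarrow> 'k greg_free set"
  where "greg_of \<equiv> gq.op.tauh"

lemma Greg1_eq: "Greg1 = gq.pr.Q"
  by (simp add: Greg1_def greg_T_def greg_ideal_def)

lemma greg_gen_eq: "greg_x = greg_of 2 0 (nx (lf 1) (lf 2))" "greg_y = greg_of 2 0 (ny (lf 1) (lf 2))"
  "greg_g = greg_of 2 1 (ng (lf 1) (lf 2))"
  using gq.op.gen_eq_tauh[of GenX] gq.op.gen_eq_tauh[of GenY] gq.op.gen_eq_tauh[of GenG]
  by (simp_all add: greg_x_def greg_y_def greg_g_def greg_T_def greg_ideal_def greg_T_gen_def)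

lemma mset_leaves_3: "mset (leaves m) = mset (leaves a) + mset (leaves b) + mset (leaves c) \<and> greg.mdeg m = e + greg.mdeg a + greg.mdeg b + greg.mdeg c"
  if "content {#} (mset (leaves a) + mset (leaves b) + mset (leaves c)) u"
    "greg.homog (e + greg.mdeg a + greg.mdeg b + greg.mdeg c) u" "m \<in> keys u"
  using that by (auto simp: content_def greg.homog_def)

text \<open>The bridge between the operad and the trees. From left to right relations are extracted
  from the operadic ideal by \<open>tauh_zero_rel\<close>; from right to left the relators at leaves
  spread to all trees by \<open>tauh_vanish3\<close> and to all contexts by
  \<open>tauh_rel\<close>.\<close>

lemma tg_zero_iff:
  fixes w :: "('k::field, greg_gen) lin"
  assumes w: "keys w \<subseteq> greg.Mon n d"
  shows "greg_of n d w = \<zero>\<^bsub>cpt gq.pr.Q n d\<^esub> \<longleftrightarrow> w \<in> greg_rel"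
proof
  assume z: "greg_of n d w = \<zero>\<^bsub>cpt gq.pr.Q n d\<^esub>"
  have R: "\<exists>n d w. keys w \<subseteq> greg.Mon n d \<and> r = greg.free.tauh n d w \<and> w \<in> greg_rel"
    if "r \<in> {prelie_relation, greg_relation :: 'k greg_free}" for r
  proof -
    have "pl 1 (lf 1) (lf 2) (lf 3) \<in> (greg_rel :: ('k, greg_gen) lin set)"
      "gr 1 (lf 1) (lf 2) (lf 3) \<in> (greg_rel :: ('k, greg_gen) lin set)"
      using pl_rel[of 0 "lf 2" 0 "lf 3" "lf 1"] gr_rel[of 0 "lf 2" 0 "lf 3" "lf 1"] by auto
    then show ?thesis using that pl_keys gr_keys unfolding prelie_relation_eq greg_relation_eq by blast
  qed
  show "w \<in> greg_rel"
  proof (rule gq.tauh_zero_rel)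
    show "greg.subst q f e u \<in> greg_rel" if "\<And>j. greg.homog q (e j)" "u \<in> greg_rel"
      for q f and e :: "nat \<Rightarrow> ('k, greg_gen) lin" and u
      using that by (rule subst_greg_rel)
    show "ren f u \<in> greg_rel" if "u \<in> greg_rel" for f and u :: "('k, greg_gen) lin"
      using that by (rule ren_greg_rel)
  qed (use R w z in auto)
next
  assume w: "w \<in> greg_rel"
  have base: "greg_of n d (ren f r) = \<zero>\<^bsub>cpt gq.pr.Q n d\<^esub>" if r: "r \<in> greg_base" for n d f and r :: "('k, greg_gen) lin"
  proof -
    have z: "greg_of 3 0 (pl 1 (lf 1) (lf 2) (lf 3)) = \<zero>\<^bsub>cpt gq.pr.Q 3 0\<^esub>"
      "greg_of 3 1 (gr 1 (lf 1) (lf 2) (lf 3)) = \<zero>\<^bsub>cpt gq.pr.Q 3 1\<^esub>"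
      using gq.tauh_relator[OF pl_keys] gq.tauh_relator[OF gr_keys]
      unfolding prelie_relation_eq greg_relation_eq by simp_all
    have h: "greg.homog (0 + greg.mdeg a + greg.mdeg b + greg.mdeg c) (pl x (bas a) (bas b) (bas c))"
      "greg.homog (1 + greg.mdeg a + greg.mdeg b + greg.mdeg c) (gr x (bas a) (bas b) (bas c))"
      for a b c and x :: 'k
      by (auto simp: pl_def gr_def intro!: greg.homog_diff greg.homog_add greg.homog_scl)
    have c: "content {#} (mset (leaves a) + mset (leaves b) + mset (leaves c)) (pl x (bas a) (bas b) (bas c))"
      "content {#} (mset (leaves a) + mset (leaves b) + mset (leaves c)) (gr x (bas a) (bas b) (bas c))"
      for a b c and x :: 'k
      unfolding pl_def gr_def by (rule content_rules | simp del: nd_bas)+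
    have pl0: "greg_of n d (pl (sg (greg.mdeg b * greg.mdeg c)) (bas a) (bas b) (bas c) :: ('k, greg_gen) lin) = \<zero>\<^bsub>cpt gq.pr.Q n d\<^esub>" for a b c
      by (rule gq.op.tauh_vanish3[OF pl_keys z(1) pl_gr_inst(1) ren_pl mset_leaves_3[OF c(1) h(1)]]) assumption
    have gr0: "greg_of n d (gr (sg (greg.mdeg b * greg.mdeg c)) (bas a) (bas b) (bas c) :: ('k, greg_gen) lin) = \<zero>\<^bsub>cpt gq.pr.Q n d\<^esub>" for a b c
      by (rule gq.op.tauh_vanish3[OF gr_keys z(2) pl_gr_inst(2) ren_gr mset_leaves_3[OF c(2) h(2)]]) assumption
    show ?thesis using r
    proof (cases rule: greg_base_cases)
      case (pl a b c)
      then show ?thesis using pl0[of "relabel f b" "relabel f c" "relabel f a"] by simp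
    next
      case (gr a b c)
      then show ?thesis using gr0[of "relabel f b" "relabel f c" "relabel f a"] by simp
    qed
  qed
  have "greg_of n d (ren (\<lambda>j. j) w) = \<zero>\<^bsub>cpt gq.pr.Q n d\<^esub>"
    using base w by (rule gq.op.tauh_rel)
  then show "greg_of n d w = \<zero>\<^bsub>cpt gq.pr.Q n d\<^esub>" by simp
qed

lemma tg_eq_iff:
  fixes w :: "('k::field, greg_gen) lin"
  assumes "keys v \<subseteq> greg.Mon n d" "keys w \<subseteq> greg.Mon n d"
  shows "greg_of n d v = greg_of n d w \<longleftrightarrow> v - w \<in> greg_rel"
proof -
  have "keys (v - w) \<subseteq> greg.Mon n d" using assms keys_diff_subset[of v w] by blast
  from tg_zero_iff[OF this] show ?thesis
    using gq.op.md.minus_equality[where y = "greg_of n d v" and x = "\<ominus>\<^bsub>cpt gq.pr.Q n d\<^esub> greg_of n d w" and n = n and d = d]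
      gq.op.md.r_neg[where x = "greg_of n d w" and n = n and d = d]
    by (auto simp: gq.op.tauh_diff gq.op.md.minus_eq)
qed

section \<open>The differential of Greg in terms of trees\<close>

lemma dd_ren:
  fixes u :: "('k::field, greg_gen) lin"
  shows "dd (ren f u) = ren f (dd u)"
proof (induction u rule: lin_induct)
  case (add c m v)
  have "dd (ren f (bas m)) = ren f (dd (bas m :: ('k, greg_gen) lin))"
  proof (induction m)
    case (Nd g a b)
    then show ?case by (cases g) (simp_all del: nd_bas ren_bas flip: nd_bas)
  qed simp
  with add show ?case by simp
qed simp

lemma eps_dd:
  fixes u :: "('k::field, greg_gen) lin"
  shows "dd (greg.eps q u) = sg q \<star> greg.eps q (dd u)"
proof (cases "even q")
  case True
  then show ?thesis by (simp add: greg.eps_even sg_def)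
next
  case False
  then show ?thesis using ep_dd[of u] by (simp add: greg.eps_odd[OF False] sg_def)
qed

text \<open>The differential meets either the inserted term or the surrounding tree, and in the
  latter case it passes an insertion of degree \<open>q\<close>.\<close>

lemma dd_subst:
  fixes u :: "('k::field, greg_gen) lin"
  assumes e: "\<And>j. greg.homog q (e j)"
  shows "dd (greg.subst q f e u) = greg.subst (q + 1) f (\<lambda>j. dd (e j)) u + sg q \<star> greg.subst q f e (dd u)"
proof (induction u rule: lin_induct)
  case (add c m v)
  have "dd (greg.subst q f e (bas m)) = greg.subst (q + 1) f (\<lambda>j. dd (e j)) (bas m) + sg q \<star> greg.subst q f e (dd (bas m))"
  proof (induction m)
    case (Nd g a b)
    have E: "ep (greg.subst q f e u) = sg q \<star> greg.subst q f e (ep u)" for u :: "('k, greg_gen) lin"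
      using greg.eps_subst[OF e, of 1] by simp
    have E1: "greg.eps (q + 1) (u :: ('k, greg_gen) lin) = ep (greg.eps q u)"
      "greg.eps (1 + q) (u :: ('k, greg_gen) lin) = ep (greg.eps q u)" for u
      by (metis greg.eps_eps add.commute)+
    show ?case
      by (cases g)
        (simp_all add: Nd E E1 eps_dd dd_ren scl_distribs greg.eps_commute[of q 1] algebra_simps del: nd_bas ren_bas flip: nd_bas)
  qed simp
  with add show ?case by (simp add: scl_distribs mult.commute)
qed simp

lemma dd_dd:
  fixes u :: "('k::field, greg_gen) lin"
  shows "dd (dd u) = 0"
proof (induction u rule: lin_induct)
  case (add c m v)
  have "dd (dd (bas m :: ('k, greg_gen) lin)) = 0"
  proof (induction m)
    case (Nd g a b)
    then show ?case by (cases g) (simp_all add: ep_dd flip: nd_bas)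
  qed simp
  with add show ?case by simp
qed simp

lemma dd_cmp:
  fixes u :: "('k::field, greg_gen) lin"
  assumes "keys v \<subseteq> greg.Mon n q"
  shows "dd (greg.cmp q n i u v) = greg.cmp (q + 1) n i u (dd v) + sg q \<star> greg.cmp q n i (dd u) v"
proof -
  have "greg.homog q (insertion i v j)" for j
    using greg.Mon_homog[OF assms] by (auto simp: insertion_def intro: greg.homog_ren)
  moreover have "(\<lambda>j. dd (insertion i v j)) = insertion i (dd v)"
    by (auto simp: insertion_def dd_ren)
  ultimately show ?thesis unfolding greg.cmp_def by (simp add: dd_subst)
qed

text \<open>The factor \<open>sg d\<close> turns the operator \<open>dd\<close>, which acts from the
  right, into a derivation with the sign convention of \<open>der_comp\<close>, where the sign comes
  from the first factor. A representing combination is chosen; \<open>greg_der_tg\<close> shows that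
  the choice is immaterial.\<close>

definition greg_der :: "'k::field greg_free set \<Rightarrow> 'k greg_free set"
  where "greg_der a = (let n = arity gq.pr.Q a; d = degree_of gq.pr.Q a
    in greg_of n (d + 1) (sg d \<star> dd (SOME w. keys w \<subseteq> greg.Mon n d \<and> a = greg_of n d w)))"

lemma greg_der_tg:
  fixes w :: "('k::field, greg_gen) lin"
  assumes w: "keys w \<subseteq> greg.Mon n d"
  shows "greg_der (greg_of n d w) = greg_of n (d + 1) (sg d \<star> dd w)"
proof -
  define v where "v = (SOME v. keys v \<subseteq> greg.Mon n d \<and> greg_of n d w = greg_of n d v)"
  have v: "keys v \<subseteq> greg.Mon n d \<and> greg_of n d w = greg_of n d v"
    unfolding v_def by (rule someI[of _ w]) (use w in simp)
  then have "v - w \<in> greg_rel" using tg_eq_iff[of v n d w] w by simp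
  then have "sg d \<star> dd v - sg d \<star> dd w \<in> greg_rel"
    using greg.rel_scl[OF dd_rel, of "v - w" "sg d"] by (simp add: scl_distribs)
  then have "greg_of n (d + 1) (sg d \<star> dd v) = greg_of n (d + 1) (sg d \<star> dd w)"
    using keys_dd[of v n d] keys_dd[of w n d] keys_scl_subset[of "sg d" "dd v"] keys_scl_subset[of "sg d" "dd w"] v w
    by (intro tg_eq_iff[THEN iffD2]) auto
  moreover have "greg_der (greg_of n d w) = greg_of n (d + 1) (sg d \<star> dd v)"
    unfolding greg_der_def Let_def using gq.op.arity_degree[OF gq.op.tauh_closed[of n d w]] by (simp add: v_def)
  ultimately show ?thesis by simp
qed

lemma greg_der_derivation: "operadic_derivation gq.pr.Q (greg_der :: 'k::field greg_free set \<Rightarrow> _)"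
proof (intro operadic_derivation.intro gq.pr.graded_operad_quotient operadic_derivation_axioms.intro)
  show "greg_der a \<in> ops gq.pr.Q n (d + 1)" if a: "a \<in> ops gq.pr.Q n d" for a :: "'k greg_free set" and n d
  proof -
    obtain w where w: "keys w \<subseteq> greg.Mon n d" "a = greg_of n d w" using gq.ops_tauh[OF a] .
    show ?thesis using greg_der_tg[OF w(1)] gq.op.tauh_closed by (simp add: w(2))
  qed
  show "greg_der (a \<oplus>\<^bsub>cpt gq.pr.Q n d\<^esub> b) = greg_der a \<oplus>\<^bsub>cpt gq.pr.Q n (d + 1)\<^esub> greg_der b"
    if a: "a \<in> ops gq.pr.Q n d" and b: "b \<in> ops gq.pr.Q n d" for a b :: "'k greg_free set" and n d
  proof -
    obtain v w where vw: "keys v \<subseteq> greg.Mon n d" "a = greg_of n d v" "keys w \<subseteq> greg.Mon n d" "b = greg_of n d w"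
      using gq.ops_tauh[OF a] gq.ops_tauh[OF b] by metis
    then have "keys (v + w) \<subseteq> greg.Mon n d" using keys_add[of v w] by blast
    then show ?thesis using vw
      by (simp add: greg_der_tg scl_distribs gq.op.tauh_add flip: gq.op.tauh_add)
  qed
  show "greg_der (c \<odot>\<^bsub>cpt gq.pr.Q n d\<^esub> a) = c \<odot>\<^bsub>cpt gq.pr.Q n (d + 1)\<^esub> greg_der a"
    if a: "a \<in> ops gq.pr.Q n d" for c and a :: "'k greg_free set" and n d
  proof -
    obtain v where v: "keys v \<subseteq> greg.Mon n d" "a = greg_of n d v" using gq.ops_tauh[OF a] .
    then have "keys (c \<star> v) \<subseteq> greg.Mon n d" using keys_scl_subset[of c v] by blast
    then show ?thesis using v by (simp add: greg_der_tg mult.commute flip: gq.op.tauh_scl)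
  qed
  show "greg_der (act gq.pr.Q a \<sigma>) = act gq.pr.Q (greg_der a) \<sigma>"
    if a: "a \<in> ops gq.pr.Q n d" and s: "\<sigma> permutes {1..n}" for a :: "'k greg_free set" and n d \<sigma>
  proof -
    obtain v where v: "keys v \<subseteq> greg.Mon n d" "a = greg_of n d v" using gq.ops_tauh[OF a] .
    then have "keys (ren (pinv \<sigma>) v) \<subseteq> greg.Mon n d" using greg.keys_ren_Mon permutes_inv[OF s] by blast
    then show ?thesis using v s by (simp add: greg_der_tg gq.op.tauh_ren dd_ren)
  qed
  show "greg_der (pcomp gq.pr.Q a i b) = pcomp gq.pr.Q (greg_der a) i b \<oplus>\<^bsub>cpt gq.pr.Q (m + n - 1) (p + q + 1)\<^esub>
          koszul_sign 1 p \<odot>\<^bsub>cpt gq.pr.Q (m + n - 1) (p + q + 1)\<^esub> pcomp gq.pr.Q a i (greg_der b)"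
    if a: "a \<in> ops gq.pr.Q m p" and b: "b \<in> ops gq.pr.Q n q" and i: "i \<in> {1..m}"
    for a b :: "'k greg_free set" and m p n q i
  proof -
    obtain v w where vw: "keys v \<subseteq> greg.Mon m p" "a = greg_of m p v" "keys w \<subseteq> greg.Mon n q" "b = greg_of n q w"
      using gq.ops_tauh[OF a] gq.ops_tauh[OF b] by metis
    let ?v = "sg p \<star> dd v" and ?w = "sg q \<star> dd w"
    have k: "keys ?v \<subseteq> greg.Mon m (p + 1)" "keys ?w \<subseteq> greg.Mon n (q + 1)"
      using keys_dd[OF vw(1)] keys_dd[OF vw(3)] keys_scl_subset[of "sg p" "dd v"] keys_scl_subset[of "sg q" "dd w"] by auto
    have "greg_der (pcomp gq.pr.Q a i b) =
        greg_of (m + n - 1) (p + q + 1) (sg (p + q) \<star> dd (greg.cmp q n i v w))"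
      unfolding vw(2,4) gq.op.tauh_comp[OF vw(1,3) i] by (rule greg_der_tg[OF greg.keys_cmp[OF vw(1,3) i]])
    also have "sg (p + q) \<star> dd (greg.cmp q n i v w) =
        greg.cmp q n i ?v w + sg p \<star> greg.cmp (q + 1) n i v ?w"
      by (simp add: dd_cmp[OF vw(3)] sg_add scl_distribs mult.assoc)
    finally show ?thesis
      using gq.op.tauh_comp[OF k(1) vw(3) i] gq.op.tauh_comp[OF vw(1) k(2) i]
      by (simp add: vw(2,4) greg_der_tg[OF vw(1)] greg_der_tg[OF vw(3)] gq.op.tauh_add gq.op.tauh_scl koszul_sign_eq add_ac
          del: greg.cmp_linear)
  qed
qed

abbreviation derivation_spec :: "('k::field greg_free set \<Rightarrow> 'k greg_free set) \<Rightarrow> bool"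
  where "derivation_spec D \<equiv> operadic_derivation gq.pr.Q D \<and>
    D greg_x = \<ominus>\<^bsub>cpt gq.pr.Q 2 1\<^esub> greg_g \<and>
    D greg_y = \<ominus>\<^bsub>cpt gq.pr.Q 2 1\<^esub> greg_g \<and>
    D greg_g = \<zero>\<^bsub>cpt gq.pr.Q 2 2\<^esub>"

text \<open>The explicit derivation has the prescribed values on x, y and g, so the choice that
  defines \<open>greg_d\<close> is made from a nonempty set and inherits its specification.\<close>

lemma greg_der_spec: "derivation_spec (greg_der :: 'k::field greg_free set \<Rightarrow> _)"
  and greg_d_spec: "derivation_spec (greg_d :: 'k greg_free set \<Rightarrow> _)"
proof -
  have k: "keys (nx (lf 1) (lf 2) :: ('k, greg_gen) lin) \<subseteq> greg.Mon 2 0"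
    "keys (ny (lf 1) (lf 2) :: ('k, greg_gen) lin) \<subseteq> greg.Mon 2 0"
    "keys (ng (lf 1) (lf 2) :: ('k, greg_gen) lin) \<subseteq> greg.Mon 2 1"
    by (auto simp: greg.Mon_def)
  show *: "derivation_spec (greg_der :: 'k greg_free set \<Rightarrow> _)"
    using greg_der_derivation greg_der_tg[OF k(1)] greg_der_tg[OF k(2)] greg_der_tg[OF k(3)]
    unfolding greg_gen_eq by (simp add: gq.op.tauh_uminus del: nd_bas)
  show "derivation_spec (greg_d :: 'k greg_free set \<Rightarrow> _)"
    unfolding greg_d_def Greg1_eq by (rule someI[of derivation_spec, OF *])
qed

lemma greg_d_eq:
  fixes a :: "'k::field greg_free set"
  assumes "a \<in> ops gq.pr.Q n d"
  shows "greg_d a = greg_der a"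
proof (rule gq.derivation_unique[OF _ _ _ assms])
  show "operadic_derivation gq.pr.Q (greg_d :: 'k greg_free set \<Rightarrow> _)"
    "operadic_derivation gq.pr.Q (greg_der :: 'k greg_free set \<Rightarrow> _)"
    using greg_d_spec greg_der_spec by auto
  show "greg_d (gq.pr.coset (greg.cls (Gen g))) = (greg_der (gq.pr.coset (greg.cls (Gen g))) :: 'k greg_free set)" for g
    using greg_d_spec[where 'k = 'k] greg_der_spec[where 'k = 'k]
    by (cases g) (simp_all add: greg_x_def greg_y_def greg_g_def greg_T_def greg_ideal_def greg_T_gen_def)
qed

lemma greg_d_tg:
  fixes w :: "('k::field, greg_gen) lin"
  shows "keys w \<subseteq> greg.Mon n d \<Longrightarrow> greg_d (greg_of n d w) = sg d \<odot>\<^bsub>cpt gq.pr.Q n (d + 1)\<^esub> greg_of n (d + 1) (dd w)"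
  using greg_d_eq[OF gq.op.tauh_closed[of n d w]] greg_der_tg[of w n d] by (simp add: gq.op.tauh_scl)

lemma Greg_minus1_eq: "Greg_minus1 = with_differential gq.pr.Q greg_d"
  by (simp add: Greg_minus1_def Greg1_eq)

interpretation gd: differential_graded_operad "Greg_minus1 :: ('k::field, 'k greg_free set) dg_operad"
proof (intro differential_graded_operad.intro differential_graded_operad_axioms.intro)
  show d: "operadic_derivation (Greg_minus1 :: ('k, 'k greg_free set) dg_operad) (dif Greg_minus1)"
    using greg_d_spec[where 'k = 'k] by (simp add: Greg_minus1_eq)
  interpret operadic_derivation gq.pr.Q "greg_d :: 'k greg_free set \<Rightarrow> _" using greg_d_spec[where 'k = 'k] by blast
  show "dif Greg_minus1 (dif Greg_minus1 a) = \<zero>\<^bsub>cpt Greg_minus1 n (d + 2)\<^esub>"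
    if a: "a \<in> ops Greg_minus1 n d" for a :: "'k greg_free set" and n d
  proof -
    have "a \<in> ops gq.pr.Q n d" using a by (simp add: Greg_minus1_eq)
    from gq.ops_tauh[OF this] obtain w where w: "keys w \<subseteq> greg.Mon n d" "a = greg_of n d w" .
    have k: "keys (sg d \<star> dd w) \<subseteq> greg.Mon n (d + 1)"
      using keys_dd[OF w(1)] keys_scl_subset[of "sg d" "dd w"] by blast
    have "greg_d (greg_d a) = greg_d (greg_of n (d + 1) (sg d \<star> dd w))"
      by (simp only: w(2) greg_d_tg[OF w(1)] gq.op.tauh_scl)
    also have "\<dots> = sg (d + 1) \<odot>\<^bsub>cpt gq.pr.Q n (d + 1 + 1)\<^esub> \<zero>\<^bsub>cpt gq.pr.Q n (d + 1 + 1)\<^esub>"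
      unfolding greg_d_tg[OF k] by (simp add: dd_dd)
    also have "\<dots> = \<zero>\<^bsub>cpt gq.pr.Q n (d + 2)\<^esub>"
      using gq.op.md.smult_r_null[of "sg (d + 1)" n "d + 2"] by (simp add: add.assoc)
    finally show ?thesis by (simp add: Greg_minus1_eq)
  qed
qed

section \<open>The operad Lie in terms of labelled trees\<close>

interpretation lie: binary_generators lie_deg "lie_swap :: lie_gen \<Rightarrow> 'k::field \<times> lie_gen"
  by unfold_locales (simp add: lie_deg_def)

abbreviation "nl \<equiv> nd GenL"

lemma lie_mdeg [simp]: "lie.mdeg m = 0"
proof (induction m)
  case (Nd g a b)
  have "lie_deg g = 0" by (rule lie_deg_def)
  then show ?case unfolding lie.mdeg.simps Nd by simp
qed (rule lie.mdeg.simps)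

lemma lie_homog [simp]: "lie.homog 0 u"
  by (simp add: lie.homog_def)

lemma lie_eps [simp]: "lie.eps q u = u"
  using lie.eps_homog[of 0 u q] by simp

definition jc :: "('k::field, lie_gen) lin \<Rightarrow> ('k, lie_gen) lin \<Rightarrow> ('k, lie_gen) lin \<Rightarrow> ('k, lie_gen) lin"
  where "jc u v w = nl (nl u v) w + nl (nl w u) v + nl (nl v w) u"

abbreviation "cycle1 \<equiv> cycle_of_list [1, 2, 3 :: nat]"
abbreviation "cycle2 \<equiv> cycle_of_list [1, 3, 2 :: nat]"

lemma cycles:
  "cycle1 permutes {1..3}" "cycle2 permutes {1..3}" "pinv cycle1 = cycle2" "pinv cycle2 = cycle1"
  "cycle1 1 = 2" "cycle1 2 = 3" "cycle1 3 = 1" "cycle2 1 = 3" "cycle2 2 = 1" "cycle2 3 = 2"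
proof -
  have s: "{1..3} = {1, 2, 3 :: nat}" by auto
  show "cycle1 permutes {1..3}" "cycle2 permutes {1..3}"
    using cycle_permutes[of "[1, 2, 3 :: nat]"] cycle_permutes[of "[1, 3, 2 :: nat]"] unfolding s by (simp_all add: insert_commute)
  have "cycle1 (cycle2 x) = x" "cycle2 (cycle1 x) = x" for x by (auto simp: transpose_def)
  then have "cycle1 \<circ> cycle2 = id" "cycle2 \<circ> cycle1 = id" unfolding fun_eq_iff by simp_all
  then show "pinv cycle1 = cycle2" "pinv cycle2 = cycle1" by (auto intro: inv_unique_comp)
qed (auto simp: transpose_def)

lemma jacobi_tauh:
  fixes P :: "('k::field, 'a, 'm) operad_scheme"
  assumes "operad_generators P lie_deg lie_swap gen"
  defines "z \<equiv> pcomp P (gen GenL) 1 (gen GenL)"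
  shows "operad_generators.tauh P lie_deg gen 3 0 (jc (lf 1) (lf 2) (lf 3)) =
    z \<oplus>\<^bsub>cpt P 3 0\<^esub> act P z cycle1 \<oplus>\<^bsub>cpt P 3 0\<^esub> act P z cycle2"
proof -
  interpret P: operad_generators P lie_deg lie_swap gen by fact
  have z: "z = P.tauh 3 0 (nl (nl (lf 1) (lf 2)) (lf 3))"
    using P.gen_comp_tauh[of 1 GenL GenL]
    by (simp add: z_def lie_deg_def corolla_nd lie.cmp_simps insertion_def shift_def numeral_2_eq_2[symmetric] del: nd_bas)
  show ?thesis
    unfolding z P.tauh_ren[OF cycles(1)] P.tauh_ren[OF cycles(2)] cycles(3,4)
    by (simp add: jc_def cycles P.tauh_add del: nd_bas cycle_of_list.simps One_nat_def)
qed

lemma jacobi_relation_eq: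
  "jacobi_relation = lie.free.tauh 3 0 (jc (lf 1) (lf 2) (lf 3) :: ('k::field, lie_gen) lin)"
  unfolding jacobi_tauh[OF lie.operad_generators_T] jacobi_relation_def Let_def lie_T_def lie_T_l_def ..

interpretation lq: presented_operad lie_deg "lie_swap :: lie_gen \<Rightarrow> 'k::field \<times> lie_gen" "{jacobi_relation}"
proof
  show "\<exists>n d. r \<in> ops lie.T n d" if "r \<in> {jacobi_relation :: 'k lie_free}" for r
    using that lie.free.tauh_closed unfolding jacobi_relation_eq by blast
qed

abbreviation lie_of :: "nat \<Rightarrow> int \<Rightarrow> ('k::field, lie_gen) lin \<Rightarrow> 'k lie_free set"
  where "lie_of \<equiv> lq.op.tauh"

lemma Lie_eq: "Lie = lq.pr.Q"
  by (simp add: Lie_def lie_T_def lie_ideal_def)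

lemma lie_l_eq: "lie_l = lq.pr.coset (lie.cls (Gen GenL))"
  by (simp add: lie_l_def lie_T_def lie_ideal_def lie_T_l_def)

definition lie_base :: "('k::field, lie_gen) lin set"
  where "lie_base = (\<Union>a b c. {jc (bas a) (bas b) (bas c)})"

abbreviation lie_rel :: "('k::field, lie_gen) lin set" where "lie_rel \<equiv> lie.rel lie_base"

lemma jc_keys: "keys (jc (lf 1) (lf 2) (lf 3) :: ('k::field, lie_gen) lin) \<subseteq> lie.Mon 3 0"
proof -
  have s: "{1..3} = {1, 2, 3 :: nat}" by auto
  have "content {#} (mset_set {1, 2, 3}) (jc (lf 1) (lf 2) (lf 3) :: ('k, lie_gen) lin)"
    unfolding jc_def by (rule content_add content_nd content_lf | simp)+
  then show ?thesis unfolding lie.keys_Mon_iff s by simp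
qed

lemma jc_inst:
  fixes a b c :: "('k::field, lie_gen) lin"
  assumes "keys a \<subseteq> lie.Mon k p" "keys b \<subseteq> lie.Mon l q"
  shows "lie.cmp s j (k + l + 1) (lie.cmp q l (k + 1) (lie.cmp p k 1 (jc (lf 1) (lf 2) (lf 3)) a) b) c =
      jc a (ren (\<lambda>x. x + k) b) (ren (\<lambda>x. x + (k + l)) c)"
proof -
  have S: "ren (shift n i) (lf x) = (lf (if x < i then x else if x = i then 0 else x + n - 1) :: ('k, lie_gen) lin)" for n i x
    by (simp add: shift_def)
  show ?thesis
    by (simp add: jc_def lie.cmp_simps insertion_def S lie.cmp_below[OF assms(1)] lie.cmp_below_shift[OF assms(2), of k]
        del: nd_bas ren_bas)
qed

text \<open>For Lie this implication turns identities modulo \<open>lie_rel\<close> into equations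
  between operations. Whether an operation of Lie is nonzero is always decided by its image in
  Greg.\<close>

lemma tl_zero:
  fixes w :: "('k::field, lie_gen) lin"
  assumes w: "w \<in> lie_rel"
  shows "lie_of n d w = \<zero>\<^bsub>cpt lq.pr.Q n d\<^esub>"
proof -
  have z: "lie_of 3 0 (jc (lf 1) (lf 2) (lf 3)) = \<zero>\<^bsub>cpt lq.pr.Q 3 0\<^esub>"
    using lq.tauh_relator[OF jc_keys] unfolding jacobi_relation_eq by simp
  have c: "content {#} (mset (leaves a) + mset (leaves b) + mset (leaves c)) (jc (bas a) (bas b) (bas c) :: ('k, lie_gen) lin)"
    for a b c
    unfolding jc_def by (rule content_add content_nd content_bas | simp del: nd_bas)+
  have vanish: "lie_of n d (jc (bas a) (bas b) (bas c) :: ('k, lie_gen) lin) = \<zero>\<^bsub>cpt lq.pr.Q n d\<^esub>" for a b c n d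
  proof (rule lq.op.tauh_vanish3[OF jc_keys z, where F = "\<lambda>x. jc"])
    show "mset (leaves m) = mset (leaves a) + mset (leaves b) + mset (leaves c) \<and>
        lie.mdeg m = 0 + lie.mdeg a + lie.mdeg b + lie.mdeg c"
      if "m \<in> keys (jc (bas a) (bas b) (bas c) :: ('k, lie_gen) lin)" for m
      using content_keys[OF c that] by simp
  next
    show "lie.cmp s j (k + l + 1) (lie.cmp q l (k + 1) (lie.cmp p k 1 (jc (lf 1) (lf 2) (lf 3)) a) b) c =
        jc a (ren (\<lambda>x. x + k) b) (ren (\<lambda>x. x + (k + l)) c)"
      if "keys a \<subseteq> lie.Mon k p" "keys b \<subseteq> lie.Mon l q"
      for k p l q j s and a b c :: "('k, lie_gen) lin"
      using that by (rule jc_inst)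
  qed (simp add: jc_def)
  have base: "lie_of n d (ren f r) = \<zero>\<^bsub>cpt lq.pr.Q n d\<^esub>" if "r \<in> lie_base" for n d f and r :: "('k, lie_gen) lin"
  proof -
    obtain a b c where "r = jc (bas a) (bas b) (bas c)" using \<open>r \<in> _\<close> by (auto simp: lie_base_def)
    then show ?thesis using vanish[of n d "relabel f a" "relabel f b" "relabel f c"] by (simp add: jc_def)
  qed
  have "lie_of n d (ren (\<lambda>j. j) w) = \<zero>\<^bsub>cpt lq.pr.Q n d\<^esub>"
    using base w by (rule lq.op.tauh_rel)
  then show ?thesis by simp
qed

lemma lie_swap_rel: "nl u w + nl w u \<in> lie_rel"
  using lie.rel_swap_homog[of 0 u 0 w GenL] by (simp add: lie_swap_def)

text \<open>The counterpart of \<open>ee\<close> in Lie: the bracket [i, s] replaces the leaf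
  \<open>i\<close>.\<close>

definition bb :: "nat \<Rightarrow> nat \<Rightarrow> ('k::field, lie_gen) lin \<Rightarrow> ('k, lie_gen) lin"
  where "bb s i = lie.subst 0 (\<lambda>j. j) (\<lambda>j. if j = i then nl (lf i) (lf s) else 0)"

lemma linear_map_bb [intro!, simp]: "linear_map (bb s i)"
  by (simp add: bb_def)

lemmas bb_linear [simp] = linear_mapD[OF linear_map_bb]

lemma bb_simps [simp]:
  "bb s i (lf j) = (if j = i then nl (lf i) (lf s) else 0)"
  "bb s i (nd g u w) = nd g (bb s i u) w + nd g u (bb s i w)"
  by (simp_all add: bb_def)

lemma bb_absent: "i \<notin> set (leaves m) \<Longrightarrow> bb s i (bas m :: ('k::field, lie_gen) lin) = 0"
  by (induction m) (simp_all del: nd_bas flip: nd_bas)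

lemma jc_rel: "jc (bas a) (bas b) (bas c) \<in> lie_rel"
  by (rule lie.rel_base) (auto simp: lie_base_def)

text \<open>The Jacobi identity says that bracketing with \<open>s\<close> is a derivation, so it
  can be pushed down to the leaves of the tree.\<close>

lemma bb_bracket:
  assumes "finite J" "set (leaves m) \<subseteq> J"
  shows "nl (bas m) (lf s) - (\<Sum>j\<in>J. bb s j (bas m)) \<in> (lie_rel :: ('k::field, lie_gen) lin set)"
  using assms(2)
proof (induction m)
  case (Lf i)
  then show ?case using assms(1) by (simp add: sum.delta' del: nd_bas)
next
  case (Nd g a b)
  have g: "g = GenL" by (cases g)
  let ?a = "bas a :: ('k, lie_gen) lin" and ?b = "bas b :: ('k, lie_gen) lin"
  define A B where "A = (\<Sum>j\<in>J. bb s j ?a)" and "B = (\<Sum>j\<in>J. bb s j ?b)"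
  have AB: "nl ?a (lf s) - A \<in> lie_rel" "nl ?b (lf s) - B \<in> lie_rel"
    using Nd by (auto simp: A_def B_def)
  \<comment> \<open>Antisymmetry turns the terms [[s, a], b] and [[b, s], a] of the Jacobi relator
    into -[[a, s], b] and -[a, [b, s]]; the induction hypotheses then replace [a, s] and [b, s] by
    \<open>A\<close> and \<open>B\<close>.\<close>
  have "jc ?a ?b (lf s) - nl (nl (lf s) ?a + nl ?a (lf s)) ?b + nl (nl ?a (lf s) - A) ?b
      - (nl (nl ?b (lf s)) ?a + nl ?a (nl ?b (lf s))) + nl ?a (nl ?b (lf s) - B) \<in> lie_rel"
    by (intro lie.rel_add lie.rel_diff lie.rel_left lie.rel_right AB lie_swap_rel jc_rel)
  also have "jc ?a ?b (lf s) - nl (nl (lf s) ?a + nl ?a (lf s)) ?b + nl (nl ?a (lf s) - A) ?b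
      - (nl (nl ?b (lf s)) ?a + nl ?a (nl ?b (lf s))) + nl ?a (nl ?b (lf s) - B) =
      nl (nl ?a ?b) (lf s) - (nl A ?b + nl ?a B)"
    by (simp add: jc_def algebra_simps del: nd_bas)
  also have "nl A ?b + nl ?a B = (\<Sum>j\<in>J. bb s j (nl ?a ?b))"
    by (simp add: A_def B_def sum.distrib linear_sum[OF linear_map_nd(1)] linear_sum[OF linear_map_nd(2)] del: nd_bas)
  finally show ?case by (simp add: g)
qed

text \<open>At the parent of the leaf \<open>s\<close> the tree is a bracket with \<open>s\<close>,
  which \<open>bb_bracket\<close> expands into substitutions. Higher vertices carry the expansion
  along, because the label \<open>j\<close> does not occur in the sibling and substitution therefore
  stays on one side.\<close>

lemma bb_span_bas:
  fixes m :: "lie_gen mon"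
  shows "distinct (leaves m) \<Longrightarrow> s \<in> set (leaves m) \<Longrightarrow> m \<noteq> Lf s \<Longrightarrow>
    \<exists>c :: nat \<Rightarrow> ('k::field, lie_gen) lin. (\<forall>j. content {#s#} (mset (leaves m)) (c j)) \<and>
      bas m - (\<Sum>j\<in>set (leaves m) - {s}. bb s j (c j)) \<in> lie_rel"
proof (induction m)
  case (Nd g a b)
  have g: "g = GenL" by (cases g)
  let ?a = "bas a :: ('k, lie_gen) lin" and ?b = "bas b :: ('k, lie_gen) lin"
  let ?J = "set (leaves (Nd g a b)) - {s}"
  \<comment> \<open>In each case only the labels of one child contribute; the family is continued by
    0 to the remaining labels.\<close>
  have extend: "\<exists>c'. (\<forall>j. content {#s#} (mset (leaves (Nd g a b))) (c' j)) \<and> nl ?a ?b - (\<Sum>j\<in>?J. bb s j (c' j)) \<in> lie_rel"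
    if K: "K \<subseteq> ?J" and c: "\<And>j. j \<in> K \<Longrightarrow> content {#s#} (mset (leaves (Nd g a b))) (c j)"
      and r: "nl ?a ?b - (\<Sum>j\<in>K. bb s j (c j)) \<in> lie_rel" for K and c :: "nat \<Rightarrow> ('k, lie_gen) lin"
  proof (intro exI conjI allI)
    show "content {#s#} (mset (leaves (Nd g a b))) (if j \<in> K then c j else 0)" for j
      using c by (simp add: content_zero)
    have "(\<Sum>j\<in>?J. bb s j (if j \<in> K then c j else 0)) = (\<Sum>j\<in>K. bb s j (if j \<in> K then c j else 0))"
      using K by (intro sum.mono_neutral_right) auto
    also have "\<dots> = (\<Sum>j\<in>K. bb s j (c j))" by (intro sum.cong) auto
    finally show "nl ?a ?b - (\<Sum>j\<in>?J. bb s j (if j \<in> K then c j else 0)) \<in> lie_rel"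
      using r by simp
  qed
  have "\<exists>c. (\<forall>j. content {#s#} (mset (leaves (Nd g a b))) (c j)) \<and> nl ?a ?b - (\<Sum>j\<in>?J. bb s j (c j)) \<in> lie_rel"
  proof (cases "s \<in> set (leaves a)")
    case True
    then have sb: "s \<notin> set (leaves b)" using Nd.prems(1) by auto
    show ?thesis
    proof (cases "a = Lf s")
      case True
      \<comment> \<open>Antisymmetry rewrites [s, b] as -[b, s], so all coefficients are -b.\<close>
      have "(nl ?a ?b + nl ?b ?a) - (nl ?b (lf s) - (\<Sum>j\<in>set (leaves b). bb s j ?b)) \<in> lie_rel"
        by (intro lie.rel_diff lie_swap_rel bb_bracket) auto
      then have "nl ?a ?b - (\<Sum>j\<in>set (leaves b). bb s j (- ?b)) \<in> lie_rel"
        using True by (simp add: sum_negf del: nd_bas)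
      then show ?thesis
        using sb True by (intro extend[of "set (leaves b)" "\<lambda>j. - ?b"]) (auto simp: content_def)
    next
      case a: False
      obtain c :: "nat \<Rightarrow> ('k, lie_gen) lin" where c: "\<And>j. content {#s#} (mset (leaves a)) (c j)"
        "?a - (\<Sum>j\<in>set (leaves a) - {s}. bb s j (c j)) \<in> lie_rel"
        using Nd.IH(1) Nd.prems(1) True a by auto
      have "nl (?a - (\<Sum>j\<in>set (leaves a) - {s}. bb s j (c j))) ?b \<in> lie_rel"
        by (intro lie.rel_left c)
      also have "nl (?a - (\<Sum>j\<in>set (leaves a) - {s}. bb s j (c j))) ?b =
          nl ?a ?b - (\<Sum>j\<in>set (leaves a) - {s}. bb s j (nl (c j) ?b))"
      proof -
        have "bb s j ?b = 0" if "j \<in> set (leaves a)" for j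
          using Nd.prems(1) that by (intro bb_absent) auto
        then show ?thesis by (simp add: linear_sum[OF linear_map_nd(2)] del: nd_bas)
      qed
      finally show ?thesis
        by (rule extend[of "set (leaves a) - {s}" "\<lambda>j. nl (c j) ?b", rotated -1])
          (auto intro!: content_nd[OF c(1) content_bas])
    qed
  next
    case False
    then have sb: "s \<in> set (leaves b)" using Nd.prems(2) by auto
    show ?thesis
    proof (cases "b = Lf s")
      case True
      have "nl ?a (lf s) - (\<Sum>j\<in>set (leaves a). bb s j ?a) \<in> lie_rel"
        by (intro bb_bracket) auto
      then show ?thesis
        using False True by (intro extend[of "set (leaves a)" "\<lambda>j. ?a"]) (auto simp: content_def)
    next
      case b: False
      obtain c :: "nat \<Rightarrow> ('k, lie_gen) lin" where c: "\<And>j. content {#s#} (mset (leaves b)) (c j)"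
        "?b - (\<Sum>j\<in>set (leaves b) - {s}. bb s j (c j)) \<in> lie_rel"
        using Nd.IH(2) Nd.prems(1) sb b by auto
      have "nl ?a (?b - (\<Sum>j\<in>set (leaves b) - {s}. bb s j (c j))) \<in> lie_rel"
        by (intro lie.rel_right c)
      also have "nl ?a (?b - (\<Sum>j\<in>set (leaves b) - {s}. bb s j (c j))) =
          nl ?a ?b - (\<Sum>j\<in>set (leaves b) - {s}. bb s j (nl ?a (c j)))"
      proof -
        have "bb s j ?a = 0" if "j \<in> set (leaves b)" for j
          using Nd.prems(1) that by (intro bb_absent) auto
        then show ?thesis by (simp add: linear_sum[OF linear_map_nd(1)] del: nd_bas)
      qed
      finally show ?thesis
        by (rule extend[of "set (leaves b) - {s}" "\<lambda>j. nl ?a (c j)", rotated -1])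
          (auto intro!: content_nd[OF content_bas c(1)])
    qed
  qed
  then show ?case by (simp add: g)
qed simp

lemma bb_span:
  fixes w :: "('k::field, lie_gen) lin"
  assumes "keys w \<subseteq> lie.Mon n d" "n \<ge> 2"
  shows "\<exists>c. (\<forall>j. keys (c j) \<subseteq> lie.Mon (n - 1) d) \<and> w - (\<Sum>j\<in>{1..<n}. bb n j (c j)) \<in> lie_rel"
  using assms(1)
proof (induction w rule: keys_induct)
  case zero
  then show ?case by (intro exI[of _ "\<lambda>j. 0"]) simp
next
  case (add x m v)
  note m = lie.MonD[OF add(1)]
  have "m \<noteq> Lf n"
  proof
    assume "m = Lf n"
    then show False using m(4) assms(2) by simp
  qed
  moreover have "n \<in> set (leaves m)" using m(2) assms(2) by simp
  ultimately obtain c where c: "\<And>j. content {#n#} (mset (leaves m)) (c j :: ('k, lie_gen) lin)"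
      "bas m - (\<Sum>j\<in>set (leaves m) - {n}. bb n j (c j)) \<in> lie_rel"
    using bb_span_bas[OF m(1), where 'k = 'k] by blast
  have J: "set (leaves m) - {n} = {1..<n}" unfolding m(2) by auto
  have "keys (bas m :: ('k, lie_gen) lin) \<subseteq> lie.Mon n d" using add(1) by simp
  then have "content {#} (mset_set {1..n}) (bas m :: ('k, lie_gen) lin)" unfolding lie.keys_Mon_iff by blast
  then have "mset (leaves m) = mset_set {1..n}" by (simp add: content_def)
  then have ms: "mset (leaves m) = add_mset n (mset_set {1..n - 1})"
    using upto_split[of n] assms(2) by (simp del: One_nat_def)
  have "d = 0" using m(3) by simp
  then have ck: "keys (c j) \<subseteq> lie.Mon (n - 1) d" for j
    unfolding lie.keys_Mon_iff using c(1)[of j] by (simp add: content_def ms del: One_nat_def)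
  from add obtain c' where c': "\<And>j. keys (c' j) \<subseteq> lie.Mon (n - 1) d"
      "v - (\<Sum>j\<in>{1..<n}. bb n j (c' j)) \<in> lie_rel" by blast
  have "x \<star> (bas m - (\<Sum>j\<in>{1..<n}. bb n j (c j))) + (v - (\<Sum>j\<in>{1..<n}. bb n j (c' j))) \<in> lie_rel"
    using c(2) c'(2) unfolding J by (intro lie.rel_add lie.rel_scl)
  then have "x \<star> bas m + v - (\<Sum>j\<in>{1..<n}. bb n j (x \<star> c j + c' j)) \<in> lie_rel"
    by (simp add: scl_distribs scl_sum sum.distrib algebra_simps)
  moreover have "keys (x \<star> c j + c' j) \<subseteq> lie.Mon (n - 1) d" for j
    using ck c'(1) by (rule keys_scl_add)
  ultimately show ?case by (intro exI[of _ "\<lambda>j. x \<star> c j + c' j"]) simp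
qed

section \<open>Substitution of the bracket as an operation available in every operad\<close>

definition rot :: "nat \<Rightarrow> nat \<Rightarrow> nat \<Rightarrow> nat"
  where "rot n j x = (if x = j + 1 then n else if j + 1 < x \<and> x \<le> n then x - 1 else x)"

lemma rot_permutes:
  assumes "j < n"
  shows "rot n j permutes {1..n}"
proof (rule bij_imp_permutes)
  have "inj_on (rot n j) {1..n}" using assms by (auto simp: inj_on_def rot_def split: if_splits)
  moreover have "rot n j ` {1..n} \<subseteq> {1..n}" using assms by (auto simp: rot_def)
  ultimately show "bij_betw (rot n j) {1..n} {1..n}"
    by (simp add: bij_betw_def endo_inj_surj)
qed (use assms in \<open>auto simp: rot_def\<close>)

text \<open>Composing with \<open>l\<close> at \<open>j\<close> creates the inputs j and j + 1. The
  permutation gives the new input j + 1 the label \<open>n\<close> and moves the inputs behind it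
  back by one, so the result is \<open>a\<close> with [j, n] in place of \<open>j\<close>. Written
  in operad operations only, it is preserved by homomorphisms.\<close>

definition bracket :: "('k, 'a, 'm) operad_scheme \<Rightarrow> 'a \<Rightarrow> nat \<Rightarrow> nat \<Rightarrow> 'a \<Rightarrow> 'a"
  where "bracket P l n j a = act P (pcomp P a j l) (pinv (rot n j))"

lemma (in operad_generators) tauh_bracket:
  assumes u: "keys u \<subseteq> Mon (n - 1) d" and v: "keys v \<subseteq> Mon 2 0" and j: "j \<in> {1..<n}"
  shows "bracket P (tauh 2 0 v) n j (tauh (n - 1) d u) =
    tauh n d (subst 0 (\<lambda>i. i) (\<lambda>i. if i = j then ren (\<lambda>x. if x = 1 then j else n) v else 0) u)"
proof -
  have r: "rot n j permutes {1..n}" using j by (intro rot_permutes) auto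
  have "j \<in> {1..n - 1}" "n - 1 + 2 - 1 = n" using j by auto
  with tauh_comp[OF u v this(1)]
  have "pcomp P (tauh (n - 1) d u) j (tauh 2 0 v) = tauh n d (cmp 0 2 j u v)" by simp
  then have "bracket P (tauh 2 0 v) n j (tauh (n - 1) d u) = tauh n d (ren (rot n j) (cmp 0 2 j u v))"
    unfolding bracket_def using tauh_ren[OF permutes_inv[OF r], of d] inv_inv_eq[OF permutes_bij[OF r]] by simp
  also have "ren (rot n j) (cmp 0 2 j u v) =
      subst 0 (\<lambda>i. i) (\<lambda>i. if i = j then ren (\<lambda>x. if x = 1 then j else n) v else 0) u"
    unfolding cmp_def ren_subst
  proof (rule subst_cong)
    fix m i assume "m \<in> keys u" "i \<in> set (leaves m)" "i \<noteq> j"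
    moreover from this have "m \<in> Mon (n - 1) d" using u by blast
    ultimately have "i \<in> {1..n - 1}" "i \<noteq> j" using MonD(2) by blast+
    then show "rot n j (shift 2 j i) = i" by (auto simp: rot_def shift_def)
  next
    have "rot n j (x + j - 1) = (if x = 1 then j else n)" if "m \<in> keys v" "x \<in> set (leaves m)" for m x
    proof -
      have "x \<in> {1..2}" using MonD(2) that v by blast
      then have "x = 1 \<or> x = 2" by auto
      then show ?thesis using j by (auto simp: rot_def)
    qed
    then have "ren (\<lambda>x. rot n j (x + j - 1)) v = ren (\<lambda>x. if x = 1 then j else n) v"
      by (rule ren_cong)
    then show "ren (rot n j) (insertion j v j) = (if j = j then ren (\<lambda>x. if x = 1 then j else n) v else 0)"
      by (simp add: insertion_def)
  qed (use u MonD(1) in \<open>auto simp: insertion_def\<close>)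
  finally show ?thesis .
qed

lemma tl_bb:
  fixes u :: "('k::field, lie_gen) lin"
  assumes "keys u \<subseteq> lie.Mon (n - 1) d" "j \<in> {1..<n}"
  shows "lie_of n d (bb n j u) = bracket lq.pr.Q lie_l n j (lie_of (n - 1) d u)"
proof -
  have "keys (nl (lf 1) (lf 2) :: ('k, lie_gen) lin) \<subseteq> lie.Mon 2 0"
    by (auto simp: lie.Mon_def)
  note br = lq.op.tauh_bracket[OF assms(1) this assms(2)]
  have "(\<lambda>i. if i = j then ren (\<lambda>x. if x = 1 then j else n) (nl (lf 1) (lf 2)) else 0) =
      (\<lambda>i. if i = j then nl (lf j) (lf n) else (0 :: ('k, lie_gen) lin))"
    by (simp add: fun_eq_iff)
  moreover have "lie_l = lie_of 2 0 (nl (lf 1) (lf 2) :: ('k, lie_gen) lin)"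
    using lq.op.gen_eq_tauh[of GenL, where 'k = 'k] by (simp add: lie_deg_def lie_l_eq)
  ultimately show ?thesis using br by (simp only: bb_def)
qed

text \<open>The image x - y of the bracket, with y(1, 2) replaced by x(2, 1) so that it matches the
  term planted by \<open>ee\<close>.\<close>

definition lam :: "('k::field, greg_gen) lin"
  where "lam = nx (lf 1) (lf 2) - nx (lf 2) (lf 1)"

lemma lam_keys: "keys (lam :: ('k::field, greg_gen) lin) \<subseteq> greg.Mon 2 0"
  unfolding lam_def by (rule order.trans[OF keys_diff_subset]) (auto simp: greg.Mon_def)

lemma lam_eq: "greg_x \<ominus>\<^bsub>cpt gq.pr.Q 2 0\<^esub> greg_y = greg_of 2 0 (lam :: ('k::field, greg_gen) lin)"
proof -
  let ?x = "nx (lf 1) (lf 2) :: ('k, greg_gen) lin" and ?y = "ny (lf 1) (lf 2) :: ('k, greg_gen) lin"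
  have k: "keys ?x \<subseteq> greg.Mon 2 0" "keys ?y \<subseteq> greg.Mon 2 0" by (auto simp: greg.Mon_def)
  have "(?x - ?y) - lam \<in> greg_rel"
    using greg.rel_uminus[OF swap_rel(3)[of 0 "lf 1" 0 "lf 2"]] by (simp add: lam_def del: nd_bas)
  moreover have "keys (?x - ?y) \<subseteq> greg.Mon 2 0" using keys_diff_subset[of ?x ?y] k by blast
  ultimately have "greg_of 2 0 (?x - ?y) = greg_of 2 0 lam" using tg_eq_iff lam_keys by blast
  then show ?thesis by (simp only: greg_gen_eq gq.op.tauh_diff)
qed

lemma tg_ee:
  fixes u :: "('k::field, greg_gen) lin"
  assumes "keys u \<subseteq> greg.Mon (n - 1) d" "j \<in> {1..<n}"
  shows "greg_of n d (ee n j u) = bracket gq.pr.Q (greg_of 2 0 lam) n j (greg_of (n - 1) d u)"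
proof -
  have "ren (\<lambda>x. if x = 1 then j else n) (lam :: ('k, greg_gen) lin) = nx (lf j) (lf n) - nx (lf n) (lf j)"
    by (simp add: lam_def)
  then have "(\<lambda>i. if i = j then ren (\<lambda>x. if x = 1 then j else n) lam else 0) =
      (\<lambda>i. if i = j then nx (lf j) (lf n) - nx (lf n) (lf j) else (0 :: ('k, greg_gen) lin))"
    by (simp only: fun_eq_iff) simp
  then show ?thesis
    using gq.op.tauh_bracket[OF assms(1) lam_keys assms(2)] by (simp only: ee_def)
qed

section \<open>The comparison of Lie with the cohomology of Greg\<close>

lemma (in graded_operad) minus_zero_eq:
  assumes "a \<in> ops P n d" "b \<in> ops P n d" "a \<ominus>\<^bsub>cpt P n d\<^esub> b = \<zero>\<^bsub>cpt P n d\<^esub>"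
  shows "a = b"
  using md.minus_equality[where y = a and x = "\<ominus>\<^bsub>cpt P n d\<^esub> b" and n = n and d = d] assms
  by (simp add: md.minus_eq)

lemma keys_sum_subset: "(\<And>j. j \<in> S \<Longrightarrow> keys (f j) \<subseteq> A) \<Longrightarrow> keys (sum f S) \<subseteq> A"
  using keys_sum[of f S] by blast

lemma (in graded_generators) Mon_1:
  assumes "m \<in> Mon 1 d"
  shows "m = Lf 1" "d = 0"
proof -
  have "length (leaves m) = 1" using MonD(4)[OF assms] .
  then obtain j where j: "m = Lf j" by (cases m) (auto simp: add_is_1)
  then show "m = Lf 1" "d = 0" using MonD(2,3)[OF assms] by auto
qed

lemma (in graded_generators) keys_Mon_1:
  assumes "keys u \<subseteq> Mon 1 d"
  shows "u = lookup u (Lf 1) \<star> bas (Lf 1)" "d \<noteq> 0 \<Longrightarrow> u = 0"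
proof -
  have "lookup u m = 0" if "m \<noteq> Lf 1" for m
  proof -
    have "m \<notin> keys u" using assms Mon_1(1) that by blast
    then show ?thesis by (simp add: in_keys_iff)
  qed
  then show "u = lookup u (Lf 1) \<star> bas (Lf 1)"
    by (intro poly_mapping_eqI) (auto simp: lookup_single when_def)
  assume "d \<noteq> 0"
  then have "keys u = {}" using assms Mon_1(2) by blast
  then show "u = 0" by simp
qed

lemma act_lam: "act gq.pr.Q (greg_of 2 0 lam) (transpose 1 2) = \<ominus>\<^bsub>cpt gq.pr.Q 2 0\<^esub> (greg_of 2 0 lam :: 'k::field greg_free set)"
proof -
  have "transpose 1 2 permutes {1..2::nat}" by (rule permutes_swap_id) auto
  moreover have "ren (transpose 1 2) lam = - (lam :: ('k, greg_gen) lin)" by (simp add: lam_def)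
  ultimately show ?thesis by (simp only: gq.op.tauh_ren pinv_transpose gq.op.tauh_uminus)
qed

lemma greg_d_lam: "greg_d (greg_of 2 0 lam) = (\<zero>\<^bsub>cpt gq.pr.Q 2 1\<^esub> :: 'k::field greg_free set)"
proof -
  have "dd lam = - (ng (lf 1) (lf 2) - ng (lf 2) (lf 1) :: ('k, greg_gen) lin)"
    by (simp add: lam_def del: nd_bas)
  then have "dd lam \<in> (greg_rel :: ('k, greg_gen) lin set)"
    using greg.rel_uminus[OF swap_rel(1)[of 0 "lf 1" 0 "lf 2"]] by simp
  then have "greg_of 2 (0 + 1) (dd lam) = (\<zero>\<^bsub>cpt gq.pr.Q 2 (0 + 1)\<^esub> :: 'k greg_free set)"
    using tg_zero_iff[OF keys_dd[OF lam_keys]] by blast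
  then show ?thesis using greg_d_tg[where 'k = 'k, OF lam_keys] by (simp add: gq.op.smult_simps)
qed

text \<open>The commutator of a pre-Lie product satisfies the Jacobi identity: the Jacobi sum is the
  sum of the pre-Lie relators at the three cyclic permutations of the leaves.\<close>

lemma greg_jacobi:
  defines "z \<equiv> pcomp gq.pr.Q (greg_of 2 0 lam) 1 (greg_of 2 0 lam) :: 'k::field greg_free set"
  shows "z \<oplus>\<^bsub>cpt gq.pr.Q 3 0\<^esub> act gq.pr.Q z cycle1 \<oplus>\<^bsub>cpt gq.pr.Q 3 0\<^esub> act gq.pr.Q z cycle2 = \<zero>\<^bsub>cpt gq.pr.Q 3 0\<^esub>"
proof -
  define u where "u = greg.cmp 0 2 1 lam (lam :: ('k, greg_gen) lin)"
  let ?v = "u + ren cycle2 u + ren cycle1 u"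
  have z: "z = greg_of 3 0 u" using gq.op.tauh_comp[OF lam_keys lam_keys, of 1] by (simp add: z_def u_def)
  have "z \<oplus>\<^bsub>cpt gq.pr.Q 3 0\<^esub> act gq.pr.Q z cycle1 \<oplus>\<^bsub>cpt gq.pr.Q 3 0\<^esub> act gq.pr.Q z cycle2 = greg_of 3 0 ?v"
    unfolding z gq.op.tauh_ren[OF cycles(1)] gq.op.tauh_ren[OF cycles(2)] cycles(3,4) by (simp only: gq.op.tauh_add)
  moreover have "?v \<in> greg_rel"
  proof -
    have u: "u = nx (nx (lf 1) (lf 2)) (lf 3) - nx (nx (lf 2) (lf 1)) (lf 3)
        - (nx (lf 3) (nx (lf 1) (lf 2)) - nx (lf 3) (nx (lf 2) (lf 1)))"
      by (simp add: u_def lam_def greg.cmp_simps insertion_def shift_def numeral_2_eq_2[symmetric] del: nd_bas)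
    have "pl 1 (lf 1) (lf 2) (lf 3) + pl 1 (lf 2) (lf 3) (lf 1) + pl 1 (lf 3) (lf 1) (lf 2) \<in> (greg_rel :: ('k, greg_gen) lin set)"
      using pl_rel[of 0 "lf _ :: ('k, greg_gen) lin" 0 "lf _" "lf _"] by (intro greg.rel_add) simp_all
    also have "pl 1 (lf 1) (lf 2) (lf 3) + pl 1 (lf 2) (lf 3) (lf 1) + pl 1 (lf 3) (lf 1) (lf 2) = ?v"
      unfolding u by (simp add: pl_def cycles algebra_simps del: nd_bas cycle_of_list.simps One_nat_def)
    finally show ?thesis .
  qed
  moreover have "keys ?v \<subseteq> greg.Mon 3 0"
  proof -
    have k: "keys u \<subseteq> greg.Mon 3 0" using greg.keys_cmp[OF lam_keys lam_keys, of 1] by (simp add: u_def)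
    then show ?thesis
      using greg.keys_ren_Mon[OF k cycles(1)] greg.keys_ren_Mon[OF k cycles(2)]
        keys_add[of u "ren cycle2 u"] keys_add[of "u + ren cycle2 u" "ren cycle1 u"] by blast
  qed
  ultimately show ?thesis using tg_zero_iff by metis
qed

lemma lie_generators:
  "operad_generators (gd.Z :: ('k::field, 'k greg_free set) operad) lie_deg lie_swap (\<lambda>_. greg_of 2 0 lam)"
proof (intro operad_generators.intro gd.graded_operad_Z lie.binary_generators_axioms operad_generators_axioms.intro)
  show "greg_of 2 0 lam \<in> ops (gd.Z :: ('k, 'k greg_free set) operad) 2 (lie_deg g)" for g
    unfolding gd.Z_simps unfolding cocycles_def Greg_minus1_eq with_differential_simps lie_deg_def
    using greg_d_lam[where 'k = 'k] by simp
  show "act gd.Z (greg_of 2 0 lam) (transpose 1 2) =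
      fst (lie_swap g) \<odot>\<^bsub>cpt gd.Z 2 (lie_deg g)\<^esub> (greg_of 2 0 lam :: 'k greg_free set)" for g
    unfolding gd.Z_simps unfolding Greg_minus1_eq with_differential_simps act_lam lie_swap_def fst_conv lie_deg_def
    using gq.op.smult_simps(4)[where 'k = 'k, OF gq.op.tauh_closed] gq.op.smult_simps(6)[where 'k = 'k and c = 1, OF gq.op.tauh_closed]
    by simp
qed

text \<open>The target is the operad of cocycles. As x - y is a cocycle, the universal property
  yields a homomorphism all of whose values are closed, which is compatibility with the zero
  differential.\<close>

lemma lie_hom_exists:
  "\<exists>f. operad_hom lq.pr.Q (gd.Z :: ('k::field, 'k greg_free set) operad) f \<and> f lie_l = greg_of 2 0 lam"
proof -
  interpret g: operad_generators "gd.Z :: ('k, 'k greg_free set) operad" lie_deg lie_swap "\<lambda>_. greg_of 2 0 lam"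
    by (rule lie_generators)
  have "\<exists>f. operad_hom lq.pr.Q (gd.Z :: ('k, 'k greg_free set) operad) f \<and>
      (\<forall>g. f (lq.pr.coset (lie.cls (Gen g))) = greg_of 2 0 lam)"
  proof (rule lq.universal_hom[OF lie_generators])
    fix t :: "('k, lie_gen) opterm"
    assume t: "twf lie_deg t" "lie.cls t \<in> {jacobi_relation}"
    then have c: "lie.cls t = lie.free.tauh 3 0 (jc (lf 1) (lf 2) (lf 3))" by (simp add: jacobi_relation_eq)
    have "lie.cls t \<in> ops lie.T (tar t) (tdeg lie_deg t)" using t(1) by (intro lie.cls_ops) simp
    then have e: "tar t = 3" "tdeg lie_deg t = 0"
      using lie.free.disjoint_cpt[OF lie.free.tauh_closed[of 3 0 "jc (lf 1) (lf 2) (lf 3)"]] unfolding c by auto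
    have "g.interp t = g.tauh 3 0 (jc (lf 1) (lf 2) (lf 3))"
      by (rule lie.interp_tauh[OF lie_generators t(1) jc_keys c])
    also have "\<dots> = \<zero>\<^bsub>cpt gd.Z 3 0\<^esub>"
      by (rule HOL.trans[OF jacobi_tauh[OF lie_generators]])
        (unfold gd.Z_simps, unfold Greg_minus1_eq with_differential_simps, rule greg_jacobi)
    finally show "g.interp t = \<zero>\<^bsub>cpt gd.Z (tar t) (tdeg lie_deg t)\<^esub>" unfolding e .
  qed
  then show ?thesis unfolding lie_l_eq by blast
qed

section \<open>Maps from Lie to Greg that send the bracket to x - y\<close>

locale lie_to_greg =
  fixes \<phi> :: "'k::field lie_free set \<Rightarrow> 'k greg_free set"
  assumes hom: "operad_hom lq.pr.Q gq.pr.Q \<phi>"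
    and phi_l: "\<phi> lie_l = greg_of 2 0 lam"
    and phi_cocycle: "a \<in> ops lq.pr.Q n d \<Longrightarrow> greg_d (\<phi> a) = \<zero>\<^bsub>cpt gq.pr.Q n (d + 1)\<^esub>"
begin

sublocale h: operad_hom lq.pr.Q gq.pr.Q \<phi> by (rule hom)

lemma lie_l_closed: "lie_l \<in> ops (lq.pr.Q :: ('k, 'k lie_free set) operad) 2 0"
  using lq.op.gen_closed[of GenL] by (simp add: lie_l_eq lie_deg_def)

lemma bracket_arg:
  assumes "a \<in> ops lq.pr.Q (n - 1) d" "j \<in> {1..<n}"
  shows "pcomp lq.pr.Q a j lie_l \<in> ops (lq.pr.Q :: ('k, 'k lie_free set) operad) n d" "j \<in> {1..n - 1}"
    "pinv (rot n j) permutes {1..n}"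
proof -
  show j: "j \<in> {1..n - 1}" using assms(2) by auto
  then have "n - 1 + 2 - 1 = n" by auto
  with lq.op.comp_closed[OF assms(1) lie_l_closed j]
  show "pcomp lq.pr.Q a j lie_l \<in> ops (lq.pr.Q :: ('k, 'k lie_free set) operad) n d" by simp
  show "pinv (rot n j) permutes {1..n}" using assms(2) by (intro permutes_inv rot_permutes) auto
qed

lemma phi_bracket:
  assumes "a \<in> ops lq.pr.Q (n - 1) d" "j \<in> {1..<n}"
  shows "\<phi> (bracket lq.pr.Q lie_l n j a) = bracket gq.pr.Q (greg_of 2 0 lam) n j (\<phi> a)"
  unfolding bracket_def
  by (simp only: h.hom_act[OF bracket_arg(1,3)[OF assms]] h.hom_comp[OF assms(1) lie_l_closed bracket_arg(2)[OF assms]] phi_l)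

lemma phi_sum:
  assumes "S \<subseteq> {1..<n}" and c: "\<And>j. keys (c j) \<subseteq> lie.Mon (n - 1) d" and w: "\<And>j. keys (w j) \<subseteq> greg.Mon (n - 1) d"
    and eq: "\<And>j. j \<in> {1..<n} \<Longrightarrow> \<phi> (lie_of (n - 1) d (c j)) = greg_of (n - 1) d (w j)"
  shows "\<phi> (lie_of n d (\<Sum>j\<in>S. bb n j (c j))) = greg_of n d (\<Sum>j\<in>S. ee n j (w j))"
proof -
  have "finite S" using assms(1) finite_subset by blast
  then show ?thesis using assms(1)
  proof (induction S rule: finite_induct)
    case empty
    then show ?case by (simp add: h.hom_zero)
  next
    case (insert j S)
    have "\<phi> (lie_of n d (bb n j (c j))) = greg_of n d (ee n j (w j))"
      using insert.prems phi_bracket[of "lie_of (n - 1) d (c j)" n d j] eq[of j] tl_bb[OF c, of j] tg_ee[OF w, of j]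
      by simp
    then show ?case using insert
      by (simp add: lq.op.tauh_add gq.op.tauh_add h.hom_add)
  qed
qed

lemma tl_sum_zero:
  assumes "S \<subseteq> {1..<n}" and c: "\<And>j. keys (c j) \<subseteq> lie.Mon (n - 1) d"
    and eq: "\<And>j. j \<in> {1..<n} \<Longrightarrow> lie_of (n - 1) d (c j) = (\<zero>\<^bsub>cpt lq.pr.Q (n - 1) d\<^esub> :: 'k lie_free set)"
  shows "lie_of n d (\<Sum>j\<in>S. bb n j (c j)) = (\<zero>\<^bsub>cpt lq.pr.Q n d\<^esub> :: 'k lie_free set)"
proof -
  have "finite S" using assms(1) finite_subset by blast
  then show ?thesis using assms(1)
  proof (induction S rule: finite_induct)
    case (insert j S)
    then have j: "j \<in> {1..<n}" "j \<in> {1..n - 1}" "Suc (n - Suc 0) = n" by auto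
    have "pinv (rot n j) permutes {1..n}" using j by (intro permutes_inv rot_permutes) auto
    then have "bracket lq.pr.Q lie_l n j \<zero>\<^bsub>cpt lq.pr.Q (n - 1) d\<^esub> = (\<zero>\<^bsub>cpt lq.pr.Q n d\<^esub> :: 'k lie_free set)"
      unfolding bracket_def using lq.op.comp_zero_left[OF lie_l_closed j(2), of d] lq.op.act_zero by (simp add: j(3))
    then have "lie_of n d (bb n j (c j)) = (\<zero>\<^bsub>cpt lq.pr.Q n d\<^esub> :: 'k lie_free set)"
      using tl_bb[OF c j(1)] eq[OF j(1)] by simp
    then show ?case using insert by (simp add: lq.op.tauh_add)
  qed simp
qed

lemma linear_homotopy_defect: "linear_map (homotopy_defect J s)"
  by (auto simp: linear_map_def homotopy_defect_def scl_distribs sum.distrib scl_sum algebra_simps)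

lemma homotopy_Mon:
  fixes w :: "('k, greg_gen) lin"
  assumes w: "keys w \<subseteq> greg.Mon n d" and n: "n \<ge> 2"
  shows "homotopy_defect {1..<n} n w \<in> greg_rel"
proof (rule rel_linear[OF linear_homotopy_defect])
  fix m assume "m \<in> keys w"
  then have m: "m \<in> greg.Mon n d" using w by blast
  note M = greg.MonD[OF m]
  have "m \<noteq> Lf n"
  proof
    assume "m = Lf n"
    then show False using M(4) n by simp
  qed
  moreover have "n \<in> set (leaves m)" "set (leaves m) - {n} \<subseteq> {1..<n}" unfolding M(2) using n by auto
  ultimately show "homotopy_defect {1..<n} n (bas m) \<in> (greg_rel :: ('k, greg_gen) lin set)"
    using M(1) by (intro homotopy) auto
qed

text \<open>The planted bracket is closed only up to the symmetry of g: its differential is g(s, j)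
  - g(j, s). Hence the differential commutes with the substitution modulo relations only.\<close>

lemma dd_ee_rel:
  fixes u :: "('k, greg_gen) lin"
  shows "ee s j (dd u) - dd (ee s j u) \<in> greg_rel"
proof -
  let ?e = "\<lambda>i. if i = j then nx (lf j) (lf s) - nx (lf s) (lf j) else (0 :: ('k, greg_gen) lin)"
  have "dd (ee s j u) = greg.subst (0 + 1) (\<lambda>j. j) (\<lambda>i. dd (?e i)) u + sg 0 \<star> ee s j (dd u)"
    unfolding ee_def by (rule dd_subst) (auto intro!: greg.homog_diff greg.homog_nd[of 0 _ 0])
  moreover have "greg.subst (0 + 1) (\<lambda>j. j) (\<lambda>i. dd (?e i)) u \<in> greg_rel"
  proof (rule greg.subst_arg_rel)
    have "ng (lf s) (lf j) - ng (lf j) (lf s) \<in> (greg_rel :: ('k, greg_gen) lin set)"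
      using swap_rel(1)[of 0 "lf s" 0 "lf j"] by simp
    then show "dd (?e i) \<in> greg_rel" for i by (simp del: nd_bas)
  qed
  ultimately show ?thesis using greg.rel_uminus by fastforce
qed

lemma cc_ee_Mon:
  fixes w :: "('k, greg_gen) lin"
  assumes w: "keys w \<subseteq> greg.Mon (n - 1) d" and j: "j \<in> {1..<n}"
  shows "cc n i (ee n j w) = (if i = j then w else 0)"
proof (rule lin_eqI[of "\<lambda>w. cc n i (ee n j w)" "\<lambda>w. if i = j then w else 0"])
  show "linear_map (\<lambda>w :: ('k, greg_gen) lin. cc n i (ee n j w))" by (rule linear_map_comp[OF linear_map_ops(5) linear_map_ops(6)])
  show "linear_map (\<lambda>w :: ('k, greg_gen) lin. if i = j then w else 0)" by (cases "i = j") auto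
  fix m assume "m \<in> keys w"
  then have m: "m \<in> greg.Mon (n - 1) d" using w by blast
  have "n \<notin> set (leaves m)" "j \<in> set (leaves m)" unfolding greg.MonD(2)[OF m] using j by auto
  then show "cc n i (ee n j (bas m)) = (if i = j then bas m else (0 :: ('k, greg_gen) lin))"
    using greg.MonD(1)[OF m] by (intro cc_ee)
qed

end

context lie_to_greg
begin

theorem phi_boundary:
  fixes y :: "('k, greg_gen) lin"
  assumes "keys c \<subseteq> lie.Mon n d" "keys y \<subseteq> greg.Mon n (d - 1)" "\<phi> (lie_of n d c) = greg_of n d (dd y)"
  shows "lie_of n d c = \<zero>\<^bsub>cpt lq.pr.Q n d\<^esub>"
  using assms
proof (induction n arbitrary: c y)
  case 0
  then have "c = 0" by (simp add: lie.Mon_empty)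
  then show ?case by simp
next
  case (Suc k)
  show ?case
  proof (cases "k = 0")
    case True
    show ?thesis
    proof (cases "d = 0")
      case d: True
      define x where "x = lookup c (Lf 1)"
      have c: "c = x \<star> lf 1" using lie.keys_Mon_1(1)[of c d] Suc.prems(1) True by (simp add: x_def)
      \<comment> \<open>The single tree of arity 1 is a leaf of degree 0, while \<open>y\<close> has
        degree -1.\<close>
      have y: "y = 0" using greg.keys_Mon_1(2)[of y "d - 1"] Suc.prems(2) True d by simp
      have u: "lie_of 1 0 (lf 1 :: ('k, lie_gen) lin) = ounit lq.pr.Q" "greg_of 1 0 (lf 1 :: ('k, greg_gen) lin) = ounit gq.pr.Q"
        using lq.op.interp_eq_tauh[where 'k = 'k, of Unit] gq.op.interp_eq_tauh[where 'k = 'k, of Unit] by simp_all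
      have "\<phi> (lie_of 1 0 c) = greg_of 1 0 (x \<star> lf 1)"
        unfolding c lq.op.tauh_scl gq.op.tauh_scl u using h.hom_smult[OF lq.op.unit_closed, of x] h.hom_unit by simp
      then have "greg_of 1 0 (x \<star> lf 1) = (\<zero>\<^bsub>cpt gq.pr.Q 1 0\<^esub> :: 'k greg_free set)"
        using Suc.prems(3) True d y by simp
      moreover have "keys (x \<star> lf 1 :: ('k, greg_gen) lin) \<subseteq> greg.Mon 1 0"
        using keys_scl_subset[of x "lf 1 :: ('k, greg_gen) lin"] by (auto simp: greg.Mon_def split: if_splits)
      ultimately have "x \<star> lf 1 \<in> (greg_rel :: ('k, greg_gen) lin set)" using tg_zero_iff by blast
      \<comment> \<open>The unit of Greg is nonzero, since no relation contains a bare leaf.\<close>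
      then have "x = 0" using greg_rel_lookup_Lf[of "x \<star> lf 1" 1] by simp
      then show ?thesis using c by simp
    next
      case False
      then show ?thesis using lie.keys_Mon_1(2)[of c d] Suc.prems(1) True by simp
    qed
  next
    case False
    let ?n = "Suc k"
    have n: "?n \<ge> 2" "?n - 1 = k" using False by auto
    obtain e :: "nat \<Rightarrow> ('k, lie_gen) lin" where e: "\<And>j. keys (e j) \<subseteq> lie.Mon k d"
      "c - (\<Sum>j\<in>{1..<?n}. bb ?n j (e j)) \<in> lie_rel"
      using bb_span[OF Suc.prems(1) n(1)] unfolding n(2) by blast
    have ce: "lie_of ?n d c = lie_of ?n d (\<Sum>j\<in>{1..<?n}. bb ?n j (e j))"
      using tl_zero[OF e(2), of ?n d] unfolding lq.op.tauh_diff
      by (rule lq.op.minus_zero_eq[OF lq.op.tauh_closed lq.op.tauh_closed])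
    have "\<exists>w. keys w \<subseteq> greg.Mon k d \<and> \<phi> (lie_of k d (e j)) = greg_of k d w" for j
      using gq.ops_tauh[OF h.hom_closed[OF lq.op.tauh_closed[of k d "e j"]]] by metis
    then obtain w where w: "\<And>j. keys (w j) \<subseteq> greg.Mon k d" "\<And>j. \<phi> (lie_of k d (e j)) = greg_of k d (w j)" by metis
    have "greg_of ?n d (\<Sum>j\<in>{1..<?n}. ee ?n j (w j)) = greg_of ?n d (dd y)"
      using phi_sum[of "{1..<?n}" ?n e d w] e(1) w Suc.prems(3) ce n(2) by simp
    moreover have "keys (ee ?n j (w j)) \<subseteq> greg.Mon ?n d" for j using keys_ee[of "w j" ?n d] w(1) by simp
    then have "keys (\<Sum>j\<in>{1..<?n}. ee ?n j (w j)) \<subseteq> greg.Mon ?n d" by (intro keys_sum_subset)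
    moreover have "keys (dd y) \<subseteq> greg.Mon ?n d" using keys_dd[OF Suc.prems(2)] by simp
    ultimately have r: "(\<Sum>j\<in>{1..<?n}. ee ?n j (w j)) - dd y \<in> greg_rel" using tg_eq_iff by blast
    have "lie_of k d (e i) = \<zero>\<^bsub>cpt lq.pr.Q k d\<^esub>" if i: "i \<in> {1..<?n}" for i
    proof (rule Suc.IH[OF e(1)])
      have "cc ?n i (\<Sum>j\<in>{1..<?n}. ee ?n j (w j)) = (\<Sum>j\<in>{1..<?n}. if i = j then w j else 0)"
        unfolding linear_sum[OF linear_map_ops(5)]
        by (rule sum.cong) (use cc_ee_Mon[of _ ?n d] w(1) n(2) in auto)
      then have "cc ?n i ((\<Sum>j\<in>{1..<?n}. ee ?n j (w j)) - dd y) = w i - dd (cc ?n i y)"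
        using i by (simp add: dd_cc)
      then have "w i - dd (cc ?n i y) \<in> greg_rel" using cc_rel[OF r, of ?n i] by simp
      moreover show ky: "keys (cc ?n i y) \<subseteq> greg.Mon k (d - 1)" using keys_cc[OF Suc.prems(2), of i] by simp
      moreover have "keys (dd (cc ?n i y)) \<subseteq> greg.Mon k d" using keys_dd[OF ky] by simp
      ultimately show "\<phi> (lie_of k d (e i)) = greg_of k d (dd (cc ?n i y))"
        using tg_eq_iff[OF w(1)] w(2) by metis
    qed
    then show ?thesis unfolding ce using tl_sum_zero[of "{1..<?n}" ?n e d] e(1) n(2) by simp
  qed
qed

theorem cocycle_decomposition:
  fixes w :: "('k, greg_gen) lin"
  assumes "keys w \<subseteq> greg.Mon n d" "dd w \<in> greg_rel"
  shows "\<exists>y a. keys y \<subseteq> greg.Mon n (d - 1) \<and> a \<in> ops lq.pr.Q n d \<and>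
    greg_of n d w = greg_of n d (dd y) \<oplus>\<^bsub>cpt gq.pr.Q n d\<^esub> \<phi> a"
  using assms
proof (induction n arbitrary: w)
  case 0
  then have "w = 0" by (simp add: greg.Mon_empty)
  then show ?case using h.hom_zero[of 0 d] by (intro exI[of _ 0] exI[of _ "\<zero>\<^bsub>cpt lq.pr.Q 0 d\<^esub>"]) simp
next
  case (Suc k)
  show ?case
  proof (cases "k = 0")
    case True
    define x where "x = lookup w (Lf 1)"
    have w: "w = x \<star> lf 1" using greg.keys_Mon_1(1)[of w d] Suc.prems(1) True by (simp add: x_def)
    show ?thesis
    proof (cases "d = 0")
      case d: True
      have "greg_of 1 0 (lf 1 :: ('k, greg_gen) lin) = ounit gq.pr.Q"
        using gq.op.interp_eq_tauh[where 'k = 'k, of Unit] by simp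
      then have "greg_of 1 0 w = \<phi> (x \<odot>\<^bsub>cpt lq.pr.Q 1 0\<^esub> ounit lq.pr.Q)"
        unfolding w gq.op.tauh_scl using h.hom_smult[OF lq.op.unit_closed, of x] h.hom_unit by simp
      moreover have "x \<odot>\<^bsub>cpt lq.pr.Q 1 0\<^esub> ounit lq.pr.Q \<in> ops lq.pr.Q 1 0"
        by (rule lq.op.smult_simps(1)[OF lq.op.unit_closed])
      ultimately show ?thesis using True d h.hom_closed[of _ 1 0]
        by (intro exI[of _ 0] exI[of _ "x \<odot>\<^bsub>cpt lq.pr.Q 1 0\<^esub> ounit lq.pr.Q"]) simp
    next
      case False
      then have "w = 0" using greg.keys_Mon_1(2)[of w d] Suc.prems(1) True by simp
      then show ?thesis using h.hom_zero[of "Suc k" d] by (intro exI[of _ 0] exI[of _ "\<zero>\<^bsub>cpt lq.pr.Q (Suc k) d\<^esub>"]) simp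
    qed
  next
    case False
    let ?n = "Suc k"
    have n: "?n \<ge> 2" "?n - 1 = k" using False by auto
    have "\<exists>y a. keys y \<subseteq> greg.Mon k (d - 1) \<and> a \<in> ops lq.pr.Q k d \<and>
        greg_of k d (cc ?n j w) = greg_of k d (dd y) \<oplus>\<^bsub>cpt gq.pr.Q k d\<^esub> \<phi> a" for j
      using Suc.IH[of "cc ?n j w"] keys_cc[OF Suc.prems(1), of j] cc_rel[OF Suc.prems(2), of ?n j] by (simp add: dd_cc)
    then obtain y a where ya: "\<And>j. keys (y j) \<subseteq> greg.Mon k (d - 1)" "\<And>j. a j \<in> ops lq.pr.Q k d"
        "\<And>j. greg_of k d (cc ?n j w) = greg_of k d (dd (y j)) \<oplus>\<^bsub>cpt gq.pr.Q k d\<^esub> \<phi> (a j)" by metis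
    have "\<exists>e. keys e \<subseteq> lie.Mon k d \<and> a j = lie_of k d e" for j
      using lq.ops_tauh[OF ya(2)[of j]] by metis
    then obtain e where e: "\<And>j. keys (e j) \<subseteq> lie.Mon k d" "\<And>j. a j = lie_of k d (e j)" by metis
    have "\<exists>v. keys v \<subseteq> greg.Mon k d \<and> \<phi> (a j) = greg_of k d v" for j
      using gq.ops_tauh[OF h.hom_closed[OF ya(2)[of j]]] by metis
    then obtain v where v: "\<And>j. keys (v j) \<subseteq> greg.Mon k d" "\<And>j. \<phi> (a j) = greg_of k d (v j)" by metis
    let ?J = "{1..<?n}"
    \<comment> \<open>The new primitive collects the homotopy applied to \<open>w\<close> and the
      primitives of the smaller cocycles, planted back by substitution.\<close>
    define Y where "Y = hh ?n w + (\<Sum>j\<in>?J. ee ?n j (y j))"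
    define V where "V = (\<Sum>j\<in>?J. ee ?n j (v j))"
    have kY: "keys Y \<subseteq> greg.Mon ?n (d - 1)"
    proof -
      have "keys (ee ?n j (y j)) \<subseteq> greg.Mon ?n (d - 1)" for j using keys_ee[of "y j" ?n "d - 1"] ya(1) by simp
      then have "keys (\<Sum>j\<in>?J. ee ?n j (y j)) \<subseteq> greg.Mon ?n (d - 1)" by (intro keys_sum_subset)
      then show ?thesis 
        unfolding Y_def using keys_hh[OF Suc.prems(1), of ?n] keys_add[of "hh ?n w" "\<Sum>j\<in>?J. ee ?n j (y j)"] by blast
    qed
    have kV: "keys V \<subseteq> greg.Mon ?n d"
      unfolding V_def using keys_ee[of "v _" ?n d] v(1) by (intro keys_sum_subset) simp
    have r: "cc ?n j w - (dd (y j) + v j) \<in> greg_rel" for j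
    proof -
      have "keys (dd (y j)) \<subseteq> greg.Mon k d" using keys_dd[OF ya(1), of j] by simp
      then have "keys (dd (y j) + v j) \<subseteq> greg.Mon k d" using keys_add[of "dd (y j)" "v j"] v(1) by blast
      moreover have "keys (cc ?n j w) \<subseteq> greg.Mon k d" using keys_cc[OF Suc.prems(1), of j] by simp
      ultimately show ?thesis using ya(3)[of j] by (simp add: tg_eq_iff[symmetric] gq.op.tauh_add v(2))
    qed
    \<comment> \<open>Four sources of relations: \<open>dd w\<close> is one, the homotopy formula,
      the decompositions of the smaller cocycles after substitution, and the commutation of the
      differential with substitution. Their sum is the claimed equation.\<close>
    have "hh ?n (dd w) - homotopy_defect ?J ?n w + (\<Sum>j\<in>?J. ee ?n j (cc ?n j w - (dd (y j) + v j)))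
        + (\<Sum>j\<in>?J. ee ?n j (dd (y j)) - dd (ee ?n j (y j))) \<in> greg_rel"
    proof -
      have sum: "sum f S \<in> greg_rel" if "\<And>j. f j \<in> greg_rel" for f :: "nat \<Rightarrow> ('k, greg_gen) lin" and S
        using that by (induction S rule: infinite_finite_induct) (auto intro: greg.rel_add)
      show ?thesis
        by (intro greg.rel_add greg.rel_diff hh_rel Suc.prems homotopy_Mon[OF Suc.prems(1) n(1)] sum ee_rel r dd_ee_rel)
    qed
    also have "hh ?n (dd w) - homotopy_defect ?J ?n w + (\<Sum>j\<in>?J. ee ?n j (cc ?n j w - (dd (y j) + v j)))
        + (\<Sum>j\<in>?J. ee ?n j (dd (y j)) - dd (ee ?n j (y j))) = w - (dd Y + V)"
      by (simp add: homotopy_defect_def Y_def V_def sum_subtractf sum.distrib linear_sum[OF linear_map_ops(1)] algebra_simps)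
    finally have "w - (dd Y + V) \<in> greg_rel" .
    moreover have "keys (dd Y) \<subseteq> greg.Mon ?n d" using keys_dd[OF kY] by simp
    then have "keys (dd Y + V) \<subseteq> greg.Mon ?n d" using keys_add[of "dd Y" V] kV by blast
    ultimately have "greg_of ?n d w = greg_of ?n d (dd Y) \<oplus>\<^bsub>cpt gq.pr.Q ?n d\<^esub> greg_of ?n d V"
      using tg_eq_iff[OF Suc.prems(1), of "dd Y + V"] by (simp add: gq.op.tauh_add)
    also have "greg_of ?n d V = \<phi> (lie_of ?n d (\<Sum>j\<in>?J. bb ?n j (e j)))"
      unfolding V_def using phi_sum[of ?J ?n e d v] e v n(2) by simp
    finally show ?thesis using kY lq.op.tauh_closed by blast
  qed
qed

end

section \<open>Passage to cohomology\<close>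

text \<open>The additive inverse of a module is tied to its carrier, so differences in the operad of
  cocycles and in Greg are different terms. The multiple by -1 uses the same scalar multiplication
  in both and translates directly.\<close>

lemma (in graded_operad) minus_smult:
  assumes "b \<in> ops P n d"
  shows "a \<ominus>\<^bsub>cpt P n d\<^esub> b = a \<oplus>\<^bsub>cpt P n d\<^esub> (- 1) \<odot>\<^bsub>cpt P n d\<^esub> b"
  using smult_simps(4)[OF assms] smult_simps(6)[OF assms, of 1] by (simp add: md.minus_eq)

lemma Z_eq:
  "ops (gd.Z :: ('k::field, 'k greg_free set) operad) n d = cocycles Greg_minus1 n d"
  "add (cpt (gd.Z :: ('k, 'k greg_free set) operad) n d) = add (cpt gq.pr.Q n d)"
  "\<zero>\<^bsub>cpt (gd.Z :: ('k, 'k greg_free set) operad) n d\<^esub> = \<zero>\<^bsub>cpt gq.pr.Q n d\<^esub>"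
  "module.smult (cpt (gd.Z :: ('k, 'k greg_free set) operad) n d) = module.smult (cpt gq.pr.Q n d)"
  "ounit (gd.Z :: ('k, 'k greg_free set) operad) = ounit gq.pr.Q"
  "pcomp (gd.Z :: ('k, 'k greg_free set) operad) = pcomp gq.pr.Q"
  "act (gd.Z :: ('k, 'k greg_free set) operad) = act gq.pr.Q"
  unfolding gd.Z_simps unfolding Greg_minus1_eq with_differential_simps by (rule HOL.refl)+

lemma cocycles_iff:
  "a \<in> cocycles Greg_minus1 n d \<longleftrightarrow> a \<in> ops gq.pr.Q n d \<and> greg_d a = \<zero>\<^bsub>cpt gq.pr.Q n (d + 1)\<^esub>"
  by (simp add: cocycles_def Greg_minus1_eq)

lemma coboundaries_eq: "coboundaries Greg_minus1 n d = greg_d ` ops gq.pr.Q n (d - 1)"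
  by (simp add: coboundaries_def Greg_minus1_eq)

text \<open>The sign between \<open>dd\<close> and \<open>greg_d\<close> is absorbed into the
  primitive, so both operators have the same boundaries.\<close>

lemma greg_d_boundary:
  fixes y :: "('k::field, greg_gen) lin"
  assumes "keys y \<subseteq> greg.Mon n (d - 1)"
  shows "greg_d (greg_of n (d - 1) (sg (d - 1) \<star> y)) = greg_of n d (dd y)" "greg_d (greg_of n (d - 1) y) = greg_of n d (dd (sg (d - 1) \<star> y))"
proof -
  have "keys (sg (d - 1) \<star> y) \<subseteq> greg.Mon n (d - 1)" using assms keys_scl_subset[of "sg (d - 1)" y] by blast
  from greg_d_tg[OF this] show "greg_d (greg_of n (d - 1) (sg (d - 1) \<star> y)) = greg_of n d (dd y)"
    by (simp flip: gq.op.tauh_scl)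
  from greg_d_tg[OF assms] show "greg_d (greg_of n (d - 1) y) = greg_of n d (dd (sg (d - 1) \<star> y))"
    by (simp flip: gq.op.tauh_scl)
qed

context lie_to_greg
begin

lemma phi_cocycles: "a \<in> ops lq.pr.Q n d \<Longrightarrow> \<phi> a \<in> cocycles Greg_minus1 n d"
  by (simp add: cocycles_iff h.hom_closed phi_cocycle)

lemma phi_coboundary:
  assumes a: "a \<in> ops lq.pr.Q n d" and b: "\<phi> a \<in> coboundaries Greg_minus1 n d"
  shows "a = \<zero>\<^bsub>cpt lq.pr.Q n d\<^esub>"
proof -
  obtain z where z: "z \<in> ops gq.pr.Q n (d - 1)" "\<phi> a = greg_d z" using b by (auto simp: coboundaries_eq)
  obtain y where y: "keys y \<subseteq> greg.Mon n (d - 1)" "z = greg_of n (d - 1) y" using gq.ops_tauh[OF z(1)] .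
  obtain c where c: "keys c \<subseteq> lie.Mon n d" "a = lie_of n d c" using lq.ops_tauh[OF a] .
  have "keys (sg (d - 1) \<star> y) \<subseteq> greg.Mon n (d - 1)" using y(1) keys_scl_subset[of "sg (d - 1)" y] by blast
  from phi_boundary[OF c(1) this] show ?thesis
    using z(2) greg_d_boundary(2)[OF y(1)] unfolding y(2) c(2) by metis
qed

lemma phi_difference:
  assumes a: "a \<in> ops lq.pr.Q n d" and b: "b \<in> ops lq.pr.Q n d"
    and *: "\<phi> a \<oplus>\<^bsub>cpt gq.pr.Q n d\<^esub> (- 1) \<odot>\<^bsub>cpt gq.pr.Q n d\<^esub> \<phi> b \<in> coboundaries Greg_minus1 n d"
  shows "a = b"
proof (rule lq.op.minus_zero_eq[OF a b])
  have s: "(- 1) \<odot>\<^bsub>cpt lq.pr.Q n d\<^esub> b \<in> ops lq.pr.Q n d" by (rule lq.op.smult_simps(1)[OF b])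
  have "\<phi> (a \<oplus>\<^bsub>cpt lq.pr.Q n d\<^esub> (- 1) \<odot>\<^bsub>cpt lq.pr.Q n d\<^esub> b) \<in> coboundaries Greg_minus1 n d"
    using * unfolding h.hom_add[OF a s] h.hom_smult[OF b] .
  then show "a \<ominus>\<^bsub>cpt lq.pr.Q n d\<^esub> b = \<zero>\<^bsub>cpt lq.pr.Q n d\<^esub>"
    unfolding lq.op.minus_smult[OF b] by (rule phi_coboundary[OF lq.op.md.a_closed[OF a s]])
qed

lemma zero_coboundary: "\<zero>\<^bsub>cpt gq.pr.Q n d\<^esub> \<in> coboundaries (Greg_minus1 :: ('k, 'k greg_free set) dg_operad) n d"
  using gd.coh.ideal_zero[of n d, where 'k = 'k] unfolding Z_eq .

text \<open>Elements with the same image have images that differ by zero, which is a boundary; so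
  injectivity on cohomology classes already gives injectivity.\<close>

lemma phi_inj: "inj_on \<phi> (ops lq.pr.Q n d)"
proof (rule inj_onI)
  fix a b assume a: "a \<in> ops lq.pr.Q n d" and b: "b \<in> ops lq.pr.Q n d" and eq: "\<phi> a = \<phi> b"
  have "\<phi> b \<ominus>\<^bsub>cpt gq.pr.Q n d\<^esub> \<phi> b = \<zero>\<^bsub>cpt gq.pr.Q n d\<^esub>"
    using gq.op.md.r_neg[where x = "\<phi> b" and n = n and d = d] h.hom_closed[OF b] by (simp add: gq.op.md.minus_eq)
  then show "a = b"
    using phi_difference[OF a b] zero_coboundary[of n d] unfolding eq gq.op.minus_smult[OF h.hom_closed[OF b]] by simp
qed

theorem phi_cohomology:
  "operad_iso lq.pr.Q (cohomology Greg_minus1) (\<lambda>a. cohomology_class Greg_minus1 (\<phi> a))"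
proof -
  let ?Z = "gd.Z :: ('k, 'k greg_free set) operad"
  let ?H = "quotient_operad ?Z (coboundaries Greg_minus1)"
  let ?c = "op_coset ?Z (coboundaries Greg_minus1)"
  have Z: "\<phi> a \<in> ops ?Z n d" if "a \<in> ops lq.pr.Q n d" for a n d
    using phi_cocycles[OF that] unfolding Z_eq .
  have "operad_hom lq.pr.Q ?H (\<lambda>a. ?c (\<phi> a))"
  proof (intro operad_hom.intro lq.pr.graded_operad_quotient gd.coh.graded_operad_quotient operad_hom_axioms.intro)
    show "?c (\<phi> a) \<in> ops ?H n d" if "a \<in> ops lq.pr.Q n d" for a n d
      using Z[OF that] unfolding gd.coh.qt.f_onto by blast
    show "?c (\<phi> (a \<oplus>\<^bsub>cpt lq.pr.Q n d\<^esub> b)) = ?c (\<phi> a) \<oplus>\<^bsub>cpt ?H n d\<^esub> ?c (\<phi> b)"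
      if "a \<in> ops lq.pr.Q n d" "b \<in> ops lq.pr.Q n d" for a b n d
      unfolding gd.coh.qt.f_add[OF Z[OF that(1)] Z[OF that(2)]] Z_eq h.hom_add[OF that] by (rule HOL.refl)
    show "?c (\<phi> (c \<odot>\<^bsub>cpt lq.pr.Q n d\<^esub> a)) = c \<odot>\<^bsub>cpt ?H n d\<^esub> ?c (\<phi> a)" if "a \<in> ops lq.pr.Q n d" for a c n d
      unfolding gd.coh.qt.f_smult[OF Z[OF that]] Z_eq h.hom_smult[OF that] by (rule HOL.refl)
    show "?c (\<phi> (ounit lq.pr.Q)) = ounit ?H"
      unfolding gd.coh.qt.f_unit Z_eq h.hom_unit by (rule HOL.refl)
    show "?c (\<phi> (pcomp lq.pr.Q a i b)) = pcomp ?H (?c (\<phi> a)) i (?c (\<phi> b))"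
      if "a \<in> ops lq.pr.Q m p" "b \<in> ops lq.pr.Q n q" "i \<in> {1..m}" for a b m p n q i
      unfolding gd.coh.qt.f_comp[OF Z[OF that(1)] Z[OF that(2)] that(3)] Z_eq h.hom_comp[OF that] by (rule HOL.refl)
    show "?c (\<phi> (act lq.pr.Q a \<sigma>)) = act ?H (?c (\<phi> a)) \<sigma>" if "a \<in> ops lq.pr.Q n d" "\<sigma> permutes {1..n}" for a n d \<sigma>
      unfolding gd.coh.qt.f_act[OF Z[OF that(1)] that(2)] Z_eq h.hom_act[OF that] by (rule HOL.refl)
  qed
  moreover have "bij_betw (\<lambda>a. ?c (\<phi> a)) (ops lq.pr.Q n d) (ops ?H n d)" for n d
  proof (rule bij_betw_imageI)
    show "inj_on (\<lambda>a. ?c (\<phi> a)) (ops lq.pr.Q n d)"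
    proof (rule inj_onI)
      fix a b assume a: "a \<in> ops lq.pr.Q n d" and b: "b \<in> ops lq.pr.Q n d" and eq: "?c (\<phi> a) = ?c (\<phi> b)"
      have "\<phi> a \<ominus>\<^bsub>cpt ?Z n d\<^esub> \<phi> b \<in> coboundaries Greg_minus1 n d"
        using eq unfolding gd.coh.cos_eq_iff[OF Z[OF a] Z[OF b]] .
      then show "a = b"
        unfolding graded_operad.minus_smult[OF gd.graded_operad_Z Z[OF b]] Z_eq by (rule phi_difference[OF a b])
    qed
    show "(\<lambda>a. ?c (\<phi> a)) ` ops lq.pr.Q n d = ops ?H n d"
    proof (intro equalityI subsetI)
      fix x assume "x \<in> (\<lambda>a. ?c (\<phi> a)) ` ops lq.pr.Q n d"
      then show "x \<in> ops ?H n d" using Z unfolding gd.coh.qt.f_onto by blast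
    next
      fix x assume "x \<in> ops ?H n d"
      then obtain z where z0: "z \<in> cocycles Greg_minus1 n d" and xz: "x = ?c z"
        unfolding gd.coh.qt.f_onto Z_eq by blast
      note z = z0[unfolded cocycles_iff, THEN conjunct1] z0[unfolded cocycles_iff, THEN conjunct2] xz
      obtain w where w: "keys w \<subseteq> greg.Mon n d" "z = greg_of n d w" using gq.ops_tauh[OF z(1)] .
      have "keys (sg d \<star> dd w) \<subseteq> greg.Mon n (d + 1)"
        using keys_dd[OF w(1)] keys_scl_subset[of "sg d" "dd w"] by blast
      from tg_zero_iff[OF this] have "sg d \<star> dd w \<in> greg_rel"
        using z(2) greg_d_tg[OF w(1)] unfolding w(2) gq.op.tauh_scl by metis
      then have "dd w \<in> greg_rel" using greg.rel_scl[of "sg d \<star> dd w" _ "sg d"] by simp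
      from cocycle_decomposition[OF w(1) this] obtain y a where y: "keys y \<subseteq> greg.Mon n (d - 1)"
        and a: "a \<in> ops lq.pr.Q n d" and wa: "greg_of n d w = greg_of n d (dd y) \<oplus>\<^bsub>cpt gq.pr.Q n d\<^esub> \<phi> a" by blast
      have "greg_of n d (dd y) \<in> coboundaries Greg_minus1 n d"
        unfolding coboundaries_eq greg_d_boundary(1)[OF y, symmetric] by (rule imageI) (rule gq.op.tauh_closed)
      from gd.coh.cos_cong[OF Z[OF a] this] have "x = ?c (\<phi> a)"
        unfolding Z_eq z(3) w(2) wa .
      then show "x \<in> (\<lambda>a. ?c (\<phi> a)) ` ops lq.pr.Q n d" using a by blast
    qed
  qed
  ultimately show ?thesis unfolding operad_iso_def cohomology_def cohomology_class_def by blast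
qed

end

lemma Lie_dg_eq: "Lie_dg = with_differential lq.pr.Q (zero_differential lq.pr.Q)"
  by (simp add: Lie_dg_def Lie_eq)

lemma dg_operad_hom_iff:
  fixes \<phi> :: "'k::field lie_free set \<Rightarrow> 'k greg_free set"
  shows "dg_operad_hom Lie_dg Greg_minus1 \<phi> \<longleftrightarrow> operad_hom lq.pr.Q gq.pr.Q \<phi> \<and>
    (\<forall>n d. \<forall>a \<in> ops lq.pr.Q n d. greg_d (\<phi> a) = \<zero>\<^bsub>cpt gq.pr.Q n (d + 1)\<^esub>)" (is "?l \<longleftrightarrow> ?r")
proof -
  have dg: "differential_graded_operad (Lie_dg :: ('k, 'k lie_free set) dg_operad)"
    unfolding Lie_dg_eq by (rule zero_differential[OF lq.pr.graded_operad_quotient])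
  have zd: "zero_differential lq.pr.Q a = (\<zero>\<^bsub>cpt lq.pr.Q n (d + 1)\<^esub> :: 'k lie_free set)"
    if "a \<in> ops lq.pr.Q n d" for a n d
    using lq.op.arity_degree[OF that] by (simp add: zero_differential_def)
  have "?l \<longleftrightarrow> operad_hom lq.pr.Q gq.pr.Q \<phi> \<and>
      (\<forall>n d a. a \<in> ops lq.pr.Q n d \<longrightarrow> \<phi> (zero_differential lq.pr.Q a) = greg_d (\<phi> a))"
    using dg gd.differential_graded_operad_axioms[where 'k = 'k]
    unfolding dg_operad_hom_def dg_operad_hom_axioms_def Lie_dg_eq Greg_minus1_eq operad_hom_with_differential
      with_differential_simps by blast
  also have "\<dots> \<longleftrightarrow> ?r"
    using operad_hom.hom_zero[of lq.pr.Q gq.pr.Q \<phi>] zd by metis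
  finally show ?thesis .
qed

text \<open>A homomorphism is a function on a whole type, constrained only on the components, so it
  is not unique as a function. The map is therefore shown to exist, and every function of this kind
  is shown to be an embedding that induces the isomorphism.\<close>

theorem corollary10:
  fixes L :: "('k::field_char_0, 'k lie_free set) dg_operad"
    and G :: "('k, 'k greg_free set) dg_operad"
  defines "L \<equiv> Lie_dg" and "G \<equiv> Greg_minus1"
  shows "(\<exists>\<phi>. dg_operad_hom L G \<phi> \<and> \<phi> lie_l = greg_x \<ominus>\<^bsub>cpt G 2 0\<^esub> greg_y) \<and>
    (\<forall>\<phi>. dg_operad_hom L G \<phi> \<and> \<phi> lie_l = greg_x \<ominus>\<^bsub>cpt G 2 0\<^esub> greg_y \<longrightarrow>
       dg_operad_embedding L G \<phi> \<and>
       operad_iso Lie (cohomology G) (\<lambda>a. cohomology_class G (\<phi> a)))"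
proof -
  have l: "greg_x \<ominus>\<^bsub>cpt G 2 0\<^esub> greg_y = greg_of 2 0 lam"
    unfolding G_def Greg_minus1_eq with_differential_simps by (rule lam_eq)
  obtain f where f: "operad_hom lq.pr.Q (gd.Z :: ('k, 'k greg_free set) operad) f" "f lie_l = greg_of 2 0 lam"
    using lie_hom_exists by blast
  interpret f: operad_hom lq.pr.Q "gd.Z :: ('k, 'k greg_free set) operad" f by (rule f(1))
  have f_cocycle: "f a \<in> ops gq.pr.Q n d \<and> greg_d (f a) = \<zero>\<^bsub>cpt gq.pr.Q n (d + 1)\<^esub>"
    if "a \<in> ops lq.pr.Q n d" for a n d
    using f.hom_closed[OF that] unfolding Z_eq cocycles_iff .
  have "operad_hom lq.pr.Q gq.pr.Q f"
  \<comment> \<open>The operad of cocycles has the operations of Greg restricted to smaller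
    carriers, so the same function is a homomorphism into Greg.\<close>
  proof (intro operad_hom.intro lq.pr.graded_operad_quotient gq.pr.graded_operad_quotient operad_hom_axioms.intro)
    show "f a \<in> ops gq.pr.Q n d" if "a \<in> ops lq.pr.Q n d" for a n d
      by (rule f_cocycle[OF that, THEN conjunct1])
    show "f (a \<oplus>\<^bsub>cpt lq.pr.Q n d\<^esub> b) = f a \<oplus>\<^bsub>cpt gq.pr.Q n d\<^esub> f b"
      if "a \<in> ops lq.pr.Q n d" "b \<in> ops lq.pr.Q n d" for a b n d
      using f.hom_add[OF that] unfolding Z_eq .
    show "f (c \<odot>\<^bsub>cpt lq.pr.Q n d\<^esub> a) = c \<odot>\<^bsub>cpt gq.pr.Q n d\<^esub> f a" if "a \<in> ops lq.pr.Q n d" for a c n d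
      using f.hom_smult[OF that] unfolding Z_eq .
    show "f (ounit lq.pr.Q) = ounit gq.pr.Q" using f.hom_unit unfolding Z_eq .
    show "f (pcomp lq.pr.Q a i b) = pcomp gq.pr.Q (f a) i (f b)"
      if "a \<in> ops lq.pr.Q m p" "b \<in> ops lq.pr.Q n q" "i \<in> {1..m}" for a b m p n q i
      using f.hom_comp[OF that] unfolding Z_eq .
    show "f (act lq.pr.Q a \<sigma>) = act gq.pr.Q (f a) \<sigma>" if "a \<in> ops lq.pr.Q n d" "\<sigma> permutes {1..n}" for a n d \<sigma>
      using f.hom_act[OF that] unfolding Z_eq .
  qed
  moreover have "\<forall>n d. \<forall>a \<in> ops lq.pr.Q n d. greg_d (f a) = \<zero>\<^bsub>cpt gq.pr.Q n (d + 1)\<^esub>"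
    by (intro allI ballI) (rule f_cocycle[THEN conjunct2])
  ultimately have "operad_hom lq.pr.Q gq.pr.Q f \<and>
      (\<forall>n d. \<forall>a \<in> ops lq.pr.Q n d. greg_d (f a) = \<zero>\<^bsub>cpt gq.pr.Q n (d + 1)\<^esub>)" by (rule conjI)
  then have "dg_operad_hom L G f" unfolding L_def G_def dg_operad_hom_iff .
  moreover have "dg_operad_embedding L G \<phi> \<and> operad_iso Lie (cohomology G) (\<lambda>a. cohomology_class G (\<phi> a))"
    if H: "dg_operad_hom L G \<phi>" "\<phi> lie_l = greg_of 2 0 lam" for \<phi>
  proof -
    interpret lie_to_greg \<phi>
    proof (rule lie_to_greg.intro)
      note h = H(1)[unfolded L_def G_def dg_operad_hom_iff]
      show "operad_hom lq.pr.Q gq.pr.Q \<phi>" by (rule h[THEN conjunct1])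
      show "\<phi> lie_l = greg_of 2 0 lam" by (rule H(2))
      show "greg_d (\<phi> a) = \<zero>\<^bsub>cpt gq.pr.Q n (d + 1)\<^esub>" if "a \<in> ops lq.pr.Q n d" for a n d
        using h[THEN conjunct2] that by simp
    qed
    have "inj_on \<phi> (ops L n d)" for n d
      using phi_inj unfolding L_def Lie_dg_eq with_differential_simps .
    then have "dg_operad_embedding L G \<phi>" using H(1) by (simp add: dg_operad_embedding_def)
    then show ?thesis using phi_cohomology unfolding Lie_eq G_def by (rule conjI)
  qed
  ultimately show ?thesis unfolding l using f(2) by blast
qed

end
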